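(* Consider the general branching process with reproduction point process $\xi=\sum_{k=1}^{N}\delta_{X_k}$ on $(0,\infty)$ and intensity measure $\mu=\mathbb{E}[\xi(\cdot)]$, where $\mu$ is not concentrated on any lattice $h\mathbb{N}_0$, $h>0$. Suppose that: (A1) $\mathbb{E}[N]=\mu((0,\infty))>1$; (A2) there is $\alpha>0$ with $m(\alpha)=\int_{(0,\infty)}e^{-\alpha t}\,\mu(\mathrm{d}t)=1$; (A3) $m'(\alpha):=-\int_{(0,\infty)}te^{-\alpha t}\,\mu(\mathrm{d}t)\in(-\infty,0)$; (A4) $0<\sigma^2:=\mathbb{E}\big[\big(\sum_{k=1}^{N}e^{-\alpha X_k}-1\big)^2\big]<\infty$. Let $(W_t)_{t\ge0}$ be Nerman's martingale and $W$ its almost sure limit. Then, as $t\to\infty$, $$\mathcal{L}\big(e^{\alpha t/2}(W-W_t)\,\big|\,\mathcal{H}_t\big)\ \to\ \mathcal{L}\Big(\Big(\frac{\sigma^2}{-\alpha m'(\alpha)}W\Big)^{1/2}X\,\Big|\,\mathcal{F}_\infty\Big)\quad\text{weakly, in }\mathbb{P}\text{-probability},$$ where $X$ is a standard normal random variable independent of $\mathcal{F}_\infty$.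
   Context: Tree notation: $\mathcal{I}=\bigcup_{n\ge0}\mathbb{N}^n$ is the Ulam–Harris tree with $\mathbb{N}^0=\{\varnothing\}$. For $u=(u_1,\dots,u_m)\in\mathcal{I}$, $|u|=m$, $u|_k=(u_1,\dots,u_k)$ for $k\le m$, and $uv$ denotes concatenation. Write $u\preceq v$ ("$v$ stems from $u$") if $u=v|_j$ for some $0\le j\le|v|$. For $F,L\subseteq\mathcal{I}$ and $v\in\mathcal I$: $F\preceq v$ if $u\preceq v$ for some $u\in F$, and $F\preceq L$ if $F\preceq v$ for every $v\in L$. Model: $(\xi_u)_{u\in\mathcal{I}}$ are i.i.d. point processes on $(0,\infty)$ (integer-valued random measures, values in $[0,\infty]$), $\xi_u=\sum_{k=1}^{N(u)}\delta_{X_k(u)}$, $N(u)=\xi_u((0,\infty))\in\mathbb{N}_0\cup\{\infty\}$; write $\xi=\xi_\varnothing$, $N=N(\varnothing)$, $X_k=X_k(\varnothing)$. Birth times: $S(\varnothing)=0$, $S(uk)=S(u)+X_k(u)$, with $X_k(u):=\infty$ if $k>N(u)$. The coming generation at time $t\ge0$ is $\mathcal{I}_t=\{u\in\mathcal{I}: S(u|_{|u|-1})\le t<S(u)<\infty\}$. Filtrations: a subset $L\subseteq\mathcal{I}$ is a line if $u\not\preceq v$ for all distinct $u,v\in L$. For a line $L$, $\mathcal{F}_L=\sigma(\xi_u: L\not\preceq u)$. Let $\mathcal{F}_n=\sigma(\xi_u:|u|<n)$ and $\mathcal{F}_\infty=\sigma(\mathcal{F}_n:n\in\mathbb{N})$.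 For $t\ge0$, the random line $\mathcal{I}_t$ is an optional line (i.e. $\{\mathcal{I}_t\preceq L\}\in\mathcal{F}_L$ for all deterministic lines $L$), and $\mathcal{H}_t:=\mathcal{F}_{\mathcal{I}_t}=\{A\in\mathcal{F}_\infty: A\cap\{\mathcal{I}_t\preceq L\}\in\mathcal{F}_L\text{ for all lines }L\subseteq\mathcal{I}\}$. Nerman's martingale: $W_t=\sum_{u\in\mathcal{I}_t}e^{-\alpha S(u)}$ for $t\ge0$; it is a nonnegative $(\mathcal{H}_t)_{t\ge0}$-martingale converging a.s. to a finite limit $W\ge0$. Convergence notion: for real random variables $X_t$, $Y$, "$\mathcal{L}(X_t|\mathcal{H}_t)\to\mathcal{L}(Y|\mathcal{F}_\infty)$ weakly in $\mathbb{P}$-probability as $t\to\infty$" means that $\mathbb{E}[f(X_t)|\mathcal{H}_t]\to\mathbb{E}[f(Y)|\mathcal{F}_\infty]$ in $\mathbb{P}$-probability as $t\to\infty$ for every bounded continuous $f:\mathbb{R}\to\mathbb{R}$. *)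

theory Defs
  imports "HOL-Probability.Probability" "HOL-Library.Sublist"
begin

section \<open>Random measures\<close>

text \<open>
  The measurable space of all measures on \<^term>\<open>K\<close>, with the sigma-algebra generated by the evaluations
  at the measurable sets. It is the analogue of \<^const>\<open>subprob_algebra\<close> without a bound on the total mass.
\<close>

definition measure_algebra :: "'a measure \<Rightarrow> 'a measure measure" where
  "measure_algebra K =
     (SUP A \<in> sets K. vimage_algebra {m. sets m = sets K} (\<lambda>m. emeasure m A) borel)"

lemma space_measure_algebra: "space (measure_algebra K) = {m. sets m = sets K}"
  by (auto simp add: measure_algebra_def space_Sup_eq_UN)

lemma measurable_emeasure_measure_algebra [measurable]:
  "A \<in> sets K \<Longrightarrow> (\<lambda>m. emeasure m A) \<in> borel_measurable (measure_algebra K)"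
  by (auto intro!: measurable_Sup1 measurable_vimage_algebra1 simp: measure_algebra_def)

definition halfline :: "real measure" where
  "halfline = restrict_space borel {0<..}"

lemma space_halfline [simp]: "space halfline = {0<..}"
  by (simp add: halfline_def space_restrict_space)

definition npoints :: "real measure \<Rightarrow> ennreal" where
  "npoints \<zeta> = emeasure \<zeta> {0<..}"

text \<open>
  The formula \<open>\<zeta> = \<Sum>\<^bsub>k \<le> N\<^esub> \<delta>\<^bsub>X\<^sub>k\<^esub>\<close> with \<open>N\<close> the number of points of \<open>\<zeta>\<close> and positive \<open>X\<^sub>k\<close>.
  Points are counted from \<open>0\<close>: \<^term>\<open>x k \<zeta>\<close> is \<open>X\<^bsub>k+1\<^esub>\<close>, and it is relevant only for
  \<open>k + 1 \<le> N\<close>, i.e. \<open>k < N\<close>. Since \<open>N\<close> is the total mass, the formula forces \<open>N\<close> to be an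
  integer or infinite.
\<close>

definition enumerates :: "(nat \<Rightarrow> real measure \<Rightarrow> real) \<Rightarrow> real measure \<Rightarrow> bool" where
  "enumerates x \<zeta> \<longleftrightarrow>
     (\<forall>k. of_nat k < npoints \<zeta> \<longrightarrow> 0 < x k \<zeta>) \<and>
     (\<forall>A\<in>sets halfline.
        emeasure \<zeta> A = (\<Sum>k. if of_nat k < npoints \<zeta> then indicator A (x k \<zeta>) else 0))"

section \<open>The general branching process\<close>

text \<open>
  Individuals are words over the naturals; since children are counted from \<open>0\<close>, the word
  \<^term>\<open>u @ [k]\<close> is the child number \<open>k + 1\<close> of \<^term>\<open>u\<close>. The k-th point of \<open>\<xi>\<^sub>u\<close> is a measurable
  functional of the point measure \<open>\<xi>\<^sub>u\<close>, the same for all \<open>u\<close>, but otherwise arbitrary (for instance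
  the points may be listed in increasing order); it needs to enumerate the atoms only for
  the measures that occur as realizations.
\<close>

definition general_branching_process ::
  "'w measure \<Rightarrow> (nat list \<Rightarrow> 'w \<Rightarrow> real measure) \<Rightarrow> (nat \<Rightarrow> real measure \<Rightarrow> real) \<Rightarrow> bool" where
  "general_branching_process M \<xi> x \<longleftrightarrow>
     prob_space M \<and>
     prob_space.indep_vars M (\<lambda>_. measure_algebra halfline) \<xi> UNIV \<and>
     (\<forall>u. distr M (measure_algebra halfline) (\<xi> u) = distr M (measure_algebra halfline) (\<xi> [])) \<and>
     (\<forall>k. x k \<in> borel_measurable (measure_algebra halfline)) \<and>
     (\<forall>u. \<forall>\<omega>\<in>space M. enumerates x (\<xi> u \<omega>))"

definition intensity :: "'w measure \<Rightarrow> (nat list \<Rightarrow> 'w \<Rightarrow> real measure) \<Rightarrow> real measure" where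
  "intensity M \<xi> = measure_of {0<..} (sets halfline) (\<lambda>A. \<integral>\<^sup>+\<omega>. emeasure (\<xi> [] \<omega>) A \<partial>M)"

definition laplace :: "real measure \<Rightarrow> real \<Rightarrow> ennreal" where
  "laplace \<mu> \<theta> = (\<integral>\<^sup>+t. ennreal (exp (- \<theta> * t)) \<partial>\<mu>)"

definition laplace_deriv :: "real measure \<Rightarrow> real \<Rightarrow> real" where
  "laplace_deriv \<mu> \<theta> = - (\<integral>t. t * exp (- \<theta> * t) \<partial>\<mu>)"

text \<open>
  \<open>\<Sum>\<^bsub>k \<le> N\<^esub> exp (- \<alpha> X\<^sub>k)\<close>. As usual for \<^const>\<open>infsum\<close>, the value is \<open>0\<close> where the series diverges, which
  is a null event as soon as \<open>m(\<alpha>) = 1\<close>. The same applies to \<open>nerman\<close> below.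
\<close>

definition first_generation_sum ::
  "(nat list \<Rightarrow> 'w \<Rightarrow> real measure) \<Rightarrow> (nat \<Rightarrow> real measure \<Rightarrow> real) \<Rightarrow> real \<Rightarrow> 'w \<Rightarrow> real" where
  "first_generation_sum \<xi> x \<alpha> \<omega> =
     (\<Sum>\<^sub>\<infinity>k \<in> {k. of_nat k < npoints (\<xi> [] \<omega>)}. exp (- \<alpha> * x k (\<xi> [] \<omega>)))"

definition displacement ::
  "(nat list \<Rightarrow> 'w \<Rightarrow> real measure) \<Rightarrow> (nat \<Rightarrow> real measure \<Rightarrow> real) \<Rightarrow>
   nat list \<Rightarrow> nat \<Rightarrow> 'w \<Rightarrow> ereal" where
  "displacement \<xi> x u k \<omega> =
     (if of_nat k < npoints (\<xi> u \<omega>) then ereal (x k (\<xi> u \<omega>)) else \<infinity>)"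

definition birth_time ::
  "(nat list \<Rightarrow> 'w \<Rightarrow> real measure) \<Rightarrow> (nat \<Rightarrow> real measure \<Rightarrow> real) \<Rightarrow>
   nat list \<Rightarrow> 'w \<Rightarrow> ereal" where
  "birth_time \<xi> x u \<omega> = (\<Sum>j<length u. displacement \<xi> x (take j u) (u ! j) \<omega>)"

lemma birth_time_Nil [simp]: "birth_time \<xi> x [] \<omega> = 0"
  by (simp add: birth_time_def)

lemma birth_time_snoc:
  "birth_time \<xi> x (u @ [k]) \<omega> = birth_time \<xi> x u \<omega> + displacement \<xi> x u k \<omega>"
  by (simp add: birth_time_def nth_append)

text \<open>
  The root is never a member for \<open>t \<ge> 0\<close>: \<^term>\<open>butlast []\<close> is \<^term>\<open>[]\<close>, so the condition reads \<open>0 \<le> t < 0\<close>.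
\<close>

definition coming_generation ::
  "(nat list \<Rightarrow> 'w \<Rightarrow> real measure) \<Rightarrow> (nat \<Rightarrow> real measure \<Rightarrow> real) \<Rightarrow>
   real \<Rightarrow> 'w \<Rightarrow> nat list set" where
  "coming_generation \<xi> x t \<omega> =
     {u. birth_time \<xi> x (butlast u) \<omega> \<le> ereal t \<and> ereal t < birth_time \<xi> x u \<omega> \<and>
         birth_time \<xi> x u \<omega> < \<infinity>}"

definition nerman ::
  "(nat list \<Rightarrow> 'w \<Rightarrow> real measure) \<Rightarrow> (nat \<Rightarrow> real measure \<Rightarrow> real) \<Rightarrow> real \<Rightarrow>
   real \<Rightarrow> 'w \<Rightarrow> real" where
  "nerman \<xi> x \<alpha> t \<omega> =
     (\<Sum>\<^sub>\<infinity>u \<in> coming_generation \<xi> x t \<omega>. exp (- \<alpha> * real_of_ereal (birth_time \<xi> x u \<omega>)))"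

section \<open>Lines and filtrations\<close>

definition stems_from :: "'a list set \<Rightarrow> 'a list \<Rightarrow> bool" where
  "stems_from F v \<longleftrightarrow> (\<exists>u\<in>F. prefix u v)"

definition covers :: "'a list set \<Rightarrow> 'a list set \<Rightarrow> bool" where
  "covers F L \<longleftrightarrow> (\<forall>v\<in>L. stems_from F v)"

definition is_line :: "'a list set \<Rightarrow> bool" where
  "is_line L \<longleftrightarrow> (\<forall>u\<in>L. \<forall>v\<in>L. u \<noteq> v \<longrightarrow> \<not> prefix u v)"

text \<open>
  The sigma-algebra generated by the \<open>\<xi>\<^sub>u\<close> for \<open>u\<close> in \<open>U\<close>, on \<^term>\<open>space M\<close> also if \<open>U\<close> is empty.
  Sigma-algebras are represented by measures, as in the library's conditional expectation; only
  their \<^const>\<open>sets\<close> and \<^const>\<open>space\<close> matter.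
\<close>

definition generated ::
  "'w measure \<Rightarrow> (nat list \<Rightarrow> 'w \<Rightarrow> real measure) \<Rightarrow> nat list set \<Rightarrow> 'w measure" where
  "generated M \<xi> U =
     sigma (space M) (\<Union>u\<in>U. {\<xi> u -` A \<inter> space M | A. A \<in> sets (measure_algebra halfline)})"

definition F_line ::
  "'w measure \<Rightarrow> (nat list \<Rightarrow> 'w \<Rightarrow> real measure) \<Rightarrow> nat list set \<Rightarrow> 'w measure" where
  "F_line M \<xi> L = generated M \<xi> {u. \<not> stems_from L u}"

definition F_gen :: "'w measure \<Rightarrow> (nat list \<Rightarrow> 'w \<Rightarrow> real measure) \<Rightarrow> nat \<Rightarrow> 'w measure" where
  "F_gen M \<xi> n = generated M \<xi> {u. length u < n}"

definition F_infty :: "'w measure \<Rightarrow> (nat list \<Rightarrow> 'w \<Rightarrow> real measure) \<Rightarrow> 'w measure" where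
  "F_infty M \<xi> = sigma (space M) (\<Union>n. sets (F_gen M \<xi> n))"

definition pre_line_events ::
  "'w measure \<Rightarrow> (nat list \<Rightarrow> 'w \<Rightarrow> real measure) \<Rightarrow> ('w \<Rightarrow> nat list set) \<Rightarrow> 'w set set" where
  "pre_line_events M \<xi> J =
     {A \<in> sets (F_infty M \<xi>).
        \<forall>L. is_line L \<longrightarrow> A \<inter> {\<omega>\<in>space M. covers (J \<omega>) L} \<in> sets (F_line M \<xi> L)}"

text \<open>
  The events above form a sigma-algebra for every optional line \<open>J\<close>, in particular for the
  coming generation; see \<open>sets_H_filtration\<close>.
\<close>

definition H_filtration ::
  "'w measure \<Rightarrow> (nat list \<Rightarrow> 'w \<Rightarrow> real measure) \<Rightarrow> (nat \<Rightarrow> real measure \<Rightarrow> real) \<Rightarrow>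
   real \<Rightarrow> 'w measure" where
  "H_filtration M \<xi> x t = sigma (space M) (pre_line_events M \<xi> (coming_generation \<xi> x t))"

section \<open>Weak convergence of conditional laws in probability\<close>

definition tendsto_in_prob ::
  "'w measure \<Rightarrow> (real \<Rightarrow> 'w \<Rightarrow> real) \<Rightarrow> ('w \<Rightarrow> real) \<Rightarrow> bool" where
  "tendsto_in_prob M Y Z \<longleftrightarrow>
     (\<forall>\<epsilon>>0. ((\<lambda>t. measure M {\<omega>\<in>space M. \<epsilon> < \<bar>Y t \<omega> - Z \<omega>\<bar>}) \<longlongrightarrow> 0) at_top)"

definition cond_law_tendsto_in_prob ::
  "'w measure \<Rightarrow> (real \<Rightarrow> 'w \<Rightarrow> real) \<Rightarrow> (real \<Rightarrow> 'w measure) \<Rightarrow>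
   ('w \<Rightarrow> real) \<Rightarrow> 'w measure \<Rightarrow> bool" where
  "cond_law_tendsto_in_prob M Y H Z G \<longleftrightarrow>
     (\<forall>f :: real \<Rightarrow> real. continuous_on UNIV f \<longrightarrow> bounded (range f) \<longrightarrow>
        tendsto_in_prob M (\<lambda>t. real_cond_exp M (H t) (\<lambda>\<omega>. f (Y t \<omega>)))
          (real_cond_exp M G (\<lambda>\<omega>. f (Z \<omega>))))"

section \<open>Basic facts\<close>

lemma measurable_point_process:
  assumes "general_branching_process M \<xi> x"
  shows "\<xi> u \<in> measurable M (measure_algebra halfline)"
  using assms by (auto simp: general_branching_process_def prob_space.indep_vars_def)

lemma sets_halfline_greaterThan [measurable]: "{0<..} \<in> sets halfline"
  by (metis sets.top space_halfline)

lemma sets_intensity: "sets (intensity M \<xi>) = sets halfline"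
  unfolding intensity_def by (metis sets.sets_measure_of_eq space_halfline)

lemma emeasure_intensity:
  assumes "general_branching_process M \<xi> x" "A \<in> sets halfline"
  shows "emeasure (intensity M \<xi>) A = (\<integral>\<^sup>+\<omega>. emeasure (\<xi> [] \<omega>) A \<partial>M)"
proof -
  note [measurable] = measurable_point_process[OF assms(1), of "[]"]
  have s: "sets (\<xi> [] \<omega>) = sets halfline" if "\<omega> \<in> space M" for \<omega>
    using measurable_space[OF measurable_point_process[OF assms(1), of "[]"] that]
    by (simp add: space_measure_algebra)
  have "countably_additive (sets halfline) (\<lambda>A. \<integral>\<^sup>+\<omega>. emeasure (\<xi> [] \<omega>) A \<partial>M)"
  proof (rule countably_additiveI)
    fix B :: "nat \<Rightarrow> real set"
    assume B: "range B \<subseteq> sets halfline" "disjoint_family B"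
    have [measurable]: "\<And>i. B i \<in> sets halfline" using B by auto
    have "(\<Sum>i. \<integral>\<^sup>+\<omega>. emeasure (\<xi> [] \<omega>) (B i) \<partial>M) = (\<integral>\<^sup>+\<omega>. (\<Sum>i. emeasure (\<xi> [] \<omega>) (B i)) \<partial>M)"
      by (rule nn_integral_suminf[symmetric]) measurable
    also have "\<dots> = (\<integral>\<^sup>+\<omega>. emeasure (\<xi> [] \<omega>) (\<Union>i. B i) \<partial>M)"
      using B by (intro nn_integral_cong suminf_emeasure) (auto simp: s)
    finally show "(\<Sum>i. \<integral>\<^sup>+\<omega>. emeasure (\<xi> [] \<omega>) (B i) \<partial>M) = (\<integral>\<^sup>+\<omega>. emeasure (\<xi> [] \<omega>) (\<Union>i. B i) \<partial>M)" .
  qed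
  moreover have "positive (sets halfline) (\<lambda>A. \<integral>\<^sup>+\<omega>. emeasure (\<xi> [] \<omega>) A \<partial>M)"
    by (simp add: positive_def)
  moreover have "sigma_algebra {0<..} (sets halfline)"
    by (metis sets.sigma_algebra_axioms space_halfline)
  ultimately show ?thesis
    unfolding intensity_def using assms(2)
    by (subst emeasure_measure_of_sigma) auto
qed

lemma space_generated [simp]: "space (generated M \<xi> U) = space M"
  by (simp add: generated_def space_measure_of_conv)

lemma space_F_line [simp]: "space (F_line M \<xi> L) = space M"
  by (simp add: F_line_def)

lemma space_F_infty [simp]: "space (F_infty M \<xi>) = space M"
  by (simp add: F_infty_def space_measure_of_conv)

lemma measurable_generated:
  assumes "general_branching_process M \<xi> x" "u \<in> U"
  shows "\<xi> u \<in> measurable (generated M \<xi> U) (measure_algebra halfline)"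
proof (rule measurableI)
  show "\<xi> u \<omega> \<in> space (measure_algebra halfline)" if "\<omega> \<in> space (generated M \<xi> U)" for \<omega>
    using measurable_space[OF measurable_point_process[OF assms(1)]] that by simp
  show "\<xi> u -` A \<inter> space (generated M \<xi> U) \<in> sets (generated M \<xi> U)"
    if "A \<in> sets (measure_algebra halfline)" for A
    using assms(2) that unfolding space_generated unfolding generated_def
    by (intro in_measure_of) auto
qed

lemma measurable_displacement:
  assumes "general_branching_process M \<xi> x" "u \<in> U"
  shows "displacement \<xi> x u k \<in> borel_measurable (generated M \<xi> U)"
proof -
  note [measurable] = measurable_generated[OF assms]
  have [measurable]: "x k \<in> borel_measurable (measure_algebra halfline)"
    using assms by (auto simp: general_branching_process_def)
  show ?thesis
    unfolding displacement_def[abs_def] npoints_def by measurable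
qed

lemma measurable_birth_time:
  assumes "general_branching_process M \<xi> x" "\<And>v. strict_prefix v u \<Longrightarrow> v \<in> U"
  shows "birth_time \<xi> x u \<in> borel_measurable (generated M \<xi> U)"
  unfolding birth_time_def[abs_def]
proof (intro borel_measurable_ereal_sum measurable_displacement[OF assms(1)] assms(2))
  fix j assume "j \<in> {..<length u}"
  then show "strict_prefix (take j u) u"
    by (metis length_take lessThan_iff min.absorb4 nat_less_le prefix_order.le_neq_trans take_is_prefix)
qed

lemma optional_line_coming_generation:
  assumes gbp: "general_branching_process M \<xi> x" and L: "is_line L"
  shows "{\<omega>\<in>space M. covers (coming_generation \<xi> x t \<omega>) L} \<in> sets (F_line M \<xi> L)"
proof -
  let ?F = "F_line M \<xi> L"
  have bt: "birth_time \<xi> x u \<in> borel_measurable ?F" if "v \<in> L" "prefix u v" for u v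
    unfolding F_line_def
  proof (rule measurable_birth_time[OF gbp])
    fix w assume w: "strict_prefix w u"
    have "\<not> prefix v' w" if v': "v' \<in> L" for v'
    proof
      assume "prefix v' w"
      then have "strict_prefix v' v"
        using w \<open>prefix u v\<close> by (meson prefix_order.le_less_trans prefix_order.less_le_trans)
      then show False
        using L v' \<open>v \<in> L\<close> unfolding is_line_def strict_prefix_def by blast
    qed
    then show "w \<in> {u. \<not> stems_from L u}"
      by (auto simp: stems_from_def)
  qed
  have mem: "{\<omega>\<in>space ?F. u \<in> coming_generation \<xi> x t \<omega>} \<in> sets ?F" if "v \<in> L" "prefix u v" for u v
  proof -
    have "prefix (butlast u) v"
      using that by (meson prefix_order.trans prefixeq_butlast)
    note [measurable] = bt[OF that] bt[OF that(1) this]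
    show ?thesis unfolding coming_generation_def mem_Collect_eq by measurable
  qed
  have "{\<omega>\<in>space M. covers (coming_generation \<xi> x t \<omega>) L} =
        {\<omega>\<in>space ?F. \<forall>v\<in>L. \<exists>u\<in>set (prefixes v). u \<in> coming_generation \<xi> x t \<omega>}"
    unfolding covers_def stems_from_def space_F_line by (meson in_set_prefixes)
  also have "\<dots> \<in> sets ?F"
  proof (rule sets.sets_Collect_countable_All')
    fix v assume v: "v \<in> L"
    show "{\<omega>\<in>space ?F. \<exists>u\<in>set (prefixes v). u \<in> coming_generation \<xi> x t \<omega>} \<in> sets ?F"
    proof (rule sets.sets_Collect_finite_Ex)
      show "{\<omega>\<in>space ?F. u \<in> coming_generation \<xi> x t \<omega>} \<in> sets ?F" if "u \<in> set (prefixes v)" for u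
        using mem[OF v] that by (simp add: in_set_prefixes)
    qed simp
  qed simp
  finally show ?thesis .
qed

lemma sets_H_filtration:
  assumes gbp: "general_branching_process M \<xi> x"
  shows "sets (H_filtration M \<xi> x t) = pre_line_events M \<xi> (coming_generation \<xi> x t)"
proof -
  let ?J = "coming_generation \<xi> x t"
  let ?C = "\<lambda>L. {\<omega>\<in>space M. covers (?J \<omega>) L}"
  have C: "?C L \<in> sets (F_line M \<xi> L)" if "is_line L" for L
    by (rule optional_line_coming_generation[OF gbp that])
  have "sigma_algebra (space M) (pre_line_events M \<xi> ?J)"
    unfolding sigma_algebra_iff2
  proof (intro conjI ballI allI impI)
    show "pre_line_events M \<xi> ?J \<subseteq> Pow (space M)"
      using sets.space_closed[of "F_infty M \<xi>"] by (auto simp: pre_line_events_def)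
    show "{} \<in> pre_line_events M \<xi> ?J"
      by (simp add: pre_line_events_def)
  next
    fix A assume A: "A \<in> pre_line_events M \<xi> ?J"
    have "(space M - A) \<inter> ?C L \<in> sets (F_line M \<xi> L)" if "is_line L" for L
    proof -
      have "(space M - A) \<inter> ?C L = ?C L - A \<inter> ?C L" by auto
      then show ?thesis using A C[OF that] that by (auto simp: pre_line_events_def)
    qed
    moreover have "space M - A \<in> sets (F_infty M \<xi>)"
      using A by (metis (no_types, lifting) mem_Collect_eq pre_line_events_def sets.compl_sets space_F_infty)
    ultimately show "space M - A \<in> pre_line_events M \<xi> ?J"
      by (simp add: pre_line_events_def)
  next
    fix A :: "nat \<Rightarrow> _" assume A: "range A \<subseteq> pre_line_events M \<xi> ?J"
    have "(\<Union>i. A i) \<inter> ?C L \<in> sets (F_line M \<xi> L)" if "is_line L" for L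
    proof -
      have "(\<Union>i. A i \<inter> ?C L) \<in> sets (F_line M \<xi> L)"
        using A that by (intro sets.countable_UN) (auto simp: pre_line_events_def)
      then show ?thesis by (simp add: Int_UN_distrib2)
    qed
    moreover have "(\<Union>i. A i) \<in> sets (F_infty M \<xi>)"
      using A by (intro sets.countable_UN) (auto simp: pre_line_events_def)
    ultimately show "(\<Union>i. A i) \<in> pre_line_events M \<xi> ?J"
      by (simp add: pre_line_events_def)
  qed
  then show ?thesis
    unfolding H_filtration_def by (rule sigma_algebra.sets_measure_of_eq)
qed

end

theory Submission
  imports Defs
begin

text \<open>
  With the weights \<open>e\<^bsup>-\<alpha>S(u)\<^esup>\<close> the process is a multiplicative cascade, \<open>W\<close> is the limit of its total
  mass, and \<open>W = \<Sum>\<^bsub>u\<^esub> e\<^bsup>-\<alpha>S(u)\<^esup> W\<^bsub>u\<^esub>\<close> with \<open>u\<close> running over the coming generation at time \<open>t\<close>, where the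
  \<open>W\<^bsub>u\<^esub>\<close> are copies of \<open>W\<close> that are independent of each other and of \<open>\<H>\<^bsub>t\<^esub>\<close>. Hence \<open>W - W\<^bsub>t\<^esub>\<close> is,
  conditionally on \<open>\<H>\<^bsub>t\<^esub>\<close>, a sum of independent centred variables \<open>e\<^bsup>-\<alpha>S(u)\<^esup> (W\<^bsub>u\<^esub> - 1)\<close>, each of order at most
  \<open>e\<^bsup>-\<alpha>t\<^esup>\<close>, with conditional variance \<open>v \<Sum>\<^bsub>u\<^esub> e\<^bsup>-2\<alpha>S(u)\<^esup>\<close>, where \<open>v\<close> is the variance of \<open>W\<close>. The mean of
  \<open>e\<^bsup>\<alpha>t\<^esup> \<Sum>\<^bsub>u\<^esub> e\<^bsup>-2\<alpha>S(u)\<^esup>\<close> converges to a constant \<open>c\<close> by the renewal theorem, and applying this to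
  the subtrees of an earlier line together with the law of large numbers shows that the sum itself
  converges to \<open>c W\<close>. So the conditional characteristic functions converge to those of the normal
  mixture, and trigonometric polynomials approximate bounded continuous functions on compact sets.
\<close>

section \<open>A renewal theorem\<close>

text \<open>Two constants meet in the limit variance. With \<open>f\<close> the mean of the sum of
  the squared weights of the children, the fixed point equation of \<open>W\<close> gives
  \<open>v = \<sigma>2 / (1 - f)\<close>, and the renewal theorem gives
  \<open>c = (1 - f) / m\<close> with \<open>m\<close> the mean step, which is
  \<open>-\<alpha>\<close> times the derivative in (A3). Only \<open>v * c\<close> survives, and
  \<open>f\<close> cancels. The bound \<open>f < 1\<close> drives the contractions: it makes the
  generation totals converge in L2, kills the mass that has not crossed a level, and shrinks the
  squared error in the law of large numbers, where the earlier line is the first generation and the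
  estimate is iterated. Only second moments are available, so the normal approximation works with a
  truncated Taylor remainder; it suffices that all weights on the line are below \<open>T\<close>.
  No generating family of the \<sigma>-algebra at time \<open>t\<close> is ever described. All that
  is used of an event in it is that, for each single \<open>u\<close>, its part on which
  \<open>u\<close> lies on the line does not depend on the subtree of \<open>u\<close>. Estimates
  that are uniform over such events become L1 bounds for conditional expectations.\<close>

lemma real_additive_subgroup_cases:
  fixes P :: "real set"
  assumes add: "\<And>p q. p \<in> P \<Longrightarrow> q \<in> P \<Longrightarrow> p + q \<in> P"
    and neg: "\<And>p. p \<in> P \<Longrightarrow> - p \<in> P"
    and p0: "p0 \<in> P" "0 < p0"
  obtains (dense) "\<And>\<epsilon>. 0 < \<epsilon> \<Longrightarrow> \<exists>p\<in>P. 0 < p \<and> p < \<epsilon>"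
    | (cyclic) h where "0 < h" "\<And>p. p \<in> P \<Longrightarrow> 0 < p \<Longrightarrow> \<exists>n::nat. p = h * real n"
proof (cases "\<forall>\<epsilon>>0. \<exists>p\<in>P. 0 < p \<and> p < \<epsilon>")
  case True
  then show ?thesis using dense by blast
next
  case False
  then obtain \<epsilon> where \<epsilon>: "0 < \<epsilon>" "\<And>p. p \<in> P \<Longrightarrow> 0 < p \<Longrightarrow> \<epsilon> \<le> p"
    by (meson not_less)
  define S where "S = {p \<in> P. 0 < p}"
  have S: "S \<noteq> {}" "bdd_below S"
    using p0 by (auto simp: S_def intro!: bdd_belowI[of _ 0])
  define h where "h = Inf S"
  obtain p1 where p1: "p1 \<in> S" "p1 < h + \<epsilon>"
    using cInf_lessD[OF S(1), of "h + \<epsilon>"] \<epsilon>(1) h_def by auto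
  have h_le: "h \<le> p" if "p \<in> S" for p
    using that S unfolding h_def by (simp add: cInf_lower)
  \<comment> \<open>The infimum is attained: a second element of \<open>S\<close> between
    \<open>h\<close> and \<open>p1\<close> would have a positive difference from \<open>p1\<close>
    smaller than \<open>\<epsilon>\<close>.\<close>
  have "p1 = h"
  proof (rule ccontr)
    assume "p1 \<noteq> h"
    then have "h < p1" using h_le[OF p1(1)] by simp
    then obtain p2 where p2: "p2 \<in> S" "p2 < p1"
      using cInf_lessD[OF S(1)] h_def by auto
    have "p1 - p2 \<in> P" using p1 p2 add[of p1 "- p2"] neg[of p2] by (auto simp: S_def)
    then have "\<epsilon> \<le> p1 - p2" using \<epsilon>(2) p2 by auto
    then show False using h_le[OF p2(1)] p1 by linarith
  qed
  then have hP: "h \<in> P" "0 < h" using p1 by (auto simp: S_def)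
  have mult: "h * real n \<in> P" for n
  proof (induction n)
    case 0
    show ?case using add[OF hP(1) neg[OF hP(1)]] by simp
  next
    case (Suc n)
    then show ?case using add[OF hP(1) Suc] by (simp add: algebra_simps)
  qed
  show ?thesis
  proof (rule cyclic[OF hP(2)])
    fix p assume p: "p \<in> P" "0 < p"
    \<comment> \<open>Division with remainder: the remainder lies in \<open>P\<close> and below its
      least positive element \<open>h\<close>, so it vanishes.\<close>
    define n where "n = nat \<lfloor>p / h\<rfloor>"
    have n: "real n \<le> p / h" "p / h < real n + 1"
      using p hP(2) by (auto simp: n_def)
    have 1: "0 \<le> p - h * real n" "p - h * real n < h"
      using n hP(2) by (auto simp: field_simps)
    have "p - h * real n \<in> P" using add[OF p(1) neg[OF mult[of n]]] by simp
    then have "p - h * real n = 0" using 1 h_le[of "p - h * real n"] by (force simp: S_def)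
    then show "\<exists>n::nat. p = h * real n" by (intro exI[of _ n]) simp
  qed
qed

lemma (in prob_space) square_expectation_le:
  fixes X :: "'a \<Rightarrow> real"
  assumes "integrable M X" "integrable M (\<lambda>x. (X x)\<^sup>2)"
  shows "(expectation X)\<^sup>2 \<le> expectation (\<lambda>x. (X x)\<^sup>2)"
  using variance_positive[of X] variance_eq[OF assms] by simp

section \<open>Convolution with the step law of a random walk with positive steps\<close>

locale renewal = prob_space F for F :: "real measure" +
  assumes sets_F [measurable_cong, simp]: "sets F = sets borel"
    and pos: "AE y in F. 0 < y"
begin

lemma space_F [simp]: "space F = UNIV"
  using sets_eq_imp_space_eq[OF sets_F] by simp

lemma prob_UNIV [simp]: "prob UNIV = 1"
  using prob_space by simp

lemma integrable_bounded:
  fixes g :: "real \<Rightarrow> real"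
  assumes [measurable]: "g \<in> borel_measurable borel" and "\<And>y. \<bar>g y\<bar> \<le> C"
  shows "integrable F g"
  using assms by (intro integrable_const_bound[of _ C]) auto

lemma convolution_bounded:
  fixes g :: "real \<Rightarrow> real"
  assumes [measurable]: "g \<in> borel_measurable borel" and C: "\<And>y. \<bar>g y\<bar> \<le> C"
  shows "(\<lambda>t. \<integral>y. g (t - y) \<partial>F) \<in> borel_measurable borel"
    and "\<bar>\<integral>y. g (t - y) \<partial>F\<bar> \<le> C"
proof -
  show "(\<lambda>t. \<integral>y. g (t - y) \<partial>F) \<in> borel_measurable borel" by measurable
  have "0 \<le> C" using C[of 0] by simp
  have "\<bar>\<integral>y. g (t - y) \<partial>F\<bar> \<le> (\<integral>y. \<bar>g (t - y)\<bar> \<partial>F)" by simp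
  also have "\<dots> \<le> (\<integral>y. C \<partial>F)"
    by (intro integral_mono integrable_abs integrable_bounded[where C=C]) (auto simp: C \<open>0 \<le> C\<close>)
  finally show "\<bar>\<integral>y. g (t - y) \<partial>F\<bar> \<le> C" by (simp add: prob_space)
qed

lemma convolution_vanishing:
  fixes g :: "real \<Rightarrow> real"
  assumes [measurable]: "g \<in> borel_measurable borel" and C: "\<And>y. \<bar>g y\<bar> \<le> C"
    and lim: "(g \<longlongrightarrow> 0) at_top"
  shows "((\<lambda>t. \<integral>y. g (t - y) \<partial>F) \<longlongrightarrow> 0) at_top"
proof -
  have "((\<lambda>t. \<integral>y. g (t - y) \<partial>F) \<longlongrightarrow> (\<integral>y. 0 \<partial>F)) at_top"
  proof (rule integral_dominated_convergence_at_top[where w="\<lambda>_. C"])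
    show "AE y in F. ((\<lambda>t. g (t - y)) \<longlongrightarrow> 0) at_top"
    proof (rule AE_I2)
      fix y :: real
      have "filterlim (\<lambda>t. t - y) at_top at_top"
        using filterlim_tendsto_add_at_top[OF tendsto_const[of "-y"] filterlim_ident] by simp
      then show "((\<lambda>t. g (t - y)) \<longlongrightarrow> 0) at_top" by (rule filterlim_compose[OF lim])
    qed
  qed (auto simp: C)
  then show ?thesis by simp
qed

text \<open>
  The functions \<open>K(t - S\<^sub>n)\<close> of the random walk form a bounded martingale up to time \<open>t\<close>, and the conditional
  variance of its first increment is dominated by that of each later one; as these sum to at
  most \<open>1\<close>, the first one is at most \<open>1/n\<close> for large \<open>t\<close>.
\<close>
lemma mean_square_increment:
  fixes K :: "real \<Rightarrow> real"
  assumes [measurable]: "K \<in> borel_measurable borel" and K01: "\<And>t. 0 \<le> K t" "\<And>t. K t \<le> 1"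
    and harm: "\<And>t. 0 \<le> t \<Longrightarrow> K t = (\<integral>y. K (t - y) \<partial>F)"
  shows "((\<lambda>t. \<integral>y. (K (t - y) - K t)\<^sup>2 \<partial>F) \<longlongrightarrow> 0) at_top"
proof -
  define D where "D = (\<lambda>t. \<integral>y. (K (t - y) - K t)\<^sup>2 \<partial>F)"
  have diff1: "\<bar>K s - K t\<bar> \<le> 1" for s t using K01[of s] K01[of t] by auto
  have sq1: "(K s - K t)\<^sup>2 \<le> 1" for s t
    using diff1[of s t] by (metis abs_square_le_1)
  have [measurable]: "D \<in> borel_measurable borel" unfolding D_def by measurable
  have int_sq: "integrable F (\<lambda>y. (K (f y) - K (g y))\<^sup>2)"
    if [measurable]: "f \<in> borel_measurable borel" "g \<in> borel_measurable borel" for f g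
    by (rule integrable_bounded[where C=1]) (auto simp: sq1)
  have intK: "integrable F (\<lambda>y. K (f y))" if [measurable]: "f \<in> borel_measurable borel" for f
    by (rule integrable_bounded[where C=1]) (auto simp: K01)
  have intK2: "integrable F (\<lambda>y. (K (f y))\<^sup>2)" if [measurable]: "f \<in> borel_measurable borel" for f
    by (rule integrable_bounded[where C=1]) (auto simp: K01 abs_square_le_1)
  have D0: "0 \<le> D t" for t by (simp add: D_def)
  have D1: "D t \<le> 1" for t
  proof -
    have "D t \<le> (\<integral>y. 1 \<partial>F)" unfolding D_def by (intro integral_mono int_sq) (auto simp: sq1)
    then show ?thesis by (simp add: prob_space)
  qed
  \<comment> \<open>\<open>harm\<close> is known only for \<open>t \<ge> 0\<close>.
    \<open>e1\<close> pays for steps longer than \<open>t\<close> and for negative \<open>t\<close>,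
    while \<open>e2\<close> makes \<open>var\<close> trivially true for negative \<open>t\<close>.
    Both vanish at infinity, hence so do their convolutions.\<close>
  define e1 where "e1 = (\<lambda>t. if t < 0 then 1 else measure F {t<..})"
  define e2 where "e2 = (\<lambda>t::real. if t < 0 then 2 else (0::real))"
  have [measurable]: "e2 \<in> borel_measurable borel" unfolding e2_def by measurable
  have e2b: "\<bar>e2 t\<bar> \<le> 2" for t by (simp add: e2_def)
  have e2l: "(e2 \<longlongrightarrow> 0) at_top"
    by (rule tendsto_eventually) (auto simp: e2_def eventually_at_top_linorder intro!: exI[of _ 0])
  have e1eq: "measure F {t<..} = (\<integral>y. indicat_real {0<..} (y - t) \<partial>F)" for t
  proof -
    have "(\<integral>y. indicat_real {0<..} (y - t) \<partial>F) = (\<integral>y. indicat_real {t<..} y \<partial>F)"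
      by (intro Bochner_Integration.integral_cong) (auto simp: indicator_def)
    then show ?thesis by simp
  qed
  have [measurable]: "(\<lambda>t. measure F {t<..}) \<in> borel_measurable borel" unfolding e1eq by measurable
  have [measurable]: "e1 \<in> borel_measurable borel" unfolding e1_def by measurable
  have e1b: "\<bar>e1 t\<bar> \<le> 1" for t by (simp add: e1_def)
  have "((\<lambda>t. \<integral>y. indicat_real {0<..} (y - t) \<partial>F) \<longlongrightarrow> (\<integral>y. 0 \<partial>F)) at_top"
  proof (rule integral_dominated_convergence_at_top[where w="\<lambda>_. 1"])
    show "AE y in F. ((\<lambda>t. indicator {0<..} (y - t) :: real) \<longlongrightarrow> 0) at_top"
    proof (rule AE_I2)
      fix y :: real
      show "((\<lambda>t. indicator {0<..} (y - t) :: real) \<longlongrightarrow> 0) at_top"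
        by (rule tendsto_eventually) (auto simp: eventually_at_top_linorder indicator_def intro!: exI[of _ y])
    qed
  qed (auto simp: indicator_def)
  then have "((\<lambda>t. measure F {t<..}) \<longlongrightarrow> 0) at_top" unfolding e1eq by simp
  moreover have "\<forall>\<^sub>F t in at_top. measure F {t<..} = e1 t"
    by (auto simp: e1_def eventually_at_top_linorder intro!: exI[of _ 0])
  ultimately have e1l: "(e1 \<longlongrightarrow> 0) at_top" by (rule Lim_transform_eventually)
  \<comment> \<open>For \<open>y \<le> t\<close> the increment \<open>K (t - y) - K t\<close> is the
    mean over \<open>z\<close> of the same increment started at \<open>t - z\<close>, so Jensen's
    inequality bounds its square.\<close>
  have sub: "D t \<le> (\<integral>z. D (t - z) \<partial>F) + e1 t" for t
  proof (cases "t < 0")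
    case True
    have "0 \<le> (\<integral>z. D (t - z) \<partial>F)" by (simp add: D0)
    then show ?thesis using True D1[of t] by (simp add: e1_def)
  next
    case False
    interpret FF: pair_sigma_finite F F ..
    interpret FP: pair_prob_space F F ..
    have int: "integrable (F \<Otimes>\<^sub>M F) (\<lambda>(z, y). (K (t - z - y) - K (t - z))\<^sup>2)"
      by (rule FP.integrable_const_bound[of _ 1]) (auto simp: sq1)
    have "(\<integral>z. D (t - z) \<partial>F) = (\<integral>y. (\<integral>z. (K (t - z - y) - K (t - z))\<^sup>2 \<partial>F) \<partial>F)"
      unfolding D_def by (rule FF.Fubini_integral[OF int, symmetric])
    also have "\<dots> \<ge> (\<integral>y. (K (t - y) - K t)\<^sup>2 - indicator {t<..} y \<partial>F)"
    proof (rule integral_mono)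
      show "integrable F (\<lambda>y. (K (t - y) - K t)\<^sup>2 - indicator {t<..} y)"
        by (intro Bochner_Integration.integrable_diff int_sq) (auto intro!: integrable_bounded[where C=1])
      show "integrable F (\<lambda>y. \<integral>z. (K (t - z - y) - K (t - z))\<^sup>2 \<partial>F)"
        using FF.integrable_snd[OF int] by simp
      fix y
      show "(K (t - y) - K t)\<^sup>2 - indicator {t<..} y \<le> (\<integral>z. (K (t - z - y) - K (t - z))\<^sup>2 \<partial>F)"
      proof (cases "t < y")
        case True
        have "0 \<le> (\<integral>z. (K (t - z - y) - K (t - z))\<^sup>2 \<partial>F)" by simp
        moreover have "(K (t - y) - K t)\<^sup>2 - indicator {t<..} y \<le> 0"
          using True sq1[of "t - y" t] by (simp add: indicator_def)
        ultimately show ?thesis by linarith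
      next
        case F2: False
        have "(\<integral>z. K (t - z - y) - K (t - z) \<partial>F) = (\<integral>z. K ((t - y) - z) \<partial>F) - (\<integral>z. K (t - z) \<partial>F)"
          by (subst Bochner_Integration.integral_diff) (auto intro!: intK simp: algebra_simps)
        also have "\<dots> = K (t - y) - K t" using F2 False harm[of "t - y"] harm[of t] by simp
        finally have "(K (t - y) - K t)\<^sup>2 = (\<integral>z. K (t - z - y) - K (t - z) \<partial>F)\<^sup>2" by simp
        also have "\<dots> \<le> (\<integral>z. (K (t - z - y) - K (t - z))\<^sup>2 \<partial>F)"
          by (rule square_expectation_le) (auto intro!: intK int_sq)
        finally show ?thesis using F2 by (simp add: indicator_def)
      qed
    qed
    also have "(\<integral>y. (K (t - y) - K t)\<^sup>2 - indicator {t<..} y \<partial>F) = D t - e1 t"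
    proof (subst Bochner_Integration.integral_diff)
      show "integrable F (\<lambda>y. (K (t - y) - K t)\<^sup>2)" by (rule int_sq) measurable
      show "integrable F (indicat_real {t<..})" by (rule integrable_bounded[where C=1]) auto
    qed (use False in \<open>auto simp: e1_def D_def\<close>)
    finally show ?thesis by simp
  qed
  \<comment> \<open>For \<open>t \<ge> 0\<close> equality holds: \<open>K t\<close> is the mean of
    \<open>K (t - y)\<close>, and \<open>D t\<close> is a variance.\<close>
  have var: "D t \<le> (\<integral>y. (K (t - y))\<^sup>2 \<partial>F) - (K t)\<^sup>2 + e2 t" for t
  proof (cases "t < 0")
    case True
    have "0 \<le> (\<integral>y. (K (t - y))\<^sup>2 \<partial>F)" by simp
    moreover have "(K t)\<^sup>2 \<le> 1" using K01[of t] by (simp add: abs_square_le_1)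
    moreover have "e2 t = 2" using True by (simp add: e2_def)
    ultimately show ?thesis using D1[of t] by linarith
  next
    case False
    have "D t = (\<integral>y. (K (t - y))\<^sup>2 + (K t)\<^sup>2 - 2 * K (t - y) * K t \<partial>F)"
      unfolding D_def by (simp add: power2_diff)
    also have "\<dots> = (\<integral>y. (K (t - y))\<^sup>2 \<partial>F) + (K t)\<^sup>2 - 2 * (\<integral>y. K (t - y) \<partial>F) * K t"
    proof (subst Bochner_Integration.integral_diff)
      show "integrable F (\<lambda>y. (K (t - y))\<^sup>2 + (K t)\<^sup>2)"
        by (intro Bochner_Integration.integrable_add intK2) auto
      show "integrable F (\<lambda>y. 2 * K (t - y) * K t)"
        by (intro integrable_mult_left integrable_mult_right intK) auto
      have "(\<integral>y. (K (t - y))\<^sup>2 + (K t)\<^sup>2 \<partial>F) = (\<integral>y. (K (t - y))\<^sup>2 \<partial>F) + (\<integral>y. (K t)\<^sup>2 \<partial>F)"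
        by (intro Bochner_Integration.integral_add intK2) auto
      then show "(\<integral>y. (K (t - y))\<^sup>2 + (K t)\<^sup>2 \<partial>F) - (\<integral>y. 2 * K (t - y) * K t \<partial>F) =
          (\<integral>y. (K (t - y))\<^sup>2 \<partial>F) + (K t)\<^sup>2 - 2 * (\<integral>y. K (t - y) \<partial>F) * K t" by simp
    qed
    also have "\<dots> = (\<integral>y. (K (t - y))\<^sup>2 \<partial>F) - (K t)\<^sup>2"
      using False harm[of t] by (simp add: power2_eq_square)
    finally show ?thesis using False by (simp add: e2_def)
  qed
  \<comment> \<open>\<open>B\<close> is the \<open>n\<close>-fold convolution of the square of
    \<open>K\<close>, and \<open>e\<close> collects the convolved error terms. The variances of
    \<open>n\<close> successive increments telescope, and \<open>B \<le> 1\<close> keeps their sum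
    bounded independently of \<open>n\<close>.\<close>
  have step: "\<exists>B e C. B \<in> borel_measurable borel \<and> (\<forall>t. 0 \<le> B t \<and> B t \<le> 1) \<and>
      e \<in> borel_measurable borel \<and> (\<forall>t. \<bar>e t\<bar> \<le> C) \<and> (e \<longlongrightarrow> 0) at_top \<and>
      (\<forall>t. real n * D t \<le> B t - (K t)\<^sup>2 + e t)" for n
  proof (induction n)
    case 0
    show ?case
      by (rule exI[of _ "\<lambda>t. (K t)\<^sup>2"], rule exI[of _ "\<lambda>_. 0"], rule exI[of _ 0])
         (auto simp: K01 abs_square_le_1)
  next
    case (Suc n)
    then obtain B e C where [measurable]: "B \<in> borel_measurable borel" "e \<in> borel_measurable borel"
      and B: "\<And>t. 0 \<le> B t" "\<And>t. B t \<le> 1" and e: "\<And>t. \<bar>e t\<bar> \<le> C" "(e \<longlongrightarrow> 0) at_top"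
      and n: "\<And>t. real n * D t \<le> B t - (K t)\<^sup>2 + e t" by blast
    have Bb: "\<bar>B t\<bar> \<le> 1" for t using B[of t] by simp
    let ?B = "\<lambda>t. \<integral>y. B (t - y) \<partial>F"
    let ?e = "\<lambda>t. (\<integral>y. e (t - y) \<partial>F) + real n * e1 t + e2 t"
    have "real (Suc n) * D t \<le> ?B t - (K t)\<^sup>2 + ?e t" for t
    proof -
      have "real n * (\<integral>y. D (t - y) \<partial>F) = (\<integral>y. real n * D (t - y) \<partial>F)" by simp
      also have "\<dots> \<le> (\<integral>y. B (t - y) - (K (t - y))\<^sup>2 + e (t - y) \<partial>F)"
        by (intro integral_mono n Bochner_Integration.integrable_add Bochner_Integration.integrable_diff
              intK2 integrable_bounded[where C=1] integrable_bounded[where C=C] integrable_mult_right)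
           (auto simp: Bb e D0 D1)
      also have "\<dots> = ?B t - (\<integral>y. (K (t - y))\<^sup>2 \<partial>F) + (\<integral>y. e (t - y) \<partial>F)"
        by (subst Bochner_Integration.integral_add,
            (intro Bochner_Integration.integrable_diff
              intK2 integrable_bounded[where C=1] integrable_bounded[where C=C]; auto simp: Bb e)+,
            subst Bochner_Integration.integral_diff)
           (auto intro!: intK2 integrable_bounded[where C=1] simp: Bb)
      finally have 1: "real n * (\<integral>y. D (t - y) \<partial>F) \<le> ?B t - (\<integral>y. (K (t - y))\<^sup>2 \<partial>F) + (\<integral>y. e (t - y) \<partial>F)" .
      have "real n * D t \<le> real n * ((\<integral>z. D (t - z) \<partial>F) + e1 t)"
        by (intro mult_left_mono sub) auto
      then show ?thesis using 1 var[of t] by (simp add: algebra_simps)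
    qed
    moreover have "\<bar>?e t\<bar> \<le> C + real n + 2" for t
    proof -
      have "\<bar>real n * e1 t\<bar> \<le> real n" using e1b[of t] mult_left_mono[of "\<bar>e1 t\<bar>" 1 "real n"] by (simp add: abs_mult)
      then show ?thesis using convolution_bounded(2)[of e C t] e e2b[of t] by fastforce
    qed
    moreover have "(?e \<longlongrightarrow> 0) at_top"
      using convolution_vanishing[OF _ e] by (auto intro!: tendsto_eq_intros e1l e2l)
    moreover have "0 \<le> ?B t" "?B t \<le> 1" for t
      using convolution_bounded(2)[of B 1 t] Bb by (auto simp: B)
    moreover have "?B \<in> borel_measurable borel" "?e \<in> borel_measurable borel" by measurable
    ultimately show ?case by blast
  qed
  have "(D \<longlongrightarrow> 0) at_top"
  proof (rule order_tendstoI)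
    fix a :: real assume "a < 0"
    then show "\<forall>\<^sub>F t in at_top. a < D t" using D0 by (intro always_eventually) (auto intro: less_le_trans)
  next
    fix a :: real assume a: "0 < a"
    obtain n where n: "2 / a < real n" using reals_Archimedean2 by blast
    obtain B e where B: "\<forall>t. B t \<le> (1::real)" and e: "(e \<longlongrightarrow> 0) at_top"
      and le: "\<forall>t. real n * D t \<le> B t - (K t)\<^sup>2 + e t" using step[of n] by blast
    have n0: "0 < real n" using n a by (meson divide_pos_pos less_trans zero_less_numeral)
    have "\<forall>\<^sub>F t in at_top. e t < 1" using e by (rule order_tendstoD) simp
    then show "\<forall>\<^sub>F t in at_top. D t < a"
    proof eventually_elim
      case (elim t)
      have "real n * D t < 2" using le[rule_format, of t] B[rule_format, of t] elim zero_le_power2[of "K t"] by linarith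
      also have "2 < real n * a" using n a by (simp add: field_simps)
      finally show ?case using n0 by simp
    qed
  qed
  then show ?thesis unfolding D_def .
qed

text \<open>The asymptotic periods of \<open>K\<close> form an additive group. Vanishing mean square
  increments together with the Lipschitz bound put the support of \<open>F\<close> into this group.
  Since \<open>F\<close> is not lattice, the group contains arbitrarily small positive elements, and
  the Lipschitz bound extends the conclusion from a dense set of periods to every
  \<open>p\<close>.\<close>

lemma asymptotic_translation_invariance:
  fixes K :: "real \<Rightarrow> real"
  assumes [measurable]: "K \<in> borel_measurable borel" and K01: "\<And>t. 0 \<le> K t" "\<And>t. K t \<le> 1"
    and harm: "\<And>t. 0 \<le> t \<Longrightarrow> K t = (\<integral>y. K (t - y) \<partial>F)"
    and lip: "\<And>s t. \<bar>K s - K t\<bar> \<le> C * \<bar>s - t\<bar>"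
    and nonlattice: "\<And>h. h > 0 \<Longrightarrow> \<not> (AE y in F. y \<in> range (\<lambda>n::nat. h * real n))"
  shows "((\<lambda>t. K (t + p) - K t) \<longlongrightarrow> 0) at_top"
proof -
  have C0: "0 \<le> C" using order_trans[OF abs_ge_zero lip[of 1 0]] by simp
  define D where "D = (\<lambda>t. \<integral>y. (K (t - y) - K t)\<^sup>2 \<partial>F)"
  have Dl: "(D \<longlongrightarrow> 0) at_top" unfolding D_def by (rule mean_square_increment[OF _ K01 harm]) simp_all
  have sq1: "(K s - K t)\<^sup>2 \<le> 1" for s t
    using K01[of s] K01[of t] by (auto simp: abs_square_le_1)
  define P where "P = {p. ((\<lambda>t. K (t + p) - K t) \<longlongrightarrow> 0) at_top}"
  have shift: "filterlim (\<lambda>t. t + p) at_top at_top" for p :: real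
    using filterlim_tendsto_add_at_top[OF tendsto_const[of p] filterlim_ident] by (simp add: add.commute)
  have add: "p + q \<in> P" if "p \<in> P" "q \<in> P" for p q
  proof -
    have 1: "((\<lambda>t. K ((t + q) + p) - K (t + q)) \<longlongrightarrow> 0) at_top"
      using filterlim_compose[OF _ shift, of _ _ q] that unfolding P_def by blast
    have 2: "((\<lambda>t. K (t + q) - K t) \<longlongrightarrow> 0) at_top" using that unfolding P_def by blast
    show ?thesis using tendsto_add[OF 1 2] by (simp add: P_def algebra_simps)
  qed
  have neg: "- p \<in> P" if "p \<in> P" for p
  proof -
    have "((\<lambda>t. K ((t + (-p)) + p) - K (t + (-p))) \<longlongrightarrow> 0) at_top"
      using filterlim_compose[OF _ shift, of _ _ "-p"] that unfolding P_def by blast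
    from tendsto_minus[OF this] show ?thesis by (simp add: P_def)
  qed
  \<comment> \<open>A ball around \<open>y\<close> has mass \<open>q > 0\<close>, and by the
    Lipschitz bound its points have nearly the same increment as \<open>y\<close>; so a small
    \<open>D t\<close> forces a small increment at \<open>y\<close>.\<close>
  have supp: "y \<in> P" if y: "\<And>\<epsilon>. 0 < \<epsilon> \<Longrightarrow> measure F (ball y \<epsilon>) \<noteq> 0" for y
  proof -
    have "((\<lambda>t. (K (t + (-y)) - K t)\<^sup>2) \<longlongrightarrow> 0) at_top"
    proof (rule order_tendstoI)
      fix a :: real assume "a < 0"
      then show "\<forall>\<^sub>F t in at_top. a < (K (t + (-y)) - K t)\<^sup>2"
        by (intro always_eventually) (auto intro: less_le_trans)
    next
      fix a :: real assume a: "0 < a"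
      \<comment> \<open>Chosen so that the Lipschitz error
        \<open>2 * C\<^sup>2 * \<epsilon>\<^sup>2\<close> is at most \<open>a / 2\<close>; the
        \<open>+ 1\<close> covers \<open>C = 0\<close>.\<close>
      define \<epsilon> where "\<epsilon> = sqrt (a / (4 * (C\<^sup>2 + 1)))"
      have pos: "0 < C\<^sup>2 + 1" by (simp add: add_nonneg_pos)
      have e0: "0 < \<epsilon>" using a pos by (simp add: \<epsilon>_def)
      have "\<epsilon>\<^sup>2 = a / (4 * (C\<^sup>2 + 1))" using a pos by (simp add: \<epsilon>_def)
      then have "4 * \<epsilon>\<^sup>2 + 4 * (C\<^sup>2 * \<epsilon>\<^sup>2) = a" using pos by (simp add: field_simps)
      then have e2: "2 * C\<^sup>2 * \<epsilon>\<^sup>2 \<le> a / 2"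
        using zero_le_power2[of \<epsilon>] by linarith
      define q where "q = measure F (ball y \<epsilon>)"
      have q: "0 < q" using y[OF e0] by (simp add: q_def zero_less_measure_iff)
      have "\<forall>\<^sub>F t in at_top. D t < q * a / 4" using Dl by (rule order_tendstoD) (use q a in auto)
      then show "\<forall>\<^sub>F t in at_top. (K (t + (-y)) - K t)\<^sup>2 < a"
      proof eventually_elim
        case (elim t)
        have pt: "(K (t - y) - K t)\<^sup>2 \<le> 2 * (K (t - z) - K t)\<^sup>2 + 2 * C\<^sup>2 * \<epsilon>\<^sup>2" if "z \<in> ball y \<epsilon>" for z
        proof -
          have "\<bar>K (t - y) - K (t - z)\<bar> \<le> C * \<epsilon>"
            using lip[of "t - y" "t - z"] that C0 mult_left_mono[of "\<bar>z - y\<bar>" \<epsilon> C]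
            by (auto simp: dist_real_def abs_minus_commute[of y z])
          then have "(K (t - y) - K (t - z))\<^sup>2 \<le> (C * \<epsilon>)\<^sup>2" by (metis abs_ge_zero power2_abs power_mono)
          moreover have "(K (t - y) - K t)\<^sup>2 \<le> 2 * (K (t - z) - K t)\<^sup>2 + 2 * (K (t - y) - K (t - z))\<^sup>2"
            using zero_le_power2[of "(K (t - z) - K t) - (K (t - y) - K (t - z))"]
            by (simp add: power2_eq_square algebra_simps)
          ultimately show ?thesis by (simp add: power_mult_distrib)
        qed
        have "q * (K (t - y) - K t)\<^sup>2 = (\<integral>z. indicator (ball y \<epsilon>) z * (K (t - y) - K t)\<^sup>2 \<partial>F)"
          by (simp add: q_def)
        also have "\<dots> \<le> (\<integral>z. 2 * (K (t - z) - K t)\<^sup>2 + indicator (ball y \<epsilon>) z * (2 * C\<^sup>2 * \<epsilon>\<^sup>2) \<partial>F)"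
        proof (rule integral_mono)
          show "integrable F (\<lambda>z. indicator (ball y \<epsilon>) z * (K (t - y) - K t)\<^sup>2)"
            by (intro integrable_mult_left integrable_bounded[where C=1]) (auto simp: indicator_def)
          show "integrable F (\<lambda>z. 2 * (K (t - z) - K t)\<^sup>2 + indicator (ball y \<epsilon>) z * (2 * C\<^sup>2 * \<epsilon>\<^sup>2))"
            by (intro Bochner_Integration.integrable_add integrable_mult_left integrable_mult_right
                integrable_bounded[where C=1])
               (auto simp: indicator_def sq1)
        qed (use pt in \<open>auto simp: indicator_def\<close>)
        also have "\<dots> = 2 * D t + q * (2 * C\<^sup>2 * \<epsilon>\<^sup>2)"
        proof (subst Bochner_Integration.integral_add)
          show "integrable F (\<lambda>z. 2 * (K (t - z) - K t)\<^sup>2)"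
            by (intro integrable_mult_right integrable_bounded[where C=1]) (auto simp: sq1)
          show "integrable F (\<lambda>z. indicator (ball y \<epsilon>) z * (2 * C\<^sup>2 * \<epsilon>\<^sup>2))"
            by (intro integrable_mult_left integrable_bounded[where C=1]) (auto simp: indicator_def)
        qed (simp add: q_def D_def)
        also have "\<dots> < q * a"
        proof -
          have "q * (2 * C\<^sup>2 * \<epsilon>\<^sup>2) \<le> q * (a / 2)" using e2 q by (intro mult_left_mono) auto
          then show ?thesis using elim by simp
        qed
        finally show ?case using q by simp
      qed
    qed
    then have "((\<lambda>t. \<bar>K (t + (-y)) - K t\<bar>) \<longlongrightarrow> 0) at_top"
      using tendsto_real_sqrt[of _ 0] by fastforce
    then have "- y \<in> P" unfolding P_def using tendsto_rabs_zero_iff by blast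
    from neg[OF this] show ?thesis by simp
  qed
  have AEP: "AE y in F. y \<in> P"
  proof -
    \<comment> \<open>By Lindelof's theorem countably many of the null balls have the same union as
      all of them, so almost every \<open>y\<close> lies in no null ball, that is, in the
      support.\<close>
    define \<B> where "\<B> = {ball y \<epsilon> | y \<epsilon>. measure F (ball y \<epsilon>) = 0}"
    obtain \<B>' where B': "\<B>' \<subseteq> \<B>" "countable \<B>'" "\<Union>\<B>' = \<Union>\<B>"
    proof (rule Lindelof)
      show "open S" if "S \<in> \<B>" for S using that by (auto simp: \<B>_def)
    qed
    have "AE y in F. \<forall>U\<in>\<B>'. y \<notin> U"
    proof (subst AE_ball_countable[OF B'(2)], intro ballI)
      fix U assume "U \<in> \<B>'"
      then have U: "measure F U = 0" "U \<in> sets F" using B'(1) by (auto simp: \<B>_def)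
      then show "AE y in F. y \<notin> U"
        by (intro AE_not_in null_setsI) (auto simp: emeasure_eq_measure)
    qed
    then show ?thesis
    proof eventually_elim
      case (elim y)
      then have "y \<notin> \<Union>\<B>" using B'(3) by auto
      show ?case
      proof (rule supp, rule notI)
        fix \<epsilon> :: real assume "0 < \<epsilon>" "measure F (ball y \<epsilon>) = 0"
        then have "y \<in> ball y \<epsilon>" "ball y \<epsilon> \<in> \<B>" by (auto simp: \<B>_def)
        then show False using \<open>y \<notin> \<Union>\<B>\<close> by blast
      qed
    qed
  qed
  then have "AE y in F. y \<in> P \<and> 0 < y" using pos by eventually_elim auto
  then have "\<exists>p. p \<in> P \<and> 0 < p"
    by (rule eventually_happens'[rotated]) (simp add: ae_filter_eq_bot_iff emeasure_space_1[simplified])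
  then obtain p0 where p0: "p0 \<in> P" "0 < p0" by blast
  consider (dense) "\<And>\<epsilon>. 0 < \<epsilon> \<Longrightarrow> \<exists>p\<in>P. 0 < p \<and> p < \<epsilon>"
    | (cyclic) h where "0 < h" "\<And>p. p \<in> P \<Longrightarrow> 0 < p \<Longrightarrow> \<exists>n::nat. p = h * real n"
    by (rule real_additive_subgroup_cases[OF add neg p0]) blast+
  then show ?thesis
  proof cases
    case cyclic
    have "AE y in F. y \<in> range (\<lambda>n::nat. h * real n)"
      using AEP pos
    proof eventually_elim
      case (elim y)
      then show ?case using cyclic(2)[of y] by auto
    qed
    then show ?thesis using nonlattice[OF cyclic(1)] by simp
  next
    case dense
    have mult: "real n * q \<in> P" if "q \<in> P" for q n
    proof (induction n)
      case 0
      show ?case using add[OF that neg[OF that]] by simp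
    next
      case (Suc n)
      then show ?case using add[OF that Suc] by (simp add: algebra_simps)
    qed
    show ?thesis
    proof (rule tendstoI)
      fix a :: real assume a: "0 < a"
      obtain q where q: "q \<in> P" "0 < q" "q < a / (2 * (C + 1))"
        using dense[of "a / (2 * (C + 1))"] a C0 by auto
      \<comment> \<open>The period \<open>of_int k * q\<close> is within \<open>q\<close> of
        \<open>p\<close>, which costs at most \<open>C * q \<le> a / 2\<close>.\<close>
      define k where "k = \<lfloor>p / q\<rfloor>"
      have k: "\<bar>p - of_int k * q\<bar> \<le> q"
      proof -
        have "of_int k \<le> p / q" "p / q < of_int k + 1" by (auto simp: k_def)
        then have "of_int k * q \<le> p" "p < (of_int k + 1) * q" using q(2) by (auto simp: field_simps)
        then show ?thesis by (simp add: algebra_simps)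
      qed
      have kP: "of_int k * q \<in> P"
      proof (cases "0 \<le> k")
        case True
        then show ?thesis using mult[OF q(1), of "nat k"] by simp
      next
        case False
        then show ?thesis using neg[OF mult[OF q(1), of "nat (- k)"]] by simp
      qed
      have "\<forall>\<^sub>F t in at_top. dist (K (t + of_int k * q) - K t) 0 < a / 2"
        using kP a unfolding P_def by (intro tendstoD) auto
      then show "\<forall>\<^sub>F t in at_top. dist (K (t + p) - K t) 0 < a"
      proof eventually_elim
        case (elim t)
        have "\<bar>K (t + p) - K (t + of_int k * q)\<bar> \<le> C * q"
          using lip[of "t + p" "t + of_int k * q"] mult_left_mono[OF k C0] by simp
        also have "\<dots> \<le> a / 2"
        proof -
          have "q * (2 * (C + 1)) < a" using q(3) C0 by (simp add: field_simps)
          then show ?thesis using q(2) by (simp add: algebra_simps)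
        qed
        finally show ?case using elim unfolding dist_real_def by linarith
      qed
    qed
  qed
qed

text \<open>The limit comes from a conserved quantity. Integrating the renewal equation over all
  times up to \<open>t\<close> shows that the integral of \<open>V\<close> over a window of random
  length \<open>y\<close> ending at \<open>t\<close> has mean \<open>1 - f\<close> under
  \<open>F\<close>, for every \<open>t \<ge> 0\<close>. Window integrals of \<open>V\<close> of
  fixed length \<open>\<delta>\<close> inherit this with the constant
  \<open>\<delta> * (1 - f)\<close>. They are asymptotically translation invariant, so the random
  window contributes \<open>y\<close> times its value at \<open>t\<close>, and the mean is
  asymptotically \<open>m\<close> times this value. The growth bound \<open>Vexp\<close> then
  squeezes \<open>V\<close> between window integrals up to factors
  \<open>exp \<delta>\<close>.\<close>

theorem renewal_limit:
  fixes V :: "real \<Rightarrow> real"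
  assumes nonlattice: "\<And>h. h > 0 \<Longrightarrow> \<not> (AE y in F. y \<in> range (\<lambda>n::nat. h * real n))"
    and mean: "integrable F (\<lambda>y. y)"
    and [measurable]: "V \<in> borel_measurable borel" and V01: "\<And>t. 0 \<le> V t" "\<And>t. V t \<le> 1"
    and Vneg: "\<And>t. t < 0 \<Longrightarrow> V t = exp t"
    and Vren: "\<And>t. 0 \<le> t \<Longrightarrow> ennreal (V t) = (\<integral>\<^sup>+y. ennreal (V (t - y)) \<partial>F)"
    and Vexp: "\<And>t h. 0 \<le> h \<Longrightarrow> V (t + h) \<le> exp h * V t"
  shows "(V \<longlongrightarrow> (1 - (\<integral>y. exp (- y) \<partial>F)) / (\<integral>y. y \<partial>F)) at_top"
proof -
  interpret FL: pair_sigma_finite F lborel ..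
  define f where "f = (\<integral>y. exp (- y) \<partial>F)"
  define m where "m = (\<integral>y. y \<partial>F)"
  have exp_bound: "AE y in F. norm (exp (- y)) \<le> 1" using pos by eventually_elim simp
  have int_exp: "integrable F (\<lambda>y. exp (- y))"
    by (rule integrable_const_bound[OF exp_bound]) simp
  have f_nn: "(\<integral>\<^sup>+y. ennreal (exp (- y)) \<partial>F) = ennreal f"
    unfolding f_def using int_exp by (intro nn_integral_eq_integral) auto
  have f01: "0 \<le> f" "f \<le> 1"
  proof -
    show "0 \<le> f" by (simp add: f_def)
    have "f \<le> (\<integral>y. 1 \<partial>F)" unfolding f_def
      by (rule integral_mono_AE) (use exp_bound int_exp in auto)
    then show "f \<le> 1" by simp
  qed
  have m_pos: "0 < m"
  proof (rule ccontr)
    assume "\<not> 0 < m"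
    moreover have "0 \<le> m" unfolding m_def using pos by (intro integral_nonneg_AE) auto
    ultimately have "(\<integral>y. y \<partial>F) = 0" by (simp add: m_def)
    then have "AE y in F. y = 0"
      using pos by (subst integral_nonneg_eq_0_iff_AE[OF mean, symmetric]) auto
    then have "AE y in F. False" using pos by eventually_elim auto
    then show False by simp
  qed
  have exp_line: "(\<integral>\<^sup>+s. indicator {..<0} s * ennreal (exp s) \<partial>lborel) = 1"
  proof -
    have "(\<integral>\<^sup>+s. indicator {..<0} s * ennreal (exp s) \<partial>lborel) =
        (\<integral>\<^sup>+s. indicator {..<0} (0 + (-1) * s) * ennreal (exp (0 + (-1) * s)) \<partial>lborel)"
      by (subst nn_integral_real_affine[where t=0 and c="-1"]) auto
    also have "\<dots> = (\<integral>\<^sup>+s. ennreal (exp (- s)) * indicator {0..} s \<partial>lborel)"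
      using AE_lborel_singleton[of "0::real"]
      by (intro nn_integral_cong_AE) (auto simp: indicator_def elim!: eventually_mono)
    also have "\<dots> = ennreal (0 - (- exp (- 0)))"
    proof (rule nn_integral_FTC_atLeast)
      have "((\<lambda>x::real. - exp (- x)) \<longlongrightarrow> - 0) at_top"
        by (intro tendsto_minus filterlim_compose[OF exp_at_bot filterlim_uminus_at_bot_at_top])
      then show "((\<lambda>x::real. - exp (- x)) \<longlongrightarrow> 0) at_top" by simp
    qed (auto intro!: derivative_eq_intros)
    finally show ?thesis by simp
  qed
  define G where "G = (\<lambda>y t. \<integral>\<^sup>+s. indicator {0..<y} s * ennreal (V (t - s)) \<partial>lborel)"
  have identity: "(\<integral>\<^sup>+y. G y t \<partial>F) = ennreal (1 - f)" if t: "0 \<le> t" for t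
  proof -
    define I where "I = (\<lambda>t. \<integral>\<^sup>+s. indicator {..t} s * ennreal (V s) \<partial>lborel)"
    have "I t \<le> (\<integral>\<^sup>+s. indicator {..<0} s * ennreal (exp s) + indicator {0..t} s \<partial>lborel)"
      unfolding I_def by (intro nn_integral_mono) (auto simp: indicator_def Vneg V01)
    also have "\<dots> = 1 + ennreal t"
      using t by (subst nn_integral_add) (auto simp: exp_line)
    finally have I_fin: "I t \<noteq> \<infinity>" by (auto simp: top_unique)
    have [measurable]: "I \<in> borel_measurable borel"
    proof -
      have "I = (\<lambda>t. \<integral>\<^sup>+s. indicator {s'. 0 \<le> s'} (t - s) * ennreal (V s) \<partial>lborel)"
        unfolding I_def by (intro ext nn_integral_cong) (auto simp: indicator_def)
      also have "\<dots> \<in> borel_measurable borel" by measurable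
      finally show ?thesis .
    qed
    have [measurable]: "(\<lambda>y. G y t) \<in> borel_measurable borel"
    proof -
      have "(\<lambda>y. G y t) = (\<lambda>y. \<integral>\<^sup>+s. indicator {0..} s * indicator {s'. 0 < s'} (y - s) * ennreal (V (t - s)) \<partial>lborel)"
        unfolding G_def by (intro ext nn_integral_cong) (auto simp: indicator_def)
      also have "\<dots> \<in> borel_measurable borel" by measurable
      finally show ?thesis .
    qed
    have split: "I t = I (t - y) + G y t" if y: "0 < y" for y
    proof -
      have "G y t = (\<integral>\<^sup>+s. indicator {t-y<..t} s * ennreal (V s) \<partial>lborel)"
        unfolding G_def
        by (subst (2) nn_integral_real_affine[where t=t and c="-1"])
           (auto intro!: nn_integral_cong simp: indicator_def)
      moreover have "I t = (\<integral>\<^sup>+s. indicator {..t-y} s * ennreal (V s) + indicator {t-y<..t} s * ennreal (V s) \<partial>lborel)"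
        unfolding I_def using y by (intro nn_integral_cong) (auto simp: indicator_def)
      moreover have "\<dots> = I (t - y) + (\<integral>\<^sup>+s. indicator {t-y<..t} s * ennreal (V s) \<partial>lborel)"
        unfolding I_def by (rule nn_integral_add) measurable
      ultimately show ?thesis by simp
    qed
    \<comment> \<open>On the negative half-line \<open>V\<close> is \<open>exp\<close>, and
      convolution multiplies it by \<open>f\<close>. There the renewal equation misses a fraction
      \<open>1 - f\<close> of a function of integral 1, which is the constant in
      \<open>identity\<close>.\<close>
    have conv_neg: "(\<integral>\<^sup>+y. ennreal (V (s - y)) \<partial>F) = ennreal f * ennreal (exp s)" if s: "s < 0" for s
    proof -
      have "(\<integral>\<^sup>+y. ennreal (V (s - y)) \<partial>F) = (\<integral>\<^sup>+y. ennreal (exp (- y)) * ennreal (exp s) \<partial>F)"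
        using pos by (intro nn_integral_cong_AE, eventually_elim)
          (use s in \<open>auto simp: Vneg exp_diff exp_minus divide_inverse ennreal_mult'[symmetric] mult.commute\<close>)
      then show ?thesis by (simp add: nn_integral_multc f_nn)
    qed
    have "I t + 0 = (\<integral>\<^sup>+y. I t \<partial>F)" by (simp add: emeasure_space_1[simplified])
    also have "\<dots> = (\<integral>\<^sup>+y. I (t - y) + G y t \<partial>F)"
      using pos by (intro nn_integral_cong_AE, eventually_elim) (rule split)
    also have "\<dots> = (\<integral>\<^sup>+y. I (t - y) \<partial>F) + (\<integral>\<^sup>+y. G y t \<partial>F)"
      by (intro nn_integral_add) measurable
    finally have 1: "I t = (\<integral>\<^sup>+y. I (t - y) \<partial>F) + (\<integral>\<^sup>+y. G y t \<partial>F)" by simp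
    have "(\<integral>\<^sup>+y. I (t - y) \<partial>F) = (\<integral>\<^sup>+y. \<integral>\<^sup>+s. indicator {..t} s * ennreal (V (s - y)) \<partial>lborel \<partial>F)"
      unfolding I_def
    proof (rule nn_integral_cong)
      fix y
      show "(\<integral>\<^sup>+s. indicator {..t - y} s * ennreal (V s) \<partial>lborel) =
          (\<integral>\<^sup>+s. indicator {..t} s * ennreal (V (s - y)) \<partial>lborel)"
        using nn_integral_real_affine[where t="- y" and c=1 and f="\<lambda>s. indicator {..t - y} s * ennreal (V s)"]
        by (auto intro!: nn_integral_cong simp: indicator_def)
    qed
    also have "\<dots> = (\<integral>\<^sup>+s. \<integral>\<^sup>+y. indicator {..t} s * ennreal (V (s - y)) \<partial>F \<partial>lborel)"
      by (rule FL.Fubini'[symmetric]) measurable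
    also have "\<dots> = (\<integral>\<^sup>+s. indicator {..t} s * (\<integral>\<^sup>+y. ennreal (V (s - y)) \<partial>F) \<partial>lborel)"
      by (intro nn_integral_cong nn_integral_cmult) measurable
    also have "\<dots> + ennreal (1 - f) = I t"
    proof -
      have "ennreal (1 - f) = (\<integral>\<^sup>+s. ennreal (1 - f) * (indicator {..<0} s * ennreal (exp s)) \<partial>lborel)"
        by (subst nn_integral_cmult) (auto simp: exp_line)
      also have "(\<integral>\<^sup>+s. indicator {..t} s * (\<integral>\<^sup>+y. ennreal (V (s - y)) \<partial>F) \<partial>lborel) + \<dots> = I t"
        unfolding I_def
      proof (subst nn_integral_add[symmetric], goal_cases)
        case 3
        show ?case
        proof (intro nn_integral_cong)
          fix s :: real
          show "indicator {..t} s * (\<integral>\<^sup>+y. ennreal (V (s - y)) \<partial>F) +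
              ennreal (1 - f) * (indicator {..<0} s * ennreal (exp s)) = indicator {..t} s * ennreal (V s)"
            using t f01 by (cases "s < 0")
             (auto simp: conv_neg Vneg Vren indicator_def distrib_right[symmetric] ennreal_plus[symmetric] simp del: ennreal_plus)
        qed
      qed measurable
      finally show ?thesis .
    qed
    finally have 2: "(\<integral>\<^sup>+y. I (t - y) \<partial>F) + ennreal (1 - f) = I t" .
    then have "(\<integral>\<^sup>+y. I (t - y) \<partial>F) \<noteq> \<infinity>" using I_fin by auto
    with 1 2 show ?thesis by (metis ennreal_add_left_cancel infinity_ennreal_def)
  qed
  \<comment> \<open>The hypotheses on \<open>V\<close> bound its growth but allow downward jumps, so
    translation invariance cannot be applied to \<open>V\<close> itself. Its integrals over windows
    of length \<open>\<delta>\<close> are Lipschitz with constant 2.\<close>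
  have window: "\<exists>K. (\<forall>t. K t \<le> \<delta> * exp \<delta> * V t) \<and> (\<forall>t. \<delta> * V t \<le> exp \<delta> * K (t - \<delta>)) \<and>
      (K \<longlongrightarrow> \<delta> * (1 - f) / m) at_top" if \<delta>: "0 < \<delta>" "\<delta> \<le> 1" for \<delta>
  proof -
    define Kn where "Kn = (\<lambda>t. \<integral>\<^sup>+r. indicator {0..\<delta>} r * ennreal (V (t + r)) \<partial>lborel)"
    define K where "K = (\<lambda>t. \<integral>r. indicator {0..\<delta>} r * V (t + r) \<partial>lborel)"
    have [measurable]: "Kn \<in> borel_measurable borel" unfolding Kn_def by measurable
    have [measurable]: "K \<in> borel_measurable borel" unfolding K_def by measurable
    have int: "integrable lborel (\<lambda>r. indicator {a..b} r * g r)"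
      if [measurable]: "g \<in> borel_measurable borel" and "\<And>r. 0 \<le> g r" "\<And>r. g r \<le> 1" for a b and g :: "real \<Rightarrow> real"
    proof (rule Bochner_Integration.integrable_bound)
      show "integrable lborel (indicat_real {a..b})"
        by (cases "a \<le> b") auto
    qed (use that in \<open>auto simp: indicator_def\<close>)
    have KnK: "Kn t = ennreal (K t)" for t
    proof -
      have "ennreal (K t) = (\<integral>\<^sup>+r. ennreal (indicator {0..\<delta>} r * V (t + r)) \<partial>lborel)"
        unfolding K_def by (intro nn_integral_eq_integral[symmetric] int) (auto simp: V01)
      also have "\<dots> = Kn t"
        unfolding Kn_def by (intro nn_integral_cong) (simp add: indicator_def)
      finally show ?thesis ..
    qed
    have K0: "0 \<le> K t" for t unfolding K_def by (simp add: V01)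
    have "K t \<le> (\<integral>r. indicator {0..\<delta>} r * 1 \<partial>lborel)" for t
      unfolding K_def by (intro integral_mono int mult_left_mono) (auto simp: V01)
    then have K1: "K t \<le> 1" for t using \<delta> by (auto intro: order_trans)
    have harm_nn: "Kn t = (\<integral>\<^sup>+y. Kn (t - y) \<partial>F)" if t: "0 \<le> t" for t
    proof -
      have "Kn t = (\<integral>\<^sup>+r. indicator {0..\<delta>} r * (\<integral>\<^sup>+y. ennreal (V (t + r - y)) \<partial>F) \<partial>lborel)"
        unfolding Kn_def using t by (intro nn_integral_cong) (auto simp: indicator_def Vren)
      also have "\<dots> = (\<integral>\<^sup>+r. \<integral>\<^sup>+y. indicator {0..\<delta>} r * ennreal (V (t + r - y)) \<partial>F \<partial>lborel)"
        by (intro nn_integral_cong nn_integral_cmult[symmetric]) measurable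
      also have "\<dots> = (\<integral>\<^sup>+y. \<integral>\<^sup>+r. indicator {0..\<delta>} r * ennreal (V (t + r - y)) \<partial>lborel \<partial>F)"
        by (rule FL.Fubini') measurable
      finally show ?thesis by (simp add: Kn_def algebra_simps)
    qed
    have harm: "K t = (\<integral>y. K (t - y) \<partial>F)" if t: "0 \<le> t" for t
    proof -
      have "(\<integral>y. K (t - y) \<partial>F) = enn2real (\<integral>\<^sup>+y. ennreal (K (t - y)) \<partial>F)"
        by (rule integral_eq_nn_integral) (auto simp: K0)
      also have "\<dots> = enn2real (Kn t)" unfolding harm_nn[OF t] by (simp add: KnK)
      finally show ?thesis by (simp add: KnK K0)
    qed
    have lip: "\<bar>K s - K t\<bar> \<le> 2 * \<bar>s - t\<bar>" for s t
    proof -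
      have *: "\<bar>K s - K t\<bar> \<le> 2 * (t - s)" if st: "s \<le> t" for s t
      proof -
        have Keq: "K t = (\<integral>r. indicator {t..t+\<delta>} r * V r \<partial>lborel)" for t
        proof -
          have "(\<integral>r. indicator {t..t+\<delta>} r * V r \<partial>lborel) =
              (\<integral>r. indicator {t..t+\<delta>} (t + 1 * r) * V (t + 1 * r) \<partial>lborel)"
            using lborel_integral_real_affine[of 1 "\<lambda>r. indicator {t..t+\<delta>} r * V r" t] by simp
          also have "\<dots> = K t"
            unfolding K_def by (rule Bochner_Integration.integral_cong) (auto simp: indicator_def)
          finally show ?thesis ..
        qed
        have eq: "K s - K t = (\<integral>r. indicator {s..s+\<delta>} r * V r - indicator {t..t+\<delta>} r * V r \<partial>lborel)"
          unfolding Keq[of s] Keq[of t]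
          by (rule Bochner_Integration.integral_diff[OF int int, symmetric]) (simp_all add: V01)
        have "\<bar>K s - K t\<bar> \<le> (\<integral>r. \<bar>indicator {s..s+\<delta>} r * V r - indicator {t..t+\<delta>} r * V r\<bar> \<partial>lborel)"
          unfolding eq by (rule integral_abs_bound)
        also have "\<dots> \<le> (\<integral>r. indicator {s..t} r * 1 + indicator {s+\<delta>..t+\<delta>} r * 1 \<partial>lborel)"
        proof (rule integral_mono)
          show "integrable lborel (\<lambda>r. \<bar>indicator {s..s+\<delta>} r * V r - indicator {t..t+\<delta>} r * V r\<bar>)"
            by (rule integrable_abs, rule Bochner_Integration.integrable_diff[OF int int]) (simp_all add: V01)
          show "integrable lborel (\<lambda>r. indicator {s..t} r * 1 + indicator {s+\<delta>..t+\<delta>} r * 1 :: real)"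
            by (rule Bochner_Integration.integrable_add[OF int int]) simp_all
          fix r
          show "\<bar>indicator {s..s+\<delta>} r * V r - indicator {t..t+\<delta>} r * V r\<bar>
              \<le> indicator {s..t} r * 1 + indicator {s+\<delta>..t+\<delta>} r * 1"
          proof -
            have "\<bar>indicator {s..s+\<delta>} r * V r - indicator {t..t+\<delta>} r * V r\<bar>
                = \<bar>indicat_real {s..s+\<delta>} r - indicator {t..t+\<delta>} r\<bar> * V r"
              using V01[of r] by (simp add: left_diff_distrib[symmetric] abs_mult)
            also have "\<dots> \<le> \<bar>indicat_real {s..s+\<delta>} r - indicator {t..t+\<delta>} r\<bar>"
              using V01[of r] by (simp add: mult_left_le)
            also have "\<dots> \<le> indicator {s..t} r * 1 + indicator {s+\<delta>..t+\<delta>} r * 1"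
              using st by (simp split: split_indicator)
            finally show ?thesis .
          qed
        qed
        also have "\<dots> = 2 * (t - s)"
          using st by (subst Bochner_Integration.integral_add[OF int int]) simp_all
        finally show ?thesis .
      qed
      show ?thesis
      proof (cases "s \<le> t")
        case True
        then show ?thesis using *[of s t] by simp
      next
        case False
        then show ?thesis using *[of t s] abs_minus_commute[of "K s" "K t"] by simp
      qed
    qed
    have inv: "((\<lambda>t. K (t + p) - K t) \<longlongrightarrow> 0) at_top" for p
      by (rule asymptotic_translation_invariance[OF _ K0 K1 harm lip nonlattice]) simp_all
    \<comment> \<open>The random window, now for \<open>K\<close> in place of \<open>V\<close>: its
      mean under \<open>F\<close> is constant in \<open>t\<close>, while its distance to
      \<open>y * K t\<close> tends to 0.\<close>
    define g where "g = (\<lambda>y t. \<integral>s. indicator {0..y} s * K (t - s) \<partial>lborel)"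
    have g_nn: "ennreal (g y t) = (\<integral>\<^sup>+s. indicator {0..<y} s * Kn (t - s) \<partial>lborel)" for y t
    proof -
      have "ennreal (g y t) = (\<integral>\<^sup>+s. ennreal (indicator {0..y} s * K (t - s)) \<partial>lborel)"
        unfolding g_def by (intro nn_integral_eq_integral[symmetric] int) (auto simp: K0 K1)
      also have "\<dots> = (\<integral>\<^sup>+s. indicator {0..<y} s * Kn (t - s) \<partial>lborel)"
        using AE_lborel_singleton[of y]
        by (intro nn_integral_cong_AE) (auto simp: indicator_def KnK elim!: eventually_mono)
      finally show ?thesis .
    qed
    have g0: "0 \<le> g y t" for y t unfolding g_def by (simp add: K0)
    have gy: "g y t \<le> y" if "0 \<le> y" for y t
    proof -
      have "g y t \<le> (\<integral>s. indicator {0..y} s * 1 \<partial>lborel)"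
        unfolding g_def by (intro integral_mono int mult_left_mono) (auto simp: K0 K1)
      then show ?thesis using that by simp
    qed
    have g_meas: "(\<lambda>y. g y t) \<in> borel_measurable borel" for t
    proof -
      have "(\<lambda>y. g y t) = (\<lambda>y. \<integral>s. indicator {0..} s * indicator {0..} (y - s) * K (t - s) \<partial>lborel)"
        unfolding g_def by (intro ext Bochner_Integration.integral_cong) (auto simp: indicator_def)
      also have "\<dots> \<in> borel_measurable borel" by measurable
      finally show ?thesis .
    qed
    note [measurable] = g_meas
    have int_g: "integrable F (\<lambda>y. g y t)" for t
      by (rule Bochner_Integration.integrable_bound[OF mean])
         (use pos in \<open>auto simp: g0 gy elim!: eventually_mono\<close>)
    have int_g_eq: "(\<integral>y. g y t \<partial>F) = \<delta> * (1 - f)" if t: "0 \<le> t" for t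
    proof -
      have "(\<integral>\<^sup>+y. ennreal (g y t) \<partial>F) =
          (\<integral>\<^sup>+y. \<integral>\<^sup>+s. \<integral>\<^sup>+r. indicator {0..<y} s * (indicator {0..\<delta>} r * ennreal (V (t - s + r))) \<partial>lborel \<partial>lborel \<partial>F)"
        unfolding g_nn Kn_def by (intro nn_integral_cong nn_integral_cmult[symmetric]) measurable
      also have "\<dots> = (\<integral>\<^sup>+y. \<integral>\<^sup>+r. \<integral>\<^sup>+s. indicator {0..<y} s * (indicator {0..\<delta>} r * ennreal (V (t - s + r))) \<partial>lborel \<partial>lborel \<partial>F)"
        by (intro nn_integral_cong lborel_pair.Fubini') measurable
      also have "\<dots> = (\<integral>\<^sup>+y. \<integral>\<^sup>+r. indicator {0..\<delta>} r * G y (t + r) \<partial>lborel \<partial>F)"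
        unfolding G_def
        by (intro nn_integral_cong, subst nn_integral_cmult[symmetric])
           (auto intro!: nn_integral_cong simp: algebra_simps)
      also have "\<dots> = (\<integral>\<^sup>+r. \<integral>\<^sup>+y. indicator {0..\<delta>} r * G y (t + r) \<partial>F \<partial>lborel)"
      proof (rule FL.Fubini'[symmetric])
        have "(\<lambda>p. indicator {0..\<delta>} (snd p) * G (fst p) (t + snd p)) =
          (\<lambda>p. indicator {0..\<delta>} (snd p) * (\<integral>\<^sup>+s. indicator {0..} s * indicator {0<..} (fst p - s) * ennreal (V (t + snd p - s)) \<partial>lborel))"
          unfolding G_def by (intro ext arg_cong2[where f="(*)"] refl nn_integral_cong) (auto simp: indicator_def)
        also have "\<dots> \<in> borel_measurable (F \<Otimes>\<^sub>M lborel)" by measurable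
        finally show "(\<lambda>(y, r). indicator {0..\<delta>} r * G y (t + r)) \<in> borel_measurable (F \<Otimes>\<^sub>M lborel)"
          by (simp add: case_prod_beta')
      qed
      also have "\<dots> = (\<integral>\<^sup>+r. indicator {0..\<delta>} r * ennreal (1 - f) \<partial>lborel)"
        using t by (intro nn_integral_cong) (auto simp: indicator_def identity)
      also have "\<dots> = ennreal (\<delta> * (1 - f))"
        using \<delta> by (subst nn_integral_multc) (auto simp: ennreal_mult')
      finally show ?thesis using g0 \<delta> f01 by (subst integral_eq_nn_integral) (auto simp: g_meas)
    qed
    have inner: "((\<lambda>t. y * K t - g y t) \<longlongrightarrow> 0) at_top" if y: "0 < y" for y
    proof -
      have "((\<lambda>t. \<integral>s. indicator {0..y} s * (K t - K (t - s)) \<partial>lborel) \<longlongrightarrow> (\<integral>s. 0 \<partial>(lborel :: real measure))) at_top"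
      proof (rule integral_dominated_convergence_at_top[where w="indicat_real {0..y}"])
        show "AE s in lborel. ((\<lambda>t. indicator {0..y} s * (K t - K (t - s))) \<longlongrightarrow> 0) at_top"
        proof (rule AE_I2)
          fix s :: real
          from tendsto_mult_left[OF tendsto_minus[OF inv[of "- s"]], of "indicator {0..y} s"]
          show "((\<lambda>t. indicator {0..y} s * (K t - K (t - s))) \<longlongrightarrow> 0) at_top" by simp
        qed
        show "\<forall>\<^sub>F t in at_top. AE s in lborel. norm (indicator {0..y} s * (K t - K (t - s))) \<le> indicat_real {0..y} s"
        proof (intro always_eventually allI AE_I2)
          fix t s show "norm (indicator {0..y} s * (K t - K (t - s))) \<le> indicat_real {0..y} s"
            using K0[of t] K1[of t] K0[of "t - s"] K1[of "t - s"] by (auto simp: indicator_def)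
        qed
      qed (use y in auto)
      moreover have "(\<integral>s. indicator {0..y} s * (K t - K (t - s)) \<partial>lborel) = y * K t - g y t" for t
      proof -
        have "(\<integral>s. indicator {0..y} s * (K t - K (t - s)) \<partial>lborel) =
            (\<integral>s. indicator {0..y} s * K t - indicator {0..y} s * K (t - s) \<partial>lborel)"
          by (simp add: algebra_simps)
        also have "\<dots> = y * K t - g y t"
          unfolding g_def using y
          by (subst Bochner_Integration.integral_diff[OF _ int]) (simp_all add: K0 K1)
        finally show ?thesis .
      qed
      ultimately show ?thesis by simp
    qed
    have "((\<lambda>t. \<integral>y. y * K t - g y t \<partial>F) \<longlongrightarrow> (\<integral>y. 0 \<partial>F)) at_top"
    proof (rule integral_dominated_convergence_at_top[where w="\<lambda>y. y"])
      show "AE y in F. ((\<lambda>t. y * K t - g y t) \<longlongrightarrow> 0) at_top"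
        using pos by eventually_elim (rule inner)
      show "\<forall>\<^sub>F t in at_top. AE y in F. norm (y * K t - g y t) \<le> y"
      proof (rule always_eventually, rule allI)
        fix t
        show "AE y in F. norm (y * K t - g y t) \<le> y"
          using pos
        proof eventually_elim
          case (elim y)
          have "0 \<le> y * K t" "y * K t \<le> y" using elim K0[of t] K1[of t] by (auto simp: mult_left_le)
          then show ?case using g0[of y t] gy[of y t] elim unfolding real_norm_def by linarith
        qed
      qed
      show "(\<lambda>y. y * K t - g y t) \<in> borel_measurable F" for t by measurable
    qed (simp_all add: mean)
    moreover have "(\<integral>y. y * K t - g y t \<partial>F) = m * K t - (\<integral>y. g y t \<partial>F)" for t
      unfolding m_def
      by (subst Bochner_Integration.integral_diff[OF integrable_mult_left[OF mean] int_g]) simp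
    ultimately have "((\<lambda>t. m * K t - (\<integral>y. g y t \<partial>F)) \<longlongrightarrow> 0) at_top" by simp
    moreover have "\<forall>\<^sub>F t in at_top. m * K t - (\<integral>y. g y t \<partial>F) = m * K t - \<delta> * (1 - f)"
      by (rule eventually_mono[OF eventually_ge_at_top[of 0]]) (simp add: int_g_eq)
    ultimately have "((\<lambda>t. m * K t - \<delta> * (1 - f)) \<longlongrightarrow> 0) at_top" by (rule Lim_transform_eventually)
    then have "((\<lambda>t. ((m * K t - \<delta> * (1 - f)) + \<delta> * (1 - f)) / m) \<longlongrightarrow> (0 + \<delta> * (1 - f)) / m) at_top"
      using m_pos by (intro tendsto_intros) auto
    then have lim: "(K \<longlongrightarrow> \<delta> * (1 - f) / m) at_top" using m_pos by simp
    have up: "K t \<le> \<delta> * exp \<delta> * V t" for t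
    proof -
      have "K t \<le> (\<integral>r. indicator {0..\<delta>} r * (exp \<delta> * V t) \<partial>lborel)"
        unfolding K_def
      proof (rule integral_mono)
        fix r :: real
        show "indicator {0..\<delta>} r * V (t + r) \<le> indicator {0..\<delta>} r * (exp \<delta> * V t)"
        proof (cases "r \<in> {0..\<delta>}")
          case True
          then have "V (t + r) \<le> exp r * V t" by (intro Vexp) auto
          also have "\<dots> \<le> exp \<delta> * V t" using True by (intro mult_right_mono V01) auto
          finally show ?thesis using True by simp
        qed simp
      next
        show "integrable lborel (\<lambda>r. indicator {0..\<delta>} r * (exp \<delta> * V t))"
          using \<delta> by (intro integrable_mult_left) auto
        show "integrable lborel (\<lambda>r. indicator {0..\<delta>} r * V (t + r))"
          by (rule int) (simp_all add: V01)
      qed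
      then show ?thesis using \<delta> by simp
    qed
    have low: "\<delta> * V t \<le> exp \<delta> * K (t - \<delta>)" for t
    proof -
      have "\<delta> * V t = (\<integral>r. indicator {0..\<delta>} r * V t \<partial>lborel)" using \<delta> by simp
      also have "\<dots> \<le> (\<integral>r. exp \<delta> * (indicator {0..\<delta>} r * V (t - \<delta> + r)) \<partial>lborel)"
      proof (rule integral_mono)
        fix r :: real
        show "indicator {0..\<delta>} r * V t \<le> exp \<delta> * (indicator {0..\<delta>} r * V (t - \<delta> + r))"
        proof (cases "r \<in> {0..\<delta>}")
          case True
          then have "V ((t - \<delta> + r) + (\<delta> - r)) \<le> exp (\<delta> - r) * V (t - \<delta> + r)" by (intro Vexp) auto
          also have "\<dots> \<le> exp \<delta> * V (t - \<delta> + r)" using True by (intro mult_right_mono V01) auto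
          finally show ?thesis using True by simp
        qed simp
      next
        show "integrable lborel (\<lambda>r. indicator {0..\<delta>} r * V t)"
          using \<delta> by (intro integrable_mult_left) auto
        show "integrable lborel (\<lambda>r. exp \<delta> * (indicator {0..\<delta>} r * V (t - \<delta> + r)))"
          by (rule integrable_mult_right, rule int) (simp_all add: V01)
      qed
      finally show ?thesis by (simp add: K_def)
    qed
    show ?thesis using up low lim by blast
  qed
  define c where "c = (1 - f) / m"
  have c0: "0 \<le> c" using f01 m_pos by (simp add: c_def)
  have "(V \<longlongrightarrow> c) at_top"
  proof (rule order_tendstoI)
    fix a assume a: "a < c"
    have "((\<lambda>\<delta>. exp (- \<delta>) * c) \<longlongrightarrow> exp (- 0) * c) (at_right 0)" by (intro tendsto_intros)
    then have "\<forall>\<^sub>F \<delta> in at_right 0. a < exp (- \<delta>) * c" by (rule order_tendstoD) (use a in simp)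
    moreover have "\<forall>\<^sub>F \<delta> in at_right (0::real). 0 < \<delta> \<and> \<delta> < 1"
      by (rule eventually_at_rightI[of 0 1]) auto
    ultimately obtain \<delta> where \<delta>: "a < exp (- \<delta>) * c" "0 < \<delta>" "\<delta> < 1"
      using eventually_happens'[OF trivial_limit_at_right_real eventually_conj] by blast
    obtain K where K: "\<And>t. K t \<le> \<delta> * exp \<delta> * V t" "(K \<longlongrightarrow> \<delta> * (1 - f) / m) at_top"
      using window[of \<delta>] \<delta> by auto
    have "\<delta> * exp \<delta> * a < \<delta> * c"
    proof -
      have "exp \<delta> * a < exp \<delta> * (exp (- \<delta>) * c)" using \<delta> by simp
      also have "\<dots> = c" by (simp add: exp_minus)
      finally show ?thesis using \<delta> by simp
    qed
    then have "\<forall>\<^sub>F t in at_top. \<delta> * exp \<delta> * a < K t"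
      using K(2) by (intro order_tendstoD(1)[OF K(2)]) (simp add: c_def)
    then show "\<forall>\<^sub>F t in at_top. a < V t"
    proof eventually_elim
      case (elim t)
      then have "\<delta> * exp \<delta> * a < \<delta> * exp \<delta> * V t" using K(1)[of t] by simp
      then show ?case using \<delta> by simp
    qed
  next
    fix a assume a: "c < a"
    have "((\<lambda>\<delta>. exp \<delta> * c) \<longlongrightarrow> exp 0 * c) (at_right 0)" by (intro tendsto_intros)
    then have "\<forall>\<^sub>F \<delta> in at_right 0. exp \<delta> * c < a" by (rule order_tendstoD) (use a in simp)
    moreover have "\<forall>\<^sub>F \<delta> in at_right (0::real). 0 < \<delta> \<and> \<delta> < 1"
      by (rule eventually_at_rightI[of 0 1]) auto
    ultimately obtain \<delta> where \<delta>: "exp \<delta> * c < a" "0 < \<delta>" "\<delta> < 1"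
      using eventually_happens'[OF trivial_limit_at_right_real eventually_conj] by blast
    obtain K where K: "\<And>t. \<delta> * V t \<le> exp \<delta> * K (t - \<delta>)" "(K \<longlongrightarrow> \<delta> * (1 - f) / m) at_top"
      using window[of \<delta>] \<delta> by auto
    have "filterlim (\<lambda>t. t - \<delta>) at_top at_top"
      using filterlim_tendsto_add_at_top[OF tendsto_const[of "- \<delta>"] filterlim_ident] by simp
    from filterlim_compose[OF K(2) this]
    have "((\<lambda>t. exp \<delta> * K (t - \<delta>)) \<longlongrightarrow> exp \<delta> * (\<delta> * (1 - f) / m)) at_top" by (rule tendsto_mult_left)
    moreover have "exp \<delta> * (\<delta> * (1 - f) / m) < \<delta> * a"
    proof -
      have "exp \<delta> * (\<delta> * (1 - f) / m) = \<delta> * (exp \<delta> * c)" by (simp add: c_def)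
      also have "\<dots> < \<delta> * a" using \<delta> by simp
      finally show ?thesis .
    qed
    ultimately have "\<forall>\<^sub>F t in at_top. exp \<delta> * K (t - \<delta>) < \<delta> * a" by (rule order_tendstoD)
    then show "\<forall>\<^sub>F t in at_top. V t < a"
    proof eventually_elim
      case (elim t)
      then have "\<delta> * V t < \<delta> * a" using K(1)[of t] by simp
      then show ?case using \<delta> by simp
    qed
  qed
  then show ?thesis by (simp add: c_def f_def m_def)
qed

end

section \<open>Multiplicative cascades\<close>

text \<open>The marks of the subtree rooted at \<open>u\<close>, reindexed as a full tree, so that
  functionals of subtrees are functionals of the whole family composed with
  \<open>sh u\<close>.\<close>

definition sh :: "'a list \<Rightarrow> ('a list \<Rightarrow> 'b) \<Rightarrow> 'a list \<Rightarrow> 'b" where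
  "sh u \<eta> = (\<lambda>v. \<eta> (u @ v))"

lemma sh_apply_Nil [simp]: "sh u \<eta> [] = \<eta> u"
  by (simp add: sh_def)

lemma sh_Nil [simp]: "sh [] \<eta> = \<eta>"
  by (simp add: sh_def)

lemma sh_sh [simp]: "sh v (sh u \<eta>) = sh (u @ v) \<eta>"
  by (simp add: sh_def)

section \<open>Square integrable functions and orthogonality\<close>

lemma integrable_mult_squares:
  fixes f g :: "'a \<Rightarrow> real"
  assumes [measurable]: "f \<in> borel_measurable M" "g \<in> borel_measurable M"
    and "integrable M (\<lambda>x. (f x)\<^sup>2)" "integrable M (\<lambda>x. (g x)\<^sup>2)"
  shows "integrable M (\<lambda>x. f x * g x)"
proof (rule Bochner_Integration.integrable_bound)
  show "integrable M (\<lambda>x. (f x)\<^sup>2 + (g x)\<^sup>2)" using assms by simp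
  have "\<bar>s * t\<bar> \<le> s\<^sup>2 + t\<^sup>2" for s t :: real
  proof -
    have "2 * \<bar>s\<bar> * \<bar>t\<bar> \<le> s\<^sup>2 + t\<^sup>2" using sum_squares_bound[of "\<bar>s\<bar>" "\<bar>t\<bar>"] by simp
    moreover have "0 \<le> \<bar>s\<bar> * \<bar>t\<bar>" by simp
    ultimately show ?thesis unfolding abs_mult by linarith
  qed
  then show "AE x in M. norm (f x * g x) \<le> norm ((f x)\<^sup>2 + (g x)\<^sup>2)" by simp
qed measurable

lemma integrable_square_iff:
  fixes f :: "'a \<Rightarrow> real"
  assumes [measurable]: "f \<in> borel_measurable M"
  shows "integrable M (\<lambda>x. (f x)\<^sup>2) \<longleftrightarrow> (\<integral>\<^sup>+x. ennreal ((f x)\<^sup>2) \<partial>M) < \<infinity>"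
  by (simp add: integrable_iff_bounded)

lemma square_sum_le: "(s + t)\<^sup>2 \<le> 2 * s\<^sup>2 + 2 * t\<^sup>2" for s t :: real
  using zero_le_power2[of "s - t"] by (simp add: power2_eq_square algebra_simps)

lemma integrable_square_add:
  fixes f g :: "'a \<Rightarrow> real"
  assumes [measurable]: "f \<in> borel_measurable M" "g \<in> borel_measurable M"
    and "integrable M (\<lambda>x. (f x)\<^sup>2)" "integrable M (\<lambda>x. (g x)\<^sup>2)"
  shows "integrable M (\<lambda>x. (f x + g x)\<^sup>2)"
proof (rule Bochner_Integration.integrable_bound)
  show "integrable M (\<lambda>x. 2 * (f x)\<^sup>2 + 2 * (g x)\<^sup>2)" using assms by simp
  show "AE x in M. norm ((f x + g x)\<^sup>2) \<le> norm (2 * (f x)\<^sup>2 + 2 * (g x)\<^sup>2)"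
    using square_sum_le by auto
qed measurable

text \<open>Pythagoras, in terms of \<open>nn_integral\<close> so that it combines with the possibly
  infinite sums over the tree.\<close>

lemma nn_integral_square_add:
  fixes f g :: "'a \<Rightarrow> real"
  assumes [measurable]: "f \<in> borel_measurable M" "g \<in> borel_measurable M"
    and f: "integrable M (\<lambda>x. (f x)\<^sup>2)" and g: "integrable M (\<lambda>x. (g x)\<^sup>2)"
    and orth: "(\<integral>x. f x * g x \<partial>M) = 0"
  shows "(\<integral>\<^sup>+x. ennreal ((f x + g x)\<^sup>2) \<partial>M) =
    (\<integral>\<^sup>+x. ennreal ((f x)\<^sup>2) \<partial>M) + (\<integral>\<^sup>+x. ennreal ((g x)\<^sup>2) \<partial>M)"
proof -
  have fg: "integrable M (\<lambda>x. f x * g x)" by (rule integrable_mult_squares) (use f g in auto)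
  have "(\<integral>x. (f x + g x)\<^sup>2 \<partial>M) = (\<integral>x. ((f x)\<^sup>2 + (g x)\<^sup>2) + 2 * (f x * g x) \<partial>M)"
    by (simp add: power2_sum mult.assoc)
  also have "\<dots> = (\<integral>x. (f x)\<^sup>2 + (g x)\<^sup>2 \<partial>M) + (\<integral>x. 2 * (f x * g x) \<partial>M)"
    by (intro Bochner_Integration.integral_add Bochner_Integration.integrable_add f g integrable_mult_right fg)
  also have "\<dots> = (\<integral>x. (f x)\<^sup>2 \<partial>M) + (\<integral>x. (g x)\<^sup>2 \<partial>M)"
    using f g orth by simp
  finally have eq: "(\<integral>x. (f x + g x)\<^sup>2 \<partial>M) = (\<integral>x. (f x)\<^sup>2 \<partial>M) + (\<integral>x. (g x)\<^sup>2 \<partial>M)" .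
  have "integrable M (\<lambda>x. (f x + g x)\<^sup>2)" by (rule integrable_square_add) (use f g in auto)
  then have "(\<integral>\<^sup>+x. ennreal ((f x + g x)\<^sup>2) \<partial>M) = ennreal (\<integral>x. (f x + g x)\<^sup>2 \<partial>M)"
    by (intro nn_integral_eq_integral) auto
  also have "\<dots> = ennreal (\<integral>x. (f x)\<^sup>2 \<partial>M) + ennreal (\<integral>x. (g x)\<^sup>2 \<partial>M)"
    unfolding eq by (intro ennreal_plus) auto
  finally show ?thesis using f g by (simp add: nn_integral_eq_integral)
qed

text \<open>A child number \<open>k\<close> of an individual with mark \<open>\<zeta>\<close> has
  the relative weight \<open>a k \<zeta>\<close>; weight 0 stands for a missing child. The strict
  bound by 1 reflects that all displacements are positive.\<close>

locale cascade = prob_space M for M :: "'w measure" +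
  fixes \<xi> :: "nat list \<Rightarrow> 'w \<Rightarrow> real measure" and a :: "nat \<Rightarrow> real measure \<Rightarrow> real"
  assumes indep: "indep_vars (\<lambda>_. measure_algebra halfline) \<xi> UNIV"
    and ident: "\<And>u. distr M (measure_algebra halfline) (\<xi> u) = distr M (measure_algebra halfline) (\<xi> [])"
    and a_measurable [measurable]: "\<And>k. a k \<in> borel_measurable (measure_algebra halfline)"
    and a_nonneg [simp]: "\<And>k \<zeta>. 0 \<le> a k \<zeta>" and a_less_1: "\<And>k \<zeta>. a k \<zeta> < 1"
begin

abbreviation N :: "real measure measure" where "N \<equiv> measure_algebra halfline"

abbreviation Om :: "(nat list \<Rightarrow> real measure) measure" where "Om \<equiv> PiM UNIV (\<lambda>_. N)"

definition fam :: "'w \<Rightarrow> nat list \<Rightarrow> real measure" where "fam \<omega> = (\<lambda>u. \<xi> u \<omega>)"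

lemma fam_apply: "fam \<omega> u = \<xi> u \<omega>"
  by (simp add: fam_def)

lemma fam_Nil [simp]: "fam \<omega> [] = \<xi> [] \<omega>"
  by (simp add: fam_def)

abbreviation gen :: "nat list set \<Rightarrow> 'w measure" where "gen U \<equiv> generated M \<xi> U"

text \<open>\<open>outside u\<close> knows every mark except those in the subtree of
  \<open>u\<close>, the mark of \<open>u\<close> itself belonging to this subtree.
  \<open>past u\<close> knows only the strict ancestors of \<open>u\<close>, which already determine
  the weight of \<open>u\<close> and whether it lies on a stopping line.\<close>

abbreviation outside :: "nat list \<Rightarrow> 'w measure" where "outside u \<equiv> gen {w. \<not> prefix u w}"

abbreviation past :: "nat list \<Rightarrow> 'w measure" where "past u \<equiv> gen {w. strict_prefix w u}"

subsection \<open>Measurability and independence\<close>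

lemma measurable_xi [measurable]: "\<xi> u \<in> measurable M N"
  using indep by (auto simp: indep_vars_def)

lemma sets_gen: "sets (gen U) = sigma_sets (space M) (\<Union>u\<in>U. {\<xi> u -` A \<inter> space M | A. A \<in> sets N})"
  unfolding generated_def by (rule sets_measure_of) auto

lemma gen_subset: "U \<subseteq> V \<Longrightarrow> sets (gen U) \<subseteq> sets (gen V)"
  unfolding sets_gen by (intro sigma_sets_mono') auto

lemma gen_subset_M: "sets (gen U) \<subseteq> sets M"
  unfolding sets_gen by (intro sets.sigma_sets_subset) (auto intro: measurable_sets[OF measurable_xi])

lemma measurable_gen_mono: "f \<in> measurable (gen U) K \<Longrightarrow> U \<subseteq> V \<Longrightarrow> f \<in> measurable (gen V) K"
  using gen_subset[of U V] by (auto simp: measurable_def)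

lemma measurable_gen_M: "f \<in> measurable (gen U) K \<Longrightarrow> f \<in> measurable M K"
  using gen_subset_M[of U] by (auto simp: measurable_def)

lemma measurable_xi_gen: "u \<in> U \<Longrightarrow> \<xi> u \<in> measurable (gen U) N"
proof (rule measurableI)
  show "\<xi> u \<omega> \<in> space N" if "\<omega> \<in> space (gen U)" for \<omega>
    using measurable_space[OF measurable_xi] that by simp
  show "\<xi> u -` A \<inter> space (gen U) \<in> sets (gen U)" if "u \<in> U" "A \<in> sets N" for A
    using that unfolding sets_gen space_generated by (intro sigma_sets.Basic) auto
qed

lemma measurable_sh [measurable]: "sh u \<in> measurable Om Om"
  unfolding sh_def by (rule measurable_PiM_single') (auto simp: space_PiM PiE_iff)

lemma measurable_sh_fam_gen:
  assumes "\<And>w. prefix u w \<Longrightarrow> w \<in> U"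
  shows "(\<lambda>\<omega>. sh u (fam \<omega>)) \<in> measurable (gen U) Om"
  unfolding sh_def fam_def
proof (rule measurable_PiM_single')
  show "(\<lambda>\<omega>. \<xi> (u @ v) \<omega>) \<in> measurable (gen U) N" for v
    by (rule measurable_xi_gen) (simp add: assms)
  show "(\<lambda>\<omega> v. \<xi> (u @ v) \<omega>) \<in> space (gen U) \<rightarrow> UNIV \<rightarrow>\<^sub>E space N"
    using measurable_space[OF measurable_xi] by auto
qed

lemma measurable_sh_fam [measurable]: "(\<lambda>\<omega>. sh u (fam \<omega>)) \<in> measurable M Om"
  using measurable_gen_M[OF measurable_sh_fam_gen[of u UNIV]] by simp

lemma measurable_fam [measurable]: "fam \<in> measurable M Om"
  using measurable_sh_fam[of "[]"] by simp

lemma measurable_component [measurable]: "(\<lambda>\<eta>. \<eta> u) \<in> measurable Om N"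
  by (rule measurable_component_singleton) simp

lemma indep_gen:
  assumes "U \<inter> V = {}"
  shows "indep_set (sets (gen U)) (sets (gen V))"
proof -
  let ?E = "\<lambda>u. {\<xi> u -` A \<inter> space M | A. A \<in> sets N}"
  have "indep_sets ?E UNIV" using indep unfolding indep_vars_def2 by blast
  then have i: "indep_sets ?E (\<Union>j\<in>UNIV. case_bool U V j)" by (rule indep_sets_mono) auto
  have "indep_sets (\<lambda>j. sigma_sets (space M) (\<Union>u\<in>case_bool U V j. ?E u)) UNIV"
  proof (rule indep_sets_collect_sigma[OF i])
    show "Int_stable (?E u)" for u
    proof (rule Int_stableI, safe)
      fix A B assume "A \<in> sets N" "B \<in> sets N"
      then show "\<exists>C. (\<xi> u -` A \<inter> space M) \<inter> (\<xi> u -` B \<inter> space M) = \<xi> u -` C \<inter> space M \<and> C \<in> sets N"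
        by (intro exI[of _ "A \<inter> B"]) auto
    qed
    show "disjoint_family_on (case_bool U V) UNIV"
      using assms by (auto simp: disjoint_family_on_def split: bool.splits)
  qed
  then show ?thesis unfolding indep_set_def
    by (rule indep_sets_mono_sets) (auto simp: sets_gen split: bool.splits)
qed

text \<open>Prefixing by \<open>u\<close> is injective, so reindexing the product of copies of one
  law reproduces that product.\<close>

lemma distr_sh_fam: "distr M Om (\<lambda>\<omega>. sh u (fam \<omega>)) = distr M Om fam"
proof -
  have law: "distr M Om (\<lambda>\<omega>. sh u (fam \<omega>)) = PiM UNIV (\<lambda>_. distr M N (\<xi> []))" for u
  proof -
    let ?P = "PiM UNIV (\<lambda>_ :: nat list. distr M N (\<xi> []))"
    have "distr M Om (\<lambda>\<omega>. \<lambda>v\<in>UNIV. \<xi> v \<omega>) = PiM UNIV (\<lambda>v. distr M N (\<xi> v))"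
      using indep by (subst (asm) indep_vars_iff_distr_eq_PiM') auto
    also have "(\<lambda>v. distr M N (\<xi> v)) = (\<lambda>v. distr M N (\<xi> []))" by (rule ext) (rule ident)
    finally have fam: "distr M Om fam = ?P" by (simp add: fam_def[abs_def])
    have "distr ?P ?P (\<lambda>\<eta>. \<lambda>v\<in>UNIV. \<eta> (u @ v)) = ?P"
      by (rule distr_PiM_reindex) (auto intro: prob_space_distr simp: inj_on_def)
    moreover have "(\<lambda>\<eta> :: nat list \<Rightarrow> real measure. \<lambda>v\<in>UNIV. \<eta> (u @ v)) = sh u"
      by (simp add: fun_eq_iff sh_def)
    ultimately have "distr ?P ?P (sh u) = ?P" by simp
    moreover have "distr ?P ?P (sh u) = distr ?P Om (sh u)"
      by (rule distr_cong) (auto intro!: sets_PiM_cong)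
    ultimately have "distr (distr M Om fam) Om (sh u) = ?P" by (simp add: fam)
    then show ?thesis by (simp add: distr_distr comp_def)
  qed
  show ?thesis using law[of u] law[of "[]"] by simp
qed

lemma AE_sh:
  assumes [measurable]: "Measurable.pred Om P" and "AE \<omega> in M. P (fam \<omega>)"
  shows "AE \<omega> in M. P (sh u (fam \<omega>))"
proof -
  have "AE \<eta> in distr M Om fam. P \<eta>" using assms by (subst AE_distr_iff) auto
  then have "AE \<eta> in distr M Om (\<lambda>\<omega>. sh u (fam \<omega>)). P \<eta>" unfolding distr_sh_fam .
  then show ?thesis by (subst (asm) AE_distr_iff) auto
qed

lemma id_measurable_outside: "(\<lambda>\<omega>. \<omega>) \<in> measurable M (gen U)"
proof (rule measurableI)
  show "(\<lambda>\<omega>. \<omega>) -` A \<inter> space M \<in> sets M" if "A \<in> sets (gen U)" for A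
    using subsetD[OF gen_subset_M that] by (simp add: vimage_ident)
qed simp

text \<open>Independence of a subtree from everything outside it, in the form required by Fubini.
  The outside is represented by the identity map, taken with values in the coarser
  \<sigma>-algebra.\<close>

lemma distr_pair_outside:
  "distr M (outside u) (\<lambda>\<omega>. \<omega>) \<Otimes>\<^sub>M distr M Om fam =
    distr M (outside u \<Otimes>\<^sub>M Om) (\<lambda>\<omega>. (\<omega>, sh u (fam \<omega>)))"
proof -
  let ?\<mu> = "distr M (outside u) (\<lambda>\<omega>. \<omega>)" and ?\<nu> = "distr M Om fam"
  have m: "(\<lambda>\<omega>. (\<omega>, sh u (fam \<omega>))) \<in> measurable M (outside u \<Otimes>\<^sub>M Om)"
    by (rule measurable_Pair[OF id_measurable_outside measurable_sh_fam])
  interpret \<nu>: prob_space ?\<nu> by (rule prob_space_distr) measurable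
  interpret \<mu>: prob_space ?\<mu> by (rule prob_space_distr[OF id_measurable_outside])
  show ?thesis
  proof (rule pair_measure_eqI)
    fix A B assume "A \<in> sets ?\<mu>" "B \<in> sets ?\<nu>"
    then have A: "A \<in> sets (outside u)" and B: "B \<in> sets Om" by simp_all
    let ?B = "(\<lambda>\<omega>. sh u (fam \<omega>)) -` B \<inter> space M"
    have AM: "A \<subseteq> space M" using sets.sets_into_space[OF A] by simp
    have "?B \<in> sets (gen {w. prefix u w})"
      using measurable_sets[OF measurable_sh_fam_gen[of u "{w. prefix u w}"] B] by simp
    moreover have "indep_set (sets (outside u)) (sets (gen {w. prefix u w}))" by (rule indep_gen) auto
    ultimately have "prob (A \<inter> ?B) = prob A * prob ?B" using A unfolding indep_sets2_eq by blast
    then have "emeasure M (A \<inter> ?B) = emeasure M A * emeasure M ?B"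
      by (simp add: emeasure_eq_measure ennreal_mult)
    moreover have "emeasure ?\<mu> A = emeasure M A"
      using A AM by (simp add: emeasure_distr[OF id_measurable_outside] Int_absorb2)
    moreover have "emeasure ?\<nu> B = emeasure M ?B"
      using B unfolding distr_sh_fam[of u, symmetric] by (simp add: emeasure_distr)
    moreover have "emeasure (distr M (outside u \<Otimes>\<^sub>M Om) (\<lambda>\<omega>. (\<omega>, sh u (fam \<omega>)))) (A \<times> B) = emeasure M (A \<inter> ?B)"
      using A B AM by (subst emeasure_distr[OF m]) (auto intro!: arg_cong[where f="emeasure M"])
    ultimately show "emeasure ?\<mu> A * emeasure ?\<nu> B =
        emeasure (distr M (outside u \<Otimes>\<^sub>M Om) (\<lambda>\<omega>. (\<omega>, sh u (fam \<omega>)))) (A \<times> B)" by simp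
  qed (auto intro: \<mu>.sigma_finite_measure_axioms \<nu>.sigma_finite_measure_axioms cong: sets_pair_measure_cong)
qed

text \<open>The branching property: whatever is decided outside the subtree of \<open>u\<close> can
  be held fixed while the subtree is replaced by an independent copy of the whole family.\<close>

lemma nn_freeze:
  assumes H: "H \<in> borel_measurable (outside u \<Otimes>\<^sub>M Om)"
  shows "(\<integral>\<^sup>+\<omega>. H (\<omega>, sh u (fam \<omega>)) \<partial>M) = (\<integral>\<^sup>+\<omega>. \<integral>\<^sup>+\<omega>'. H (\<omega>, fam \<omega>') \<partial>M \<partial>M)"
proof -
  note [measurable] = id_measurable_outside
  let ?\<mu> = "distr M (outside u) (\<lambda>\<omega>. \<omega>)" and ?\<nu> = "distr M Om fam"
  interpret \<nu>: prob_space ?\<nu> by (rule prob_space_distr) measurable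
  have H': "H \<in> borel_measurable (?\<mu> \<Otimes>\<^sub>M ?\<nu>)" using H by (simp cong: measurable_cong_sets)
  have m: "(\<lambda>\<omega>. (\<omega>, sh u (fam \<omega>))) \<in> measurable M (outside u \<Otimes>\<^sub>M Om)" by measurable
  have "(\<integral>\<^sup>+\<omega>. H (\<omega>, sh u (fam \<omega>)) \<partial>M) = (\<integral>\<^sup>+p. H p \<partial>(?\<mu> \<Otimes>\<^sub>M ?\<nu>))"
    unfolding distr_pair_outside by (rule nn_integral_distr[OF m, symmetric]) (simp add: H)
  also have "\<dots> = (\<integral>\<^sup>+\<omega>. \<integral>\<^sup>+\<eta>. H (\<omega>, \<eta>) \<partial>?\<nu> \<partial>?\<mu>)"
    by (rule \<nu>.nn_integral_fst[OF H', symmetric])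
  also have "\<dots> = (\<integral>\<^sup>+\<omega>. \<integral>\<^sup>+\<eta>. H (\<omega>, \<eta>) \<partial>?\<nu> \<partial>M)"
    using \<nu>.borel_measurable_nn_integral_fst[OF H'] by (intro nn_integral_distr id_measurable_outside) simp
  also have "\<dots> = (\<integral>\<^sup>+\<omega>. \<integral>\<^sup>+\<omega>'. H (\<omega>, fam \<omega>') \<partial>M \<partial>M)"
  proof (rule nn_integral_cong)
    fix \<omega> assume "\<omega> \<in> space M"
    then have "(\<lambda>\<eta>. H (\<omega>, \<eta>)) \<in> borel_measurable Om"
      by (intro measurable_compose[OF measurable_Pair1' H]) simp
    then show "(\<integral>\<^sup>+\<eta>. H (\<omega>, \<eta>) \<partial>?\<nu>) = (\<integral>\<^sup>+\<omega>'. H (\<omega>, fam \<omega>') \<partial>M)"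
      by (intro nn_integral_distr measurable_fam) simp
  qed
  finally show ?thesis .
qed

lemma freeze:
  fixes H :: "_ \<Rightarrow> _::{banach, second_countable_topology}"
  assumes H: "H \<in> borel_measurable (outside u \<Otimes>\<^sub>M Om)"
    and int: "integrable M (\<lambda>\<omega>. H (\<omega>, sh u (fam \<omega>)))"
  shows "(\<integral>\<omega>. H (\<omega>, sh u (fam \<omega>)) \<partial>M) = (\<integral>\<omega>. (\<integral>\<omega>'. H (\<omega>, fam \<omega>') \<partial>M) \<partial>M)"
proof -
  note [measurable] = id_measurable_outside
  let ?\<mu> = "distr M (outside u) (\<lambda>\<omega>. \<omega>)" and ?\<nu> = "distr M Om fam"
  interpret \<nu>: prob_space ?\<nu> by (rule prob_space_distr) measurable
  interpret \<mu>: prob_space ?\<mu> by (rule prob_space_distr) measurable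
  interpret P: pair_sigma_finite ?\<mu> ?\<nu> ..
  have H': "H \<in> borel_measurable (?\<mu> \<Otimes>\<^sub>M ?\<nu>)" using H by (simp cong: measurable_cong_sets)
  have m: "(\<lambda>\<omega>. (\<omega>, sh u (fam \<omega>))) \<in> measurable M (outside u \<Otimes>\<^sub>M Om)" by measurable
  have I: "integrable (?\<mu> \<Otimes>\<^sub>M ?\<nu>) H"
    unfolding distr_pair_outside using int by (simp add: integrable_distr_eq[OF m H])
  have "(\<integral>\<omega>. H (\<omega>, sh u (fam \<omega>)) \<partial>M) = (\<integral>p. H p \<partial>(?\<mu> \<Otimes>\<^sub>M ?\<nu>))"
    unfolding distr_pair_outside by (rule integral_distr[OF m H, symmetric])
  also have "\<dots> = (\<integral>\<omega>. \<integral>\<eta>. H (\<omega>, \<eta>) \<partial>?\<nu> \<partial>?\<mu>)"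
    by (rule P.integral_fst'[OF I, symmetric])
  also have "\<dots> = (\<integral>\<omega>. \<integral>\<eta>. H (\<omega>, \<eta>) \<partial>?\<nu> \<partial>M)"
    using \<nu>.borel_measurable_lebesgue_integral[of "\<lambda>\<omega> \<eta>. H (\<omega>, \<eta>)" ?\<mu>] H'
    by (intro integral_distr id_measurable_outside) simp
  also have "\<dots> = (\<integral>\<omega>. \<integral>\<omega>'. H (\<omega>, fam \<omega>') \<partial>M \<partial>M)"
  proof (rule Bochner_Integration.integral_cong[OF refl])
    fix \<omega> assume "\<omega> \<in> space M"
    then have "(\<lambda>\<eta>. H (\<omega>, \<eta>)) \<in> borel_measurable Om"
      by (intro measurable_compose[OF measurable_Pair1' H]) simp
    then show "(\<integral>\<eta>. H (\<omega>, \<eta>) \<partial>?\<nu>) = (\<integral>\<omega>'. H (\<omega>, fam \<omega>') \<partial>M)"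
      by (intro integral_distr measurable_fam) simp
  qed
  finally show ?thesis .
qed

subsection \<open>Weights and lines\<close>

primrec wt :: "nat list \<Rightarrow> (nat list \<Rightarrow> real measure) \<Rightarrow> real" where
  "wt [] \<eta> = 1"
| "wt (k # u) \<eta> = a k (\<eta> []) * wt u (sh [k] \<eta>)"

lemma wt_append: "wt (u @ v) \<eta> = wt u \<eta> * wt v (sh u \<eta>)"
  by (induction u arbitrary: \<eta>) (simp_all add: mult.assoc)

lemma wt_snoc: "wt (u @ [k]) \<eta> = wt u \<eta> * a k (\<eta> u)"
  by (simp add: wt_append)

lemma wt_nonneg [simp]: "0 \<le> wt u \<eta>"
  by (induction u arbitrary: \<eta>) simp_all

lemma wt_le_1: "wt u \<eta> \<le> 1"
  by (induction u arbitrary: \<eta>) (auto intro!: mult_le_one simp: a_less_1 less_imp_le)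

lemma wt_antimono: "prefix u v \<Longrightarrow> wt v \<eta> \<le> wt u \<eta>"
  by (auto simp: prefix_def wt_append mult_left_le wt_le_1)

lemma measurable_wt [measurable]: "wt u \<in> borel_measurable Om"
proof (induction u)
  case (Cons k u)
  note [measurable] = Cons
  show ?case unfolding wt.simps[abs_def] by measurable
qed simp

lemma measurable_wt_past: "(\<lambda>\<omega>. wt u (fam \<omega>)) \<in> borel_measurable (past u)"
proof (induction u rule: rev_induct)
  case (snoc k u)
  have 1: "(\<lambda>\<omega>. wt u (fam \<omega>)) \<in> borel_measurable (past (u @ [k]))"
    by (rule measurable_gen_mono[OF snoc]) (auto simp: strict_prefix_def)
  have 2: "\<xi> u \<in> measurable (past (u @ [k])) N"
    by (rule measurable_xi_gen) (simp add: strict_prefix_def)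
  have "(\<lambda>\<omega>. wt (u @ [k]) (fam \<omega>)) = (\<lambda>\<omega>. wt u (fam \<omega>) * a k (\<xi> u \<omega>))"
    by (simp add: wt_snoc fam_apply[of _ u])
  then show ?case
    using borel_measurable_times[OF 1 measurable_compose[OF 2 a_measurable]] by simp
qed simp

text \<open>Membership of \<open>u\<close> is decided by its strict ancestors alone. This is more
  than optionality, and it holds for the first generation and for the coming generations.\<close>

definition line :: "(nat list \<Rightarrow> 'w \<Rightarrow> bool) \<Rightarrow> bool" where
  "line J \<longleftrightarrow> (\<forall>u. Measurable.pred (past u) (J u)) \<and>
    (\<forall>\<omega>\<in>space M. \<forall>u v. J u \<omega> \<longrightarrow> J v \<omega> \<longrightarrow> prefix u v \<longrightarrow> u = v)"

lemma past_outside: "\<not> strict_prefix u v \<Longrightarrow> f \<in> measurable (past v) K \<Longrightarrow> f \<in> measurable (outside u) K"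
  by (erule measurable_gen_mono) (auto dest: prefix_order.le_less_trans)

text \<open>Orthogonality along a line. When \<open>u\<close> lies on the line, individuals
  comparable with \<open>u\<close> do not, so all other terms are determined outside the subtree of
  \<open>u\<close>, and the centred term of \<open>u\<close> integrates to 0 against them. The
  parameter \<open>p u\<close> lets the function attached to \<open>u\<close> depend on its
  ancestors, as needed for levels rescaled by the weight of \<open>u\<close>.\<close>

lemma square_line_sum:
  fixes R :: "real \<Rightarrow> (nat list \<Rightarrow> real measure) \<Rightarrow> real" and p :: "nat list \<Rightarrow> 'w \<Rightarrow> real"
  assumes J: "line J" and B: "finite B"
    and p: "\<And>u. u \<in> B \<Longrightarrow> p u \<in> borel_measurable (past u)"
    and R [measurable]: "case_prod R \<in> borel_measurable (borel \<Otimes>\<^sub>M Om)"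
    and R0: "\<And>q. (\<integral>\<omega>. R q (fam \<omega>) \<partial>M) = 0"
    and RC: "\<And>q. (\<integral>\<^sup>+\<omega>. ennreal ((R q (fam \<omega>))\<^sup>2) \<partial>M) \<le> ennreal C"
    and Y: "Y \<in> borel_measurable M" "\<And>u. u \<in> B \<Longrightarrow> Y \<in> borel_measurable (outside u)"
    and Y2: "integrable M (\<lambda>\<omega>. (Y \<omega>)\<^sup>2)"
  shows "integrable M (\<lambda>\<omega>. (Y \<omega> + (\<Sum>u\<in>B. of_bool (J u \<omega>) * wt u (fam \<omega>) * R (p u \<omega>) (sh u (fam \<omega>))))\<^sup>2)"
    and "(\<integral>\<^sup>+\<omega>. ennreal ((Y \<omega> + (\<Sum>u\<in>B. of_bool (J u \<omega>) * wt u (fam \<omega>) * R (p u \<omega>) (sh u (fam \<omega>))))\<^sup>2) \<partial>M) =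
      (\<integral>\<^sup>+\<omega>. ennreal ((Y \<omega>)\<^sup>2) \<partial>M) +
      (\<Sum>u\<in>B. \<integral>\<^sup>+\<omega>. of_bool (J u \<omega>) * ennreal ((wt u (fam \<omega>))\<^sup>2) *
         (\<integral>\<^sup>+\<omega>'. ennreal ((R (p u \<omega>) (fam \<omega>'))\<^sup>2) \<partial>M) \<partial>M)"
proof -
  define X where "X = (\<lambda>u \<omega>. of_bool (J u \<omega>) * wt u (fam \<omega>) * R (p u \<omega>) (sh u (fam \<omega>)))"
  have Jm: "Measurable.pred (past u) (J u)" for u using J by (simp add: line_def)
  have X_meas: "X u \<in> borel_measurable (gen U)" if "u \<in> B" "\<And>w. strict_prefix w u \<or> prefix u w \<Longrightarrow> w \<in> U" for u U
  proof -
    have sub: "{w. strict_prefix w u} \<subseteq> U" using that by auto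
    have [measurable]: "p u \<in> borel_measurable (gen U)" "Measurable.pred (gen U) (J u)"
      "(\<lambda>\<omega>. wt u (fam \<omega>)) \<in> borel_measurable (gen U)"
      by (rule measurable_gen_mono[OF _ sub], rule p[OF that(1)] Jm measurable_wt_past)+
    have [measurable]: "(\<lambda>\<omega>. sh u (fam \<omega>)) \<in> measurable (gen U) Om"
      by (rule measurable_sh_fam_gen) (use that in auto)
    show ?thesis unfolding X_def by measurable
  qed
  have X_M: "X u \<in> borel_measurable M" if "u \<in> B" for u
    by (rule measurable_gen_M[OF X_meas[OF that, of UNIV]]) simp
  have X2: "(\<integral>\<^sup>+\<omega>. ennreal ((X u \<omega>)\<^sup>2) \<partial>M) = (\<integral>\<^sup>+\<omega>. of_bool (J u \<omega>) * ennreal ((wt u (fam \<omega>))\<^sup>2) *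
         (\<integral>\<^sup>+\<omega>'. ennreal ((R (p u \<omega>) (fam \<omega>'))\<^sup>2) \<partial>M) \<partial>M)" if u: "u \<in> B" for u
  proof -
    have [measurable]: "p u \<in> borel_measurable (outside u)" "Measurable.pred (outside u) (J u)"
      "(\<lambda>\<omega>. wt u (fam \<omega>)) \<in> borel_measurable (outside u)"
      by (rule past_outside[of u u], simp, rule p[OF u] Jm measurable_wt_past)+
    have "(\<integral>\<^sup>+\<omega>. ennreal ((X u \<omega>)\<^sup>2) \<partial>M) =
        (\<integral>\<^sup>+\<omega>. (\<lambda>(\<omega>, \<eta>). of_bool (J u \<omega>) * ennreal ((wt u (fam \<omega>))\<^sup>2) * ennreal ((R (p u \<omega>) \<eta>)\<^sup>2)) (\<omega>, sh u (fam \<omega>)) \<partial>M)"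
      by (intro nn_integral_cong) (auto simp: X_def power_mult_distrib ennreal_mult)
    also have "\<dots> = (\<integral>\<^sup>+\<omega>. \<integral>\<^sup>+\<omega>'. of_bool (J u \<omega>) * ennreal ((wt u (fam \<omega>))\<^sup>2) * ennreal ((R (p u \<omega>) (fam \<omega>'))\<^sup>2) \<partial>M \<partial>M)"
      by (subst nn_freeze) auto
    also have "\<dots> = (\<integral>\<^sup>+\<omega>. of_bool (J u \<omega>) * ennreal ((wt u (fam \<omega>))\<^sup>2) * (\<integral>\<^sup>+\<omega>'. ennreal ((R (p u \<omega>) (fam \<omega>'))\<^sup>2) \<partial>M) \<partial>M)"
      by (intro nn_integral_cong nn_integral_cmult) measurable
    finally show ?thesis .
  qed
  have X2_int: "integrable M (\<lambda>\<omega>. (X u \<omega>)\<^sup>2)" if u: "u \<in> B" for u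
    unfolding integrable_square_iff[OF X_M[OF u]] X2[OF u]
  proof -
    have "(\<integral>\<^sup>+\<omega>. of_bool (J u \<omega>) * ennreal ((wt u (fam \<omega>))\<^sup>2) * (\<integral>\<^sup>+\<omega>'. ennreal ((R (p u \<omega>) (fam \<omega>'))\<^sup>2) \<partial>M) \<partial>M)
        \<le> (\<integral>\<^sup>+\<omega>. 1 * 1 * ennreal C \<partial>M)"
      by (intro nn_integral_mono mult_mono RC) (auto simp: wt_le_1 abs_square_le_1)
    also have "\<dots> < \<infinity>" by (simp add: emeasure_space_1)
    finally show "(\<integral>\<^sup>+\<omega>. of_bool (J u \<omega>) * ennreal ((wt u (fam \<omega>))\<^sup>2) * (\<integral>\<^sup>+\<omega>'. ennreal ((R (p u \<omega>) (fam \<omega>'))\<^sup>2) \<partial>M) \<partial>M) < \<infinity>" .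
  qed
  have main: "integrable M (\<lambda>\<omega>. (Y \<omega> + (\<Sum>u\<in>B'. X u \<omega>))\<^sup>2) \<and>
      (\<integral>\<^sup>+\<omega>. ennreal ((Y \<omega> + (\<Sum>u\<in>B'. X u \<omega>))\<^sup>2) \<partial>M) =
      (\<integral>\<^sup>+\<omega>. ennreal ((Y \<omega>)\<^sup>2) \<partial>M) + (\<Sum>u\<in>B'. \<integral>\<^sup>+\<omega>. ennreal ((X u \<omega>)\<^sup>2) \<partial>M)" if "B' \<subseteq> B" for B'
    using finite_subset[OF that B] that
  proof (induction B' rule: finite_induct)
    case empty
    then show ?case using Y2 by simp
  next
    case (insert u B')
    have u: "u \<in> B" using insert by simp
    define P where "P = (\<lambda>\<omega>. Y \<omega> + (\<Sum>v\<in>B'. X v \<omega>))"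
    have P2: "integrable M (\<lambda>\<omega>. (P \<omega>)\<^sup>2)" using insert unfolding P_def by simp
    have PM: "P \<in> borel_measurable M"
      unfolding P_def using insert X_M by (intro borel_measurable_add borel_measurable_sum Y(1)) auto
    \<comment> \<open>The individuals incomparable with \<open>u\<close>. Only their terms are
      measurable outside the subtree of \<open>u\<close>, and only they can lie on the line together
      with \<open>u\<close>.\<close>
    define B'' where "B'' = {v\<in>B'. \<not> prefix u v \<and> \<not> prefix v u}"
    define G where "G = (\<lambda>\<omega>. of_bool (J u \<omega>) * wt u (fam \<omega>) * (Y \<omega> + (\<Sum>v\<in>B''. X v \<omega>)))"
    have Pu [measurable]: "p u \<in> borel_measurable (outside u)" "Measurable.pred (outside u) (J u)"
      "(\<lambda>\<omega>. wt u (fam \<omega>)) \<in> borel_measurable (outside u)"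
      by (rule past_outside[of u u], simp, rule p[OF u] Jm measurable_wt_past)+
    have G_meas: "G \<in> borel_measurable (outside u)"
    proof -
      have [measurable]: "(\<lambda>\<omega>. Y \<omega> + (\<Sum>v\<in>B''. X v \<omega>)) \<in> borel_measurable (outside u)"
      proof (intro borel_measurable_add borel_measurable_sum Y(2)[OF u] X_meas)
        fix v w assume v: "v \<in> B''" and w: "strict_prefix w v \<or> prefix v w"
        show "w \<in> {w. \<not> prefix u w}"
          using v w by (auto simp: B''_def strict_prefix_def dest: prefix_order.trans prefix_same_cases)
      qed (use insert in \<open>auto simp: B''_def\<close>)
      show ?thesis unfolding G_def by measurable
    qed
    have GP: "P \<omega> * X u \<omega> = G \<omega> * R (p u \<omega>) (sh u (fam \<omega>))" if \<omega>: "\<omega> \<in> space M" for \<omega>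
    proof (cases "J u \<omega>")
      case True
      have "(\<Sum>v\<in>B'. X v \<omega>) = (\<Sum>v\<in>B''. X v \<omega>)"
      proof (rule sum.mono_neutral_right)
        show "\<forall>v\<in>B' - B''. X v \<omega> = 0"
        proof
          fix v assume v: "v \<in> B' - B''"
          then have "v \<noteq> u" "prefix u v \<or> prefix v u" using insert by (auto simp: B''_def)
          then have "\<not> J v \<omega>" using J True \<omega> unfolding line_def by blast
          then show "X v \<omega> = 0" by (simp add: X_def)
        qed
      qed (use insert in \<open>auto simp: B''_def\<close>)
      then show ?thesis using True by (simp add: P_def G_def X_def)
    qed (simp add: G_def X_def)
    have int: "integrable M (\<lambda>\<omega>. P \<omega> * X u \<omega>)"
      by (rule integrable_mult_squares[OF PM X_M[OF u] P2 X2_int[OF u]])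
    have "(\<integral>\<omega>. P \<omega> * X u \<omega> \<partial>M) = (\<integral>\<omega>. (\<lambda>(\<omega>, \<eta>). G \<omega> * R (p u \<omega>) \<eta>) (\<omega>, sh u (fam \<omega>)) \<partial>M)"
      by (intro Bochner_Integration.integral_cong) (auto simp: GP)
    also have "\<dots> = (\<integral>\<omega>. (\<integral>\<omega>'. G \<omega> * R (p u \<omega>) (fam \<omega>') \<partial>M) \<partial>M)"
    proof (subst freeze)
      note [measurable] = G_meas
      show "(\<lambda>(\<omega>, \<eta>). G \<omega> * R (p u \<omega>) \<eta>) \<in> borel_measurable (outside u \<Otimes>\<^sub>M Om)" by measurable
      show "integrable M (\<lambda>\<omega>. (\<lambda>(\<omega>, \<eta>). G \<omega> * R (p u \<omega>) \<eta>) (\<omega>, sh u (fam \<omega>)))"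
        by (rule iffD1[OF Bochner_Integration.integrable_cong[OF refl] int]) (auto simp: GP)
    qed simp
    also have "\<dots> = 0" by (simp add: R0)
    finally have orth: "(\<integral>\<omega>. P \<omega> * X u \<omega> \<partial>M) = 0" .
    have eq: "Y \<omega> + (\<Sum>v\<in>insert u B'. X v \<omega>) = P \<omega> + X u \<omega>" for \<omega>
      using insert by (simp add: P_def)
    have "(\<integral>\<^sup>+\<omega>. ennreal ((P \<omega>)\<^sup>2) \<partial>M) = (\<integral>\<^sup>+\<omega>. ennreal ((Y \<omega>)\<^sup>2) \<partial>M) + (\<Sum>u\<in>B'. \<integral>\<^sup>+\<omega>. ennreal ((X u \<omega>)\<^sup>2) \<partial>M)"
      using insert unfolding P_def by simp
    then show ?case unfolding eq
      using nn_integral_square_add[OF PM X_M[OF u] P2 X2_int[OF u] orth] integrable_square_add[OF PM X_M[OF u] P2 X2_int[OF u]]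
        insert(1,2) by (simp add: add_ac)
  qed
  show "integrable M (\<lambda>\<omega>. (Y \<omega> + (\<Sum>u\<in>B. of_bool (J u \<omega>) * wt u (fam \<omega>) * R (p u \<omega>) (sh u (fam \<omega>))))\<^sup>2)"
    using main[OF order.refl] by (simp add: X_def)
  show "(\<integral>\<^sup>+\<omega>. ennreal ((Y \<omega> + (\<Sum>u\<in>B. of_bool (J u \<omega>) * wt u (fam \<omega>) * R (p u \<omega>) (sh u (fam \<omega>))))\<^sup>2) \<partial>M) =
      (\<integral>\<^sup>+\<omega>. ennreal ((Y \<omega>)\<^sup>2) \<partial>M) +
      (\<Sum>u\<in>B. \<integral>\<^sup>+\<omega>. of_bool (J u \<omega>) * ennreal ((wt u (fam \<omega>))\<^sup>2) *
         (\<integral>\<^sup>+\<omega>'. ennreal ((R (p u \<omega>) (fam \<omega>'))\<^sup>2) \<partial>M) \<partial>M)"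
    using main[OF order.refl] X2 by (simp add: X_def)
qed

end

section \<open>Sums over words and limits of partial sums\<close>

lemma nn_integral_count_space_list:
  fixes g :: "'a::countable list \<Rightarrow> ennreal"
  shows "(\<integral>\<^sup>+u. g u \<partial>count_space UNIV) = g [] + (\<integral>\<^sup>+k. \<integral>\<^sup>+u. g (k # u) \<partial>count_space UNIV \<partial>count_space UNIV)"
proof -
  have "(\<integral>\<^sup>+u. g u \<partial>count_space UNIV) = (\<integral>\<^sup>+u. g u * indicator {[]} u + g u * indicator (- {[]}) u \<partial>count_space UNIV)"
    by (intro nn_integral_cong) (auto simp: indicator_def)
  also have "\<dots> = (\<integral>\<^sup>+u. g u * indicator {[]} u \<partial>count_space UNIV) + (\<integral>\<^sup>+u. g u * indicator (- {[]}) u \<partial>count_space UNIV)"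
    by (rule nn_integral_add) auto
  also have "(\<integral>\<^sup>+u. g u * indicator {[]} u \<partial>count_space UNIV) = g []"
    by (simp add: nn_integral_count_space_indicator[symmetric] nn_integral_count_space_finite)
  also have "(\<integral>\<^sup>+u. g u * indicator (- {[]}) u \<partial>count_space UNIV) = (\<integral>\<^sup>+u. g u \<partial>count_space (- {[]}))"
    by (simp add: nn_integral_count_space_indicator)
  also have "\<dots> = (\<integral>\<^sup>+p. g (case p of (k, u) \<Rightarrow> k # u) \<partial>count_space UNIV)"
  proof (rule nn_integral_bij_count_space[symmetric])
    show "bij_betw (\<lambda>p::'a \<times> 'a list. case p of (k, u) \<Rightarrow> k # u) UNIV (- {[]})"
      unfolding bij_betw_def
    proof
      show "inj_on (\<lambda>p::'a \<times> 'a list. case p of (k, u) \<Rightarrow> k # u) UNIV" by (auto simp: inj_on_def)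
      show "range (\<lambda>p::'a \<times> 'a list. case p of (k, u) \<Rightarrow> k # u) = - {[]}"
      proof (rule set_eqI)
        fix u :: "'a list"
        show "u \<in> range (\<lambda>p::'a \<times> 'a list. case p of (k, u) \<Rightarrow> k # u) \<longleftrightarrow> u \<in> - {[]}"
          by (cases u) (auto simp: image_iff)
      qed
    qed
  qed
  also have "\<dots> = (\<integral>\<^sup>+k. \<integral>\<^sup>+u. g (k # u) \<partial>count_space UNIV \<partial>count_space UNIV)"
    using nn_integral_fst_count_space[of "\<lambda>p. g (case p of (k, u) \<Rightarrow> k # u)"] by simp
  finally show ?thesis .
qed

lemma nn_integral_count_space_list_nat:
  fixes g :: "nat list \<Rightarrow> ennreal"
  shows "(\<integral>\<^sup>+u. g u \<partial>count_space UNIV) = g [] + (\<Sum>k. \<integral>\<^sup>+u. g (k # u) \<partial>count_space UNIV)"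
  by (subst nn_integral_count_space_list) (simp add: nn_integral_count_space_nat)

lemma enn2real_suminf_LIMSEQ:
  assumes "\<And>k. 0 \<le> c k" "(\<Sum>k. ennreal (c k) * t k) \<noteq> \<infinity>" "\<And>k. t k \<noteq> \<infinity>"
  shows "(\<lambda>m. \<Sum>k<m. c k * enn2real (t k)) \<longlonglongrightarrow> enn2real (\<Sum>k. ennreal (c k) * t k)"
proof -
  have eq: "ennreal (c k) * t k = ennreal (c k * enn2real (t k))" for k
    using assms(1)[of k] assms(3)[of k] by (simp add: ennreal_mult' less_top)
  have nn: "0 \<le> c k * enn2real (t k)" for k using assms(1)[of k] by simp
  have fin: "(\<Sum>k. ennreal (c k * enn2real (t k))) \<noteq> top" using assms(2) by (simp add: eq)
  have "summable (\<lambda>k. c k * enn2real (t k))" by (rule summable_suminf_not_top[OF nn fin])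
  then have "(\<lambda>m. \<Sum>k<m. c k * enn2real (t k)) \<longlonglongrightarrow> (\<Sum>k. c k * enn2real (t k))"
    by (rule summable_LIMSEQ)
  moreover have "(\<Sum>k. ennreal (c k) * t k) = ennreal (\<Sum>k. c k * enn2real (t k))"
    unfolding eq by (rule suminf_ennreal[OF nn fin])
  moreover have "0 \<le> (\<Sum>k. c k * enn2real (t k))"
    by (rule suminf_nonneg[OF summable_suminf_not_top[OF nn fin] nn])
  ultimately show ?thesis by simp
qed

text \<open>Carries second moment bounds for finite partial sums over to the limiting
  series.\<close>

lemma fatou_square:
  fixes X :: "nat \<Rightarrow> 'a \<Rightarrow> real"
  assumes [measurable]: "\<And>m. X m \<in> borel_measurable M" "X' \<in> borel_measurable M"
    and lim: "AE \<omega> in M. (\<lambda>m. X m \<omega>) \<longlonglongrightarrow> X' \<omega>"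
    and le: "\<And>m. (\<integral>\<^sup>+\<omega>. ennreal ((X m \<omega>)\<^sup>2) \<partial>M) \<le> c"
  shows "(\<integral>\<^sup>+\<omega>. ennreal ((X' \<omega>)\<^sup>2) \<partial>M) \<le> c"
proof -
  have "(\<integral>\<^sup>+\<omega>. ennreal ((X' \<omega>)\<^sup>2) \<partial>M) = (\<integral>\<^sup>+\<omega>. liminf (\<lambda>m. ennreal ((X m \<omega>)\<^sup>2)) \<partial>M)"
  proof (rule nn_integral_cong_AE)
    show "AE \<omega> in M. ennreal ((X' \<omega>)\<^sup>2) = liminf (\<lambda>m. ennreal ((X m \<omega>)\<^sup>2))"
      using lim
    proof eventually_elim
      case (elim \<omega>)
      then have "(\<lambda>m. ennreal ((X m \<omega>)\<^sup>2)) \<longlonglongrightarrow> ennreal ((X' \<omega>)\<^sup>2)"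
        by (intro tendsto_ennrealI tendsto_power)
      then show ?case by (rule lim_imp_Liminf[OF sequentially_bot, symmetric])
    qed
  qed
  also have "\<dots> \<le> liminf (\<lambda>m. \<integral>\<^sup>+\<omega>. ennreal ((X m \<omega>)\<^sup>2) \<partial>M)" by (rule nn_integral_liminf) measurable
  also have "\<dots> \<le> limsup (\<lambda>m. \<integral>\<^sup>+\<omega>. ennreal ((X m \<omega>)\<^sup>2) \<partial>M)"
    by (rule Liminf_le_Limsup) simp
  also have "\<dots> \<le> c" by (rule Limsup_bounded) (simp add: le)
  finally show ?thesis .
qed

lemma (in prob_space) mean_le_of_square:
  fixes X :: "'a \<Rightarrow> real"
  assumes [measurable]: "X \<in> borel_measurable M" and "(\<integral>\<^sup>+\<omega>. ennreal ((X \<omega>)\<^sup>2) \<partial>M) \<le> ennreal c" "0 \<le> c"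
  shows "integrable M X" "integrable M (\<lambda>\<omega>. (X \<omega>)\<^sup>2)" "(\<integral>\<omega>. (X \<omega>)\<^sup>2 \<partial>M) \<le> c" "(\<integral>\<^sup>+\<omega>. ennreal \<bar>X \<omega>\<bar> \<partial>M) \<le> ennreal (sqrt c)"
proof -
  show sq: "integrable M (\<lambda>\<omega>. (X \<omega>)\<^sup>2)"
    using assms(2) by (subst integrable_square_iff) (auto intro: le_less_trans)
  show c: "(\<integral>\<omega>. (X \<omega>)\<^sup>2 \<partial>M) \<le> c"
    using assms(2,3) by (simp add: nn_integral_eq_integral[OF sq])
  show int: "integrable M X" by (rule square_integrable_imp_integrable[OF assms(1) sq])
  have "(\<integral>\<omega>. \<bar>X \<omega>\<bar> \<partial>M)\<^sup>2 \<le> (\<integral>\<omega>. \<bar>X \<omega>\<bar>\<^sup>2 \<partial>M)"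
    by (rule square_expectation_le) (use int sq in auto)
  then have "(\<integral>\<omega>. \<bar>X \<omega>\<bar> \<partial>M) \<le> sqrt c" using c by (intro real_le_rsqrt) simp
  then show "(\<integral>\<^sup>+\<omega>. ennreal \<bar>X \<omega>\<bar> \<partial>M) \<le> ennreal (sqrt c)"
    using int by (subst nn_integral_eq_integral) (auto intro: ennreal_leI)
qed

section \<open>Total weights of the generations\<close>

context cascade
begin

text \<open>Values in \<open>ennreal\<close> make the recursion over the first generation valid
  without any summability condition.\<close>

primrec tot :: "nat \<Rightarrow> (nat list \<Rightarrow> real measure) \<Rightarrow> ennreal" where
  "tot 0 \<eta> = 1"
| "tot (Suc n) \<eta> = (\<Sum>k. ennreal (a k (\<eta> [])) * tot n (sh [k] \<eta>))"

lemma measurable_tot [measurable]: "tot n \<in> borel_measurable Om"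
proof (induction n)
  case (Suc n)
  note [measurable] = Suc
  show ?case unfolding tot.simps[abs_def] by measurable
qed simp

text \<open>Descendants of distinct members of a line are distinct, so together they form a part of
  generation \<open>n\<close>; it can be a proper part because some lines of descent avoid the line.
  The induction splits at the root, which is the whole line as soon as it belongs to it.\<close>

lemma tot_line_le:
  assumes "\<And>u v. P u \<Longrightarrow> P v \<Longrightarrow> prefix u v \<Longrightarrow> u = v"
  shows "(\<integral>\<^sup>+u. of_bool (P u \<and> length u \<le> n) * ennreal (wt u \<eta>) * tot (n - length u) (sh u \<eta>) \<partial>count_space UNIV) \<le> tot n \<eta>"
  using assms
proof (induction n arbitrary: P \<eta>)
  case 0
  have "(\<integral>\<^sup>+u. of_bool (P u \<and> length u \<le> 0) * ennreal (wt u \<eta>) * tot (0 - length u) (sh u \<eta>) \<partial>count_space UNIV)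
      \<le> (\<integral>\<^sup>+u. 1 * indicator {[]} u \<partial>count_space (UNIV :: nat list set))"
    by (intro nn_integral_mono) (auto simp: indicator_def)
  also have "\<dots> = 1"
    by (simp add: nn_integral_count_space_indicator[symmetric] nn_integral_count_space_finite)
  finally show ?case by simp
next
  case (Suc n)
  show ?case
  proof (cases "P []")
    case True
    have "P u \<longleftrightarrow> u = []" for u using True Suc.prems[of "[]" u] by auto
    then have "(\<integral>\<^sup>+u. of_bool (P u \<and> length u \<le> Suc n) * ennreal (wt u \<eta>) * tot (Suc n - length u) (sh u \<eta>) \<partial>count_space UNIV)
        = (\<integral>\<^sup>+u. tot (Suc n) \<eta> * indicator {[]} u \<partial>count_space (UNIV :: nat list set))"
      by (intro nn_integral_cong) (auto simp: indicator_def)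
    also have "\<dots> = tot (Suc n) \<eta>"
      by (subst nn_integral_cmult) (auto simp: nn_integral_count_space_indicator[symmetric] nn_integral_count_space_finite)
    finally show ?thesis by simp
  next
    case False
    have "(\<integral>\<^sup>+u. of_bool (P u \<and> length u \<le> Suc n) * ennreal (wt u \<eta>) * tot (Suc n - length u) (sh u \<eta>) \<partial>count_space UNIV)
        = (\<Sum>k. \<integral>\<^sup>+u. ennreal (a k (\<eta> [])) * (of_bool (P (k # u) \<and> length u \<le> n) * ennreal (wt u (sh [k] \<eta>)) * tot (n - length u) (sh u (sh [k] \<eta>))) \<partial>count_space UNIV)"
      using False
      by (subst nn_integral_count_space_list_nat) (auto intro!: suminf_cong nn_integral_cong simp: ennreal_mult ac_simps)
    also have "\<dots> = (\<Sum>k. ennreal (a k (\<eta> [])) * (\<integral>\<^sup>+u. of_bool (P (k # u) \<and> length u \<le> n) * ennreal (wt u (sh [k] \<eta>)) * tot (n - length u) (sh u (sh [k] \<eta>)) \<partial>count_space UNIV))"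
      by (intro suminf_cong nn_integral_cmult) simp
    also have "\<dots> \<le> (\<Sum>k. ennreal (a k (\<eta> [])) * tot n (sh [k] \<eta>))"
      by (intro suminf_le mult_left_mono Suc.IH) (auto dest: Suc.prems)
    finally show ?thesis by simp
  qed
qed

lemma nn_freeze_root:
  assumes [measurable]: "case_prod H \<in> borel_measurable (N \<Otimes>\<^sub>M Om)"
  shows "(\<integral>\<^sup>+\<omega>. H (\<xi> [] \<omega>) (sh [k] (fam \<omega>)) \<partial>M) = (\<integral>\<^sup>+\<omega>. \<integral>\<^sup>+\<omega>'. H (\<xi> [] \<omega>) (fam \<omega>') \<partial>M \<partial>M)"
proof -
  have [measurable]: "\<xi> [] \<in> measurable (outside [k]) N" by (rule measurable_xi_gen) simp
  have "(\<lambda>(\<omega>, \<eta>). H (\<xi> [] \<omega>) \<eta>) \<in> borel_measurable (outside [k] \<Otimes>\<^sub>M Om)" by measurable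
  from nn_freeze[OF this] show ?thesis by simp
qed

definition root_line :: "nat list \<Rightarrow> 'w \<Rightarrow> bool" where
  "root_line u \<omega> \<longleftrightarrow> length u = 1"

lemma line_root_line: "line root_line"
  by (auto simp: line_def root_line_def[abs_def] prefix_def)

lemma root_line_sum: "(\<integral>\<^sup>+u. of_bool (root_line u \<omega>) * g u \<partial>count_space UNIV) = (\<Sum>k. g [k])"
  by (subst nn_integral_count_space_list_nat, subst nn_integral_count_space_list_nat) (simp add: root_line_def)

text \<open>The first generation as a line, with the function attached to the child \<open>k\<close>
  allowed to depend on the mark of the root through \<open>p k\<close>. The part \<open>y\<close> of
  the root is orthogonal to all contributions of the children.\<close>

lemma square_first_generation:
  fixes R :: "real \<Rightarrow> (nat list \<Rightarrow> real measure) \<Rightarrow> real" and p :: "nat \<Rightarrow> real measure \<Rightarrow> real"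
  assumes p [measurable]: "\<And>k. p k \<in> borel_measurable N"
    and R [measurable]: "case_prod R \<in> borel_measurable (borel \<Otimes>\<^sub>M Om)"
    and R0: "\<And>q. (\<integral>\<omega>. R q (fam \<omega>) \<partial>M) = 0"
    and RC: "\<And>q. (\<integral>\<^sup>+\<omega>. ennreal ((R q (fam \<omega>))\<^sup>2) \<partial>M) \<le> ennreal C"
    and y [measurable]: "y \<in> borel_measurable N"
    and y2: "integrable M (\<lambda>\<omega>. (y (\<xi> [] \<omega>))\<^sup>2)"
    and K: "finite K"
  shows "(\<integral>\<^sup>+\<omega>. ennreal ((y (\<xi> [] \<omega>) + (\<Sum>k\<in>K. a k (\<xi> [] \<omega>) * R (p k (\<xi> [] \<omega>)) (sh [k] (fam \<omega>))))\<^sup>2) \<partial>M) =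
      (\<integral>\<^sup>+\<omega>. ennreal ((y (\<xi> [] \<omega>))\<^sup>2) \<partial>M) +
      (\<Sum>k\<in>K. \<integral>\<^sup>+\<omega>. ennreal ((a k (\<xi> [] \<omega>))\<^sup>2) * (\<integral>\<^sup>+\<omega>'. ennreal ((R (p k (\<xi> [] \<omega>)) (fam \<omega>'))\<^sup>2) \<partial>M) \<partial>M)"
proof -
  let ?B = "(\<lambda>k. [k]) ` K"
  have inj: "inj_on (\<lambda>k. [k]) K" by (simp add: inj_on_def)
  have 1: "\<xi> [] \<in> measurable (past u) N" "\<xi> [] \<in> measurable (outside u) N" if "u \<in> ?B" for u
    using that by (auto intro!: measurable_xi_gen simp: strict_prefix_def)
  have "(\<integral>\<^sup>+\<omega>. ennreal ((y (\<xi> [] \<omega>) + (\<Sum>u\<in>?B. of_bool (root_line u \<omega>) * wt u (fam \<omega>) * R (p (hd u) (\<xi> [] \<omega>)) (sh u (fam \<omega>))))\<^sup>2) \<partial>M) =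
      (\<integral>\<^sup>+\<omega>. ennreal ((y (\<xi> [] \<omega>))\<^sup>2) \<partial>M) +
      (\<Sum>u\<in>?B. \<integral>\<^sup>+\<omega>. of_bool (root_line u \<omega>) * ennreal ((wt u (fam \<omega>))\<^sup>2) *
         (\<integral>\<^sup>+\<omega>'. ennreal ((R (p (hd u) (\<xi> [] \<omega>)) (fam \<omega>'))\<^sup>2) \<partial>M) \<partial>M)"
    by (rule square_line_sum(2)[OF line_root_line _ _ R R0 RC])
       (use K y2 in \<open>auto intro!: measurable_compose[OF 1(1) p] measurable_compose[OF 1(2) y]\<close>)
  then show ?thesis by (simp add: sum.reindex[OF inj] root_line_def)
qed

end

section \<open>The martingale of generation totals and its limit\<close>

locale normalized_cascade = cascade +
  fixes \<sigma>2 :: real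
  assumes mean: "(\<integral>\<^sup>+\<omega>. tot 1 (fam \<omega>) \<partial>M) = 1"
    and var: "(\<integral>\<^sup>+\<omega>. ennreal ((enn2real (tot 1 (fam \<omega>)) - 1)\<^sup>2) \<partial>M) = ennreal \<sigma>2"
    and \<sigma>2_nonneg: "0 \<le> \<sigma>2"
begin

lemma mean_suminf: "(\<Sum>k. \<integral>\<^sup>+\<omega>. ennreal (a k (\<xi> [] \<omega>)) \<partial>M) = 1"
  using mean by (simp add: nn_integral_suminf)

definition f :: real where
  "f = enn2real (\<Sum>k. \<integral>\<^sup>+\<omega>. ennreal ((a k (\<xi> [] \<omega>))\<^sup>2) \<partial>M)"

text \<open>The squares of weights below 1 are strictly smaller than the weights unless these
  vanish, and the weights have total mean 1; so the deficit \<open>?g = 1 - f\<close> is positive.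
  For the branching process \<open>f\<close> is the Laplace transform of the intensity at
  \<open>2 * \<alpha>\<close>.\<close>

lemma f_eq: "(\<Sum>k. \<integral>\<^sup>+\<omega>. ennreal ((a k (\<xi> [] \<omega>))\<^sup>2) \<partial>M) = ennreal f"
  and f_nonneg: "0 \<le> f" and f_less_1: "f < 1"
proof -
  let ?f = "\<Sum>k. \<integral>\<^sup>+\<omega>. ennreal ((a k (\<xi> [] \<omega>))\<^sup>2) \<partial>M"
  let ?g = "\<integral>\<^sup>+\<omega>. (\<Sum>k. ennreal (a k (\<xi> [] \<omega>) - (a k (\<xi> [] \<omega>))\<^sup>2)) \<partial>M"
  have sq: "(a k \<zeta>)\<^sup>2 \<le> a k \<zeta>" for k \<zeta>
    using a_less_1[of k \<zeta>] by (simp add: power2_eq_square mult_left_le)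
  have "?f + ?g = (\<Sum>k. \<integral>\<^sup>+\<omega>. ennreal ((a k (\<xi> [] \<omega>))\<^sup>2) + ennreal (a k (\<xi> [] \<omega>) - (a k (\<xi> [] \<omega>))\<^sup>2) \<partial>M)"
    by (simp add: nn_integral_suminf nn_integral_add suminf_add[symmetric])
  also have "\<dots> = 1"
    using sq by (subst mean_suminf[symmetric]) (simp add: ennreal_plus[symmetric] del: ennreal_plus)
  finally have sum: "?f + ?g = 1" .
  have "?f \<le> ?f + ?g" by simp
  then have "?f \<le> 1" unfolding sum .
  then have fin: "?f < top" by (auto intro: le_less_trans)
  show feq: "?f = ennreal f" using fin by (simp add: f_def)
  show f0: "0 \<le> f" by (simp add: f_def)
  have "?g \<noteq> 0"
  proof
    assume "?g = 0"
    then have "AE \<omega> in M. (\<Sum>k. ennreal (a k (\<xi> [] \<omega>) - (a k (\<xi> [] \<omega>))\<^sup>2)) = 0"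
      by (subst (asm) nn_integral_0_iff_AE) auto
    then have "AE \<omega> in M. tot 1 (fam \<omega>) = 0"
    proof eventually_elim
      case (elim \<omega>)
      then have 0: "ennreal (a k (\<xi> [] \<omega>) - (a k (\<xi> [] \<omega>))\<^sup>2) = 0" for k
        by (subst (asm) suminf_eq_zero_iff) (auto simp: summableI)
      have "a k (\<xi> [] \<omega>) = 0" for k
      proof (rule ccontr)
        assume "a k (\<xi> [] \<omega>) \<noteq> 0"
        then have "(a k (\<xi> [] \<omega>))\<^sup>2 < a k (\<xi> [] \<omega>) * 1"
          unfolding power2_eq_square using a_less_1[of k "\<xi> [] \<omega>"]
          using \<open>a k (\<xi> [] \<omega>) \<noteq> 0\<close> by (intro mult_strict_left_mono) (auto simp: less_le)
        then show False using 0[of k] by (simp add: ennreal_eq_0_iff)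
      qed
      then show ?case by simp
    qed
    then have "(\<integral>\<^sup>+\<omega>. tot 1 (fam \<omega>) \<partial>M) = (\<integral>\<^sup>+\<omega>. 0 \<partial>M)" by (rule nn_integral_cong_AE)
    then show False using mean by simp
  qed
  then have g0: "?g \<noteq> 0" .
  have "f \<le> 1" using \<open>?f \<le> 1\<close> unfolding feq by simp
  moreover have "f \<noteq> 1"
  proof
    assume "f = 1"
    then have "1 + ?g = 1 + 0" using sum unfolding feq by simp
    then show False using g0 by (simp only: ennreal_add_left_cancel) simp
  qed
  ultimately show "f < 1" by simp
qed

lemma nn_mean_tot: "(\<integral>\<^sup>+\<omega>. tot n (fam \<omega>) \<partial>M) = 1"
proof (induction n)
  case (Suc n)
  have "(\<integral>\<^sup>+\<omega>. tot (Suc n) (fam \<omega>) \<partial>M) = (\<Sum>k. \<integral>\<^sup>+\<omega>. ennreal (a k (\<xi> [] \<omega>)) * tot n (sh [k] (fam \<omega>)) \<partial>M)"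
    by (simp add: nn_integral_suminf)
  also have "\<dots> = (\<Sum>k. \<integral>\<^sup>+\<omega>. \<integral>\<^sup>+\<omega>'. ennreal (a k (\<xi> [] \<omega>)) * tot n (fam \<omega>') \<partial>M \<partial>M)"
    by (intro suminf_cong nn_freeze_root) measurable
  also have "\<dots> = 1"
    by (simp add: nn_integral_cmult Suc mean_suminf)
  finally show ?case .
qed (simp add: emeasure_space_1)

lemma AE_tot_finite: "AE \<omega> in M. \<forall>u n. tot n (sh u (fam \<omega>)) \<noteq> \<infinity>"
  unfolding AE_all_countable
proof (intro allI)
  fix u n
  have "AE \<omega> in M. tot n (fam \<omega>) \<noteq> \<infinity>"
    by (rule nn_integral_PInf_AE) (simp_all add: nn_mean_tot)
  then show "AE \<omega> in M. tot n (sh u (fam \<omega>)) \<noteq> \<infinity>"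
    by (rule AE_sh[rotated]) measurable
qed

definition wn :: "nat \<Rightarrow> (nat list \<Rightarrow> real measure) \<Rightarrow> real" where
  "wn n \<eta> = enn2real (tot n \<eta>)"

lemma measurable_wn [measurable]: "wn n \<in> borel_measurable Om"
  unfolding wn_def[abs_def] by measurable

lemma ennreal_wn: "AE \<omega> in M. \<forall>n. ennreal (wn n (fam \<omega>)) = tot n (fam \<omega>)"
  using AE_tot_finite
proof eventually_elim
  case (elim \<omega>)
  have "tot n (fam \<omega>) \<noteq> \<infinity>" for n using elim[rule_format, where u="[]" and n=n] by simp
  then show ?case by (simp add: wn_def less_top)
qed

lemma wn_recursion: "AE \<omega> in M. \<forall>n. (\<lambda>m. \<Sum>k<m. a k (\<xi> [] \<omega>) * wn n (sh [k] (fam \<omega>))) \<longlonglongrightarrow> wn (Suc n) (fam \<omega>)"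
  using AE_tot_finite
proof eventually_elim
  case (elim \<omega>)
  have "tot (Suc n) (fam \<omega>) \<noteq> \<infinity>" for n using elim[rule_format, where u="[]" and n="Suc n"] by simp
  then show ?case
    using elim enn2real_suminf_LIMSEQ[of "\<lambda>k. a k (\<xi> [] \<omega>)" "\<lambda>k. tot _ (sh [k] (fam \<omega>))"]
    by (simp add: wn_def)
qed

lemma integrable_wn: "integrable M (\<lambda>\<omega>. wn n (fam \<omega>))" and mean_wn: "(\<integral>\<omega>. wn n (fam \<omega>) \<partial>M) = 1"
proof -
  have nn: "(\<integral>\<^sup>+\<omega>. ennreal (wn n (fam \<omega>)) \<partial>M) = 1"
    unfolding nn_mean_tot[of n, symmetric]
    using ennreal_wn by (intro nn_integral_cong_AE) (auto elim!: eventually_mono)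
  show "integrable M (\<lambda>\<omega>. wn n (fam \<omega>))"
    using nn by (intro integrableI_nonneg) (auto simp: wn_def)
  show "(\<integral>\<omega>. wn n (fam \<omega>) \<partial>M) = 1"
    using nn by (subst integral_eq_nn_integral) (auto simp: wn_def)
qed

text \<open>One generation of the second moment recursion: independent centred copies attached to
  the children contribute with the squared weights, whose total mean is at most
  \<open>f\<close>.\<close>

lemma square_sum_bound:
  assumes [measurable]: "R \<in> borel_measurable Om" "y \<in> borel_measurable N"
    and R0: "(\<integral>\<omega>. R (fam \<omega>) \<partial>M) = 0"
    and RC: "(\<integral>\<^sup>+\<omega>. ennreal ((R (fam \<omega>))\<^sup>2) \<partial>M) \<le> ennreal C" and C: "0 \<le> C"
    and y: "(\<integral>\<^sup>+\<omega>. ennreal ((y (\<xi> [] \<omega>))\<^sup>2) \<partial>M) \<le> ennreal c" "0 \<le> c"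
    and K: "finite K"
  shows "(\<integral>\<^sup>+\<omega>. ennreal ((y (\<xi> [] \<omega>) + (\<Sum>k\<in>K. a k (\<xi> [] \<omega>) * R (sh [k] (fam \<omega>))))\<^sup>2) \<partial>M) =
      (\<integral>\<^sup>+\<omega>. ennreal ((y (\<xi> [] \<omega>))\<^sup>2) \<partial>M) +
      (\<Sum>k\<in>K. \<integral>\<^sup>+\<omega>. ennreal ((a k (\<xi> [] \<omega>))\<^sup>2) \<partial>M) * (\<integral>\<^sup>+\<omega>. ennreal ((R (fam \<omega>))\<^sup>2) \<partial>M)"
    and "(\<integral>\<^sup>+\<omega>. ennreal ((y (\<xi> [] \<omega>) + (\<Sum>k\<in>K. a k (\<xi> [] \<omega>) * R (sh [k] (fam \<omega>))))\<^sup>2) \<partial>M) \<le> ennreal (c + f * C)"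
proof -
  have "integrable M (\<lambda>\<omega>. (y (\<xi> [] \<omega>))\<^sup>2)" by (rule mean_le_of_square(2)[OF _ y]) measurable
  from square_first_generation[of "\<lambda>_ _. 0" "\<lambda>_. R", OF _ _ R0 RC _ this K]
  show eq: "(\<integral>\<^sup>+\<omega>. ennreal ((y (\<xi> [] \<omega>) + (\<Sum>k\<in>K. a k (\<xi> [] \<omega>) * R (sh [k] (fam \<omega>))))\<^sup>2) \<partial>M) =
      (\<integral>\<^sup>+\<omega>. ennreal ((y (\<xi> [] \<omega>))\<^sup>2) \<partial>M) +
      (\<Sum>k\<in>K. \<integral>\<^sup>+\<omega>. ennreal ((a k (\<xi> [] \<omega>))\<^sup>2) \<partial>M) * (\<integral>\<^sup>+\<omega>. ennreal ((R (fam \<omega>))\<^sup>2) \<partial>M)"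
    by (simp add: nn_integral_multc sum_distrib_right)
  have "(\<Sum>k\<in>K. \<integral>\<^sup>+\<omega>. ennreal ((a k (\<xi> [] \<omega>))\<^sup>2) \<partial>M) \<le> ennreal f"
    unfolding f_eq[symmetric] by (rule sum_le_suminf) (auto simp: K)
  then have "(\<integral>\<^sup>+\<omega>. ennreal ((y (\<xi> [] \<omega>))\<^sup>2) \<partial>M) +
      (\<Sum>k\<in>K. \<integral>\<^sup>+\<omega>. ennreal ((a k (\<xi> [] \<omega>))\<^sup>2) \<partial>M) * (\<integral>\<^sup>+\<omega>. ennreal ((R (fam \<omega>))\<^sup>2) \<partial>M)
      \<le> ennreal c + ennreal f * ennreal C"
    by (intro add_mono mult_mono y RC) auto
  also have "\<dots> = ennreal (c + f * C)" using y(2) f_nonneg C by (simp add: ennreal_mult)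
  finally show "(\<integral>\<^sup>+\<omega>. ennreal ((y (\<xi> [] \<omega>) + (\<Sum>k\<in>K. a k (\<xi> [] \<omega>) * R (sh [k] (fam \<omega>))))\<^sup>2) \<partial>M) \<le> ennreal (c + f * C)"
    unfolding eq .
qed

text \<open>An increment is the weighted sum over the children of their increments one generation
  earlier, so each generation gains a factor \<open>f\<close>.\<close>

lemma increment_square: "(\<integral>\<^sup>+\<omega>. ennreal ((wn (Suc n) (fam \<omega>) - wn n (fam \<omega>))\<^sup>2) \<partial>M) \<le> ennreal (\<sigma>2 * f ^ n)"
proof (induction n)
  case 0
  then show ?case using var by (simp add: wn_def)
next
  case (Suc n)
  let ?R = "\<lambda>\<eta>. wn (Suc n) \<eta> - wn n \<eta>"
  have "(\<integral>\<^sup>+\<omega>. ennreal ((wn (Suc (Suc n)) (fam \<omega>) - wn (Suc n) (fam \<omega>))\<^sup>2) \<partial>M) \<le> ennreal (0 + f * (\<sigma>2 * f ^ n))"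
  proof (rule fatou_square[where X="\<lambda>m \<omega>. 0 + (\<Sum>k\<in>{..<m}. a k (\<xi> [] \<omega>) * ?R (sh [k] (fam \<omega>)))"])
    show "AE \<omega> in M. (\<lambda>m. 0 + (\<Sum>k\<in>{..<m}. a k (\<xi> [] \<omega>) * ?R (sh [k] (fam \<omega>)))) \<longlonglongrightarrow> wn (Suc (Suc n)) (fam \<omega>) - wn (Suc n) (fam \<omega>)"
      using wn_recursion
    proof eventually_elim
      case (elim \<omega>)
      from tendsto_diff[OF elim[rule_format, of "Suc n"] elim[rule_format, of n]]
      show ?case by (simp add: sum_subtractf right_diff_distrib)
    qed
    show "(\<integral>\<^sup>+\<omega>. ennreal ((0 + (\<Sum>k\<in>{..<m}. a k (\<xi> [] \<omega>) * ?R (sh [k] (fam \<omega>))))\<^sup>2) \<partial>M) \<le> ennreal (0 + f * (\<sigma>2 * f ^ n))" for m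
      by (rule square_sum_bound(2)[where y="\<lambda>_. 0"])
         (use Suc \<sigma>2_nonneg f_nonneg in \<open>simp_all add: integrable_wn mean_wn\<close>)
  qed measurable
  then show ?case by (simp add: ac_simps)
qed

text \<open>A lower limit is defined and measurable on the whole product space, so it can be
  evaluated at every subtree before anything is known about convergence.\<close>

definition Wt :: "(nat list \<Rightarrow> real measure) \<Rightarrow> ennreal" where
  "Wt \<eta> = liminf (\<lambda>n. tot n \<eta>)"

definition W :: "(nat list \<Rightarrow> real measure) \<Rightarrow> real" where
  "W \<eta> = enn2real (Wt \<eta>)"

lemma measurable_Wt [measurable]: "Wt \<in> borel_measurable Om"
  unfolding Wt_def[abs_def] by measurable

lemma measurable_W [measurable]: "W \<in> borel_measurable Om"
  unfolding W_def[abs_def] by measurable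

lemma W_nonneg [simp]: "0 \<le> W \<eta>" by (simp add: W_def)

text \<open>The L1 norms of the increments are at most \<open>sqrt \<sigma>2 * sqrt f ^ n\<close>, a
  convergent geometric series. Hence the increments are almost surely absolutely summable, and all
  totals are dominated by the integrable \<open>G\<close>, which also lets the mean pass to the
  limit.\<close>

lemma W_limit: "AE \<omega> in M. (\<lambda>n. wn n (fam \<omega>)) \<longlonglongrightarrow> W (fam \<omega>) \<and> (\<lambda>n. tot n (fam \<omega>)) \<longlonglongrightarrow> Wt (fam \<omega>) \<and> Wt (fam \<omega>) \<noteq> \<infinity>"
  and integrable_W: "integrable M (\<lambda>\<omega>. W (fam \<omega>))"
  and mean_W: "(\<integral>\<omega>. W (fam \<omega>) \<partial>M) = 1"
proof -
  define D where "D = (\<lambda>n \<omega>. wn (Suc n) (fam \<omega>) - wn n (fam \<omega>))"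
  have [measurable]: "D n \<in> borel_measurable M" for n unfolding D_def by measurable
  have "(\<integral>\<^sup>+\<omega>. (\<Sum>n. ennreal \<bar>D n \<omega>\<bar>) \<partial>M) = (\<Sum>n. \<integral>\<^sup>+\<omega>. ennreal \<bar>D n \<omega>\<bar> \<partial>M)"
    by (rule nn_integral_suminf) measurable
  also have "\<dots> \<le> (\<Sum>n. ennreal (sqrt \<sigma>2 * (sqrt f) ^ n))"
  proof (rule suminf_le)
    fix n
    show "(\<integral>\<^sup>+\<omega>. ennreal \<bar>D n \<omega>\<bar> \<partial>M) \<le> ennreal (sqrt \<sigma>2 * (sqrt f) ^ n)"
      using mean_le_of_square(4)[of "D n" "\<sigma>2 * f ^ n"] increment_square[of n] \<sigma>2_nonneg f_nonneg
      by (simp add: D_def real_sqrt_mult real_sqrt_power)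
  qed simp_all
  also have "\<dots> = ennreal (\<Sum>n. sqrt \<sigma>2 * (sqrt f) ^ n)"
    using f_nonneg f_less_1 \<sigma>2_nonneg by (intro suminf_ennreal2 summable_mult summable_geometric) auto
  finally have fin: "(\<integral>\<^sup>+\<omega>. (\<Sum>n. ennreal \<bar>D n \<omega>\<bar>) \<partial>M) < \<infinity>" by (auto intro: le_less_trans)
  have AEfin: "AE \<omega> in M. (\<Sum>n. ennreal \<bar>D n \<omega>\<bar>) \<noteq> \<infinity>"
    by (rule nn_integral_PInf_AE) (use fin in auto)
  have wn_sum: "wn n (fam \<omega>) = 1 + (\<Sum>i<n. D i \<omega>)" for n \<omega>
    unfolding D_def by (subst sum_lessThan_telescope) (simp add: wn_def)
  have AEs: "AE \<omega> in M. summable (\<lambda>n. \<bar>D n \<omega>\<bar>)"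
    using AEfin by eventually_elim (rule summable_suminf_not_top; simp)
  show lim: "AE \<omega> in M. (\<lambda>n. wn n (fam \<omega>)) \<longlonglongrightarrow> W (fam \<omega>) \<and> (\<lambda>n. tot n (fam \<omega>)) \<longlonglongrightarrow> Wt (fam \<omega>) \<and> Wt (fam \<omega>) \<noteq> \<infinity>"
    using AEs ennreal_wn
  proof eventually_elim
    case (elim \<omega>)
    have "summable (\<lambda>n. D n \<omega>)" by (rule summable_rabs_cancel[OF elim(1)])
    then have l: "(\<lambda>n. wn n (fam \<omega>)) \<longlonglongrightarrow> 1 + (\<Sum>n. D n \<omega>)"
      unfolding wn_sum by (rule tendsto_add[OF tendsto_const summable_LIMSEQ])
    have l0: "0 \<le> 1 + (\<Sum>n. D n \<omega>)"
      by (rule LIMSEQ_le_const[OF l], rule exI[of _ 0]) (simp add: wn_def)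
    have l2: "(\<lambda>n. tot n (fam \<omega>)) \<longlonglongrightarrow> ennreal (1 + (\<Sum>n. D n \<omega>))"
      using tendsto_ennrealI[OF l] unfolding elim(2)[rule_format] .
    have Wt_eq: "Wt (fam \<omega>) = ennreal (1 + (\<Sum>n. D n \<omega>))"
      unfolding Wt_def by (rule lim_imp_Liminf[OF sequentially_bot l2])
    then have "W (fam \<omega>) = 1 + (\<Sum>n. D n \<omega>)" using l0 by (simp only: W_def enn2real_ennreal)
    then show ?case using l l2 Wt_eq by (simp only: ennreal_neq_top infinity_ennreal_def) simp
  qed
  define G where "G = (\<lambda>\<omega>. 1 + (\<Sum>n. \<bar>D n \<omega>\<bar>))"
  have [measurable]: "G \<in> borel_measurable M" unfolding G_def by measurable
  have "(\<integral>\<^sup>+\<omega>. ennreal (\<Sum>n. \<bar>D n \<omega>\<bar>) \<partial>M) = (\<integral>\<^sup>+\<omega>. (\<Sum>n. ennreal \<bar>D n \<omega>\<bar>) \<partial>M)"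
    using AEs by (intro nn_integral_cong_AE, eventually_elim) (rule suminf_ennreal2[symmetric]; simp)
  then have "integrable M (\<lambda>\<omega>. \<Sum>n. \<bar>D n \<omega>\<bar>)"
  proof (intro integrableI_nonneg)
    show "AE \<omega> in M. 0 \<le> (\<Sum>n. \<bar>D n \<omega>\<bar>)" using AEs by eventually_elim (rule suminf_nonneg; simp)
  qed (use fin in simp_all)
  then have G: "integrable M G" unfolding G_def by simp
  have bound: "AE \<omega> in M. norm (wn n (fam \<omega>)) \<le> G \<omega>" for n
    using AEs
  proof eventually_elim
    case (elim \<omega>)
    have "\<bar>\<Sum>i<n. D i \<omega>\<bar> \<le> (\<Sum>i<n. \<bar>D i \<omega>\<bar>)" by (rule sum_abs)
    also have "\<dots> \<le> (\<Sum>n. \<bar>D n \<omega>\<bar>)" by (rule sum_le_suminf) (use elim in auto)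
    finally show ?case unfolding wn_sum G_def by simp
  qed
  have lim': "AE \<omega> in M. (\<lambda>n. wn n (fam \<omega>)) \<longlonglongrightarrow> W (fam \<omega>)" using lim by eventually_elim simp
  show "integrable M (\<lambda>\<omega>. W (fam \<omega>))"
    by (rule integrable_dominated_convergence[OF _ _ G lim' bound]) measurable
  have "(\<lambda>n. \<integral>\<omega>. wn n (fam \<omega>) \<partial>M) \<longlonglongrightarrow> (\<integral>\<omega>. W (fam \<omega>) \<partial>M)"
    by (rule integral_dominated_convergence[OF _ _ G lim' bound]) measurable
  then show "(\<integral>\<omega>. W (fam \<omega>) \<partial>M) = 1"
    unfolding mean_wn by (simp add: LIMSEQ_const_iff)
qed

end

section \<open>Exhaustion of the tree by finite sets\<close>

lemma borel_measurable_nn_integral_count_space [measurable (raw)]: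
  fixes g :: "'a \<Rightarrow> 'i::countable \<Rightarrow> ennreal"
  assumes [measurable]: "\<And>i. (\<lambda>x. g x i) \<in> borel_measurable K"
  shows "(\<lambda>x. \<integral>\<^sup>+i. g x i \<partial>count_space UNIV) \<in> borel_measurable K"
proof -
  interpret sigma_finite_measure "count_space (UNIV :: 'i set)"
    by (rule sigma_finite_measure_count_space)
  have "(\<lambda>p. g (fst p) (snd p)) \<in> borel_measurable (K \<Otimes>\<^sub>M count_space UNIV)"
    by (rule measurable_compose_countable'[where f="\<lambda>i p. g (fst p) i" and g=snd and I=UNIV]) auto
  then show ?thesis by (intro borel_measurable_nn_integral) (simp add: case_prod_beta')
qed

text \<open>A bound on the length alone would leave infinitely many words, since an individual may
  have infinitely many children; hence the additional bound on the letters.\<close>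

definition fin :: "nat \<Rightarrow> nat list set" where
  "fin n = {u. set u \<subseteq> {..<n} \<and> length u \<le> n}"

lemma finite_fin [simp]: "finite (fin n)"
  unfolding fin_def by (rule finite_lists_length_le) simp

lemma fin_mono: "m \<le> n \<Longrightarrow> fin m \<subseteq> fin n"
  by (auto simp: fin_def)

lemma eventually_fin: "\<forall>\<^sub>F n in sequentially. u \<in> fin n"
proof (rule eventually_sequentiallyI)
  fix n assume n: "length u + Suc (Max (insert 0 (set u))) \<le> n"
  have "k < n" if "k \<in> set u" for k
  proof -
    have "k \<le> Max (insert 0 (set u))" using that by (intro Max_ge) auto
    then show ?thesis using n by simp
  qed
  then show "u \<in> fin n" using n by (auto simp: fin_def)
qed

lemma fin_sum_LIMSEQ: "(\<lambda>n. \<Sum>u\<in>fin n. g u) \<longlonglongrightarrow> (\<integral>\<^sup>+u. g u \<partial>count_space UNIV)" for g :: "nat list \<Rightarrow> ennreal"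
proof -
  have "(\<lambda>n. \<integral>\<^sup>+u. g u * indicator (fin n) u \<partial>count_space UNIV) \<longlonglongrightarrow> (\<integral>\<^sup>+u. g u \<partial>count_space UNIV)"
  proof (rule nn_integral_LIMSEQ)
    show "incseq (\<lambda>n u. g u * indicator (fin n) u)"
      using fin_mono by (auto simp: incseq_def le_fun_def indicator_def)
    show "(\<lambda>n. g u * indicator (fin n) u) \<longlonglongrightarrow> g u" for u
      using eventually_fin[of u] by (intro tendsto_eventually) (auto elim!: eventually_mono)
  qed simp
  moreover have "(\<integral>\<^sup>+u. g u * indicator (fin n) u \<partial>count_space UNIV) = (\<Sum>u\<in>fin n. g u)" for n
    by (simp add: nn_integral_count_space_indicator[symmetric] nn_integral_count_space_finite)
  ultimately show ?thesis by simp
qed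

lemma fin_sum_le: "(\<Sum>u\<in>fin n. g u) \<le> (\<integral>\<^sup>+u. g u \<partial>count_space UNIV)" for g :: "nat list \<Rightarrow> ennreal"
proof -
  have "(\<Sum>u\<in>fin n. g u) = (\<integral>\<^sup>+u. g u * indicator (fin n) u \<partial>count_space UNIV)"
    by (simp add: nn_integral_count_space_indicator[symmetric] nn_integral_count_space_finite)
  also have "\<dots> \<le> (\<integral>\<^sup>+u. g u \<partial>count_space UNIV)"
    by (intro nn_integral_mono) (auto simp: indicator_def)
  finally show ?thesis .
qed

lemma fin_sum_real_LIMSEQ:
  assumes "\<And>u. 0 \<le> h u" "(\<integral>\<^sup>+u. ennreal (h u) \<partial>count_space UNIV) \<noteq> \<infinity>"
  shows "(\<lambda>n. \<Sum>u\<in>fin n. h u) \<longlonglongrightarrow> enn2real (\<integral>\<^sup>+u. ennreal (h u) \<partial>count_space UNIV)"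
proof -
  have "(\<lambda>n. \<Sum>u\<in>fin n. ennreal (h u)) \<longlonglongrightarrow> (\<integral>\<^sup>+u. ennreal (h u) \<partial>count_space UNIV)" by (rule fin_sum_LIMSEQ)
  also have "(\<lambda>n. \<Sum>u\<in>fin n. ennreal (h u)) = (\<lambda>n. ennreal (\<Sum>u\<in>fin n. h u))" by (simp add: assms(1))
  also have "(\<integral>\<^sup>+u. ennreal (h u) \<partial>count_space UNIV) = ennreal (enn2real (\<integral>\<^sup>+u. ennreal (h u) \<partial>count_space UNIV))"
    using assms(2) by (simp add: less_top)
  finally show ?thesis by (subst (asm) tendsto_ennreal_iff) (auto intro: always_eventually simp: sum_nonneg assms(1))
qed

context cascade
begin

subsection \<open>Stopping lines\<close>

text \<open>For weights \<open>e\<^bsup>-\<alpha>S(u)\<^esup>\<close> and \<open>T = e\<^bsup>-\<alpha>t\<^esup>\<close>, this is the coming generation at time \<open>t\<close>.\<close>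
primrec st :: "nat list \<Rightarrow> real \<Rightarrow> (nat list \<Rightarrow> real measure) \<Rightarrow> bool" where
  "st [] T \<eta> \<longleftrightarrow> 1 < T"
| "st (k # u) T \<eta> \<longleftrightarrow> T \<le> 1 \<and> 0 < a k (\<eta> []) \<and> st u (T / a k (\<eta> [])) (sh [k] \<eta>)"

text \<open>The recursion rescales the level by the weight of the first step, which suits arguments
  by the first generation; unrolled, it says that \<open>u\<close> is the first on its line of
  descent to fall below \<open>T\<close>. Positivity of the weight excludes individuals that are
  never born.\<close>

lemma st_iff: "st u T \<eta> \<longleftrightarrow> (\<forall>j<length u. T \<le> wt (take j u) \<eta>) \<and> 0 < wt u \<eta> \<and> wt u \<eta> < T"
proof (induction u arbitrary: T \<eta>)
  case (Cons k u)
  have all: "(\<forall>j<length (k # u). T \<le> wt (take j (k # u)) \<eta>) \<longleftrightarrow>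
      T \<le> 1 \<and> (\<forall>j<length u. T \<le> a k (\<eta> []) * wt (take j u) (sh [k] \<eta>))"
    by (auto simp: less_Suc_eq_0_disj)
  show ?case
  proof (cases "0 < a k (\<eta> [])")
    case True
    then show ?thesis
      unfolding all st.simps Cons by (auto simp: field_simps zero_less_mult_iff)
  next
    case False
    then have "a k (\<eta> []) = 0" by (simp add: order_antisym)
    then show ?thesis by simp
  qed
qed auto

lemma measurable_st [measurable (raw)]:
  assumes "g \<in> borel_measurable K" "h \<in> measurable K Om"
  shows "Measurable.pred K (\<lambda>x. st u (g x) (h x))"
  using assms
proof (induction u arbitrary: g h)
  case Nil
  then show ?case by simp
next
  case (Cons k u)
  note [measurable] = Cons.prems
  have 1: "(\<lambda>x. g x / a k (h x [])) \<in> borel_measurable K" "(\<lambda>x. sh [k] (h x)) \<in> measurable K Om" by measurable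
  note [measurable] = Cons.IH[OF 1]
  show ?case unfolding st.simps by measurable
qed

lemma line_st: "line (\<lambda>u \<omega>. st u T (fam \<omega>))"
  unfolding line_def
proof (intro conjI allI ballI impI)
  fix u
  have 1: "(\<lambda>\<omega>. wt v (fam \<omega>)) \<in> borel_measurable (past u)" if "prefix v u" for v
    by (rule measurable_gen_mono[OF measurable_wt_past]) (use that in \<open>auto intro: prefix_order.less_le_trans\<close>)
  have "Measurable.pred (past u) (\<lambda>\<omega>. T \<le> wt (take j u) (fam \<omega>))" for j
    unfolding pred_def by (rule borel_measurable_le[OF borel_measurable_const 1[OF take_is_prefix]])
  moreover have "Measurable.pred (past u) (\<lambda>\<omega>. 0 < wt u (fam \<omega>))" "Measurable.pred (past u) (\<lambda>\<omega>. wt u (fam \<omega>) < T)"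
    unfolding pred_def
    using borel_measurable_less[OF borel_measurable_const 1[OF prefix_order.order_refl]]
      borel_measurable_less[OF 1[OF prefix_order.order_refl] borel_measurable_const] by blast+
  ultimately show "Measurable.pred (past u) (\<lambda>\<omega>. st u T (fam \<omega>))"
    unfolding st_iff by (intro pred_intros_logic pred_intros_countable) auto
next
  fix \<omega> u v assume s: "st u T (fam \<omega>)" "st v T (fam \<omega>)" and p: "prefix u v"
  show "u = v"
  proof (rule ccontr)
    assume "u \<noteq> v"
    then have "length u < length v" "take (length u) v = u" using p by (auto simp: prefix_def)
    then show False using s unfolding st_iff by (metis not_less)
  qed
qed

lemma measurable_line: "line J \<Longrightarrow> Measurable.pred M (J u)"
  unfolding line_def by (blast intro: measurable_gen_M)

text \<open>Nerman's martingale at time \<open>t\<close> when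
  \<open>T = exp (- \<alpha> * t)\<close>. Its quadratic companion \<open>Lq\<close> is the
  conditional variance of the remaining fluctuation, up to the variance of \<open>W\<close> as a
  factor.\<close>

definition Ls :: "real \<Rightarrow> (nat list \<Rightarrow> real measure) \<Rightarrow> ennreal" where
  "Ls T \<eta> = (\<integral>\<^sup>+u. of_bool (st u T \<eta>) * ennreal (wt u \<eta>) \<partial>count_space UNIV)"

definition Lq :: "real \<Rightarrow> (nat list \<Rightarrow> real measure) \<Rightarrow> ennreal" where
  "Lq T \<eta> = (\<integral>\<^sup>+u. of_bool (st u T \<eta>) * ennreal ((wt u \<eta>)\<^sup>2) \<partial>count_space UNIV)"

lemma measurable_Ls [measurable (raw)]:
  assumes [measurable]: "g \<in> borel_measurable K" "h \<in> measurable K Om"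
  shows "(\<lambda>x. Ls (g x) (h x)) \<in> borel_measurable K"
  unfolding Ls_def by measurable

lemma measurable_Lq [measurable (raw)]:
  assumes [measurable]: "g \<in> borel_measurable K" "h \<in> measurable K Om"
  shows "(\<lambda>x. Lq (g x) (h x)) \<in> borel_measurable K"
  unfolding Lq_def by measurable

lemma Ls_gt_1: "1 < T \<Longrightarrow> Ls T \<eta> = 1"
  unfolding Ls_def by (subst nn_integral_count_space_list_nat) simp

lemma Lq_gt_1: "1 < T \<Longrightarrow> Lq T \<eta> = 1"
  unfolding Lq_def by (subst nn_integral_count_space_list_nat) simp

lemma Ls_rec: "T \<le> 1 \<Longrightarrow> Ls T \<eta> = (\<Sum>k. ennreal (a k (\<eta> [])) * Ls (T / a k (\<eta> [])) (sh [k] \<eta>))"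
  unfolding Ls_def
  by (subst nn_integral_count_space_list_nat)
     (auto intro!: suminf_cong nn_integral_cong simp: nn_integral_cmult[symmetric] ennreal_mult ac_simps less_le)

lemma Lq_rec: "T \<le> 1 \<Longrightarrow> Lq T \<eta> = (\<Sum>k. ennreal ((a k (\<eta> []))\<^sup>2) * Lq (T / a k (\<eta> [])) (sh [k] \<eta>))"
  unfolding Lq_def
  by (subst nn_integral_count_space_list_nat)
     (auto intro!: suminf_cong nn_integral_cong simp: nn_integral_cmult[symmetric] power_mult_distrib ennreal_mult ac_simps less_le)

lemma Lq_le_Ls: "Lq T \<eta> \<le> ennreal T * Ls T \<eta>"
proof -
  have "Lq T \<eta> \<le> (\<integral>\<^sup>+u. ennreal T * (of_bool (st u T \<eta>) * ennreal (wt u \<eta>)) \<partial>count_space UNIV)"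
    unfolding Lq_def
  proof (rule nn_integral_mono)
    fix u
    show "of_bool (st u T \<eta>) * ennreal ((wt u \<eta>)\<^sup>2) \<le> ennreal T * (of_bool (st u T \<eta>) * ennreal (wt u \<eta>))"
    proof (cases "st u T \<eta>")
      case True
      then have "wt u \<eta> \<le> T" "0 \<le> T" using wt_nonneg[of u \<eta>] unfolding st_iff by linarith+
      then have "ennreal ((wt u \<eta>)\<^sup>2) \<le> ennreal (T * wt u \<eta>)"
        by (intro ennreal_leI) (simp add: power2_eq_square mult_right_mono)
      then show ?thesis using True \<open>0 \<le> T\<close> by (simp add: ennreal_mult)
    qed simp
  qed
  then show ?thesis by (simp add: nn_integral_cmult Ls_def)
qed

end

context normalized_cascade
begin

subsection \<open>The limit along a line\<close>

lemma nn_mean_Wt: "(\<integral>\<^sup>+\<omega>. Wt (fam \<omega>) \<partial>M) = 1"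
proof -
  have "(\<integral>\<^sup>+\<omega>. Wt (fam \<omega>) \<partial>M) = (\<integral>\<^sup>+\<omega>. ennreal (W (fam \<omega>)) \<partial>M)"
    using W_limit by (intro nn_integral_cong_AE, eventually_elim) (simp add: W_def less_top)
  also have "\<dots> = ennreal (\<integral>\<omega>. W (fam \<omega>) \<partial>M)"
    by (rule nn_integral_eq_integral[OF integrable_W]) simp
  finally show ?thesis by (simp add: mean_W)
qed

lemma AE_sh_limit: "AE \<omega> in M. \<forall>u. (\<lambda>n. tot n (sh u (fam \<omega>))) \<longlonglongrightarrow> Wt (sh u (fam \<omega>)) \<and> Wt (sh u (fam \<omega>)) \<noteq> \<infinity>"
  unfolding AE_all_countable
proof
  fix u
  show "AE \<omega> in M. (\<lambda>n. tot n (sh u (fam \<omega>))) \<longlonglongrightarrow> Wt (sh u (fam \<omega>)) \<and> Wt (sh u (fam \<omega>)) \<noteq> \<infinity>"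
  proof (rule AE_sh)
    show "AE \<omega> in M. (\<lambda>n. tot n (fam \<omega>)) \<longlonglongrightarrow> Wt (fam \<omega>) \<and> Wt (fam \<omega>) \<noteq> \<infinity>"
      using W_limit by eventually_elim simp
    \<comment> \<open>Convergence to a lower limit means equality of upper and lower limit, which
      exhibits the event as measurable.\<close>
    have "(\<lambda>n. tot n \<eta>) \<longlonglongrightarrow> Wt \<eta> \<longleftrightarrow> limsup (\<lambda>n. tot n \<eta>) = Wt \<eta>" for \<eta>
      by (auto simp: Wt_def tendsto_iff_Liminf_eq_Limsup)
    note eq = this
    show "Measurable.pred Om (\<lambda>\<eta>. (\<lambda>n. tot n \<eta>) \<longlonglongrightarrow> Wt \<eta> \<and> Wt \<eta> \<noteq> \<infinity>)"
      unfolding eq pred_def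
    proof (rule sets.sets_Collect_conj)
      have "(\<lambda>\<eta>. limsup (\<lambda>n. tot n \<eta>)) \<in> borel_measurable Om" by measurable
      then show "{\<eta> \<in> space Om. limsup (\<lambda>n. tot n \<eta>) = Wt \<eta>} \<in> sets Om"
        by (rule borel_measurable_eq[OF _ measurable_Wt])
      show "{\<eta> \<in> space Om. Wt \<eta> \<noteq> \<infinity>} \<in> sets Om"
        by (rule borel_measurable_neq[OF measurable_Wt borel_measurable_const])
    qed
  qed
qed

lemma nn_line_sum:
  assumes J: "line J" and [measurable]: "R \<in> borel_measurable Om"
  shows "(\<integral>\<^sup>+\<omega>. of_bool (J u \<omega>) * ennreal (wt u (fam \<omega>)) * R (sh u (fam \<omega>)) \<partial>M) =
    (\<integral>\<^sup>+\<omega>. of_bool (J u \<omega>) * ennreal (wt u (fam \<omega>)) \<partial>M) * (\<integral>\<^sup>+\<omega>. R (fam \<omega>) \<partial>M)"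
proof -
  have Jm: "Measurable.pred (past u) (J u)" using J by (simp add: line_def)
  have [measurable]: "Measurable.pred (outside u) (J u)" "(\<lambda>\<omega>. wt u (fam \<omega>)) \<in> borel_measurable (outside u)"
    by (rule past_outside[of u u], simp, rule Jm measurable_wt_past)+
  note [measurable] = measurable_line[OF J]
  have "(\<integral>\<^sup>+\<omega>. (\<lambda>(\<omega>, \<eta>). of_bool (J u \<omega>) * ennreal (wt u (fam \<omega>)) * R \<eta>) (\<omega>, sh u (fam \<omega>)) \<partial>M) =
      (\<integral>\<^sup>+\<omega>. \<integral>\<^sup>+\<omega>'. of_bool (J u \<omega>) * ennreal (wt u (fam \<omega>)) * R (fam \<omega>') \<partial>M \<partial>M)"
  proof (subst nn_freeze)
    show "(\<lambda>(\<omega>, \<eta>). of_bool (J u \<omega>) * ennreal (wt u (fam \<omega>)) * R \<eta>) \<in> borel_measurable (outside u \<Otimes>\<^sub>M Om)"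
      by measurable
  qed simp
  also have "\<dots> = (\<integral>\<^sup>+\<omega>. of_bool (J u \<omega>) * ennreal (wt u (fam \<omega>)) * (\<integral>\<^sup>+\<omega>'. R (fam \<omega>') \<partial>M) \<partial>M)"
    by (intro nn_integral_cong nn_integral_cmult) measurable
  also have "\<dots> = (\<integral>\<^sup>+\<omega>. of_bool (J u \<omega>) * ennreal (wt u (fam \<omega>)) \<partial>M) * (\<integral>\<^sup>+\<omega>. R (fam \<omega>) \<partial>M)"
    by (rule nn_integral_multc) measurable
  finally show ?thesis by simp
qed

text \<open>By the branching property a member of the line at depth at most \<open>n\<close> has, in
  the mean, descendants of its own weight in generation \<open>n\<close>; together these descendants
  are a part of a generation of mean total 1. Equality can fail when mass escapes along lines of
  descent that never meet the line.\<close>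

lemma line_sum_le_1:
  assumes J: "line J"
  shows "(\<integral>\<^sup>+\<omega>. \<integral>\<^sup>+u. of_bool (J u \<omega>) * ennreal (wt u (fam \<omega>)) \<partial>count_space UNIV \<partial>M) \<le> 1"
proof -
  note [measurable] = measurable_line[OF J]
  let ?c = "\<lambda>u. \<integral>\<^sup>+\<omega>. of_bool (J u \<omega>) * ennreal (wt u (fam \<omega>)) \<partial>M"
  have le: "(\<integral>\<^sup>+u. of_bool (length u \<le> n) * ?c u \<partial>count_space UNIV) \<le> 1" for n
  proof -
    have "(\<integral>\<^sup>+u. of_bool (length u \<le> n) * ?c u \<partial>count_space UNIV) =
        (\<integral>\<^sup>+u. \<integral>\<^sup>+\<omega>. of_bool (J u \<omega> \<and> length u \<le> n) * ennreal (wt u (fam \<omega>)) * tot (n - length u) (sh u (fam \<omega>)) \<partial>M \<partial>count_space UNIV)"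
      by (intro nn_integral_cong) (auto simp: nn_line_sum[OF J] nn_mean_tot)
    also have "\<dots> = (\<integral>\<^sup>+\<omega>. \<integral>\<^sup>+u. of_bool (J u \<omega> \<and> length u \<le> n) * ennreal (wt u (fam \<omega>)) * tot (n - length u) (sh u (fam \<omega>)) \<partial>count_space UNIV \<partial>M)"
      by (rule nn_integral_count_space_nn_integral[symmetric]) auto
    also have "\<dots> \<le> (\<integral>\<^sup>+\<omega>. tot n (fam \<omega>) \<partial>M)"
      using J unfolding line_def by (intro nn_integral_mono tot_line_le) blast
    finally show ?thesis by (simp add: nn_mean_tot)
  qed
  have "(\<integral>\<^sup>+\<omega>. \<integral>\<^sup>+u. of_bool (J u \<omega>) * ennreal (wt u (fam \<omega>)) \<partial>count_space UNIV \<partial>M) = (\<integral>\<^sup>+u. ?c u \<partial>count_space UNIV)"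
    by (rule nn_integral_count_space_nn_integral) auto
  also have "\<dots> \<le> 1"
  proof (rule LIMSEQ_le_const2)
    show "(\<lambda>n. \<integral>\<^sup>+u. of_bool (length u \<le> n) * ?c u \<partial>count_space UNIV) \<longlonglongrightarrow> (\<integral>\<^sup>+u. ?c u \<partial>count_space UNIV)"
    proof (rule nn_integral_LIMSEQ)
      show "incseq (\<lambda>n u. of_bool (length u \<le> n) * ?c u)" by (auto simp: incseq_def le_fun_def)
      show "(\<lambda>n. of_bool (length u \<le> n) * ?c u) \<longlonglongrightarrow> ?c u" for u
        by (rule tendsto_eventually, rule eventually_mono[OF eventually_ge_at_top[of "length u"]]) simp
    qed simp
  qed (use le in blast)
  finally show ?thesis .
qed

text \<open>One inequality holds pointwise by Fatou's lemma, because the descendants of the line are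
  only a part of each generation. By \<open>one\<close> no mass is lost, so both sides have mean 1
  and the inequality is almost surely an equality.\<close>

lemma W_line:
  assumes J: "line J"
    and one: "(\<integral>\<^sup>+\<omega>. \<integral>\<^sup>+u. of_bool (J u \<omega>) * ennreal (wt u (fam \<omega>)) \<partial>count_space UNIV \<partial>M) = 1"
  shows "AE \<omega> in M. Wt (fam \<omega>) = (\<integral>\<^sup>+u. of_bool (J u \<omega>) * ennreal (wt u (fam \<omega>)) * Wt (sh u (fam \<omega>)) \<partial>count_space UNIV)"
proof -
  note [measurable] = measurable_line[OF J]
  let ?S = "\<lambda>\<omega>. \<integral>\<^sup>+u. of_bool (J u \<omega>) * ennreal (wt u (fam \<omega>)) * Wt (sh u (fam \<omega>)) \<partial>count_space UNIV"
  have le: "AE \<omega> in M. ?S \<omega> \<le> Wt (fam \<omega>)"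
    using AE_sh_limit AE_space
  proof eventually_elim
    case (elim \<omega>)
    define g where "g = (\<lambda>n u. of_bool (J u \<omega> \<and> length u \<le> n) * ennreal (wt u (fam \<omega>)) * tot (n - length u) (sh u (fam \<omega>)))"
    have "(\<lambda>n. g n u) \<longlonglongrightarrow> of_bool (J u \<omega>) * ennreal (wt u (fam \<omega>)) * Wt (sh u (fam \<omega>))" for u
    \<comment> \<open>Shifting the index by \<open>length u\<close> removes the truncated
      subtraction and the condition \<open>length u \<le> n\<close>.\<close>
    proof (rule LIMSEQ_offset[where k="length u"])
      have "(\<lambda>n. of_bool (J u \<omega>) * ennreal (wt u (fam \<omega>)) * tot n (sh u (fam \<omega>))) \<longlonglongrightarrow>
          of_bool (J u \<omega>) * ennreal (wt u (fam \<omega>)) * Wt (sh u (fam \<omega>))"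
        by (rule ennreal_tendsto_cmult) (use elim in \<open>auto simp: ennreal_mult_less_top\<close>)
      then show "(\<lambda>n. g (n + length u) u) \<longlonglongrightarrow> of_bool (J u \<omega>) * ennreal (wt u (fam \<omega>)) * Wt (sh u (fam \<omega>))"
        by (simp add: g_def)
    qed
    then have "?S \<omega> = (\<integral>\<^sup>+u. liminf (\<lambda>n. g n u) \<partial>count_space UNIV)"
      by (intro nn_integral_cong lim_imp_Liminf[symmetric]) auto
    also have "\<dots> \<le> liminf (\<lambda>n. \<integral>\<^sup>+u. g n u \<partial>count_space UNIV)" by (rule nn_integral_liminf) simp
    also have "\<dots> \<le> liminf (\<lambda>n. tot n (fam \<omega>))"
      unfolding g_def using J elim(2)
      by (intro Liminf_mono always_eventually allI tot_line_le) (auto simp: line_def)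
    finally show ?case by (simp add: Wt_def)
  qed
  have S1: "(\<integral>\<^sup>+\<omega>. ?S \<omega> \<partial>M) = 1"
  proof -
    have "(\<integral>\<^sup>+\<omega>. ?S \<omega> \<partial>M) = (\<integral>\<^sup>+u. \<integral>\<^sup>+\<omega>. of_bool (J u \<omega>) * ennreal (wt u (fam \<omega>)) * Wt (sh u (fam \<omega>)) \<partial>M \<partial>count_space UNIV)"
      by (rule nn_integral_count_space_nn_integral) auto
    also have "\<dots> = (\<integral>\<^sup>+u. \<integral>\<^sup>+\<omega>. of_bool (J u \<omega>) * ennreal (wt u (fam \<omega>)) \<partial>M \<partial>count_space UNIV)"
      by (simp add: nn_line_sum[OF J] nn_mean_Wt)
    also have "\<dots> = (\<integral>\<^sup>+\<omega>. \<integral>\<^sup>+u. of_bool (J u \<omega>) * ennreal (wt u (fam \<omega>)) \<partial>count_space UNIV \<partial>M)"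
      by (rule nn_integral_count_space_nn_integral[symmetric]) auto
    finally show ?thesis by (simp add: one)
  qed
  have "(\<integral>\<^sup>+\<omega>. Wt (fam \<omega>) - ?S \<omega> \<partial>M) = (\<integral>\<^sup>+\<omega>. Wt (fam \<omega>) \<partial>M) - (\<integral>\<^sup>+\<omega>. ?S \<omega> \<partial>M)"
    by (rule nn_integral_diff) (use le S1 in auto)
  also have "\<dots> = 0" by (simp add: S1 nn_mean_Wt)
  finally have "AE \<omega> in M. Wt (fam \<omega>) - ?S \<omega> = 0"
    by (subst (asm) nn_integral_0_iff_AE) auto
  then show ?thesis using le W_limit
  proof eventually_elim
    case (elim \<omega>)
    then have "Wt (fam \<omega>) \<le> ?S \<omega>" by (simp add: diff_eq_0_iff_ennreal)
    then show ?case using elim(2) by (rule order_antisym)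
  qed
qed

lemma W_recursion: "AE \<omega> in M. (\<lambda>m. \<Sum>k<m. a k (\<xi> [] \<omega>) * W (sh [k] (fam \<omega>))) \<longlonglongrightarrow> W (fam \<omega>)"
proof -
  have "(\<integral>\<^sup>+\<omega>. \<integral>\<^sup>+u. of_bool (root_line u \<omega>) * ennreal (wt u (fam \<omega>)) \<partial>count_space UNIV \<partial>M) = 1"
    by (simp add: root_line_sum nn_integral_suminf mean_suminf)
  from W_line[OF line_root_line this] show ?thesis
    using AE_sh_limit W_limit
  proof eventually_elim
    case (elim \<omega>)
    have eq: "Wt (fam \<omega>) = (\<Sum>k. ennreal (a k (\<xi> [] \<omega>)) * Wt (sh [k] (fam \<omega>)))"
      using elim(1) by (simp add: mult.assoc root_line_sum)
    have "(\<lambda>m. \<Sum>k<m. a k (\<xi> [] \<omega>) * enn2real (Wt (sh [k] (fam \<omega>)))) \<longlonglongrightarrow>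
        enn2real (\<Sum>k. ennreal (a k (\<xi> [] \<omega>)) * Wt (sh [k] (fam \<omega>)))"
      by (rule enn2real_suminf_LIMSEQ) (use elim eq in auto)
    then show ?case by (simp add: W_def eq)
  qed
qed

lemma wn_1_recursion: "AE \<omega> in M. (\<lambda>m. \<Sum>k<m. a k (\<xi> [] \<omega>)) \<longlonglongrightarrow> wn 1 (fam \<omega>)"
  using wn_recursion
proof eventually_elim
  case (elim \<omega>)
  from elim[rule_format, of 0] show ?case by (simp add: wn_def)
qed

section \<open>The variance of the limit\<close>

definition y1 :: "real measure \<Rightarrow> real" where "y1 \<zeta> = enn2real (\<Sum>k. ennreal (a k \<zeta>)) - 1"

lemma measurable_y1 [measurable]: "y1 \<in> borel_measurable N"
  unfolding y1_def[abs_def] by measurable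

lemma y1_wn: "y1 (\<xi> [] \<omega>) = wn 1 (fam \<omega>) - 1"
  by (simp add: y1_def wn_def)

lemma y1_square: "(\<integral>\<^sup>+\<omega>. ennreal ((y1 (\<xi> [] \<omega>))\<^sup>2) \<partial>M) = ennreal \<sigma>2"
  using var by (simp add: y1_def)

lemma wn_square: "(\<integral>\<^sup>+\<omega>. ennreal ((wn n (fam \<omega>) - 1)\<^sup>2) \<partial>M) \<le> ennreal (\<sigma>2 / (1 - f))"
proof (induction n)
  case (Suc n)
  let ?R = "\<lambda>\<eta>. wn n \<eta> - 1"
  have C: "0 \<le> \<sigma>2 / (1 - f)" using \<sigma>2_nonneg f_less_1 by simp
  \<comment> \<open>The bound is the fixed point of the map taking \<open>s\<close> to
    \<open>\<sigma>2 + f * s\<close>, which is what one generation does to it.\<close>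
  have C2: "\<sigma>2 + f * (\<sigma>2 / (1 - f)) = \<sigma>2 / (1 - f)" using f_less_1 by (simp add: field_simps)
  show ?case
  proof (rule fatou_square[where X="\<lambda>m \<omega>. y1 (\<xi> [] \<omega>) + (\<Sum>k\<in>{..<m}. a k (\<xi> [] \<omega>) * ?R (sh [k] (fam \<omega>)))"])
    show "AE \<omega> in M. (\<lambda>m. y1 (\<xi> [] \<omega>) + (\<Sum>k\<in>{..<m}. a k (\<xi> [] \<omega>) * ?R (sh [k] (fam \<omega>)))) \<longlonglongrightarrow> wn (Suc n) (fam \<omega>) - 1"
      using wn_recursion wn_1_recursion
    proof eventually_elim
      case (elim \<omega>)
      from tendsto_add[OF tendsto_const[of "y1 (\<xi> [] \<omega>)"] tendsto_diff[OF elim(1)[rule_format, of n] elim(2)]]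
      show ?case by (simp add: sum_subtractf right_diff_distrib y1_wn)
    qed
    have "(\<integral>\<omega>. ?R (fam \<omega>) \<partial>M) = 0"
      using integrable_wn[of n] by (simp add: mean_wn prob_space)
    from square_sum_bound(2)[OF _ measurable_y1 this Suc C _ \<sigma>2_nonneg, of "{..<_}"]
    show "(\<integral>\<^sup>+\<omega>. ennreal ((y1 (\<xi> [] \<omega>) + (\<Sum>k\<in>{..<m}. a k (\<xi> [] \<omega>) * ?R (sh [k] (fam \<omega>))))\<^sup>2) \<partial>M) \<le> ennreal (\<sigma>2 / (1 - f))" for m
      unfolding C2 y1_square by simp
  qed measurable
qed (use \<sigma>2_nonneg f_less_1 in \<open>simp add: wn_def\<close>)

definition v :: real where "v = (\<integral>\<omega>. (W (fam \<omega>) - 1)\<^sup>2 \<partial>M)"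

lemma W_square_le: "(\<integral>\<^sup>+\<omega>. ennreal ((W (fam \<omega>) - 1)\<^sup>2) \<partial>M) \<le> ennreal (\<sigma>2 / (1 - f))"
proof (rule fatou_square[where X="\<lambda>n \<omega>. wn n (fam \<omega>) - 1"])
  show "AE \<omega> in M. (\<lambda>n. wn n (fam \<omega>) - 1) \<longlonglongrightarrow> W (fam \<omega>) - 1"
    using W_limit by eventually_elim (intro tendsto_diff tendsto_const; simp)
qed (use wn_square in auto)

lemma integrable_W_square: "integrable M (\<lambda>\<omega>. (W (fam \<omega>) - 1)\<^sup>2)"
  by (rule mean_le_of_square(2)[OF _ W_square_le]) (use \<sigma>2_nonneg f_less_1 in auto)

lemma v_nonneg: "0 \<le> v" by (simp add: v_def)

lemma nn_v: "(\<integral>\<^sup>+\<omega>. ennreal ((W (fam \<omega>) - 1)\<^sup>2) \<partial>M) = ennreal v"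
  unfolding v_def by (rule nn_integral_eq_integral[OF integrable_W_square]) simp

lemma mean_W0: "(\<integral>\<omega>. W (fam \<omega>) - 1 \<partial>M) = 0"
  using integrable_W by (simp add: mean_W prob_space)

text \<open>The recursion of \<open>W\<close> over the first generation formally gives
  \<open>v = \<sigma>2 + f * v\<close>. Fatou's lemma along partial sums over the children yields
  one inequality. For the other, the tail over the children from \<open>m\<close> on has second
  moment at most \<open>v\<close> times a tail of the series of \<open>b\<close>, and a weighted
  square inequality separates it from \<open>W - 1\<close>.\<close>

lemma v_eq: "v = \<sigma>2 / (1 - f)"
proof -
  let ?R = "\<lambda>\<eta>. W \<eta> - 1"
  define S where "S = (\<lambda>K \<omega>. \<Sum>k\<in>K. a k (\<xi> [] \<omega>) * ?R (sh [k] (fam \<omega>)))"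
  have [measurable]: "S K \<in> borel_measurable M" for K unfolding S_def by measurable
  define b where "b = (\<lambda>k. \<integral>\<omega>. (a k (\<xi> [] \<omega>))\<^sup>2 \<partial>M)"
  have b0: "0 \<le> b k" for k by (simp add: b_def)
  have b_nn: "(\<integral>\<^sup>+\<omega>. ennreal ((a k (\<xi> [] \<omega>))\<^sup>2) \<partial>M) = ennreal (b k)" for k
    unfolding b_def
  proof (rule nn_integral_eq_integral)
    have "(a k \<zeta>)\<^sup>2 \<le> 1" for \<zeta> using a_less_1[of k \<zeta>] by (simp add: abs_square_le_1)
    then show "integrable M (\<lambda>\<omega>. (a k (\<xi> [] \<omega>))\<^sup>2)" by (intro integrable_const_bound[where B=1]) auto
  qed simp
  have b_sums: "b sums f"
  proof -
    have "(\<lambda>k. ennreal (b k)) sums ennreal f"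
      unfolding f_eq[symmetric] b_nn by (rule summable_sums) simp
    then show ?thesis by (rule iffD1[OF sums_ennreal[OF b0 f_nonneg]])
  qed
  have lim: "AE \<omega> in M. (\<lambda>m. y1 (\<xi> [] \<omega>) + S {..<m} \<omega>) \<longlonglongrightarrow> W (fam \<omega>) - 1"
    using W_recursion wn_1_recursion
  proof eventually_elim
    case (elim \<omega>)
    from tendsto_add[OF tendsto_const[of "y1 (\<xi> [] \<omega>)"] tendsto_diff[OF elim]]
    show ?case by (simp add: S_def sum_subtractf right_diff_distrib y1_wn)
  qed
  have sq: "(\<integral>\<^sup>+\<omega>. ennreal ((y1 (\<xi> [] \<omega>) + S K \<omega>)\<^sup>2) \<partial>M) = ennreal (\<sigma>2 + (\<Sum>k\<in>K. b k) * v)" if "finite K" for K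
    unfolding S_def
    by (subst square_sum_bound(1)[where C=v and c=\<sigma>2])
       (use that v_nonneg \<sigma>2_nonneg b0 in \<open>simp_all add: mean_W0 nn_v y1_square b_nn ennreal_mult sum_nonneg\<close>)
  have sq0: "(\<integral>\<^sup>+\<omega>. ennreal ((S K \<omega>)\<^sup>2) \<partial>M) = ennreal ((\<Sum>k\<in>K. b k) * v)" if "finite K" for K
    unfolding S_def
    using square_sum_bound(1)[where C=v and c=0 and y="\<lambda>_. 0" and K=K and R="?R"] that v_nonneg b0
    by (simp add: mean_W0 nn_v b_nn ennreal_mult sum_nonneg)
  have up: "v \<le> \<sigma>2 + f * v"
  proof -
    have "(\<integral>\<^sup>+\<omega>. ennreal ((W (fam \<omega>) - 1)\<^sup>2) \<partial>M) \<le> ennreal (\<sigma>2 + f * v)"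
    proof (rule fatou_square[OF _ _ lim])
      fix m
      have "(\<Sum>k\<in>{..<m}. b k) \<le> f" using sum_le_suminf[of b "{..<m}"] b_sums b0 by (auto simp: sums_iff)
      then show "(\<integral>\<^sup>+\<omega>. ennreal ((y1 (\<xi> [] \<omega>) + S {..<m} \<omega>)\<^sup>2) \<partial>M) \<le> ennreal (\<sigma>2 + f * v)"
        by (subst sq) (auto intro!: ennreal_leI mult_right_mono v_nonneg)
    qed measurable
    then show ?thesis unfolding nn_v
      using \<sigma>2_nonneg f_nonneg v_nonneg by (subst (asm) ennreal_le_iff) (auto simp: add_nonneg_nonneg)
  qed
  have low: "\<sigma>2 + f * v \<le> (1 + \<delta>) * v" if \<delta>: "0 < \<delta>" for \<delta>
  proof -
    \<comment> \<open>Letting \<open>m\<close> tend to infinity removes the last term for fixed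
      \<open>\<delta>\<close>; only then does \<open>\<delta>\<close> tend to 0.\<close>
    have step: "\<sigma>2 + (\<Sum>k<m. b k) * v \<le> (1 + \<delta>) * v + (1 + 1 / \<delta>) * ((f - (\<Sum>k<m. b k)) * v)" for m
    proof -
      define t where "t = f - (\<Sum>k<m. b k)"
      have t0: "0 \<le> t" using sum_le_suminf[of b "{..<m}"] b_sums b0 by (auto simp: sums_iff t_def)
      define E where "E = (\<lambda>\<omega>. (W (fam \<omega>) - 1) - (y1 (\<xi> [] \<omega>) + S {..<m} \<omega>))"
      have [measurable]: "E \<in> borel_measurable M" unfolding E_def by measurable
      have E2: "(\<integral>\<^sup>+\<omega>. ennreal ((E \<omega>)\<^sup>2) \<partial>M) \<le> ennreal (t * v)"
      proof (rule fatou_square[where X="\<lambda>n \<omega>. S {m..<m+n} \<omega>"])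
        show "AE \<omega> in M. (\<lambda>n. S {m..<m+n} \<omega>) \<longlonglongrightarrow> E \<omega>"
          using lim
        proof eventually_elim
          case (elim \<omega>)
          have "S {m..<m+n} \<omega> = (y1 (\<xi> [] \<omega>) + S {..<n+m} \<omega>) - (y1 (\<xi> [] \<omega>) + S {..<m} \<omega>)" for n
          proof -
            have "sum g {..<n+m} = sum g {..<m} + sum g {m..<m+n}" for g :: "nat \<Rightarrow> real"
              by (subst sum.union_disjoint[symmetric]) (auto intro!: sum.cong)
            then show ?thesis unfolding S_def by simp
          qed
          then show ?case unfolding E_def using LIMSEQ_ignore_initial_segment[OF elim, of m]
            by (simp only:) (intro tendsto_diff tendsto_const; simp)
        qed
        fix n
        have "(\<Sum>k\<in>{..<m+n}. b k) \<le> f" using sum_le_suminf[of b "{..<m+n}"] b_sums b0 by (auto simp: sums_iff)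
        moreover have "(\<Sum>k\<in>{..<m+n}. b k) = (\<Sum>k<m. b k) + (\<Sum>k\<in>{m..<m+n}. b k)"
          by (subst sum.union_disjoint[symmetric]) (auto intro!: sum.cong)
        ultimately have "(\<Sum>k\<in>{m..<m+n}. b k) \<le> t" by (simp add: t_def)
        then show "(\<integral>\<^sup>+\<omega>. ennreal ((S {m..<m+n} \<omega>)\<^sup>2) \<partial>M) \<le> ennreal (t * v)"
          by (subst sq0) (auto intro!: ennreal_leI mult_right_mono v_nonneg)
      qed measurable
      have "ennreal (\<sigma>2 + (\<Sum>k<m. b k) * v) = (\<integral>\<^sup>+\<omega>. ennreal (((W (fam \<omega>) - 1) - E \<omega>)\<^sup>2) \<partial>M)"
        by (subst sq[symmetric]) (simp_all add: E_def)
      also have "\<dots> \<le> (\<integral>\<^sup>+\<omega>. ennreal (1 + \<delta>) * ennreal ((W (fam \<omega>) - 1)\<^sup>2) + ennreal (1 + 1 / \<delta>) * ennreal ((E \<omega>)\<^sup>2) \<partial>M)"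
      proof (rule nn_integral_mono)
        fix \<omega>
        have "(p - e)\<^sup>2 \<le> (1 + \<delta>) * p\<^sup>2 + (1 + 1 / \<delta>) * e\<^sup>2" for p e :: real
        proof -
          have "0 \<le> (\<delta> * p + e)\<^sup>2 / \<delta>" using \<delta> by simp
          also have "\<dots> = \<delta> * p\<^sup>2 + 2 * p * e + e\<^sup>2 / \<delta>"
            using \<delta> by (simp add: power2_eq_square field_simps)
          finally show ?thesis by (simp add: power2_diff algebra_simps)
        qed
        then show "ennreal (((W (fam \<omega>) - 1) - E \<omega>)\<^sup>2) \<le> ennreal (1 + \<delta>) * ennreal ((W (fam \<omega>) - 1)\<^sup>2) + ennreal (1 + 1 / \<delta>) * ennreal ((E \<omega>)\<^sup>2)"
          using \<delta> by (simp add: ennreal_mult[symmetric] ennreal_plus[symmetric] ennreal_leI del: ennreal_plus)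
      qed
      also have "\<dots> \<le> ennreal (1 + \<delta>) * ennreal v + ennreal (1 + 1 / \<delta>) * ennreal (t * v)"
        by (subst nn_integral_add) (auto simp: nn_integral_cmult nn_v intro!: add_mono mult_left_mono E2)
      also have "\<dots> = ennreal ((1 + \<delta>) * v + (1 + 1 / \<delta>) * (t * v))"
        using \<delta> v_nonneg t0 by (simp add: ennreal_mult[symmetric] ennreal_plus[symmetric] del: ennreal_plus)
      finally show ?thesis
        using \<delta> v_nonneg t0 by (subst (asm) ennreal_le_iff) (auto simp: t_def)
    qed
    have l: "(\<lambda>m. \<Sum>k<m. b k) \<longlonglongrightarrow> f" using b_sums by (simp add: sums_def)
    have "(\<lambda>m. \<sigma>2 + (\<Sum>k<m. b k) * v) \<longlonglongrightarrow> \<sigma>2 + f * v" by (intro tendsto_intros l)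
    moreover have "(\<lambda>m. (1 + \<delta>) * v + (1 + 1 / \<delta>) * ((f - (\<Sum>k<m. b k)) * v)) \<longlonglongrightarrow> (1 + \<delta>) * v + (1 + 1 / \<delta>) * ((f - f) * v)"
      by (intro tendsto_intros l)
    ultimately have "\<sigma>2 + f * v \<le> (1 + \<delta>) * v + (1 + 1 / \<delta>) * ((f - f) * v)"
      by (rule LIMSEQ_le) (use step in blast)
    then show ?thesis by simp
  qed
  have "\<sigma>2 + f * v \<le> v"
  proof (rule field_le_epsilon)
    fix e :: real assume e: "0 < e"
    have "\<sigma>2 + f * v \<le> (1 + e / (v + 1)) * v" by (rule low) (use e v_nonneg in auto)
    also have "\<dots> = v + e * (v / (v + 1))" by (simp add: algebra_simps)
    also have "\<dots> \<le> v + e * 1" using e v_nonneg by (intro add_left_mono mult_left_mono) auto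
    finally show "\<sigma>2 + f * v \<le> v + e" by simp
  qed
  then have "\<sigma>2 + f * v = v" using up by simp
  then show ?thesis using f_less_1 by (simp add: field_simps)
qed

end

section \<open>Mean mass of a stopping line and the size of the deviation from the limit\<close>

context normalized_cascade
begin

lemma nn_mean_Ls:
  assumes T: "0 < T"
  shows "(\<integral>\<^sup>+\<omega>. Ls T (fam \<omega>) \<partial>M) = 1"
proof (rule antisym)
  show "(\<integral>\<^sup>+\<omega>. Ls T (fam \<omega>) \<partial>M) \<le> 1"
    unfolding Ls_def by (rule line_sum_le_1[OF line_st])
  text \<open>The mass that has not yet crossed the level \<open>T\<close> in generation \<open>n\<close> is at most \<open>f\<^sup>n/T\<close>.\<close>
  have step: "1 \<le> (\<integral>\<^sup>+\<omega>. Ls T (fam \<omega>) \<partial>M) + ennreal (f ^ n / T)" if "0 < T" for n T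
    using that
  proof (induction n arbitrary: T)
    case 0
    show ?case
    proof (cases "1 < T")
      case True
      then show ?thesis by (simp add: Ls_gt_1 emeasure_space_1)
    next
      case False
      then have "1 \<le> ennreal (1 / T)" using 0 by simp
      then show ?thesis by (simp add: add_increasing)
    qed
  next
    case (Suc n)
    show ?case
    proof (cases "1 < T")
      case True
      then show ?thesis by (simp add: Ls_gt_1 emeasure_space_1)
    next
      case False
      have "1 = (\<Sum>k. \<integral>\<^sup>+\<omega>. ennreal (a k (\<xi> [] \<omega>)) \<partial>M)" by (simp add: mean_suminf)
      also have "\<dots> \<le> (\<Sum>k. \<integral>\<^sup>+\<omega>. ennreal (a k (\<xi> [] \<omega>)) * (\<integral>\<^sup>+\<omega>'. Ls (T / a k (\<xi> [] \<omega>)) (fam \<omega>') \<partial>M)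
          + ennreal ((a k (\<xi> [] \<omega>))\<^sup>2) * ennreal (f ^ n / T) \<partial>M)"
      proof (intro suminf_le nn_integral_mono)
        fix k \<omega>
        let ?a = "a k (\<xi> [] \<omega>)"
        show "ennreal ?a \<le> ennreal ?a * (\<integral>\<^sup>+\<omega>'. Ls (T / ?a) (fam \<omega>') \<partial>M) + ennreal (?a\<^sup>2) * ennreal (f ^ n / T)"
        proof (cases "?a = 0")
          case False
          then have a: "0 < ?a" by (simp add: less_le)
          have "ennreal ?a * 1 \<le> ennreal ?a * ((\<integral>\<^sup>+\<omega>'. Ls (T / ?a) (fam \<omega>') \<partial>M) + ennreal (f ^ n / (T / ?a)))"
            by (intro mult_left_mono Suc.IH) (use a Suc.prems in auto)
          also have "\<dots> = ennreal ?a * (\<integral>\<^sup>+\<omega>'. Ls (T / ?a) (fam \<omega>') \<partial>M) + ennreal ?a * ennreal (f ^ n / (T / ?a))"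
            by (rule distrib_left)
          also have "ennreal ?a * ennreal (f ^ n / (T / ?a)) = ennreal (?a\<^sup>2) * ennreal (f ^ n / T)"
            using a Suc.prems f_nonneg by (simp add: ennreal_mult[symmetric] power2_eq_square field_simps)
          finally show ?thesis by simp
        qed simp
      qed simp_all
      also have "\<dots> = (\<Sum>k. (\<integral>\<^sup>+\<omega>. ennreal (a k (\<xi> [] \<omega>)) * (\<integral>\<^sup>+\<omega>'. Ls (T / a k (\<xi> [] \<omega>)) (fam \<omega>') \<partial>M) \<partial>M)
          + (\<integral>\<^sup>+\<omega>. ennreal ((a k (\<xi> [] \<omega>))\<^sup>2) \<partial>M) * ennreal (f ^ n / T))"
        by (subst nn_integral_add) (simp_all add: nn_integral_multc)
      also have "\<dots> = (\<Sum>k. \<integral>\<^sup>+\<omega>. ennreal (a k (\<xi> [] \<omega>)) * (\<integral>\<^sup>+\<omega>'. Ls (T / a k (\<xi> [] \<omega>)) (fam \<omega>') \<partial>M) \<partial>M)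
          + (\<Sum>k. (\<integral>\<^sup>+\<omega>. ennreal ((a k (\<xi> [] \<omega>))\<^sup>2) \<partial>M) * ennreal (f ^ n / T))"
        by (rule suminf_add[symmetric]) simp_all
      also have "(\<Sum>k. (\<integral>\<^sup>+\<omega>. ennreal ((a k (\<xi> [] \<omega>))\<^sup>2) \<partial>M) * ennreal (f ^ n / T)) = ennreal (f ^ Suc n / T)"
        using f_nonneg by (simp add: f_eq ennreal_mult'[symmetric])
      also have "(\<Sum>k. \<integral>\<^sup>+\<omega>. ennreal (a k (\<xi> [] \<omega>)) * (\<integral>\<^sup>+\<omega>'. Ls (T / a k (\<xi> [] \<omega>)) (fam \<omega>') \<partial>M) \<partial>M)
          = (\<Sum>k. \<integral>\<^sup>+\<omega>. \<integral>\<^sup>+\<omega>'. ennreal (a k (\<xi> [] \<omega>)) * Ls (T / a k (\<xi> [] \<omega>)) (fam \<omega>') \<partial>M \<partial>M)"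
        by (intro suminf_cong nn_integral_cong nn_integral_cmult[symmetric]) measurable
      also have "\<dots> = (\<Sum>k. \<integral>\<^sup>+\<omega>. ennreal (a k (\<xi> [] \<omega>)) * Ls (T / a k (\<xi> [] \<omega>)) (sh [k] (fam \<omega>)) \<partial>M)"
        by (intro suminf_cong nn_freeze_root[symmetric, where H="\<lambda>\<zeta> \<eta>. ennreal (a _ \<zeta>) * Ls (T / a _ \<zeta>) \<eta>"]) measurable
      also have "\<dots> = (\<integral>\<^sup>+\<omega>. Ls T (fam \<omega>) \<partial>M)"
        using False by (subst nn_integral_suminf[symmetric]) (auto simp: Ls_rec[of T])
      finally show ?thesis .
    qed
  qed
  show "1 \<le> (\<integral>\<^sup>+\<omega>. Ls T (fam \<omega>) \<partial>M)"
  proof (rule LIMSEQ_le_const)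
    have "(\<lambda>n. f ^ n / T) \<longlonglongrightarrow> 0 / T"
      using f_nonneg f_less_1 T by (intro tendsto_divide LIMSEQ_power_zero) auto
    then have "(\<lambda>n. ennreal (f ^ n / T)) \<longlonglongrightarrow> ennreal 0" by (intro tendsto_ennrealI) simp
    from tendsto_add[OF tendsto_const this]
    show "(\<lambda>n. (\<integral>\<^sup>+\<omega>. Ls T (fam \<omega>) \<partial>M) + ennreal (f ^ n / T)) \<longlonglongrightarrow> (\<integral>\<^sup>+\<omega>. Ls T (fam \<omega>) \<partial>M)" by simp
  qed (use step[OF T] in blast)
qed

lemma AE_Ls_finite: "0 < T \<Longrightarrow> AE \<omega> in M. Ls T (fam \<omega>) \<noteq> \<infinity>"
  by (rule nn_integral_PInf_AE) (simp_all add: nn_mean_Ls)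

definition WT :: "real \<Rightarrow> (nat list \<Rightarrow> real measure) \<Rightarrow> real" where
  "WT T \<eta> = enn2real (Ls T \<eta>)"

lemma measurable_WT [measurable (raw)]:
  assumes [measurable]: "g \<in> borel_measurable K" "h \<in> measurable K Om"
  shows "(\<lambda>x. WT (g x) (h x)) \<in> borel_measurable K"
  unfolding WT_def by measurable

text \<open>Truncated to finitely many individuals, since the line may be infinite: second moments
  and characteristic functions are computed for finite sums and then passed to the limit.\<close>

definition dev :: "real \<Rightarrow> nat \<Rightarrow> _ \<Rightarrow> real" where
  "dev T n \<omega> = (\<Sum>u\<in>fin n. of_bool (st u T (fam \<omega>)) * wt u (fam \<omega>) * (W (sh u (fam \<omega>)) - 1))"

lemma measurable_dev [measurable]: "dev T n \<in> borel_measurable M"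
  unfolding dev_def[abs_def] by measurable

lemma dev_LIMSEQ:
  assumes T: "0 < T"
  shows "AE \<omega> in M. (\<lambda>n. dev T n \<omega>) \<longlonglongrightarrow> W (fam \<omega>) - WT T (fam \<omega>)"
proof -
  have "(\<integral>\<^sup>+\<omega>. \<integral>\<^sup>+u. of_bool (st u T (fam \<omega>)) * ennreal (wt u (fam \<omega>)) \<partial>count_space UNIV \<partial>M) = 1"
    using nn_mean_Ls[OF T] by (simp add: Ls_def)
  from W_line[OF line_st this] show ?thesis
    using AE_Ls_finite[OF T] AE_sh_limit W_limit
  proof eventually_elim
    case (elim \<omega>)
    let ?J = "\<lambda>u. of_bool (st u T (fam \<omega>)) :: real"
    have 1: "(\<lambda>n. \<Sum>u\<in>fin n. ?J u * wt u (fam \<omega>)) \<longlonglongrightarrow> enn2real (\<integral>\<^sup>+u. ennreal (?J u * wt u (fam \<omega>)) \<partial>count_space UNIV)"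
    proof (rule fin_sum_real_LIMSEQ)
      have "(\<integral>\<^sup>+u. ennreal (?J u * wt u (fam \<omega>)) \<partial>count_space UNIV) = Ls T (fam \<omega>)"
        unfolding Ls_def by (intro nn_integral_cong) simp
      then show "(\<integral>\<^sup>+u. ennreal (?J u * wt u (fam \<omega>)) \<partial>count_space UNIV) \<noteq> \<infinity>" using elim(2) by simp
    qed simp
    have e1: "(\<integral>\<^sup>+u. ennreal (?J u * wt u (fam \<omega>)) \<partial>count_space UNIV) = Ls T (fam \<omega>)"
      unfolding Ls_def by (intro nn_integral_cong) simp
    have e2: "(\<integral>\<^sup>+u. ennreal (?J u * wt u (fam \<omega>) * W (sh u (fam \<omega>))) \<partial>count_space UNIV) = Wt (fam \<omega>)"
      unfolding elim(1)
    proof (intro nn_integral_cong)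
      fix u
      have "ennreal (W (sh u (fam \<omega>))) = Wt (sh u (fam \<omega>))" using elim(3) by (simp add: W_def less_top)
      then show "ennreal (?J u * wt u (fam \<omega>) * W (sh u (fam \<omega>))) = of_bool (st u T (fam \<omega>)) * ennreal (wt u (fam \<omega>)) * Wt (sh u (fam \<omega>))"
        by (simp add: ennreal_mult)
    qed
    have 2: "(\<lambda>n. \<Sum>u\<in>fin n. ?J u * wt u (fam \<omega>) * W (sh u (fam \<omega>))) \<longlonglongrightarrow>
        enn2real (\<integral>\<^sup>+u. ennreal (?J u * wt u (fam \<omega>) * W (sh u (fam \<omega>))) \<partial>count_space UNIV)"
      by (rule fin_sum_real_LIMSEQ) (use elim(4) in \<open>simp_all add: e2\<close>)
    have "dev T n \<omega> = (\<Sum>u\<in>fin n. ?J u * wt u (fam \<omega>) * W (sh u (fam \<omega>))) - (\<Sum>u\<in>fin n. ?J u * wt u (fam \<omega>))" for n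
      unfolding dev_def by (simp add: sum_subtractf right_diff_distrib)
    then show ?case using tendsto_diff[OF 2 1] unfolding e1 e2 by (simp add: W_def WT_def)
  qed
qed

lemma nn_Lq_le: "0 < T \<Longrightarrow> (\<integral>\<^sup>+\<omega>. Lq T (fam \<omega>) \<partial>M) \<le> ennreal T"
proof -
  assume T: "0 < T"
  have "(\<integral>\<^sup>+\<omega>. Lq T (fam \<omega>) \<partial>M) \<le> (\<integral>\<^sup>+\<omega>. ennreal T * Ls T (fam \<omega>) \<partial>M)"
    by (intro nn_integral_mono Lq_le_Ls)
  then show ?thesis by (simp add: nn_integral_cmult nn_mean_Ls[OF T])
qed

text \<open>By orthogonality the second moment is \<open>v\<close> times the mean of the squared
  weights on the line, and one factor of each square is below \<open>T\<close>. So the deviation has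
  order \<open>sqrt T\<close>, which for \<open>T = exp (- \<alpha> * t)\<close> is the
  normalisation in the theorem.\<close>

lemma dev_square:
  assumes T: "0 < T"
  shows "(\<integral>\<^sup>+\<omega>. ennreal ((W (fam \<omega>) - WT T (fam \<omega>))\<^sup>2) \<partial>M) \<le> ennreal (v * T)"
proof (rule fatou_square[OF _ _ dev_LIMSEQ[OF T]])
  fix n
  have "(\<integral>\<^sup>+\<omega>. ennreal ((0 + (\<Sum>u\<in>fin n. of_bool (st u T (fam \<omega>)) * wt u (fam \<omega>) * (W (sh u (fam \<omega>)) - 1)))\<^sup>2) \<partial>M)
      = (\<integral>\<^sup>+\<omega>. ennreal (0\<^sup>2) \<partial>M) + (\<Sum>u\<in>fin n. \<integral>\<^sup>+\<omega>. of_bool (st u T (fam \<omega>)) * ennreal ((wt u (fam \<omega>))\<^sup>2) *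
         (\<integral>\<^sup>+\<omega>'. ennreal ((W (fam \<omega>') - 1)\<^sup>2) \<partial>M) \<partial>M)"
    by (rule square_line_sum(2)[OF line_st finite_fin, where p="\<lambda>_ _. 0" and R="\<lambda>_ \<eta>. W \<eta> - 1" and C=v])
       (simp_all add: mean_W0 nn_v)
  then have "(\<integral>\<^sup>+\<omega>. ennreal ((dev T n \<omega>)\<^sup>2) \<partial>M) =
      (\<Sum>u\<in>fin n. \<integral>\<^sup>+\<omega>. of_bool (st u T (fam \<omega>)) * ennreal ((wt u (fam \<omega>))\<^sup>2) \<partial>M) * ennreal v"
    by (simp add: dev_def nn_v nn_integral_multc sum_distrib_right)
  also have "\<dots> = (\<integral>\<^sup>+\<omega>. (\<Sum>u\<in>fin n. of_bool (st u T (fam \<omega>)) * ennreal ((wt u (fam \<omega>))\<^sup>2)) \<partial>M) * ennreal v"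
    by (subst nn_integral_sum) simp_all
  also have "\<dots> \<le> (\<integral>\<^sup>+\<omega>. Lq T (fam \<omega>) \<partial>M) * ennreal v"
    unfolding Lq_def by (intro mult_right_mono nn_integral_mono fin_sum_le) simp
  also have "\<dots> \<le> ennreal T * ennreal v" by (intro mult_right_mono nn_Lq_le T) simp
  finally show "(\<integral>\<^sup>+\<omega>. ennreal ((dev T n \<omega>)\<^sup>2) \<partial>M) \<le> ennreal (v * T)"
    using T v_nonneg by (simp add: ennreal_mult'[symmetric] mult.commute)
qed measurable

subsection \<open>The normalised variance\<close>

definition h :: "real \<Rightarrow> real" where "h T = enn2real (\<integral>\<^sup>+\<omega>. Lq T (fam \<omega>) \<partial>M)"

lemma measurable_h [measurable]: "h \<in> borel_measurable borel"
  unfolding h_def[abs_def] by measurable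

lemma h_nonneg [simp]: "0 \<le> h T" by (simp add: h_def)

lemma nn_h: "0 < T \<Longrightarrow> (\<integral>\<^sup>+\<omega>. Lq T (fam \<omega>) \<partial>M) = ennreal (h T)"
  using le_less_trans[OF nn_Lq_le[of T] ennreal_less_top] by (simp add: h_def)

lemma h_le: "0 < T \<Longrightarrow> h T \<le> T"
  using nn_Lq_le[of T] by (simp add: nn_h)

lemma h_gt_1: "1 < T \<Longrightarrow> h T = 1"
  by (simp add: h_def Lq_gt_1 emeasure_space_1)

lemma h_le_1: "0 < T \<Longrightarrow> h T \<le> 1"
  using h_le[of T] h_gt_1[of T] by (cases "1 < T") auto

lemma h_rec:
  assumes T: "0 < T" "T \<le> 1"
  shows "ennreal (h T) = (\<Sum>k. \<integral>\<^sup>+\<omega>. ennreal ((a k (\<xi> [] \<omega>))\<^sup>2) * ennreal (h (T / a k (\<xi> [] \<omega>))) \<partial>M)"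
proof -
  have "ennreal (h T) = (\<Sum>k. \<integral>\<^sup>+\<omega>. ennreal ((a k (\<xi> [] \<omega>))\<^sup>2) * Lq (T / a k (\<xi> [] \<omega>)) (sh [k] (fam \<omega>)) \<partial>M)"
    unfolding nn_h[OF T(1), symmetric] using T by (subst nn_integral_suminf[symmetric]) (auto simp: Lq_rec[of T])
  also have "\<dots> = (\<Sum>k. \<integral>\<^sup>+\<omega>. \<integral>\<^sup>+\<omega>'. ennreal ((a k (\<xi> [] \<omega>))\<^sup>2) * Lq (T / a k (\<xi> [] \<omega>)) (fam \<omega>') \<partial>M \<partial>M)"
    by (intro suminf_cong nn_freeze_root[where H="\<lambda>\<zeta> \<eta>. ennreal ((a _ \<zeta>)\<^sup>2) * Lq (T / a _ \<zeta>) \<eta>"]) measurable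
  also have "\<dots> = (\<Sum>k. \<integral>\<^sup>+\<omega>. ennreal ((a k (\<xi> [] \<omega>))\<^sup>2) * ennreal (h (T / a k (\<xi> [] \<omega>))) \<partial>M)"
  proof (intro suminf_cong nn_integral_cong)
    fix k \<omega>
    show "(\<integral>\<^sup>+\<omega>'. ennreal ((a k (\<xi> [] \<omega>))\<^sup>2) * Lq (T / a k (\<xi> [] \<omega>)) (fam \<omega>') \<partial>M) = ennreal ((a k (\<xi> [] \<omega>))\<^sup>2) * ennreal (h (T / a k (\<xi> [] \<omega>)))"
    proof (cases "a k (\<xi> [] \<omega>) = 0")
      case False
      then have "0 < T / a k (\<xi> [] \<omega>)" using T by (simp add: less_le)
      then show ?thesis by (subst nn_integral_cmult) (simp_all add: nn_h)
    qed simp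
  qed
  finally show ?thesis .
qed

text \<open>The recursion rescales both levels by the same weights, and a level above 1 has the
  maximal value 1. Whatever is undecided after \<open>n\<close> generations contributes at most
  \<open>f ^ n\<close>. Monotonicity provides the growth bound of the renewal theorem.\<close>

lemma h_mono:
  assumes T: "0 < T" "T \<le> T'"
  shows "h T \<le> h T'"
proof -
  have step: "h T \<le> h T' + f ^ n" if "0 < T" "T \<le> T'" for n T T'
    using that
  proof (induction n arbitrary: T T')
    case 0
    then show ?case using h_le_1[of T] h_nonneg[of T'] unfolding power_0 by linarith
  next
    case (Suc n)
    show ?case
    proof (cases "1 < T'")
      case True
      then show ?thesis
        using h_le_1[of T] h_gt_1[of T'] Suc.prems zero_le_power[OF f_nonneg, of "Suc n"] by linarith
    next
      case False
      have "ennreal (h T) = (\<Sum>k. \<integral>\<^sup>+\<omega>. ennreal ((a k (\<xi> [] \<omega>))\<^sup>2) * ennreal (h (T / a k (\<xi> [] \<omega>))) \<partial>M)"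
        using Suc.prems False by (intro h_rec) auto
      also have "\<dots> \<le> (\<Sum>k. \<integral>\<^sup>+\<omega>. ennreal ((a k (\<xi> [] \<omega>))\<^sup>2) * ennreal (h (T' / a k (\<xi> [] \<omega>))) + ennreal ((a k (\<xi> [] \<omega>))\<^sup>2) * ennreal (f ^ n) \<partial>M)"
      proof (intro suminf_le nn_integral_mono)
        fix k \<omega>
        let ?a = "a k (\<xi> [] \<omega>)"
        show "ennreal (?a\<^sup>2) * ennreal (h (T / ?a)) \<le> ennreal (?a\<^sup>2) * ennreal (h (T' / ?a)) + ennreal (?a\<^sup>2) * ennreal (f ^ n)"
        proof (cases "?a = 0")
          case False
          then have a: "0 < ?a" by (simp add: less_le)
          have "h (T / ?a) \<le> h (T' / ?a) + f ^ n"
            by (rule Suc.IH) (use Suc.prems a in \<open>auto intro: divide_right_mono\<close>)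
          then have "ennreal (h (T / ?a)) \<le> ennreal (h (T' / ?a)) + ennreal (f ^ n)"
            using f_nonneg by (simp add: ennreal_plus[symmetric] del: ennreal_plus)
          then show ?thesis unfolding distrib_left[symmetric] by (rule mult_left_mono) simp
        qed simp
      qed simp_all
      also have "\<dots> = (\<Sum>k. (\<integral>\<^sup>+\<omega>. ennreal ((a k (\<xi> [] \<omega>))\<^sup>2) * ennreal (h (T' / a k (\<xi> [] \<omega>))) \<partial>M)
          + (\<integral>\<^sup>+\<omega>. ennreal ((a k (\<xi> [] \<omega>))\<^sup>2) \<partial>M) * ennreal (f ^ n))"
        by (subst nn_integral_add) (simp_all add: nn_integral_multc)
      also have "\<dots> = (\<Sum>k. \<integral>\<^sup>+\<omega>. ennreal ((a k (\<xi> [] \<omega>))\<^sup>2) * ennreal (h (T' / a k (\<xi> [] \<omega>))) \<partial>M)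
          + (\<Sum>k. (\<integral>\<^sup>+\<omega>. ennreal ((a k (\<xi> [] \<omega>))\<^sup>2) \<partial>M) * ennreal (f ^ n))"
        by (rule suminf_add[symmetric]) simp_all
      also have "\<dots> = ennreal (h T' + f ^ Suc n)"
        using Suc.prems False f_nonneg
        by (subst h_rec[symmetric]) (auto simp: f_eq ennreal_mult'[symmetric])
      finally show ?thesis using f_nonneg by (subst (asm) ennreal_le_iff) auto
    qed
  qed
  show ?thesis
  proof (rule LIMSEQ_le_const)
    have "(\<lambda>n. h T' + f ^ n) \<longlonglongrightarrow> h T' + 0"
      using f_nonneg f_less_1 by (intro tendsto_intros LIMSEQ_power_zero) auto
    then show "(\<lambda>n. h T' + f ^ n) \<longlonglongrightarrow> h T'" by simp
  qed (use step[OF T] in blast)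
qed

text \<open>On the logarithmic scale \<open>T = exp (- t)\<close> the multiplicative recursion
  \<open>h_rec\<close> becomes a renewal equation. For negative \<open>t\<close> the line consists
  of the root alone, which gives \<open>exp t\<close>.\<close>

definition V :: "real \<Rightarrow> real" where "V t = exp t * h (exp (- t))"

lemma measurable_V [measurable]: "V \<in> borel_measurable borel"
  unfolding V_def[abs_def] by measurable

lemma V_nonneg: "0 \<le> V t" by (simp add: V_def)

lemma V_le_1: "V t \<le> 1"
  using mult_left_mono[OF h_le[of "exp (- t)"], of "exp t"] by (simp add: V_def exp_minus)

end

text \<open>\<open>F\<close> is the law of \<open>- ln\<close> of the weight of a size-biased child.
  Since the weights have total mean 1 it is a probability measure, and \<open>nn_F\<close> is the
  many-to-one formula for one generation.\<close>

locale renewal_cascade = normalized_cascade +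
  fixes F :: "real measure"
  assumes sets_F: "sets F = sets borel"
    and nn_F: "\<And>g. g \<in> borel_measurable borel \<Longrightarrow>
      (\<integral>\<^sup>+y. g y \<partial>F) = (\<Sum>k. \<integral>\<^sup>+\<omega>. ennreal (a k (\<xi> [] \<omega>)) * g (- ln (a k (\<xi> [] \<omega>))) \<partial>M)"
    and nonlattice: "\<And>d. d > 0 \<Longrightarrow> \<not> (AE y in F. y \<in> range (\<lambda>n::nat. d * real n))"
    and F_mean: "integrable F (\<lambda>y. y)"
begin

definition m :: real where "m = (\<integral>y. y \<partial>F)"

definition c :: real where "c = (1 - f) / m"

lemma renewal_F: "renewal F"
proof -
  have sp: "space F = UNIV" using sets_eq_imp_space_eq[OF sets_F] by simp
  have "emeasure F (space F) = (\<integral>\<^sup>+y. 1 \<partial>F)" by simp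
  also have "\<dots> = 1" by (subst nn_F) (simp_all add: mean_suminf)
  finally have p: "prob_space F" by (rule prob_spaceI)
  have "emeasure F {..0} = (\<integral>\<^sup>+y. indicator {..0} y \<partial>F)" by (simp add: sets_F)
  also have "\<dots> = (\<Sum>k. \<integral>\<^sup>+\<omega>. ennreal (a k (\<xi> [] \<omega>)) * indicator {..0} (- ln (a k (\<xi> [] \<omega>))) \<partial>M)"
    by (rule nn_F) simp
  also have "\<dots> = (\<Sum>k. \<integral>\<^sup>+\<omega>. 0 \<partial>M)"
  proof (intro suminf_cong nn_integral_cong)
    fix k \<omega>
    show "ennreal (a k (\<xi> [] \<omega>)) * indicator {..0} (- ln (a k (\<xi> [] \<omega>))) = 0"
      using a_less_1[of k "\<xi> [] \<omega>"] a_nonneg[of k "\<xi> [] \<omega>"]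
      by (cases "a k (\<xi> [] \<omega>) = 0") (auto simp: indicator_def less_le)
  qed
  finally have null: "{..0} \<in> null_sets F" by (simp add: null_sets_def sets_F)
  have "AE y in F. 0 < y"
    using AE_not_in[OF null] by eventually_elim (simp add: not_le)
  then show ?thesis
    by (intro renewal.intro p renewal_axioms.intro sets_F)
qed

lemma V_limit: "(V \<longlongrightarrow> c) at_top"
proof -
  interpret F: renewal F by (rule renewal_F)
  have "(\<integral>\<^sup>+y. ennreal (exp (- y)) \<partial>F) = (\<Sum>k. \<integral>\<^sup>+\<omega>. ennreal ((a k (\<xi> [] \<omega>))\<^sup>2) \<partial>M)"
  proof (subst nn_F, simp, intro suminf_cong nn_integral_cong)
    fix k \<omega>
    show "ennreal (a k (\<xi> [] \<omega>)) * ennreal (exp (- (- ln (a k (\<xi> [] \<omega>))))) = ennreal ((a k (\<xi> [] \<omega>))\<^sup>2)"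
      using a_nonneg[of k "\<xi> [] \<omega>"]
      by (cases "a k (\<xi> [] \<omega>) = 0") (auto simp: ennreal_mult[symmetric] power2_eq_square less_le)
  qed
  then have "(\<integral>\<^sup>+y. ennreal (exp (- y)) \<partial>F) = ennreal f" by (simp add: f_eq)
  then have f: "(\<integral>y. exp (- y) \<partial>F) = f"
    using f_nonneg by (subst integral_eq_nn_integral) auto
  have "(V \<longlongrightarrow> (1 - (\<integral>y. exp (- y) \<partial>F)) / (\<integral>y. y \<partial>F)) at_top"
  proof (rule F.renewal_limit[OF nonlattice F_mean measurable_V V_nonneg V_le_1])
    show "V t = exp t" if "t < 0" for t using that by (simp add: V_def h_gt_1)
    show "V (t + d) \<le> exp d * V t" if "0 \<le> d" for t d
      using h_mono[of "exp (- (t + d))" "exp (- t)"] that by (simp add: V_def exp_add)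
    show "ennreal (V t) = (\<integral>\<^sup>+y. ennreal (V (t - y)) \<partial>F)" if t: "0 \<le> t" for t
    proof -
      have "ennreal (V t) = ennreal (exp t) * ennreal (h (exp (- t)))" by (simp add: V_def ennreal_mult)
      also have "\<dots> = (\<Sum>k. \<integral>\<^sup>+\<omega>. ennreal (exp t) * (ennreal ((a k (\<xi> [] \<omega>))\<^sup>2) * ennreal (h (exp (- t) / a k (\<xi> [] \<omega>)))) \<partial>M)"
        using t by (subst h_rec) (simp_all add: nn_integral_cmult)
      also have "\<dots> = (\<Sum>k. \<integral>\<^sup>+\<omega>. ennreal (a k (\<xi> [] \<omega>)) * ennreal (V (t - (- ln (a k (\<xi> [] \<omega>))))) \<partial>M)"
      proof (intro suminf_cong nn_integral_cong)
        fix k \<omega>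
        show "ennreal (exp t) * (ennreal ((a k (\<xi> [] \<omega>))\<^sup>2) * ennreal (h (exp (- t) / a k (\<xi> [] \<omega>)))) =
            ennreal (a k (\<xi> [] \<omega>)) * ennreal (V (t - (- ln (a k (\<xi> [] \<omega>)))))"
        proof (cases "a k (\<xi> [] \<omega>) = 0")
          case False
          then have a: "0 < a k (\<xi> [] \<omega>)" by (simp add: less_le)
          then have "V (t - (- ln (a k (\<xi> [] \<omega>)))) = exp t * a k (\<xi> [] \<omega>) * h (exp (- t) / a k (\<xi> [] \<omega>))"
            by (simp add: V_def exp_add exp_diff exp_minus)
          then show ?thesis using a by (simp add: ennreal_mult[symmetric] power2_eq_square mult_ac)
        qed simp
      qed
      also have "\<dots> = (\<integral>\<^sup>+y. ennreal (V (t - y)) \<partial>F)"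
        by (rule nn_F[symmetric]) simp
      finally show ?thesis .
    qed
  qed
  then show ?thesis by (simp add: f c_def m_def)
qed

lemma c_nonneg: "0 \<le> c" and c_le_1: "c \<le> 1"
  by (rule tendsto_lowerbound[OF V_limit]; simp add: V_nonneg)
     (rule tendsto_upperbound[OF V_limit]; simp add: V_le_1)

end

section \<open>Law of large numbers for the squared weights on a line\<close>

context normalized_cascade
begin

lemma nn_W2: "(\<integral>\<^sup>+\<omega>. ennreal ((W (fam \<omega>))\<^sup>2) \<partial>M) \<le> ennreal (2 * v + 2)"
proof -
  have "(\<integral>\<^sup>+\<omega>. ennreal ((W (fam \<omega>))\<^sup>2) \<partial>M) \<le> (\<integral>\<^sup>+\<omega>. 2 * ennreal ((W (fam \<omega>) - 1)\<^sup>2) + 2 \<partial>M)"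
  proof (rule nn_integral_mono)
    fix \<omega>
    have "ennreal ((W (fam \<omega>))\<^sup>2) \<le> ennreal (2 * (W (fam \<omega>) - 1)\<^sup>2 + 2)"
      using square_sum_le[of "W (fam \<omega>) - 1" 1] by (intro ennreal_leI) simp
    then show "ennreal ((W (fam \<omega>))\<^sup>2) \<le> 2 * ennreal ((W (fam \<omega>) - 1)\<^sup>2) + 2"
      by (simp add: ennreal_mult)
  qed
  also have "\<dots> = 2 * ennreal v + 2"
    by (subst nn_integral_add) (simp_all add: nn_integral_cmult nn_v emeasure_space_1)
  finally show ?thesis using v_nonneg by (simp add: ennreal_mult)
qed

text \<open>For \<open>T = exp (- \<alpha> * t)\<close> the division by \<open>T\<close> is
  multiplication by \<open>exp (\<alpha> * t)\<close>, so \<open>v * Q T\<close> is the conditional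
  variance of the normalised deviation. The goal of this part is that it approaches
  \<open>c * W\<close> in mean square.\<close>

definition Q :: "real \<Rightarrow> (nat list \<Rightarrow> real measure) \<Rightarrow> real" where
  "Q T \<eta> = enn2real (Lq T \<eta>) / T"

lemma measurable_Q [measurable (raw)]:
  assumes [measurable]: "g \<in> borel_measurable K" "l \<in> measurable K Om"
  shows "(\<lambda>x. Q (g x) (l x)) \<in> borel_measurable K"
  unfolding Q_def by measurable

lemma Q_nonneg: "0 < T \<Longrightarrow> 0 \<le> Q T \<eta>"
  by (simp add: Q_def)

lemma Q_le_WT: "0 < T \<Longrightarrow> Ls T \<eta> \<noteq> \<infinity> \<Longrightarrow> Q T \<eta> \<le> WT T \<eta>"
proof -
  assume T: "0 < T" and fin: "Ls T \<eta> \<noteq> \<infinity>"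
  have "enn2real (Lq T \<eta>) \<le> enn2real (ennreal T * Ls T \<eta>)"
    by (rule enn2real_mono[OF Lq_le_Ls]) (use fin in \<open>simp add: ennreal_mult_less_top less_top\<close>)
  also have "\<dots> = T * WT T \<eta>" using T by (simp add: enn2real_mult WT_def)
  finally show ?thesis using T by (simp add: Q_def field_simps)
qed

lemma AE_Lq_finite: "0 < T \<Longrightarrow> AE \<omega> in M. Lq T (fam \<omega>) \<noteq> \<infinity>"
  by (rule nn_integral_PInf_AE) (simp_all add: nn_h)

lemma nn_WT2:
  assumes T: "0 < T"
  shows "(\<integral>\<^sup>+\<omega>. ennreal ((WT T (fam \<omega>))\<^sup>2) \<partial>M) \<le> ennreal (6 * v + 4)"
proof (cases "1 < T")
  case True
  have "ennreal 1 \<le> ennreal (6 * v + 4)" using v_nonneg by (intro ennreal_leI) simp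
  then show ?thesis using True by (simp add: WT_def Ls_gt_1 emeasure_space_1 del: ennreal_plus)
next
  case False
  have "(\<integral>\<^sup>+\<omega>. ennreal ((WT T (fam \<omega>))\<^sup>2) \<partial>M) \<le>
      (\<integral>\<^sup>+\<omega>. 2 * ennreal ((W (fam \<omega>) - WT T (fam \<omega>))\<^sup>2) + 2 * ennreal ((W (fam \<omega>))\<^sup>2) \<partial>M)"
  proof (rule nn_integral_mono)
    fix \<omega>
    have "(WT T (fam \<omega>))\<^sup>2 \<le> 2 * (W (fam \<omega>) - WT T (fam \<omega>))\<^sup>2 + 2 * (W (fam \<omega>))\<^sup>2"
      using square_sum_le[of "WT T (fam \<omega>) - W (fam \<omega>)" "W (fam \<omega>)"] by (simp add: power2_commute)
    then have "ennreal ((WT T (fam \<omega>))\<^sup>2) \<le> ennreal (2 * (W (fam \<omega>) - WT T (fam \<omega>))\<^sup>2 + 2 * (W (fam \<omega>))\<^sup>2)"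
      by (rule ennreal_leI)
    then show "ennreal ((WT T (fam \<omega>))\<^sup>2) \<le> 2 * ennreal ((W (fam \<omega>) - WT T (fam \<omega>))\<^sup>2) + 2 * ennreal ((W (fam \<omega>))\<^sup>2)"
      by (simp add: ennreal_mult)
  qed
  also have "\<dots> = 2 * (\<integral>\<^sup>+\<omega>. ennreal ((W (fam \<omega>) - WT T (fam \<omega>))\<^sup>2) \<partial>M) + 2 * (\<integral>\<^sup>+\<omega>. ennreal ((W (fam \<omega>))\<^sup>2) \<partial>M)"
    by (subst nn_integral_add) (simp_all add: nn_integral_cmult)
  also have "\<dots> \<le> 2 * ennreal (v * T) + 2 * ennreal (2 * v + 2)"
    by (intro add_mono mult_left_mono dev_square nn_W2 T) simp_all
  also have "\<dots> = ennreal (2 * (v * T) + 2 * (2 * v + 2))"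
    using v_nonneg T by (simp add: ennreal_mult ennreal_plus)
  \<comment> \<open>\<open>T \<le> 1\<close> in this case, so \<open>2 * v + 2 * (2 * v + 2)\<close>
    is the origin of \<open>6 * v + 4\<close>.\<close>
  also have "\<dots> \<le> ennreal (6 * v + 4)"
    using False mult_left_mono[of T 1 v] v_nonneg by (intro ennreal_leI) simp
  finally show ?thesis .
qed

lemma nn_Q2: "0 < T \<Longrightarrow> (\<integral>\<^sup>+\<omega>. ennreal ((Q T (fam \<omega>))\<^sup>2) \<partial>M) \<le> ennreal (6 * v + 4)"
proof -
  assume T: "0 < T"
  have "(\<integral>\<^sup>+\<omega>. ennreal ((Q T (fam \<omega>))\<^sup>2) \<partial>M) \<le> (\<integral>\<^sup>+\<omega>. ennreal ((WT T (fam \<omega>))\<^sup>2) \<partial>M)"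
    using AE_Ls_finite[OF T]
    by (intro nn_integral_mono_AE, eventually_elim) (intro ennreal_leI power_mono Q_le_WT Q_nonneg T)
  also have "\<dots> \<le> ennreal (6 * v + 4)" by (rule nn_WT2[OF T])
  finally show ?thesis .
qed

lemma mean_Q: "0 < T \<Longrightarrow> integrable M (\<lambda>\<omega>. Q T (fam \<omega>)) \<and> (\<integral>\<omega>. Q T (fam \<omega>) \<partial>M) = h T / T"
proof
  assume T: "0 < T"
  show "integrable M (\<lambda>\<omega>. Q T (fam \<omega>))"
    by (rule mean_le_of_square(1)[OF _ nn_Q2[OF T]]) (use v_nonneg in auto)
  have "(\<integral>\<^sup>+\<omega>. ennreal (enn2real (Lq T (fam \<omega>))) \<partial>M) = ennreal (h T)"
    unfolding nn_h[OF T, symmetric]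
    using AE_Lq_finite[OF T] by (intro nn_integral_cong_AE, eventually_elim) (simp add: less_top)
  then have "(\<integral>\<omega>. enn2real (Lq T (fam \<omega>)) \<partial>M) = h T"
    by (subst integral_eq_nn_integral) auto
  then show "(\<integral>\<omega>. Q T (fam \<omega>) \<partial>M) = h T / T" by (simp add: Q_def)
qed

lemma Q_recursion:
  assumes T: "0 < T" "T \<le> 1"
  shows "AE \<omega> in M. (\<lambda>n. \<Sum>k<n. a k (\<xi> [] \<omega>) * Q (T / a k (\<xi> [] \<omega>)) (sh [k] (fam \<omega>))) \<longlonglongrightarrow> Q T (fam \<omega>)"
  using AE_Lq_finite[OF T(1)]
proof eventually_elim
  case (elim \<omega>)
  let ?a = "\<lambda>k. a k (\<xi> [] \<omega>)" and ?L = "\<lambda>k. Lq (T / a k (\<xi> [] \<omega>)) (sh [k] (fam \<omega>))"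
  have eq: "Lq T (fam \<omega>) = (\<Sum>k. ennreal ((?a k)\<^sup>2) * ?L k)" using Lq_rec[OF T(2)] by simp
  \<comment> \<open>For a child of weight 0 the quotient \<open>T / 0\<close> is 0, and no
    individual stops at level 0.\<close>
  have L0: "Lq 0 \<eta> = 0" for \<eta>
  proof -
    have "\<not> st u 0 \<eta>" for u unfolding st_iff by (simp add: not_less)
    then show ?thesis by (simp add: Lq_def)
  qed
  have fin: "?L k \<noteq> \<infinity>" for k
  proof (cases "?a k = 0")
    case True
    then show ?thesis by (simp add: L0)
  next
    case False
    have "ennreal ((?a k)\<^sup>2) * ?L k \<le> (\<Sum>k. ennreal ((?a k)\<^sup>2) * ?L k)"
      using sum_le_suminf[of "\<lambda>k. ennreal ((?a k)\<^sup>2) * ?L k" "{k}"] by simp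
    then have "ennreal ((?a k)\<^sup>2) * ?L k < \<infinity>" using elim eq by (simp add: less_top order_le_less_trans)
    then show ?thesis using False by (auto simp: ennreal_mult_less_top ennreal_mult_eq_top_iff)
  qed
  have "(\<lambda>n. \<Sum>k<n. (?a k)\<^sup>2 * enn2real (?L k)) \<longlonglongrightarrow> enn2real (\<Sum>k. ennreal ((?a k)\<^sup>2) * ?L k)"
    by (rule enn2real_suminf_LIMSEQ[OF _ _ fin]) (use elim eq in auto)
  then have "(\<lambda>n. (\<Sum>k<n. (?a k)\<^sup>2 * enn2real (?L k)) / T) \<longlonglongrightarrow> enn2real (Lq T (fam \<omega>)) / T"
    unfolding eq using T by (intro tendsto_divide tendsto_const) auto
  moreover have "(\<Sum>k<n. (?a k)\<^sup>2 * enn2real (?L k)) / T = (\<Sum>k<n. ?a k * Q (T / ?a k) (sh [k] (fam \<omega>)))" for n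
    unfolding sum_divide_distrib Q_def by (intro sum.cong refl) (simp add: power2_eq_square)
  ultimately show ?case by (simp add: Q_def)
qed

lemma wn_1_square: "integrable M (\<lambda>\<omega>. (wn 1 (fam \<omega>))\<^sup>2)"
proof -
  have "integrable M (\<lambda>\<omega>. ((wn 1 (fam \<omega>) - 1) + 1)\<^sup>2)"
    by (rule integrable_square_add)
       (use mean_le_of_square(2)[of "\<lambda>\<omega>. wn 1 (fam \<omega>) - 1" \<sigma>2] y1_square \<sigma>2_nonneg in \<open>simp_all add: y1_wn\<close>)
  then show ?thesis by simp
qed

lemma AE_summable_a: "AE \<omega> in M. summable (\<lambda>k. a k (\<xi> [] \<omega>)) \<and> (\<Sum>k. a k (\<xi> [] \<omega>)) = wn 1 (fam \<omega>)"
  using wn_1_recursion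
proof eventually_elim
  case (elim \<omega>)
  then have "(\<lambda>k. a k (\<xi> [] \<omega>)) sums wn 1 (fam \<omega>)" by (simp add: sums_def)
  then show ?case by (simp add: sums_iff)
qed

end

context renewal_cascade
begin

text \<open>The mean of \<open>Q T - c * W\<close> for positive \<open>T\<close>, which the renewal
  theorem sends to 0 as \<open>T\<close> decreases to 0.\<close>

definition rho :: "real \<Rightarrow> real" where "rho T = h T / T - c"

lemma measurable_rho [measurable]: "rho \<in> borel_measurable borel"
  unfolding rho_def[abs_def] by measurable

lemma rho_bound: "\<bar>rho T\<bar> \<le> 1"
proof (cases "0 < T")
  case True
  then have "0 \<le> h T / T" "h T / T \<le> 1" using h_le[OF True] by simp_all
  then show ?thesis using c_nonneg c_le_1 unfolding rho_def by linarith
next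
  case False
  have "\<not> st u T \<eta>" for u \<eta> using False wt_nonneg[of u \<eta>] unfolding st_iff by linarith
  then have "h T = 0" by (simp add: h_def Lq_def)
  then show ?thesis using c_nonneg c_le_1 by (simp add: rho_def)
qed

lemma rho_limit: "0 < x \<Longrightarrow> ((\<lambda>t. rho (exp (- t) / x)) \<longlongrightarrow> 0) at_top"
proof -
  assume x: "0 < x"
  \<comment> \<open>Dividing the level by \<open>x\<close> shifts the logarithmic time by
    \<open>ln x\<close>.\<close>
  have "filterlim (\<lambda>t. ln x + t) at_top at_top"
    by (rule filterlim_tendsto_add_at_top[OF tendsto_const filterlim_ident])
  from filterlim_compose[OF V_limit this]
  have "((\<lambda>t. V (ln x + t) - c) \<longlongrightarrow> c - c) at_top" by (intro tendsto_diff tendsto_const)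
  moreover have "V (ln x + t) - c = rho (exp (- t) / x)" for t
    using x by (simp add: V_def rho_def exp_add exp_diff exp_minus field_simps)
  ultimately show ?thesis by simp
qed

text \<open>The guard keeps \<open>R p\<close> centred for every real \<open>p\<close>, as
  \<open>square_first_generation\<close> demands; the value \<open>p = 0\<close> occurs as the
  quotient by a vanishing weight.\<close>

definition R :: "real \<Rightarrow> (nat list \<Rightarrow> real measure) \<Rightarrow> real" where
  "R p \<eta> = (if 0 < p then Q p \<eta> - c * W \<eta> - rho p else 0)"

lemma measurable_R [measurable]: "case_prod R \<in> borel_measurable (borel \<Otimes>\<^sub>M Om)"
  unfolding R_def[abs_def] case_prod_beta' by measurable

definition eps :: "real \<Rightarrow> ennreal" where
  "eps T = (\<integral>\<^sup>+\<omega>. ennreal ((Q T (fam \<omega>) - c * W (fam \<omega>))\<^sup>2) \<partial>M)"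

text \<open>Twice the second moment bound of \<open>Q\<close> plus twice that of \<open>W\<close>,
  namely \<open>2 * (6 * v + 4) + 2 * (2 * v + 2)\<close>.\<close>

definition C0 :: real where "C0 = 16 * v + 12"

lemma eps_bound: "0 < T \<Longrightarrow> eps T \<le> ennreal C0"
proof -
  assume T: "0 < T"
  have "eps T \<le> (\<integral>\<^sup>+\<omega>. 2 * ennreal ((Q T (fam \<omega>))\<^sup>2) + 2 * ennreal ((W (fam \<omega>))\<^sup>2) \<partial>M)"
    unfolding eps_def
  proof (rule nn_integral_mono)
    fix \<omega>
    have "c\<^sup>2 \<le> 1" using c_nonneg c_le_1 by (simp add: abs_square_le_1)
    then have "c\<^sup>2 * (W (fam \<omega>))\<^sup>2 \<le> (W (fam \<omega>))\<^sup>2" by (simp add: mult_left_le_one_le)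
    then have "(Q T (fam \<omega>) - c * W (fam \<omega>))\<^sup>2 \<le> 2 * (Q T (fam \<omega>))\<^sup>2 + 2 * (W (fam \<omega>))\<^sup>2"
      using square_sum_le[of "Q T (fam \<omega>)" "- (c * W (fam \<omega>))"] by (simp add: power_mult_distrib)
    then have "ennreal ((Q T (fam \<omega>) - c * W (fam \<omega>))\<^sup>2) \<le> ennreal (2 * (Q T (fam \<omega>))\<^sup>2 + 2 * (W (fam \<omega>))\<^sup>2)"
      by (rule ennreal_leI)
    then show "ennreal ((Q T (fam \<omega>) - c * W (fam \<omega>))\<^sup>2) \<le> 2 * ennreal ((Q T (fam \<omega>))\<^sup>2) + 2 * ennreal ((W (fam \<omega>))\<^sup>2)"
      by (simp add: ennreal_mult)
  qed
  also have "\<dots> = 2 * (\<integral>\<^sup>+\<omega>. ennreal ((Q T (fam \<omega>))\<^sup>2) \<partial>M) + 2 * (\<integral>\<^sup>+\<omega>. ennreal ((W (fam \<omega>))\<^sup>2) \<partial>M)"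
    by (subst nn_integral_add) (simp_all add: nn_integral_cmult)
  also have "\<dots> \<le> 2 * ennreal (6 * v + 4) + 2 * ennreal (2 * v + 2)"
    by (intro add_mono mult_left_mono nn_Q2 nn_W2 T) simp_all
  also have "\<dots> = ennreal (2 * (6 * v + 4) + 2 * (2 * v + 2))"
  proof -
    have e2: "2 * ennreal x = ennreal (2 * x)" if "0 \<le> x" for x using that by (simp add: ennreal_mult)
    show ?thesis
      using v_nonneg by (subst (1 2) e2) (simp_all del: ennreal_plus add: ennreal_plus[symmetric])
  qed
  finally have "eps T \<le> ennreal (2 * (6 * v + 4) + 2 * (2 * v + 2))" .
  moreover have "2 * (6 * v + 4) + 2 * (2 * v + 2) = C0" by (simp add: C0_def)
  ultimately show ?thesis by (simp only:)
qed

lemma C0_nonneg: "0 \<le> C0"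
  using v_nonneg by (simp add: C0_def)

lemma mean_R: "(\<integral>\<omega>. R p (fam \<omega>) \<partial>M) = 0"
  and R_square: "(\<integral>\<^sup>+\<omega>. ennreal ((R p (fam \<omega>))\<^sup>2) \<partial>M) \<le> (if 0 < p then eps p else 0)"
proof -
  have "(\<integral>\<omega>. R p (fam \<omega>) \<partial>M) = 0 \<and> (\<integral>\<^sup>+\<omega>. ennreal ((R p (fam \<omega>))\<^sup>2) \<partial>M) \<le> (if 0 < p then eps p else 0)"
  proof (cases "0 < p")
    case True
    let ?X = "\<lambda>\<omega>. Q p (fam \<omega>) - c * W (fam \<omega>)"
    have X2: "integrable M (\<lambda>\<omega>. (?X \<omega>)\<^sup>2)"
      by (rule mean_le_of_square(2)[OF _ eps_bound[OF True, unfolded eps_def] C0_nonneg]) measurable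
    have iX: "integrable M ?X"
      by (rule mean_le_of_square(1)[OF _ eps_bound[OF True, unfolded eps_def] C0_nonneg]) measurable
    have EX: "(\<integral>\<omega>. ?X \<omega> \<partial>M) = rho p"
      using mean_Q[OF True] integrable_W by (simp add: mean_W rho_def)
    have R: "R p (fam \<omega>) = ?X \<omega> - rho p" for \<omega> using True by (simp add: R_def)
    have 1: "(\<integral>\<omega>. R p (fam \<omega>) \<partial>M) = 0" unfolding R using iX by (simp add: EX prob_space)
    have "(\<integral>\<omega>. (?X \<omega> - rho p)\<^sup>2 \<partial>M) \<le> (\<integral>\<omega>. (?X \<omega>)\<^sup>2 \<partial>M)"
      using variance_eq[OF iX X2] unfolding EX by simp
    moreover have "integrable M (\<lambda>\<omega>. (?X \<omega> - rho p)\<^sup>2)"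
      using integrable_square_add[of ?X M "\<lambda>_. - rho p"] X2 by simp
    ultimately have "(\<integral>\<^sup>+\<omega>. ennreal ((?X \<omega> - rho p)\<^sup>2) \<partial>M) \<le> eps p"
      unfolding eps_def using X2 by (simp add: nn_integral_eq_integral ennreal_leI)
    then show ?thesis using 1 True unfolding R by simp
  qed (simp add: R_def)
  then show "(\<integral>\<omega>. R p (fam \<omega>) \<partial>M) = 0"
    and "(\<integral>\<^sup>+\<omega>. ennreal ((R p (fam \<omega>))\<^sup>2) \<partial>M) \<le> (if 0 < p then eps p else 0)" by blast+
qed

lemma R_square_bound: "(\<integral>\<^sup>+\<omega>. ennreal ((R p (fam \<omega>))\<^sup>2) \<partial>M) \<le> ennreal C0"
  using R_square[of p] eps_bound[of p] by (cases "0 < p") (auto intro: order_trans)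

text \<open>What remains of \<open>Q T - c * W\<close> after the contributions of the children are
  centred: the weighted sum of the means of these contributions, a function of the mark of the
  root.\<close>

definition yT :: "real \<Rightarrow> real measure \<Rightarrow> real" where
  "yT T \<zeta> = (\<Sum>k. a k \<zeta> * rho (T / a k \<zeta>))"

lemma measurable_yT [measurable]: "yT T \<in> borel_measurable N"
  unfolding yT_def[abs_def] by measurable

lemma yT_bound: "AE \<omega> in M. \<forall>T. summable (\<lambda>k. a k (\<xi> [] \<omega>) * rho (T / a k (\<xi> [] \<omega>))) \<and> \<bar>yT T (\<xi> [] \<omega>)\<bar> \<le> wn 1 (fam \<omega>)"
  using AE_summable_a
proof eventually_elim
  case (elim \<omega>)
  show ?case
  proof
    fix T
    have le: "norm (a k (\<xi> [] \<omega>) * rho (T / a k (\<xi> [] \<omega>))) \<le> a k (\<xi> [] \<omega>)" for k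
      using rho_bound[of "T / a k (\<xi> [] \<omega>)"] by (simp add: abs_mult mult_left_le)
    have s: "summable (\<lambda>k. norm (a k (\<xi> [] \<omega>) * rho (T / a k (\<xi> [] \<omega>))))"
      by (rule summable_comparison_test'[of "\<lambda>k. a k (\<xi> [] \<omega>)" 0]) (use elim le in auto)
    have "\<bar>yT T (\<xi> [] \<omega>)\<bar> \<le> (\<Sum>k. norm (a k (\<xi> [] \<omega>) * rho (T / a k (\<xi> [] \<omega>))))"
      unfolding yT_def using summable_norm[OF s] by simp
    also have "\<dots> \<le> (\<Sum>k. a k (\<xi> [] \<omega>))" by (rule suminf_le[OF le s]) (use elim in simp)
    finally show "summable (\<lambda>k. a k (\<xi> [] \<omega>) * rho (T / a k (\<xi> [] \<omega>))) \<and> \<bar>yT T (\<xi> [] \<omega>)\<bar> \<le> wn 1 (fam \<omega>)"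
      using summable_norm_cancel[OF s] elim by simp
  qed
qed

lemma yT_square: "integrable M (\<lambda>\<omega>. (yT T (\<xi> [] \<omega>))\<^sup>2)"
proof (rule Bochner_Integration.integrable_bound[OF wn_1_square])
  show "AE \<omega> in M. norm ((yT T (\<xi> [] \<omega>))\<^sup>2) \<le> norm ((wn 1 (fam \<omega>))\<^sup>2)"
    using yT_bound
  proof eventually_elim
    case (elim \<omega>)
    then have "\<bar>yT T (\<xi> [] \<omega>)\<bar>\<^sup>2 \<le> (wn 1 (fam \<omega>))\<^sup>2" by (intro power_mono) auto
    then show ?case by simp
  qed
qed measurable

text \<open>Tannery's theorem handles the sum over the children, with the summable weights as
  majorant because \<open>rho\<close> is bounded by 1. Dominated convergence with the square of the
  first generation total then handles the expectation.\<close>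

lemma yT_limit: "((\<lambda>t. \<integral>\<omega>. (yT (exp (- t)) (\<xi> [] \<omega>))\<^sup>2 \<partial>M) \<longlongrightarrow> 0) at_top"
proof -
  have "((\<lambda>t. \<integral>\<omega>. (yT (exp (- t)) (\<xi> [] \<omega>))\<^sup>2 \<partial>M) \<longlongrightarrow> (\<integral>\<omega>. 0 \<partial>M)) at_top"
  proof (rule integral_dominated_convergence_at_top[where w="\<lambda>\<omega>. (wn 1 (fam \<omega>))\<^sup>2"])
    show "AE \<omega> in M. ((\<lambda>t. (yT (exp (- t)) (\<xi> [] \<omega>))\<^sup>2) \<longlongrightarrow> 0) at_top"
      using AE_summable_a
    proof eventually_elim
      case (elim \<omega>)
      have "((\<lambda>t. \<Sum>k. a k (\<xi> [] \<omega>) * rho (exp (- t) / a k (\<xi> [] \<omega>))) \<longlongrightarrow> (\<Sum>k. 0)) at_top"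
      proof (rule tannerys_theorem[THEN conjunct2, THEN conjunct2])
        show "((\<lambda>t. a k (\<xi> [] \<omega>) * rho (exp (- t) / a k (\<xi> [] \<omega>))) \<longlongrightarrow> 0) at_top" for k
        proof (cases "a k (\<xi> [] \<omega>) = 0")
          case False
          then have "((\<lambda>t. rho (exp (- t) / a k (\<xi> [] \<omega>))) \<longlongrightarrow> 0) at_top"
            by (intro rho_limit) (simp add: less_le)
          from tendsto_mult_left[OF this, of "a k (\<xi> [] \<omega>)"] show ?thesis by simp
        qed simp
        show "\<forall>\<^sub>F (k, t) in at_top \<times>\<^sub>F at_top. norm (a k (\<xi> [] \<omega>) * rho (exp (- t) / a k (\<xi> [] \<omega>))) \<le> a k (\<xi> [] \<omega>)"
          using rho_bound by (intro always_eventually) (auto simp: abs_mult mult_left_le)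
      qed (use elim in simp_all)
      from tendsto_power[OF this, of 2] show ?case by (simp add: yT_def)
    qed
    show "\<forall>\<^sub>F t in at_top. AE \<omega> in M. norm ((yT (exp (- t)) (\<xi> [] \<omega>))\<^sup>2) \<le> (wn 1 (fam \<omega>))\<^sup>2"
    proof (rule always_eventually, rule allI)
      fix t
      show "AE \<omega> in M. norm ((yT (exp (- t)) (\<xi> [] \<omega>))\<^sup>2) \<le> (wn 1 (fam \<omega>))\<^sup>2"
        using yT_bound
      proof eventually_elim
        case (elim \<omega>)
        then have "\<bar>yT (exp (- t)) (\<xi> [] \<omega>)\<bar>\<^sup>2 \<le> (wn 1 (fam \<omega>))\<^sup>2" by (intro power_mono) auto
        then show ?case by simp
      qed
    qed
  qed (use wn_1_square in simp_all)
  then show ?thesis by simp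
qed

text \<open>For \<open>T \<le> 1\<close>, \<open>Q\<close> and \<open>W\<close> satisfy the same
  linear recursion over the children, with levels divided by the weights. Centring makes the
  children orthogonal, so the squared error at level \<open>T\<close> is controlled by those of the
  children multiplied by squared weights.\<close>

lemma eps_recursion:
  assumes T: "0 < T" "T \<le> 1"
  shows "eps T \<le> ennreal (\<integral>\<omega>. (yT T (\<xi> [] \<omega>))\<^sup>2 \<partial>M) +
    (\<Sum>k. \<integral>\<^sup>+\<omega>. ennreal ((a k (\<xi> [] \<omega>))\<^sup>2) * (\<integral>\<^sup>+\<omega>'. ennreal ((R (T / a k (\<xi> [] \<omega>)) (fam \<omega>'))\<^sup>2) \<partial>M) \<partial>M)"
  unfolding eps_def
proof (rule fatou_square[where X="\<lambda>n \<omega>. yT T (\<xi> [] \<omega>) + (\<Sum>k\<in>{..<n}. a k (\<xi> [] \<omega>) * R (T / a k (\<xi> [] \<omega>)) (sh [k] (fam \<omega>)))"])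
  have [measurable]: "(\<lambda>x. R (g x) (l x)) \<in> borel_measurable K"
    if [measurable]: "g \<in> borel_measurable K" "l \<in> measurable K Om" for g l and K :: "'b measure"
    using measurable_compose[OF measurable_Pair[OF that] measurable_R] by simp
  show "(\<lambda>\<omega>. yT T (\<xi> [] \<omega>) + (\<Sum>k\<in>{..<n}. a k (\<xi> [] \<omega>) * R (T / a k (\<xi> [] \<omega>)) (sh [k] (fam \<omega>)))) \<in> borel_measurable M" for n
    unfolding R_def by measurable
  show "AE \<omega> in M. (\<lambda>n. yT T (\<xi> [] \<omega>) + (\<Sum>k\<in>{..<n}. a k (\<xi> [] \<omega>) * R (T / a k (\<xi> [] \<omega>)) (sh [k] (fam \<omega>)))) \<longlonglongrightarrow> Q T (fam \<omega>) - c * W (fam \<omega>)"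
    using Q_recursion[OF T] W_recursion yT_bound
  proof eventually_elim
    case (elim \<omega>)
    let ?a = "\<lambda>k. a k (\<xi> [] \<omega>)"
    have 1: "(\<lambda>n. \<Sum>k<n. ?a k * rho (T / ?a k)) \<longlonglongrightarrow> yT T (\<xi> [] \<omega>)"
      unfolding yT_def using elim(3) by (intro summable_LIMSEQ) blast
    have "?a k * R (T / ?a k) \<eta> = ?a k * Q (T / ?a k) \<eta> - c * (?a k * W \<eta>) - ?a k * rho (T / ?a k)" for k \<eta>
    proof (cases "?a k = 0")
      case False
      then have "0 < T / ?a k" using T by (simp add: less_le)
      then show ?thesis by (simp add: R_def algebra_simps)
    qed simp
    then have "yT T (\<xi> [] \<omega>) + (\<Sum>k<n. ?a k * R (T / ?a k) (sh [k] (fam \<omega>))) =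
        yT T (\<xi> [] \<omega>) + ((\<Sum>k<n. ?a k * Q (T / ?a k) (sh [k] (fam \<omega>))) - c * (\<Sum>k<n. ?a k * W (sh [k] (fam \<omega>))) - (\<Sum>k<n. ?a k * rho (T / ?a k)))" for n
      by (simp add: sum_subtractf sum_distrib_left)
    moreover have "(\<lambda>n. yT T (\<xi> [] \<omega>) + ((\<Sum>k<n. ?a k * Q (T / ?a k) (sh [k] (fam \<omega>))) - c * (\<Sum>k<n. ?a k * W (sh [k] (fam \<omega>))) - (\<Sum>k<n. ?a k * rho (T / ?a k))))
        \<longlonglongrightarrow> yT T (\<xi> [] \<omega>) + (Q T (fam \<omega>) - c * W (fam \<omega>) - yT T (\<xi> [] \<omega>))"
      by (intro tendsto_add tendsto_diff tendsto_mult tendsto_const elim(1) elim(2) 1)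
    ultimately show ?case by simp
  qed
  show "(\<integral>\<^sup>+\<omega>. ennreal ((yT T (\<xi> [] \<omega>) + (\<Sum>k\<in>{..<n}. a k (\<xi> [] \<omega>) * R (T / a k (\<xi> [] \<omega>)) (sh [k] (fam \<omega>))))\<^sup>2) \<partial>M)
      \<le> ennreal (\<integral>\<omega>. (yT T (\<xi> [] \<omega>))\<^sup>2 \<partial>M) +
        (\<Sum>k. \<integral>\<^sup>+\<omega>. ennreal ((a k (\<xi> [] \<omega>))\<^sup>2) * (\<integral>\<^sup>+\<omega>'. ennreal ((R (T / a k (\<xi> [] \<omega>)) (fam \<omega>'))\<^sup>2) \<partial>M) \<partial>M)" for n
    by (subst square_first_generation[OF _ measurable_R mean_R R_square_bound measurable_yT yT_square, where p="\<lambda>k \<zeta>. T / a k \<zeta>"])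
       (auto simp: nn_integral_eq_integral yT_square intro!: add_left_mono sum_le_suminf)
qed measurable

text \<open>Children with rescaled level at most \<open>T0\<close> fall under \<open>small\<close>
  and contribute at most \<open>f * B\<close> together. For the others the weight is below
  \<open>T / T0\<close>, so one factor of its square is small, and the other factors have total mean
  1.\<close>

lemma eps_step:
  assumes T: "0 < T" "T \<le> 1" and T0: "0 < T0" and B: "0 \<le> B"
    and small: "\<And>q. 0 < q \<Longrightarrow> q \<le> T0 \<Longrightarrow> eps q \<le> ennreal B"
  shows "eps T \<le> ennreal ((\<integral>\<omega>. (yT T (\<xi> [] \<omega>))\<^sup>2 \<partial>M) + (f * B + C0 * (T / T0)))"
proof -
  have "(\<Sum>k. \<integral>\<^sup>+\<omega>. ennreal ((a k (\<xi> [] \<omega>))\<^sup>2) * (\<integral>\<^sup>+\<omega>'. ennreal ((R (T / a k (\<xi> [] \<omega>)) (fam \<omega>'))\<^sup>2) \<partial>M) \<partial>M)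
      \<le> (\<Sum>k. \<integral>\<^sup>+\<omega>. ennreal ((a k (\<xi> [] \<omega>))\<^sup>2) * ennreal B + ennreal (a k (\<xi> [] \<omega>)) * ennreal (C0 * (T / T0)) \<partial>M)"
  proof (intro suminf_le nn_integral_mono)
    fix k \<omega>
    let ?a = "a k (\<xi> [] \<omega>)"
    let ?r = "\<integral>\<^sup>+\<omega>'. ennreal ((R (T / ?a) (fam \<omega>'))\<^sup>2) \<partial>M"
    show "ennreal (?a\<^sup>2) * ?r \<le> ennreal (?a\<^sup>2) * ennreal B + ennreal ?a * ennreal (C0 * (T / T0))"
    proof (cases "?a = 0")
      case False
      then have a: "0 < ?a" by (simp add: less_le)
      then have pos: "0 < T / ?a" using T by simp
      show ?thesis
      proof (cases "T / ?a \<le> T0")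
        case True
        have "?r \<le> ennreal B" using R_square[of "T / ?a"] small[OF pos True] pos by (auto intro: order_trans)
        then have "ennreal (?a\<^sup>2) * ?r \<le> ennreal (?a\<^sup>2) * ennreal B" by (intro mult_left_mono) auto
        then show ?thesis by (rule order_trans) simp
      next
        case False
        then have "?a \<le> T / T0" using a T0 by (simp add: field_simps)
        then have "?a * (C0 * ?a) \<le> ?a * (C0 * (T / T0))"
          using a C0_nonneg by (intro mult_left_mono) auto
        then have "?a\<^sup>2 * C0 \<le> ?a * (C0 * (T / T0))" by (simp add: power2_eq_square mult_ac)
        then have "ennreal (?a\<^sup>2) * ennreal C0 \<le> ennreal ?a * ennreal (C0 * (T / T0))"
          using a C0_nonneg T T0 by (simp add: ennreal_mult[symmetric] ennreal_leI)
        moreover have "ennreal (?a\<^sup>2) * ?r \<le> ennreal (?a\<^sup>2) * ennreal C0"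
          by (intro mult_left_mono R_square_bound) simp
        ultimately have "ennreal (?a\<^sup>2) * ?r \<le> ennreal ?a * ennreal (C0 * (T / T0))" by (rule order_trans[rotated])
        then show ?thesis by (rule order_trans) simp
      qed
    qed simp
  qed simp_all
  also have "\<dots> = (\<Sum>k. (\<integral>\<^sup>+\<omega>. ennreal ((a k (\<xi> [] \<omega>))\<^sup>2) \<partial>M) * ennreal B
      + (\<integral>\<^sup>+\<omega>. ennreal (a k (\<xi> [] \<omega>)) \<partial>M) * ennreal (C0 * (T / T0)))"
    by (subst nn_integral_add) (simp_all add: nn_integral_multc)
  also have "\<dots> = ennreal f * ennreal B + 1 * ennreal (C0 * (T / T0))"
    by (subst suminf_add[symmetric]) (simp_all add: f_eq mean_suminf)
  also have "\<dots> = ennreal (f * B + C0 * (T / T0))"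
    using f_nonneg B C0_nonneg T T0 by (simp add: ennreal_mult[symmetric] ennreal_plus[symmetric] del: ennreal_plus)
  finally have "eps T \<le> ennreal (\<integral>\<omega>. (yT T (\<xi> [] \<omega>))\<^sup>2 \<partial>M) + ennreal (f * B + C0 * (T / T0))"
    using eps_recursion[OF T] by (meson add_left_mono order_trans)
  also have "\<dots> = ennreal ((\<integral>\<omega>. (yT T (\<xi> [] \<omega>))\<^sup>2 \<partial>M) + (f * B + C0 * (T / T0)))"
    using f_nonneg B C0_nonneg T T0 by (subst ennreal_plus) (auto intro!: add_nonneg_nonneg)
  finally show ?thesis .
qed

text \<open>Starting from the crude bound \<open>C0\<close>, each use of \<open>eps_step\<close>
  multiplies the bound by \<open>f\<close>, at the price of a shorter range of levels and a new
  small error.\<close>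

lemma eps_limit:
  assumes "0 < \<delta>"
  shows "\<exists>T0>0. \<forall>T. 0 < T \<longrightarrow> T \<le> T0 \<longrightarrow> eps T \<le> ennreal \<delta>"
proof -
  have step: "\<exists>T0>0. \<forall>T. 0 < T \<longrightarrow> T \<le> T0 \<longrightarrow> eps T \<le> ennreal (C0 * f ^ n + \<delta>)" if "0 < \<delta>" for n \<delta>
    using that
  proof (induction n arbitrary: \<delta>)
    case 0
    have "eps T \<le> ennreal (C0 * f ^ 0 + \<delta>)" if "0 < T" for T
      by (rule order_trans[OF eps_bound[OF that] ennreal_leI]) (use 0 in simp)
    then show ?case by (intro exI[of _ 1]) simp
  next
    case (Suc n)
    obtain T0 where T0: "0 < T0" "\<And>T. 0 < T \<Longrightarrow> T \<le> T0 \<Longrightarrow> eps T \<le> ennreal (C0 * f ^ n + \<delta> / 3)"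
      using Suc.IH[of "\<delta> / 3"] Suc.prems by auto
    have "\<forall>\<^sub>F t in at_top. (\<integral>\<omega>. (yT (exp (- t)) (\<xi> [] \<omega>))\<^sup>2 \<partial>M) < \<delta> / 3"
      using yT_limit by (rule order_tendstoD) (use Suc.prems in simp)
    then obtain t0 where t0: "\<And>t. t0 \<le> t \<Longrightarrow> (\<integral>\<omega>. (yT (exp (- t)) (\<xi> [] \<omega>))\<^sup>2 \<partial>M) < \<delta> / 3"
      unfolding eventually_at_top_linorder by blast
    \<comment> \<open>The budget \<open>\<delta>\<close> is split in thirds:
      \<open>exp (- t0)\<close> controls the \<open>yT\<close> term, the last entry controls
      \<open>C0 * (T / T0)\<close>, and the remaining third is the error of the previous round,
      multiplied by \<open>f < 1\<close>.\<close>
    define T1 where "T1 = min 1 (min (exp (- t0)) (\<delta> / 3 * T0 / (C0 + 1)))"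
    have T1: "0 < T1" using Suc.prems T0 C0_nonneg by (simp add: T1_def)
    have "eps T \<le> ennreal (C0 * f ^ Suc n + \<delta>)" if T: "0 < T" "T \<le> T1" for T
    proof -
      have T': "T \<le> 1" "T \<le> exp (- t0)" "T \<le> \<delta> / 3 * T0 / (C0 + 1)" using T by (auto simp: T1_def)
      have "ln T \<le> ln (exp (- t0))" using T' T by (subst ln_le_cancel_iff) auto
      then have "t0 \<le> - ln T" by simp
      from t0[OF this] have 1: "(\<integral>\<omega>. (yT T (\<xi> [] \<omega>))\<^sup>2 \<partial>M) < \<delta> / 3" using T by simp
      have "0 < C0 + 1" using C0_nonneg by simp
      then have "T * (C0 + 1) \<le> \<delta> / 3 * T0" by (rule iffD1[OF pos_le_divide_eq T'(3)])
      then have "C0 * T \<le> \<delta> / 3 * T0" using T by (simp add: algebra_simps)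
      then have 2: "C0 * (T / T0) \<le> \<delta> / 3" using T0(1) by (simp add: field_simps)
      have 3: "f * (C0 * f ^ n + \<delta> / 3) \<le> C0 * f ^ Suc n + \<delta> / 3"
        using f_nonneg f_less_1 Suc.prems mult_right_mono[of f 1 "\<delta> / 3"] by (simp add: algebra_simps)
      have "eps T \<le> ennreal ((\<integral>\<omega>. (yT T (\<xi> [] \<omega>))\<^sup>2 \<partial>M) + (f * (C0 * f ^ n + \<delta> / 3) + C0 * (T / T0)))"
        by (rule eps_step[OF T(1) T'(1) T0(1) _ T0(2)]) (use C0_nonneg f_nonneg Suc.prems in auto)
      also have "\<dots> \<le> ennreal (C0 * f ^ Suc n + \<delta>)"
        using 1 2 3 by (intro ennreal_leI) linarith
      finally show ?thesis .
    qed
    then show ?case using T1 by blast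
  qed
  have "(\<lambda>n. C0 * f ^ n) \<longlonglongrightarrow> C0 * 0"
    using f_nonneg f_less_1 by (intro tendsto_mult tendsto_const LIMSEQ_power_zero) auto
  then have "\<forall>\<^sub>F n in sequentially. C0 * f ^ n < \<delta> / 2" by (rule order_tendstoD) (use assms in simp)
  then obtain n where n: "C0 * f ^ n < \<delta> / 2" by (auto simp: eventually_sequentially)
  obtain T0 where "0 < T0" "\<forall>T. 0 < T \<longrightarrow> T \<le> T0 \<longrightarrow> eps T \<le> ennreal (C0 * f ^ n + \<delta> / 2)"
    using step[of "\<delta> / 2" n] assms by auto
  moreover have "ennreal (C0 * f ^ n + \<delta> / 2) \<le> ennreal \<delta>" using n by (intro ennreal_leI) simp
  ultimately have "0 < T0 \<and> (\<forall>T. 0 < T \<longrightarrow> T \<le> T0 \<longrightarrow> eps T \<le> ennreal \<delta>)"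
    by (blast intro: order_trans)
  then show ?thesis by blast
qed

end

section \<open>Elementary estimates for products and exponentials\<close>

lemma norm_prod_diff_le:
  fixes z w :: "'i \<Rightarrow> 'b::{real_normed_div_algebra, comm_ring_1}"
  assumes "finite I" "\<And>i. i \<in> I \<Longrightarrow> norm (z i) \<le> 1" "\<And>i. i \<in> I \<Longrightarrow> norm (w i) \<le> 1"
  shows "norm ((\<Prod>i\<in>I. z i) - (\<Prod>i\<in>I. w i)) \<le> (\<Sum>i\<in>I. norm (z i - w i))"
  using assms
proof (induction I rule: finite_induct)
  case (insert i I)
  have w1: "norm (\<Prod>i\<in>I. w i) \<le> 1"
    unfolding prod_norm[symmetric] using insert by (intro prod_le_1) auto
  have "(\<Prod>i\<in>insert i I. z i) - (\<Prod>i\<in>insert i I. w i) =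
      z i * ((\<Prod>i\<in>I. z i) - (\<Prod>i\<in>I. w i)) + (z i - w i) * (\<Prod>i\<in>I. w i)"
    using insert by (simp add: algebra_simps)
  then have "norm ((\<Prod>i\<in>insert i I. z i) - (\<Prod>i\<in>insert i I. w i)) \<le>
      norm (z i) * norm ((\<Prod>i\<in>I. z i) - (\<Prod>i\<in>I. w i)) + norm (z i - w i) * norm (\<Prod>i\<in>I. w i)"
    using norm_triangle_ineq by (metis norm_mult)
  also have "\<dots> \<le> 1 * (\<Sum>i\<in>I. norm (z i - w i)) + norm (z i - w i) * 1"
    using insert w1 by (intro add_mono mult_mono mult_left_mono insert.IH) (auto intro: sum_nonneg)
  finally show ?case using insert by simp
qed simp

lemma abs_exp_diff_le:
  fixes x y :: real
  assumes "0 \<le> x" "0 \<le> y"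
  shows "\<bar>exp (- x) - exp (- y)\<bar> \<le> \<bar>x - y\<bar>"
proof -
  have *: "exp (- x) - exp (- y) \<le> y - x" "0 \<le> exp (- x) - exp (- y)" if "0 \<le> x" "x \<le> y" for x y :: real
  proof -
    have "exp (- x) - exp (- y) = exp (- x) * (1 - exp (- (y - x)))"
      by (simp add: right_diff_distrib exp_add[symmetric])
    also have "\<dots> \<le> 1 * (1 - exp (- (y - x)))"
      using that by (intro mult_right_mono) auto
    also have "\<dots> \<le> y - x" using exp_ge_add_one_self[of "- (y - x)"] unfolding mult_1 by linarith
    finally show "exp (- x) - exp (- y) \<le> y - x" .
    show "0 \<le> exp (- x) - exp (- y)" using that by simp
  qed
  show ?thesis using *[of x y] *[of y x] assms by (cases "x \<le> y") auto
qed

lemma exp_minus_taylor1: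
  fixes y :: real
  assumes "0 \<le> y"
  shows "\<bar>exp (- y) - (1 - y)\<bar> \<le> y\<^sup>2 / 2"
proof -
  have "\<bar>exp (- y) - (1 - y)\<bar> = exp (- y) - (1 - y)"
    using exp_ge_add_one_self[of "- y"] by simp
  also have "\<dots> \<le> y\<^sup>2 / 2"
  proof -
    have "(\<lambda>z. exp (- z) - (1 - z)) 0 - 0\<^sup>2 / 2 \<ge> (exp (- y) - (1 - y)) - y\<^sup>2 / 2"
    proof (rule DERIV_nonpos_imp_nonincreasing[OF assms])
      fix z :: real assume z: "0 \<le> z" "z \<le> y"
      have "((\<lambda>z. (exp (- z) - (1 - z)) - z\<^sup>2 / 2) has_real_derivative (- exp (- z) + 1 - z)) (at z)"
        by (auto intro!: derivative_eq_intros)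
      moreover have "- exp (- z) + 1 - z \<le> 0" using exp_ge_add_one_self[of "- z"] by simp
      ultimately show "\<exists>D. ((\<lambda>z. (exp (- z) - (1 - z)) - z\<^sup>2 / 2) has_real_derivative D) (at z) \<and> D \<le> 0" by blast
    qed
    then show ?thesis by simp
  qed
  finally show ?thesis .
qed

context normalized_cascade
begin

subsection \<open>The conditional characteristic function\<close>

definition chi :: "real \<Rightarrow> complex" where
  "chi s = (\<integral>\<omega>. iexp (s * (W (fam \<omega>) - 1)) \<partial>M)"

text \<open>The first term is the Taylor remainder of a characteristic function in the form with a
  minimum, which vanishes with \<open>r\<close> under a second moment alone. The second comes from
  exchanging \<open>1 - s\<^sup>2 * v / 2\<close> for the exponential: the error
  \<open>(s\<^sup>2 * v / 2)\<^sup>2 / 2\<close> is \<open>s\<^sup>2\<close> times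
  \<open>v\<^sup>2 * s\<^sup>2 / 8\<close>.\<close>

definition remainder :: "real \<Rightarrow> real" where
  "remainder r = (\<integral>\<omega>. min (6 * (W (fam \<omega>) - 1)\<^sup>2) (r * \<bar>W (fam \<omega>) - 1\<bar> ^ 3) \<partial>M) / 6 + v\<^sup>2 * r\<^sup>2 / 8"

lemma measurable_chi [measurable]: "chi \<in> borel_measurable borel"
  unfolding chi_def[abs_def] by measurable

lemma integrable_min: "0 \<le> r \<Longrightarrow> integrable M (\<lambda>\<omega>. min (6 * (W (fam \<omega>) - 1)\<^sup>2) (r * \<bar>W (fam \<omega>) - 1\<bar> ^ 3))"
  by (rule Bochner_Integration.integrable_bound[OF integrable_mult_right[OF integrable_W_square, of 6]])
     (auto simp: min_def)

lemma chi_bound: "norm (chi s) \<le> 1"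
proof -
  have "norm (chi s) \<le> (\<integral>\<omega>. norm (iexp (s * (W (fam \<omega>) - 1))) \<partial>M)"
    unfolding chi_def by (rule integral_norm_bound)
  then show ?thesis by (simp add: prob_space)
qed

lemma chi_approx: "norm (chi s - of_real (exp (- (s\<^sup>2 * v / 2)))) \<le> s\<^sup>2 * remainder \<bar>s\<bar>"
proof -
  let ?X = "\<lambda>\<omega>. W (fam \<omega>) - 1"
  have "char (distr M borel ?X) s = chi s"
    unfolding char_def chi_def by (subst integral_distr) auto
  moreover have "norm (char (distr M borel ?X) s - (1 - s\<^sup>2 * v / 2)) \<le>
      (s\<^sup>2 / 6) * expectation (\<lambda>\<omega>. min (6 * (?X \<omega>)\<^sup>2) (\<bar>s\<bar> * \<bar>?X \<omega>\<bar> ^ 3))"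
    by (rule char_approx3') (use integrable_W integrable_W_square mean_W0 in \<open>simp_all add: v_def\<close>)
  ultimately have 1: "norm (chi s - of_real (1 - s\<^sup>2 * v / 2)) \<le>
      (s\<^sup>2 / 6) * expectation (\<lambda>\<omega>. min (6 * (?X \<omega>)\<^sup>2) (\<bar>s\<bar> * \<bar>?X \<omega>\<bar> ^ 3))" by simp
  have "\<bar>exp (- (s\<^sup>2 * v / 2)) - (1 - s\<^sup>2 * v / 2)\<bar> \<le> (s\<^sup>2 * v / 2)\<^sup>2 / 2"
    by (rule exp_minus_taylor1) (use v_nonneg in simp)
  then have 2: "norm (complex_of_real (1 - s\<^sup>2 * v / 2) - of_real (exp (- (s\<^sup>2 * v / 2)))) \<le> (s\<^sup>2 * v / 2)\<^sup>2 / 2"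
    by (subst of_real_diff[symmetric], subst norm_of_real) (simp add: abs_minus_commute)
  have "norm (chi s - of_real (exp (- (s\<^sup>2 * v / 2)))) \<le>
      norm (chi s - of_real (1 - s\<^sup>2 * v / 2)) + norm (complex_of_real (1 - s\<^sup>2 * v / 2) - of_real (exp (- (s\<^sup>2 * v / 2))))"
    using norm_triangle_ineq[of "chi s - of_real (1 - s\<^sup>2 * v / 2)" "of_real (1 - s\<^sup>2 * v / 2) - of_real (exp (- (s\<^sup>2 * v / 2)))"]
    by (simp only: diff_add_cancel add_diff_eq)
  also have "\<dots> \<le> (s\<^sup>2 / 6) * expectation (\<lambda>\<omega>. min (6 * (?X \<omega>)\<^sup>2) (\<bar>s\<bar> * \<bar>?X \<omega>\<bar> ^ 3)) + (s\<^sup>2 * v / 2)\<^sup>2 / 2"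
    using 1 2 by (rule add_mono)
  also have "\<dots> = s\<^sup>2 * remainder \<bar>s\<bar>"
    by (simp add: remainder_def distrib_left power2_eq_square)
  finally show ?thesis .
qed

lemma remainder_mono: "0 \<le> r \<Longrightarrow> r \<le> r' \<Longrightarrow> remainder r \<le> remainder r'"
  unfolding remainder_def
  by (intro add_mono divide_right_mono mult_left_mono integral_mono integrable_min power_mono min.mono mult_right_mono) auto

lemma remainder_nonneg: "0 \<le> r \<Longrightarrow> 0 \<le> remainder r"
  unfolding remainder_def by (intro add_nonneg_nonneg divide_nonneg_nonneg integral_nonneg) auto

lemma remainder_limit: "(remainder \<longlongrightarrow> 0) (at_right 0)"
proof -
  have "((\<lambda>r. \<integral>\<omega>. min (6 * (W (fam \<omega>) - 1)\<^sup>2) (r * \<bar>W (fam \<omega>) - 1\<bar> ^ 3) \<partial>M) \<longlongrightarrow> 0) (at_right 0)"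
  proof (rule tendsto_at_right_sequentially[of 0 1])
    fix r :: "nat \<Rightarrow> real" assume r: "\<And>n. 0 < r n" "r \<longlonglongrightarrow> 0"
    have "(\<lambda>n. \<integral>\<omega>. min (6 * (W (fam \<omega>) - 1)\<^sup>2) (r n * \<bar>W (fam \<omega>) - 1\<bar> ^ 3) \<partial>M) \<longlonglongrightarrow> (\<integral>\<omega>. 0 \<partial>M)"
    proof (rule integral_dominated_convergence[where w="\<lambda>\<omega>. 6 * (W (fam \<omega>) - 1)\<^sup>2"])
      show "AE \<omega> in M. (\<lambda>n. min (6 * (W (fam \<omega>) - 1)\<^sup>2) (r n * \<bar>W (fam \<omega>) - 1\<bar> ^ 3)) \<longlonglongrightarrow> 0"
      proof (rule AE_I2)
        fix \<omega>
        have "(\<lambda>n. min (6 * (W (fam \<omega>) - 1)\<^sup>2) (r n * \<bar>W (fam \<omega>) - 1\<bar> ^ 3)) \<longlonglongrightarrow> min (6 * (W (fam \<omega>) - 1)\<^sup>2) (0 * \<bar>W (fam \<omega>) - 1\<bar> ^ 3)"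
          by (intro tendsto_min tendsto_mult tendsto_const r(2))
        then show "(\<lambda>n. min (6 * (W (fam \<omega>) - 1)\<^sup>2) (r n * \<bar>W (fam \<omega>) - 1\<bar> ^ 3)) \<longlonglongrightarrow> 0" by simp
      qed
      show "AE \<omega> in M. norm (min (6 * (W (fam \<omega>) - 1)\<^sup>2) (r n * \<bar>W (fam \<omega>) - 1\<bar> ^ 3)) \<le> 6 * (W (fam \<omega>) - 1)\<^sup>2" for n
        using r(1)[of n] by (intro AE_I2) (auto simp: min_def)
    qed (use integrable_W_square in simp_all)
    then show "(\<lambda>n. \<integral>\<omega>. min (6 * (W (fam \<omega>) - 1)\<^sup>2) (r n * \<bar>W (fam \<omega>) - 1\<bar> ^ 3) \<partial>M) \<longlonglongrightarrow> 0" by simp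
  qed simp
  moreover have "((\<lambda>r::real. v\<^sup>2 * r\<^sup>2 / 8) \<longlongrightarrow> v\<^sup>2 * 0\<^sup>2 / 8) (at_right 0)" by (intro tendsto_intros) simp
  ultimately have "((\<lambda>r. (\<integral>\<omega>. min (6 * (W (fam \<omega>) - 1)\<^sup>2) (r * \<bar>W (fam \<omega>) - 1\<bar> ^ 3) \<partial>M) / 6 + v\<^sup>2 * r\<^sup>2 / 8) \<longlongrightarrow> 0 / 6 + v\<^sup>2 * 0\<^sup>2 / 8) (at_right 0)"
    by (intro tendsto_add[OF tendsto_divide[OF _ tendsto_const]]) auto
  then show ?thesis by (simp add: remainder_def[abs_def])
qed

text \<open>Everything that the central limit theorem needs from an event of the past at level
  \<open>T\<close>. By \<open>pre_H\<close> it holds for the events of the filtration at time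
  \<open>t\<close> with \<open>T = exp (- \<alpha> * t)\<close>.\<close>

definition pre :: "real \<Rightarrow> _ set \<Rightarrow> bool" where
  "pre T A \<longleftrightarrow> A \<in> sets M \<and> (\<forall>u. {\<omega>\<in>A. st u T (fam \<omega>)} \<in> sets (outside u))"

definition factor :: "real \<Rightarrow> real \<Rightarrow> nat list \<Rightarrow> _ \<Rightarrow> complex" where
  "factor T s u \<omega> = (if st u T (fam \<omega>) then iexp (s * wt u (fam \<omega>) * (W (sh u (fam \<omega>)) - 1)) else 1)"

definition mean_factor :: "real \<Rightarrow> real \<Rightarrow> nat list \<Rightarrow> _ \<Rightarrow> complex" where
  "mean_factor T s u \<omega> = (if st u T (fam \<omega>) then chi (s * wt u (fam \<omega>)) else 1)"

lemma st_gen: "{w. strict_prefix w u} \<subseteq> U \<Longrightarrow> Measurable.pred (gen U) (\<lambda>\<omega>. st u T (fam \<omega>))"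
  using line_st[of T] unfolding line_def by (blast intro: measurable_gen_mono)

lemma wt_gen: "{w. strict_prefix w u} \<subseteq> U \<Longrightarrow> (\<lambda>\<omega>. wt u (fam \<omega>)) \<in> borel_measurable (gen U)"
  using measurable_wt_past by (rule measurable_gen_mono)

lemma mean_factor_gen:
  assumes U: "{w. strict_prefix w u} \<subseteq> U"
  shows "mean_factor T s u \<in> borel_measurable (gen U)"
proof -
  note [measurable] = st_gen[OF U] wt_gen[OF U]
  show ?thesis unfolding mean_factor_def[abs_def] by measurable
qed

lemma factor_gen:
  assumes U: "{w. strict_prefix w u} \<subseteq> U" "{w. prefix u w} \<subseteq> U"
  shows "factor T s u \<in> borel_measurable (gen U)"
proof -
  have [measurable]: "(\<lambda>\<omega>. sh u (fam \<omega>)) \<in> measurable (gen U) Om"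
    by (rule measurable_sh_fam_gen) (use U in auto)
  note [measurable] = st_gen[OF U(1)] wt_gen[OF U(1)]
  show ?thesis unfolding factor_def[abs_def] by measurable
qed

lemma measurable_factor [measurable]: "factor T s u \<in> borel_measurable M"
  by (rule measurable_gen_M[OF factor_gen[of u UNIV]]) auto

lemma measurable_mean_factor [measurable]: "mean_factor T s u \<in> borel_measurable M"
  by (rule measurable_gen_M[OF mean_factor_gen[of u UNIV]]) auto

lemma norm_factor: "norm (factor T s u \<omega>) \<le> 1" "norm (mean_factor T s u \<omega>) \<le> 1"
  by (simp_all add: factor_def mean_factor_def chi_bound)

lemma norm_prod_le_1:
  fixes z :: "'i \<Rightarrow> complex"
  assumes "\<And>i. i \<in> I \<Longrightarrow> norm (z i) \<le> 1"
  shows "norm (\<Prod>i\<in>I. z i) \<le> 1"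
  unfolding prod_norm[symmetric] using assms by (intro prod_le_1) auto

text \<open>
  The factors are averaged one individual at a time: on the event that \<open>u\<close> lies on the line, only
  individuals incomparable with \<open>u\<close> contribute to the remaining product, which is therefore
  independent of the subtree rooted at \<open>u\<close>.
\<close>
lemma averaged_product:
  assumes A: "pre T A" and B: "finite B1" "finite B2" "B1 \<inter> B2 = {}"
  shows "(\<integral>\<omega>. indicator A \<omega> * ((\<Prod>u\<in>B1. mean_factor T s u \<omega>) * (\<Prod>u\<in>B2. factor T s u \<omega>)) \<partial>M) =
    (\<integral>\<omega>. indicator A \<omega> * (\<Prod>u\<in>B1 \<union> B2. mean_factor T s u \<omega>) \<partial>M)"
  using B(2,1,3)
proof (induction B2 arbitrary: B1 rule: finite_induct)
  case (insert u B2)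
  have [measurable]: "A \<in> sets M" using A by (simp add: pre_def)
  define P where "P = (\<lambda>\<omega>. indicator A \<omega> * ((\<Prod>u\<in>B1. mean_factor T s u \<omega>) * (\<Prod>u\<in>B2. factor T s u \<omega>)))"
  have [measurable]: "P \<in> borel_measurable M" unfolding P_def by measurable
  have P1: "norm (P \<omega>) \<le> 1" for \<omega>
  proof -
    have "norm ((\<Prod>u\<in>B1. mean_factor T s u \<omega>) * (\<Prod>u\<in>B2. factor T s u \<omega>)) \<le> 1 * 1"
      unfolding norm_mult by (intro mult_mono norm_prod_le_1 norm_factor) auto
    then show ?thesis by (simp add: P_def norm_mult indicator_def)
  qed
  define inc where "inc = (\<lambda>B. {w\<in>B. \<not> prefix u w \<and> \<not> prefix w u})"
  define G where "G = (\<lambda>\<omega>. indicator {\<omega>\<in>A. st u T (fam \<omega>)} \<omega> *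
    ((\<Prod>u\<in>inc B1. mean_factor T s u \<omega>) * (\<Prod>u\<in>inc B2. factor T s u \<omega>)))"
  have G_meas: "G \<in> borel_measurable (outside u)"
  proof -
    have sub: "{w'. strict_prefix w' w} \<subseteq> {w. \<not> prefix u w}" "{w'. prefix w w'} \<subseteq> {w. \<not> prefix u w}"
      if "w \<in> inc B" for w B
      using that by (auto simp: inc_def strict_prefix_def dest: prefix_order.trans prefix_same_cases)
    have 1: "indicator {\<omega>\<in>A. st u T (fam \<omega>)} \<in> borel_measurable (outside u)"
      using A by (intro borel_measurable_indicator) (simp add: pre_def)
    show ?thesis unfolding G_def
      by (intro borel_measurable_times 1 borel_measurable_prod mean_factor_gen factor_gen sub)
  qed
  have GP: "(if st u T (fam \<omega>) then P \<omega> else 0) = G \<omega>" if \<omega>: "\<omega> \<in> space M" for \<omega>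
  proof (cases "st u T (fam \<omega>)")
    case True
    have other: "\<not> st w T (fam \<omega>)" if "w \<in> B" "w \<notin> inc B" "u \<notin> B" for w B
      using line_st[of T] True \<omega> that unfolding line_def inc_def by blast
    have "(\<Prod>u\<in>B1. mean_factor T s u \<omega>) = (\<Prod>u\<in>inc B1. mean_factor T s u \<omega>)"
      by (rule prod.mono_neutral_right)
         (use insert other in \<open>auto simp: inc_def mean_factor_def\<close>)
    moreover have "(\<Prod>u\<in>B2. factor T s u \<omega>) = (\<Prod>u\<in>inc B2. factor T s u \<omega>)"
      by (rule prod.mono_neutral_right)
         (use insert other in \<open>auto simp: inc_def factor_def\<close>)
    ultimately show ?thesis using True by (simp add: P_def G_def indicator_def)
  qed (simp add: G_def)
  have int: "integrable M (\<lambda>\<omega>. P \<omega> * factor T s u \<omega>)" "integrable M (\<lambda>\<omega>. P \<omega> * mean_factor T s u \<omega>)"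
    using P1 norm_factor
    by (auto intro!: integrable_const_bound[where B=1] AE_I2 mult_le_one simp: norm_mult)
  \<comment> \<open>The factor of \<open>u\<close> minus its average, with everything outside the
    subtree of \<open>u\<close> as the first argument. For a fixed first argument the mean over the
    subtree vanishes by the definition of \<open>chi\<close>.\<close>
  define H where "H = (\<lambda>(\<omega>, \<eta>). G \<omega> * (iexp (s * wt u (fam \<omega>) * (W \<eta> - 1)) - chi (s * wt u (fam \<omega>))))"
  have H_meas: "H \<in> borel_measurable (outside u \<Otimes>\<^sub>M Om)"
  proof -
    have [measurable]: "(\<lambda>\<omega>. wt u (fam \<omega>)) \<in> borel_measurable (outside u)"
      by (rule wt_gen) (auto simp: strict_prefix_def)
    note [measurable] = G_meas
    show ?thesis unfolding H_def by measurable
  qed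
  have HP: "P \<omega> * factor T s u \<omega> - P \<omega> * mean_factor T s u \<omega> = H (\<omega>, sh u (fam \<omega>))" if "\<omega> \<in> space M" for \<omega>
    using GP[OF that] by (auto simp: H_def factor_def mean_factor_def right_diff_distrib split: if_splits)
  have int_H: "integrable M (\<lambda>\<omega>. H (\<omega>, sh u (fam \<omega>)))"
    by (rule iffD1[OF Bochner_Integration.integrable_cong[OF refl HP] Bochner_Integration.integrable_diff[OF int]])
  have "(\<integral>\<omega>. P \<omega> * factor T s u \<omega> - P \<omega> * mean_factor T s u \<omega> \<partial>M) = (\<integral>\<omega>. H (\<omega>, sh u (fam \<omega>)) \<partial>M)"
    by (rule Bochner_Integration.integral_cong[OF refl HP])
  also have "\<dots> = (\<integral>\<omega>. (\<integral>\<omega>'. H (\<omega>, fam \<omega>') \<partial>M) \<partial>M)" by (rule freeze[OF H_meas int_H])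
  also have "\<dots> = (\<integral>\<omega>. 0 \<partial>M)"
  proof (rule Bochner_Integration.integral_cong[OF refl])
    fix \<omega>
    have "integrable M (\<lambda>\<omega>'. iexp (s * wt u (fam \<omega>) * (W (fam \<omega>') - 1)))"
      by (rule integrable_const_bound[where B=1]) auto
    then have "(\<integral>\<omega>'. iexp (s * wt u (fam \<omega>) * (W (fam \<omega>') - 1)) - chi (s * wt u (fam \<omega>)) \<partial>M) = 0"
      by (subst Bochner_Integration.integral_diff) (simp_all add: chi_def prob_space)
    then show "(\<integral>\<omega>'. H (\<omega>, fam \<omega>') \<partial>M) = 0" unfolding H_def by simp
  qed
  finally have eq: "(\<integral>\<omega>. P \<omega> * factor T s u \<omega> \<partial>M) = (\<integral>\<omega>. P \<omega> * mean_factor T s u \<omega> \<partial>M)"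
    using int by simp
  have "(\<integral>\<omega>. indicator A \<omega> * ((\<Prod>u\<in>B1. mean_factor T s u \<omega>) * (\<Prod>u\<in>insert u B2. factor T s u \<omega>)) \<partial>M) =
      (\<integral>\<omega>. P \<omega> * factor T s u \<omega> \<partial>M)"
    using insert by (simp add: P_def mult_ac)
  also have "\<dots> = (\<integral>\<omega>. indicator A \<omega> * ((\<Prod>u\<in>insert u B1. mean_factor T s u \<omega>) * (\<Prod>u\<in>B2. factor T s u \<omega>)) \<partial>M)"
    unfolding eq using insert by (simp add: P_def mult_ac)
  also have "\<dots> = (\<integral>\<omega>. indicator A \<omega> * (\<Prod>u\<in>insert u B1 \<union> B2. mean_factor T s u \<omega>) \<partial>M)"
    by (rule insert.IH) (use insert in auto)
  finally show ?case by simp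
qed simp

text \<open>On the line the weights are below \<open>T\<close>, so after division by
  \<open>sqrt T\<close> each factor of the conditional characteristic function is \<open>chi\<close>
  at an argument of size at most \<open>\<bar>\<theta>\<bar> * sqrt T\<close>. Exchanging each for
  its Gaussian counterpart costs its squared argument times a common remainder, and the squared
  weights on the line have mean sum at most \<open>T\<close>. The bound does not depend on
  \<open>A\<close>.\<close>

lemma clt_estimate:
  assumes A: "pre T A" and T: "0 < T"
  shows "norm ((\<integral>\<omega>. indicator A \<omega> * iexp (\<theta> * ((W (fam \<omega>) - WT T (fam \<omega>)) / sqrt T)) \<partial>M)
      - (\<integral>\<omega>. indicator A \<omega> * of_real (exp (- (\<theta>\<^sup>2 * v * Q T (fam \<omega>) / 2))) \<partial>M)) \<le> \<theta>\<^sup>2 * remainder (\<bar>\<theta>\<bar> * sqrt T)"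
proof -
  have [measurable]: "A \<in> sets M" using A by (simp add: pre_def)
  define s where "s = \<theta> / sqrt T"
  have s2: "s\<^sup>2 * T = \<theta>\<^sup>2" using T by (simp add: s_def power_divide)
  define q where "q = (\<lambda>n \<omega>. \<Sum>u\<in>fin n. of_bool (st u T (fam \<omega>)) * (wt u (fam \<omega>))\<^sup>2)"
  have [measurable]: "q n \<in> borel_measurable M" for n unfolding q_def by measurable
  have q0: "0 \<le> q n \<omega>" for n \<omega> unfolding q_def by (intro sum_nonneg) simp
  define X where "X = (\<lambda>n \<omega>. indicator A \<omega> * iexp (s * dev T n \<omega>))"
  define Y where "Y = (\<lambda>n \<omega>. indicator A \<omega> * complex_of_real (exp (- (s\<^sup>2 * v * q n \<omega> / 2))))"
  have [measurable]: "X n \<in> borel_measurable M" "Y n \<in> borel_measurable M" for n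
    unfolding X_def Y_def by measurable
  have X1: "norm (X n \<omega>) \<le> 1" and Y1: "norm (Y n \<omega>) \<le> 1" for n \<omega>
    using q0[of n \<omega>] v_nonneg by (simp_all add: X_def Y_def norm_mult indicator_def)
  have intY: "integrable M (Y n)" for n by (rule integrable_const_bound[where B=1]) (auto simp: Y1)
  have int_eq: "(\<integral>\<omega>. X n \<omega> \<partial>M) = (\<integral>\<omega>. indicator A \<omega> * (\<Prod>u\<in>fin n. mean_factor T s u \<omega>) \<partial>M)" for n
  proof -
    have "iexp (s * dev T n \<omega>) = (\<Prod>u\<in>fin n. factor T s u \<omega>)" for \<omega>
    proof -
      have "iexp (s * dev T n \<omega>) = exp (\<Sum>u\<in>fin n. \<i> * complex_of_real (s * (of_bool (st u T (fam \<omega>)) * wt u (fam \<omega>) * (W (sh u (fam \<omega>)) - 1))))"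
        by (simp add: dev_def sum_distrib_left)
      also have "\<dots> = (\<Prod>u\<in>fin n. factor T s u \<omega>)"
        by (subst exp_sum) (auto intro!: prod.cong simp: factor_def mult.assoc)
      finally show ?thesis .
    qed
    then show ?thesis
      unfolding X_def using averaged_product[OF A, of "{}" "fin n" s] by simp
  qed
  have rem0: "0 \<le> remainder (\<bar>\<theta>\<bar> * sqrt T)" using T by (intro remainder_nonneg) simp
  have bound: "norm ((\<integral>\<omega>. X n \<omega> \<partial>M) - (\<integral>\<omega>. Y n \<omega> \<partial>M)) \<le> \<theta>\<^sup>2 * remainder (\<bar>\<theta>\<bar> * sqrt T)" for n
  proof -
    let ?m = "\<lambda>\<omega>. \<Prod>u\<in>fin n. mean_factor T s u \<omega>"
    let ?g = "\<lambda>u \<omega>. (if st u T (fam \<omega>) then complex_of_real (exp (- ((s * wt u (fam \<omega>))\<^sup>2 * v / 2))) else 1)"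
    have Yeq: "Y n \<omega> = indicator A \<omega> * (\<Prod>u\<in>fin n. ?g u \<omega>)" for \<omega>
    proof -
      have "- (s\<^sup>2 * v * q n \<omega> / 2) = (\<Sum>u\<in>fin n. - (of_bool (st u T (fam \<omega>)) * ((s * wt u (fam \<omega>))\<^sup>2 * v / 2)))"
        unfolding q_def sum_negf sum_distrib_left sum_divide_distrib
        by (intro arg_cong[where f=uminus] sum.cong) (auto simp: power_mult_distrib)
      then have "exp (- (s\<^sup>2 * v * q n \<omega> / 2)) = (\<Prod>u\<in>fin n. exp (- (of_bool (st u T (fam \<omega>)) * ((s * wt u (fam \<omega>))\<^sup>2 * v / 2))))"
        by (simp add: exp_sum)
      then have "complex_of_real (exp (- (s\<^sup>2 * v * q n \<omega> / 2))) = (\<Prod>u\<in>fin n. ?g u \<omega>)"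
        by (simp only: of_real_prod) (intro prod.cong; simp)
      then show ?thesis by (simp add: Y_def)
    qed
    have pw: "norm (indicator A \<omega> * ?m \<omega> - Y n \<omega>) \<le> s\<^sup>2 * remainder (\<bar>\<theta>\<bar> * sqrt T) * q n \<omega>" for \<omega>
    proof -
      have "norm (indicator A \<omega> * ?m \<omega> - Y n \<omega>) \<le> norm (?m \<omega> - (\<Prod>u\<in>fin n. ?g u \<omega>))"
        unfolding Yeq right_diff_distrib[symmetric] norm_mult by (simp add: indicator_def)
      also have "\<dots> \<le> (\<Sum>u\<in>fin n. norm (mean_factor T s u \<omega> - ?g u \<omega>))"
        by (rule norm_prod_diff_le) (auto simp: norm_factor v_nonneg)
      also have "\<dots> \<le> (\<Sum>u\<in>fin n. s\<^sup>2 * remainder (\<bar>\<theta>\<bar> * sqrt T) * (of_bool (st u T (fam \<omega>)) * (wt u (fam \<omega>))\<^sup>2))"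
      proof (rule sum_mono)
        fix u
        show "norm (mean_factor T s u \<omega> - ?g u \<omega>) \<le> s\<^sup>2 * remainder (\<bar>\<theta>\<bar> * sqrt T) * (of_bool (st u T (fam \<omega>)) * (wt u (fam \<omega>))\<^sup>2)"
        proof (cases "st u T (fam \<omega>)")
          case True
          then have w: "wt u (fam \<omega>) \<le> T" unfolding st_iff by simp
          have "\<bar>s * wt u (fam \<omega>)\<bar> \<le> \<bar>s\<bar> * T" using w by (simp add: abs_mult mult_left_mono)
          also have "\<dots> = \<bar>\<theta>\<bar> * (T / sqrt T)" using T by (simp add: s_def abs_divide)
          also have "T / sqrt T = sqrt T" using T by (intro real_div_sqrt) simp
          finally have "remainder \<bar>s * wt u (fam \<omega>)\<bar> \<le> remainder (\<bar>\<theta>\<bar> * sqrt T)" by (intro remainder_mono) auto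
          then have "(s * wt u (fam \<omega>))\<^sup>2 * remainder \<bar>s * wt u (fam \<omega>)\<bar> \<le> (s * wt u (fam \<omega>))\<^sup>2 * remainder (\<bar>\<theta>\<bar> * sqrt T)"
            by (rule mult_left_mono) simp
          then show ?thesis using True chi_approx[of "s * wt u (fam \<omega>)"]
            by (simp add: mean_factor_def power_mult_distrib mult_ac)
        qed (simp add: mean_factor_def)
      qed
      finally show ?thesis by (simp only: q_def sum_distrib_left)
    qed
    have iq: "integrable M (q n)" and Eq: "(\<integral>\<omega>. q n \<omega> \<partial>M) \<le> T"
    proof -
      have "(\<integral>\<^sup>+\<omega>. ennreal (q n \<omega>) \<partial>M) \<le> (\<integral>\<^sup>+\<omega>. Lq T (fam \<omega>) \<partial>M)"
      proof (rule nn_integral_mono)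
        fix \<omega>
        have eq: "ennreal (q n \<omega>) = (\<Sum>u\<in>fin n. of_bool (st u T (fam \<omega>)) * ennreal ((wt u (fam \<omega>))\<^sup>2))"
          unfolding q_def by (subst sum_ennreal[symmetric]) (auto intro!: sum.cong)
        show "ennreal (q n \<omega>) \<le> Lq T (fam \<omega>)" unfolding Lq_def eq by (rule fin_sum_le)
      qed
      then have le: "(\<integral>\<^sup>+\<omega>. ennreal (q n \<omega>) \<partial>M) \<le> ennreal T" using nn_Lq_le[OF T] by (rule order_trans)
      show "integrable M (q n)"
        using le by (intro integrableI_nonneg) (auto simp: q0 intro: le_less_trans)
      then show "(\<integral>\<omega>. q n \<omega> \<partial>M) \<le> T"
        using le T by (subst (asm) nn_integral_eq_integral) (auto simp: q0)
    qed
    have im: "integrable M (\<lambda>\<omega>. indicator A \<omega> * ?m \<omega>)"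
      by (rule integrable_const_bound[where B=1]) (auto simp: norm_mult indicator_def intro!: norm_prod_le_1 norm_factor)
    have "(\<integral>\<omega>. X n \<omega> \<partial>M) - (\<integral>\<omega>. Y n \<omega> \<partial>M) = (\<integral>\<omega>. indicator A \<omega> * ?m \<omega> - Y n \<omega> \<partial>M)"
      unfolding int_eq by (rule Bochner_Integration.integral_diff[OF im intY, symmetric])
    then have "norm ((\<integral>\<omega>. X n \<omega> \<partial>M) - (\<integral>\<omega>. Y n \<omega> \<partial>M)) \<le> (\<integral>\<omega>. norm (indicator A \<omega> * ?m \<omega> - Y n \<omega>) \<partial>M)"
      by (simp only: integral_norm_bound)
    also have "\<dots> \<le> (\<integral>\<omega>. s\<^sup>2 * remainder (\<bar>\<theta>\<bar> * sqrt T) * q n \<omega> \<partial>M)"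
      by (rule integral_mono[OF integrable_norm[OF Bochner_Integration.integrable_diff[OF im intY]] integrable_mult_right[OF iq] pw])
    also have "\<dots> \<le> s\<^sup>2 * remainder (\<bar>\<theta>\<bar> * sqrt T) * T"
      using Eq rem0 by (simp add: mult_left_mono)
    also have "s\<^sup>2 * remainder (\<bar>\<theta>\<bar> * sqrt T) * T = \<theta>\<^sup>2 * remainder (\<bar>\<theta>\<bar> * sqrt T)"
      by (simp only: s2[symmetric] mult_ac)
    finally show ?thesis .
  qed
  have limX: "(\<lambda>n. \<integral>\<omega>. X n \<omega> \<partial>M) \<longlonglongrightarrow> (\<integral>\<omega>. indicator A \<omega> * iexp (\<theta> * ((W (fam \<omega>) - WT T (fam \<omega>)) / sqrt T)) \<partial>M)"
  proof (rule integral_dominated_convergence[where w="\<lambda>_. 1"])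
    show "AE \<omega> in M. (\<lambda>n. X n \<omega>) \<longlonglongrightarrow> indicator A \<omega> * iexp (\<theta> * ((W (fam \<omega>) - WT T (fam \<omega>)) / sqrt T))"
      using dev_LIMSEQ[OF T]
    proof eventually_elim
      case (elim \<omega>)
      have "(\<lambda>n. indicator A \<omega> * iexp (s * dev T n \<omega>)) \<longlonglongrightarrow> indicator A \<omega> * iexp (s * (W (fam \<omega>) - WT T (fam \<omega>)))"
        by (intro tendsto_mult tendsto_const tendsto_exp tendsto_of_real elim)
      then show ?case by (simp add: X_def s_def)
    qed
  qed (auto simp: X1)
  have limY: "(\<lambda>n. \<integral>\<omega>. Y n \<omega> \<partial>M) \<longlonglongrightarrow> (\<integral>\<omega>. indicator A \<omega> * of_real (exp (- (\<theta>\<^sup>2 * v * Q T (fam \<omega>) / 2))) \<partial>M)"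
  proof (rule integral_dominated_convergence[where w="\<lambda>_. 1"])
    show "AE \<omega> in M. (\<lambda>n. Y n \<omega>) \<longlonglongrightarrow> indicator A \<omega> * of_real (exp (- (\<theta>\<^sup>2 * v * Q T (fam \<omega>) / 2)))"
      using AE_Lq_finite[OF T]
    proof eventually_elim
      case (elim \<omega>)
      have eq: "(\<integral>\<^sup>+u. ennreal (of_bool (st u T (fam \<omega>)) * (wt u (fam \<omega>))\<^sup>2) \<partial>count_space UNIV) = Lq T (fam \<omega>)"
        unfolding Lq_def by (intro nn_integral_cong) simp
      have "(\<lambda>n. q n \<omega>) \<longlonglongrightarrow> enn2real (Lq T (fam \<omega>))"
        unfolding q_def eq[symmetric] by (rule fin_sum_real_LIMSEQ) (use elim eq in auto)
      then have "(\<lambda>n. indicator A \<omega> * complex_of_real (exp (- (s\<^sup>2 * v * q n \<omega> / 2)))) \<longlonglongrightarrow>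
          indicator A \<omega> * complex_of_real (exp (- (s\<^sup>2 * v * enn2real (Lq T (fam \<omega>)) / 2)))"
        by (intro tendsto_mult tendsto_const tendsto_exp tendsto_of_real tendsto_minus tendsto_divide) auto
      moreover have "s\<^sup>2 * v * enn2real (Lq T (fam \<omega>)) = \<theta>\<^sup>2 * v * Q T (fam \<omega>)"
        unfolding s2[symmetric] Q_def using T by simp
      ultimately show ?case by (simp only: Y_def)
    qed
  qed (auto simp: Y1)
  show ?thesis
    by (rule LIMSEQ_le_const2[OF tendsto_norm[OF tendsto_diff[OF limX limY]]]) (use bound in blast)
qed

end

context renewal_cascade
begin

text \<open>Exchanges the random variance \<open>Q T\<close> for \<open>c * W\<close>: the
  exponential is Lipschitz on the relevant half-line, and the L1 distance is at most the square root
  of \<open>eps T\<close>. That \<open>T0\<close> does not depend on \<open>A\<close> is what later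
  gives L1 convergence of conditional expectations.\<close>

lemma clt_uniform:
  assumes "0 < \<delta>"
  shows "\<exists>T0>0. \<forall>T A. 0 < T \<longrightarrow> T \<le> T0 \<longrightarrow> pre T A \<longrightarrow>
    norm ((\<integral>\<omega>. indicator A \<omega> * iexp (\<theta> * ((W (fam \<omega>) - WT T (fam \<omega>)) / sqrt T)) \<partial>M)
      - (\<integral>\<omega>. indicator A \<omega> * of_real (exp (- (\<theta>\<^sup>2 * v * (c * W (fam \<omega>)) / 2))) \<partial>M)) \<le> \<delta>"
proof -
  define b where "b = \<theta>\<^sup>2 * v / 2"
  have b0: "0 \<le> b" using v_nonneg by (simp add: b_def)
  have "((\<lambda>T. \<bar>\<theta>\<bar> * sqrt T) \<longlongrightarrow> \<bar>\<theta>\<bar> * sqrt 0) (at_right 0)" by (intro tendsto_intros)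
  have "\<exists>r0>0. \<forall>r. 0 < r \<longrightarrow> r < r0 \<longrightarrow> \<theta>\<^sup>2 * remainder r < \<delta> / 2"
  proof -
    have "((\<lambda>r. \<theta>\<^sup>2 * remainder r) \<longlongrightarrow> \<theta>\<^sup>2 * 0) (at_right 0)"
      by (intro tendsto_mult tendsto_const remainder_limit)
    then have "\<forall>\<^sub>F r in at_right 0. \<theta>\<^sup>2 * remainder r < \<delta> / 2"
      by (rule order_tendstoD) (use assms in simp)
    then show ?thesis unfolding eventually_at_right_field by blast
  qed
  then obtain r0 where r0: "0 < r0" "\<And>r. 0 < r \<Longrightarrow> r < r0 \<Longrightarrow> \<theta>\<^sup>2 * remainder r < \<delta> / 2" by blast
  \<comment> \<open>The bound on \<open>T\<close> ensures
    \<open>\<bar>\<theta>\<bar> * sqrt T < r0\<close>. The case \<open>\<theta> = 0\<close> is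
    separate because \<open>r0\<close> controls only positive arguments.\<close>
  have rem: "\<theta>\<^sup>2 * remainder (\<bar>\<theta>\<bar> * sqrt T) \<le> \<delta> / 2" if "0 < T" "T \<le> (r0 / (2 * (\<bar>\<theta>\<bar> + 1)))\<^sup>2" for T
  proof (cases "\<theta> = 0")
    case True
    then show ?thesis using assms by simp
  next
    case False
    have "sqrt T \<le> sqrt ((r0 / (2 * (\<bar>\<theta>\<bar> + 1)))\<^sup>2)" using that by (intro real_sqrt_le_mono) auto
    then have "sqrt T \<le> r0 / (2 * (\<bar>\<theta>\<bar> + 1))" using r0(1) by simp
    then have "sqrt T * (2 * (\<bar>\<theta>\<bar> + 1)) \<le> r0" by (simp add: pos_le_divide_eq)
    moreover have "0 < sqrt T" using that by simp
    moreover have "\<bar>\<theta>\<bar> * sqrt T < sqrt T * (2 * (\<bar>\<theta>\<bar> + 1))"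
    proof -
      have "sqrt T * (2 * (\<bar>\<theta>\<bar> + 1)) = 2 * (\<bar>\<theta>\<bar> * sqrt T) + 2 * sqrt T" by (simp add: algebra_simps)
      moreover have "0 \<le> \<bar>\<theta>\<bar> * sqrt T" "0 < sqrt T" using that by simp_all
      ultimately show ?thesis by linarith
    qed
    ultimately have "\<bar>\<theta>\<bar> * sqrt T < r0" by linarith
    moreover have "0 < \<bar>\<theta>\<bar> * sqrt T" using False that by simp
    ultimately show ?thesis using r0(2)[of "\<bar>\<theta>\<bar> * sqrt T"] by simp
  qed
  obtain T1 where T1: "0 < T1" "\<And>T. 0 < T \<Longrightarrow> T \<le> T1 \<Longrightarrow> eps T \<le> ennreal ((\<delta> / (2 * (b + 1)))\<^sup>2)"
    using eps_limit[of "(\<delta> / (2 * (b + 1)))\<^sup>2"] assms b0 by auto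
  define T0 where "T0 = min T1 ((r0 / (2 * (\<bar>\<theta>\<bar> + 1)))\<^sup>2)"
  have "norm ((\<integral>\<omega>. indicator A \<omega> * iexp (\<theta> * ((W (fam \<omega>) - WT T (fam \<omega>)) / sqrt T)) \<partial>M)
      - (\<integral>\<omega>. indicator A \<omega> * of_real (exp (- (\<theta>\<^sup>2 * v * (c * W (fam \<omega>)) / 2))) \<partial>M)) \<le> \<delta>"
    if T: "0 < T" "T \<le> T0" and A: "pre T A" for T A
  proof -
    have [measurable]: "A \<in> sets M" using A by (simp add: pre_def)
    let ?E1 = "\<lambda>\<omega>. indicator A \<omega> * complex_of_real (exp (- (\<theta>\<^sup>2 * v * Q T (fam \<omega>) / 2)))"
    let ?E2 = "\<lambda>\<omega>. indicator A \<omega> * complex_of_real (exp (- (\<theta>\<^sup>2 * v * (c * W (fam \<omega>)) / 2)))"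
    let ?X = "\<lambda>\<omega>. Q T (fam \<omega>) - c * W (fam \<omega>)"
    have X2: "(\<integral>\<^sup>+\<omega>. ennreal ((?X \<omega>)\<^sup>2) \<partial>M) \<le> ennreal ((\<delta> / (2 * (b + 1)))\<^sup>2)"
      using T1(2)[of T] T unfolding T0_def eps_def by simp
    have iX: "integrable M ?X" by (rule mean_le_of_square(1)[OF _ X2]) auto
    have "(\<integral>\<^sup>+\<omega>. ennreal \<bar>?X \<omega>\<bar> \<partial>M) \<le> ennreal (sqrt ((\<delta> / (2 * (b + 1)))\<^sup>2))"
      by (rule mean_le_of_square(4)[OF _ X2]) auto
    then have "(\<integral>\<^sup>+\<omega>. ennreal \<bar>?X \<omega>\<bar> \<partial>M) \<le> ennreal (\<delta> / (2 * (b + 1)))"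
      using assms b0 by simp
    then have EX: "(\<integral>\<omega>. \<bar>?X \<omega>\<bar> \<partial>M) \<le> \<delta> / (2 * (b + 1))"
      using iX assms b0 by (subst (asm) nn_integral_eq_integral) auto
    have i1: "integrable M ?E1" "integrable M ?E2"
      using Q_nonneg[OF T(1)] v_nonneg c_nonneg
      by (auto intro!: integrable_const_bound[where B=1] simp: norm_mult indicator_def)
    have pw: "norm (?E1 \<omega> - ?E2 \<omega>) \<le> b * \<bar>?X \<omega>\<bar>" for \<omega>
    proof -
      have "\<bar>exp (- (b * Q T (fam \<omega>))) - exp (- (b * (c * W (fam \<omega>))))\<bar> \<le> \<bar>b * Q T (fam \<omega>) - b * (c * W (fam \<omega>))\<bar>"
        by (rule abs_exp_diff_le) (use b0 c_nonneg Q_nonneg[OF T(1)] in auto)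
      also have "\<dots> = b * \<bar>?X \<omega>\<bar>" unfolding right_diff_distrib[symmetric] abs_mult using b0 by simp
      finally have 1: "\<bar>exp (- (b * Q T (fam \<omega>))) - exp (- (b * (c * W (fam \<omega>))))\<bar> \<le> b * \<bar>?X \<omega>\<bar>" .
      have "norm (?E1 \<omega> - ?E2 \<omega>) = indicator A \<omega> * \<bar>exp (- (b * Q T (fam \<omega>))) - exp (- (b * (c * W (fam \<omega>))))\<bar>"
        unfolding right_diff_distrib[symmetric] norm_mult of_real_diff[symmetric] norm_of_real
        by (simp add: b_def indicator_def)
      also have "\<dots> \<le> 1 * (b * \<bar>?X \<omega>\<bar>)" using 1 by (intro mult_mono) (auto simp: indicator_def)
      finally show ?thesis by simp
    qed
    have "norm ((\<integral>\<omega>. ?E1 \<omega> \<partial>M) - (\<integral>\<omega>. ?E2 \<omega> \<partial>M)) = norm (\<integral>\<omega>. ?E1 \<omega> - ?E2 \<omega> \<partial>M)"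
      using i1 by simp
    also have "\<dots> \<le> (\<integral>\<omega>. norm (?E1 \<omega> - ?E2 \<omega>) \<partial>M)" by (rule integral_norm_bound)
    also have "\<dots> \<le> (\<integral>\<omega>. b * \<bar>?X \<omega>\<bar> \<partial>M)"
      by (rule integral_mono[OF integrable_norm[OF Bochner_Integration.integrable_diff[OF i1]] _ pw]) (use iX in simp)
    also have "\<dots> = b * (\<integral>\<omega>. \<bar>?X \<omega>\<bar> \<partial>M)" by simp
    also have "\<dots> \<le> b * (\<delta> / (2 * (b + 1)))" by (rule mult_left_mono[OF EX b0])
    also have "\<dots> = \<delta> / 2 * (b / (b + 1))" by simp
    also have "\<dots> \<le> \<delta> / 2 * 1" using b0 assms by (intro mult_left_mono) auto
    finally have 2: "norm ((\<integral>\<omega>. ?E1 \<omega> \<partial>M) - (\<integral>\<omega>. ?E2 \<omega> \<partial>M)) \<le> \<delta> / 2" by simp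
    have 3: "norm ((\<integral>\<omega>. indicator A \<omega> * iexp (\<theta> * ((W (fam \<omega>) - WT T (fam \<omega>)) / sqrt T)) \<partial>M) - (\<integral>\<omega>. ?E1 \<omega> \<partial>M)) \<le> \<delta> / 2"
      using clt_estimate[OF A T(1), of \<theta>] rem[of T] T unfolding T0_def by simp
    show ?thesis using norm_diff_triangle_le[OF 3 2] by simp
  qed
  moreover have "0 < T0" using T1(1) r0(1) by (simp add: T0_def)
  ultimately show ?thesis by blast
qed

end

section \<open>Weak convergence of conditional laws via characteristic functions\<close>

text \<open>Real trigonometric polynomials with arbitrary frequencies. The generators are the real
  and imaginary parts of the characters, so convergence on this class is what characteristic
  functions provide; closure under products makes it an algebra.\<close>

inductive trig :: "(real \<Rightarrow> real) \<Rightarrow> bool" where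
  cos: "trig (\<lambda>x. cos (\<theta> * x))"
| sin: "trig (\<lambda>x. sin (\<theta> * x))"
| cmult: "trig g \<Longrightarrow> trig (\<lambda>x. r * g x)"
| add: "trig g \<Longrightarrow> trig h \<Longrightarrow> trig (\<lambda>x. g x + h x)"

lemma trig_const: "trig (\<lambda>_. r)"
  using trig.cmult[OF trig.cos[of 0], of r] by simp

lemma trig_mult:
  assumes "trig g" "trig h"
  shows "trig (\<lambda>x. g x * h x)"
  using assms(1)
proof (induction rule: trig.induct)
  case (cos \<theta>)
  show ?case using assms(2)
  proof (induction rule: trig.induct)
    case (cos \<theta>')
    have "(\<lambda>x. cos (\<theta> * x) * cos (\<theta>' * x)) = (\<lambda>x. (1/2) * (cos ((\<theta> - \<theta>') * x) + cos ((\<theta> + \<theta>') * x)))"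
      by (simp add: cos_times_cos left_diff_distrib distrib_right)
    then show ?case by (simp only:) (rule trig.cmult[OF trig.add[OF trig.cos trig.cos]])
  next
    case (sin \<theta>')
    have "(\<lambda>x. cos (\<theta> * x) * sin (\<theta>' * x)) = (\<lambda>x. (1/2) * (sin ((\<theta> + \<theta>') * x) + (-1) * sin ((\<theta> - \<theta>') * x)))"
      by (simp add: cos_times_sin left_diff_distrib distrib_right)
    then show ?case by (simp only:) (rule trig.cmult[OF trig.add[OF trig.sin trig.cmult[OF trig.sin]]])
  next
    case (cmult g r)
    then show ?case using trig.cmult[OF cmult.IH, of r] by (simp add: mult_ac)
  next
    case (add g h)
    then show ?case using trig.add[OF add.IH] by (simp add: distrib_left)
  qed
next
  case (sin \<theta>)
  show ?case using assms(2)
  proof (induction rule: trig.induct)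
    case (cos \<theta>')
    have "(\<lambda>x. sin (\<theta> * x) * cos (\<theta>' * x)) = (\<lambda>x. (1/2) * (sin ((\<theta> + \<theta>') * x) + sin ((\<theta> - \<theta>') * x)))"
      by (simp add: sin_times_cos left_diff_distrib distrib_right)
    then show ?case by (simp only:) (rule trig.cmult[OF trig.add[OF trig.sin trig.sin]])
  next
    case (sin \<theta>')
    have "(\<lambda>x. sin (\<theta> * x) * sin (\<theta>' * x)) = (\<lambda>x. (1/2) * (cos ((\<theta> - \<theta>') * x) + (-1) * cos ((\<theta> + \<theta>') * x)))"
      by (simp add: sin_times_sin left_diff_distrib distrib_right)
    then show ?case by (simp only:) (rule trig.cmult[OF trig.add[OF trig.cos trig.cmult[OF trig.cos]]])
  next
    case (cmult g r)
    then show ?case using trig.cmult[OF cmult.IH, of r] by (simp add: mult_ac)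
  next
    case (add g h)
    then show ?case using trig.add[OF add.IH] by (simp add: distrib_left)
  qed
next
  case (cmult g r)
  then show ?case using trig.cmult[OF cmult.IH, of r] by (simp add: mult_ac)
next
  case (add g h')
  then show ?case using trig.add[OF add.IH] by (simp add: distrib_right)
qed

lemma trig_continuous: "trig g \<Longrightarrow> continuous_on UNIV g"
  by (induction rule: trig.induct) (auto intro!: continuous_intros)

lemma trig_bounded: "trig g \<Longrightarrow> \<exists>B. \<forall>x. \<bar>g x\<bar> \<le> B"
proof (induction rule: trig.induct)
  case (cmult g r)
  then obtain B where "\<forall>x. \<bar>g x\<bar> \<le> B" by blast
  then have "\<forall>x. \<bar>r * g x\<bar> \<le> \<bar>r\<bar> * B" by (simp add: abs_mult mult_left_mono)
  then show ?case by blast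
next
  case (add g h)
  then obtain B B' where "\<forall>x. \<bar>g x\<bar> \<le> B" "\<forall>x. \<bar>h x\<bar> \<le> B'" by blast
  then have "\<bar>g x\<bar> \<le> B" "\<bar>h x\<bar> \<le> B'" for x by blast+
  then have "\<bar>g x + h x\<bar> \<le> B + B'" for x by (rule order_trans[OF abs_triangle_ineq add_mono])
  then show ?case by blast
next
  case (cos \<theta>)
  show ?case by (rule exI[of _ 1]) simp
next
  case (sin \<theta>)
  show ?case by (rule exI[of _ 1]) simp
qed

text \<open>
  The function \<open>f\<close> on \<open>[-K, K]\<close> is a continuous function of \<open>sin (\<pi> x / (2K))\<close>, to which Weierstrass' theorem
  is applied; this keeps the approximation bounded on the whole line.
\<close>
lemma trig_approximation:
  fixes f :: "real \<Rightarrow> real"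
  assumes f: "continuous_on UNIV f" and B: "\<And>x. \<bar>f x\<bar> \<le> B" and e: "0 < e" and K: "0 < K"
  obtains g where "trig g" "\<And>x. \<bar>x\<bar> \<le> K \<Longrightarrow> \<bar>f x - g x\<bar> \<le> e" "\<And>x. \<bar>g x\<bar> \<le> B + e"
proof -
  define \<phi> where "\<phi> = (\<lambda>s. f (2 * K / pi * arcsin s))"
  have "continuous_on {-1..1} \<phi>"
    unfolding \<phi>_def
    by (rule continuous_on_compose2[OF f]) (auto intro!: continuous_intros continuous_on_arcsin)
  then obtain p where p: "real_polynomial_function p" "\<And>s. s \<in> {-1..1} \<Longrightarrow> \<bar>\<phi> s - p s\<bar> < e"
    using Stone_Weierstrass_real_polynomial_function[of "{-1..1::real}" \<phi> e] e by auto
  define g where "g = (\<lambda>x. p (sin (pi / (2 * K) * x)))"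
  have "trig (\<lambda>x. q (sin (pi / (2 * K) * x)))" if "real_polynomial_function q" for q :: "real \<Rightarrow> real"
    using that
  proof (induction rule: real_polynomial_function.induct)
    case (linear q)
    have q: "q s = q 1 * s" for s
      using linear_scale[OF bounded_linear.linear[OF linear], of s 1] by (simp add: mult.commute)
    show ?case by (subst q) (rule trig.cmult[OF trig.sin])
  next
    case (const r)
    show ?case by (rule trig_const)
  next
    case (add p q)
    show ?case by (rule trig.add[OF add.IH])
  next
    case (mult p q)
    show ?case by (rule trig_mult[OF mult.IH])
  qed
  from this[OF p(1)] have g: "trig g" unfolding g_def .
  have near: "\<bar>\<phi> (sin (pi / (2 * K) * x)) - g x\<bar> < e" for x
    unfolding g_def by (rule p(2)) simp
  have 1: "\<bar>f x - g x\<bar> \<le> e" if "\<bar>x\<bar> \<le> K" for x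
  proof -
    have "pi / (2 * K) * x = pi / 2 * (x / K)" using K by simp
    moreover have "-1 \<le> x / K" "x / K \<le> 1" using that K by (auto simp: field_simps)
    ultimately have "- (pi / 2) \<le> pi / (2 * K) * x" "pi / (2 * K) * x \<le> pi / 2"
      using mult_left_mono[of "-1" "x / K" "pi / 2"] mult_left_mono[of "x / K" 1 "pi / 2"] by simp_all
    then have "arcsin (sin (pi / (2 * K) * x)) = pi / (2 * K) * x" by (rule arcsin_sin)
    then have "\<phi> (sin (pi / (2 * K) * x)) = f x" using K by (simp add: \<phi>_def)
    then show ?thesis using near[of x] by simp
  qed
  have 2: "\<bar>g x\<bar> \<le> B + e" for x
    using near[of x] B[of "2 * K / pi * arcsin (sin (pi / (2 * K) * x))"] unfolding \<phi>_def by linarith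
  show ?thesis by (rule that[OF g 1 2])
qed

section \<open>L1 bounds for conditional expectations by testing on events\<close>

context finite_measure_subalgebra
begin

text \<open>The test events are the set where the conditional expectation is positive and its
  complement, hence the factor 2.\<close>

lemma cond_exp_L1:
  assumes u: "integrable M u" and test: "\<And>A. A \<in> sets F \<Longrightarrow> \<bar>\<integral>\<omega>. indicator A \<omega> * u \<omega> \<partial>M\<bar> \<le> \<delta>"
  shows "(\<integral>\<omega>. \<bar>real_cond_exp M F u \<omega>\<bar> \<partial>M) \<le> 2 * \<delta>"
proof -
  let ?E = "real_cond_exp M F u"
  define A where "A = {\<omega> \<in> space F. 0 < ?E \<omega>}"
  have A: "A \<in> sets F" unfolding A_def by measurable
  have Ac: "space F - A \<in> sets F" using A by blast
  have sp: "space F = space M" using subalg by (simp add: subalgebra_def)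
  have AM: "A \<in> sets M" "space F - A \<in> sets M" using A Ac subalg by (auto simp: subalgebra_def)
  have iE: "integrable M ?E" by (rule real_cond_exp_int(1)[OF u])
  have i: "integrable M (\<lambda>\<omega>. indicator B \<omega> * ?E \<omega>)" if "B \<in> sets M" for B
    using integrable_mult_indicator[OF that iE] by simp
  have eq: "(\<integral>\<omega>. indicator B \<omega> * ?E \<omega> \<partial>M) = (\<integral>\<omega>. indicator B \<omega> * u \<omega> \<partial>M)" if "B \<in> sets F" for B
    using real_cond_exp_intA[OF u that] unfolding set_lebesgue_integral_def by simp
  have "(\<integral>\<omega>. \<bar>?E \<omega>\<bar> \<partial>M) = (\<integral>\<omega>. indicator A \<omega> * ?E \<omega> - indicator (space F - A) \<omega> * ?E \<omega> \<partial>M)"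
    by (rule Bochner_Integration.integral_cong) (auto simp: A_def sp indicator_def)
  also have "\<dots> = (\<integral>\<omega>. indicator A \<omega> * u \<omega> \<partial>M) - (\<integral>\<omega>. indicator (space F - A) \<omega> * u \<omega> \<partial>M)"
    by (subst Bochner_Integration.integral_diff[OF i[OF AM(1)] i[OF AM(2)]]) (simp add: eq A Ac)
  also have "\<dots> \<le> 2 * \<delta>" using test[OF A] test[OF Ac] by linarith
  finally show ?thesis .
qed

lemma cond_exp_contraction:
  assumes u: "integrable M u" and w: "integrable M w"
  shows "(\<integral>\<omega>. \<bar>real_cond_exp M F u \<omega> - real_cond_exp M F w \<omega>\<bar> \<partial>M) \<le> 2 * (\<integral>\<omega>. \<bar>u \<omega> - w \<omega>\<bar> \<partial>M)"
proof -
  have "(\<integral>\<omega>. \<bar>real_cond_exp M F u \<omega> - real_cond_exp M F w \<omega>\<bar> \<partial>M) = (\<integral>\<omega>. \<bar>real_cond_exp M F (\<lambda>\<omega>. u \<omega> - w \<omega>) \<omega>\<bar> \<partial>M)"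
    using real_cond_exp_diff[OF u w] by (intro integral_cong_AE) auto
  also have "\<dots> \<le> 2 * (\<integral>\<omega>. \<bar>u \<omega> - w \<omega>\<bar> \<partial>M)"
  proof (rule cond_exp_L1)
    show d: "integrable M (\<lambda>\<omega>. u \<omega> - w \<omega>)" using u w by simp
    fix A assume "A \<in> sets F"
    then have A: "A \<in> sets M" using subalg by (auto simp: subalgebra_def)
    have "\<bar>\<integral>\<omega>. indicator A \<omega> * (u \<omega> - w \<omega>) \<partial>M\<bar> \<le> (\<integral>\<omega>. \<bar>indicator A \<omega> * (u \<omega> - w \<omega>)\<bar> \<partial>M)"
      by (rule integral_abs_bound)
    also have "\<dots> \<le> (\<integral>\<omega>. \<bar>u \<omega> - w \<omega>\<bar> \<partial>M)"
      using integrable_mult_indicator[OF A d] d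
      by (intro integral_mono integrable_abs) (auto simp: indicator_def)
    finally show "\<bar>\<integral>\<omega>. indicator A \<omega> * (u \<omega> - w \<omega>) \<partial>M\<bar> \<le> (\<integral>\<omega>. \<bar>u \<omega> - w \<omega>\<bar> \<partial>M)" .
  qed
  finally show ?thesis .
qed

end

text \<open>A continuity theorem for conditional laws. The L1 distance of the conditional
  expectations implies convergence in probability and behaves well under linear combinations and
  approximation of the test function. A bounded continuous function is close to a trigonometric
  polynomial on a compact interval; outside of it, both are bounded and tightness makes the
  probability small.\<close>

lemma (in prob_space) cond_law_tendsto_in_prob_of_trig:
  fixes Y :: "real \<Rightarrow> 'a \<Rightarrow> real" and Z :: "'a \<Rightarrow> real"
  assumes H: "\<And>t. subalgebra M (H t)" and G: "subalgebra M G"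
    and Y: "\<And>t. 0 \<le> t \<Longrightarrow> Y t \<in> borel_measurable M" and Z: "Z \<in> borel_measurable M"
    and tightY: "\<And>e. 0 < e \<Longrightarrow> \<exists>K>0. \<forall>t\<ge>0. prob {\<omega>\<in>space M. K < \<bar>Y t \<omega>\<bar>} \<le> e"
    and cos: "\<And>\<theta>. ((\<lambda>t. \<integral>\<omega>. \<bar>real_cond_exp M (H t) (\<lambda>\<omega>. cos (\<theta> * Y t \<omega>)) \<omega> - real_cond_exp M G (\<lambda>\<omega>. cos (\<theta> * Z \<omega>)) \<omega>\<bar> \<partial>M) \<longlongrightarrow> 0) at_top"
    and sin: "\<And>\<theta>. ((\<lambda>t. \<integral>\<omega>. \<bar>real_cond_exp M (H t) (\<lambda>\<omega>. sin (\<theta> * Y t \<omega>)) \<omega> - real_cond_exp M G (\<lambda>\<omega>. sin (\<theta> * Z \<omega>)) \<omega>\<bar> \<partial>M) \<longlongrightarrow> 0) at_top"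
  shows "cond_law_tendsto_in_prob M Y H Z G"
proof -
  have fH: "finite_measure_subalgebra M (H t)" for t
    using H by (intro finite_measure_subalgebra.intro finite_measure_axioms finite_measure_subalgebra_axioms.intro)
  have fG: "finite_measure_subalgebra M G"
    using G by (intro finite_measure_subalgebra.intro finite_measure_axioms finite_measure_subalgebra_axioms.intro)
  have sH: "sigma_finite_subalgebra M (H t)" for t
    by (rule finite_measure_subalgebra_is_sigma_finite[OF fH])
  have sG: "sigma_finite_subalgebra M G"
    by (rule finite_measure_subalgebra_is_sigma_finite[OF fG])
  define L where "L = (\<lambda>f t. \<integral>\<omega>. \<bar>real_cond_exp M (H t) (\<lambda>\<omega>. f (Y t \<omega>)) \<omega> - real_cond_exp M G (\<lambda>\<omega>. f (Z \<omega>)) \<omega>\<bar> \<partial>M)"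
  have int: "integrable M (\<lambda>\<omega>. f (V \<omega>))"
    if f: "continuous_on UNIV f" "\<And>x. \<bar>f x\<bar> \<le> B" and V: "V \<in> borel_measurable M" for f :: "real \<Rightarrow> real" and B V
  proof (rule integrable_const_bound[where B=B])
    show "(\<lambda>\<omega>. f (V \<omega>)) \<in> borel_measurable M"
      by (rule measurable_compose[OF V borel_measurable_continuous_onI[OF f(1)]])
  qed (use f in auto)
  have L0: "0 \<le> L f t" for f t unfolding L_def by simp
  have ev0: "\<forall>\<^sub>F t in at_top. 0 \<le> (t :: real)" by (rule eventually_ge_at_top)
  \<comment> \<open>Triangle inequality through \<open>g\<close>; each factor 2 is inherited from
    \<open>cond_exp_contraction\<close>.\<close>
  have L_split: "L f t \<le> L g t + 2 * (\<integral>\<omega>. \<bar>f (Y t \<omega>) - g (Y t \<omega>)\<bar> \<partial>M) + 2 * (\<integral>\<omega>. \<bar>f (Z \<omega>) - g (Z \<omega>)\<bar> \<partial>M)"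
    if f: "integrable M (\<lambda>\<omega>. f (Y t \<omega>))" "integrable M (\<lambda>\<omega>. f (Z \<omega>))"
      and g: "integrable M (\<lambda>\<omega>. g (Y t \<omega>))" "integrable M (\<lambda>\<omega>. g (Z \<omega>))" for f g :: "real \<Rightarrow> real" and t
  proof -
    let ?fH = "real_cond_exp M (H t) (\<lambda>\<omega>. f (Y t \<omega>))" and ?gH = "real_cond_exp M (H t) (\<lambda>\<omega>. g (Y t \<omega>))"
    let ?fG = "real_cond_exp M G (\<lambda>\<omega>. f (Z \<omega>))" and ?gG = "real_cond_exp M G (\<lambda>\<omega>. g (Z \<omega>))"
    note i = sigma_finite_subalgebra.real_cond_exp_int(1)[OF sH[of t] f(1)] sigma_finite_subalgebra.real_cond_exp_int(1)[OF sH[of t] g(1)]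
      sigma_finite_subalgebra.real_cond_exp_int(1)[OF sG f(2)] sigma_finite_subalgebra.real_cond_exp_int(1)[OF sG g(2)]
    have i1: "integrable M (\<lambda>\<omega>. \<bar>?gH \<omega> - ?gG \<omega>\<bar>)" "integrable M (\<lambda>\<omega>. \<bar>?fH \<omega> - ?gH \<omega>\<bar>)"
      "integrable M (\<lambda>\<omega>. \<bar>?fG \<omega> - ?gG \<omega>\<bar>)" "integrable M (\<lambda>\<omega>. \<bar>?fH \<omega> - ?fG \<omega>\<bar>)"
      using i by (auto intro!: integrable_abs Bochner_Integration.integrable_diff)
    have "L f t \<le> (\<integral>\<omega>. \<bar>?gH \<omega> - ?gG \<omega>\<bar> + \<bar>?fH \<omega> - ?gH \<omega>\<bar> + \<bar>?fG \<omega> - ?gG \<omega>\<bar> \<partial>M)"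
      unfolding L_def using i1
      by (intro integral_mono Bochner_Integration.integrable_add) auto
    also have "\<dots> = L g t + (\<integral>\<omega>. \<bar>?fH \<omega> - ?gH \<omega>\<bar> \<partial>M) + (\<integral>\<omega>. \<bar>?fG \<omega> - ?gG \<omega>\<bar> \<partial>M)"
      unfolding L_def using i1 by simp
    also have "\<dots> \<le> L g t + 2 * (\<integral>\<omega>. \<bar>f (Y t \<omega>) - g (Y t \<omega>)\<bar> \<partial>M) + 2 * (\<integral>\<omega>. \<bar>f (Z \<omega>) - g (Z \<omega>)\<bar> \<partial>M)"
      by (intro add_mono order.refl finite_measure_subalgebra.cond_exp_contraction[OF fH] finite_measure_subalgebra.cond_exp_contraction[OF fG] f g)
    finally show ?thesis .
  qed
  have L_trig: "(L g \<longlongrightarrow> 0) at_top" if "trig g" for g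
    using that
  proof (induction rule: trig.induct)
    case (cos \<theta>)
    show ?case using assms(6) by (simp add: L_def[abs_def])
  next
    case (sin \<theta>)
    show ?case using assms(7) by (simp add: L_def[abs_def])
  next
    case (cmult g r)
    obtain B where B: "\<And>x. \<bar>g x\<bar> \<le> B" using trig_bounded[OF cmult.hyps] by blast
    have "L (\<lambda>x. r * g x) t = \<bar>r\<bar> * L g t" if t: "0 \<le> t" for t
    proof -
      note c = sigma_finite_subalgebra.real_cond_exp_cmult[OF sH[of t] int[OF trig_continuous[OF cmult.hyps] B Y[OF t]], where c=r]
        sigma_finite_subalgebra.real_cond_exp_cmult[OF sG int[OF trig_continuous[OF cmult.hyps] B Z], where c=r]
      have "L (\<lambda>x. r * g x) t = (\<integral>\<omega>. \<bar>r\<bar> * \<bar>real_cond_exp M (H t) (\<lambda>\<omega>. g (Y t \<omega>)) \<omega> - real_cond_exp M G (\<lambda>\<omega>. g (Z \<omega>)) \<omega>\<bar> \<partial>M)"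
        unfolding L_def
      proof (rule integral_cong_AE)
        show "AE \<omega> in M. \<bar>real_cond_exp M (H t) (\<lambda>\<omega>. r * g (Y t \<omega>)) \<omega> - real_cond_exp M G (\<lambda>\<omega>. r * g (Z \<omega>)) \<omega>\<bar> =
            \<bar>r\<bar> * \<bar>real_cond_exp M (H t) (\<lambda>\<omega>. g (Y t \<omega>)) \<omega> - real_cond_exp M G (\<lambda>\<omega>. g (Z \<omega>)) \<omega>\<bar>"
          using c by eventually_elim (simp add: right_diff_distrib[symmetric] abs_mult)
      qed (auto intro!: borel_measurable_abs borel_measurable_diff borel_measurable_times borel_measurable_cond_exp2)
      then show ?thesis by (simp add: L_def)
    qed
    then have "\<forall>\<^sub>F t in at_top. \<bar>r\<bar> * L g t = L (\<lambda>x. r * g x) t"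
      by (intro eventually_mono[OF ev0]) simp
    moreover have "((\<lambda>t. \<bar>r\<bar> * L g t) \<longlongrightarrow> \<bar>r\<bar> * 0) at_top" by (intro tendsto_mult tendsto_const cmult.IH)
    ultimately show ?case by (simp add: Lim_transform_eventually)
  next
    case (add g h)
    obtain B where B: "\<And>x. \<bar>g x\<bar> \<le> B" using trig_bounded[OF add.hyps(1)] by blast
    obtain B' where B': "\<And>x. \<bar>h x\<bar> \<le> B'" using trig_bounded[OF add.hyps(2)] by blast
    have le: "L (\<lambda>x. g x + h x) t \<le> L g t + L h t" if t: "0 \<le> t" for t
    proof -
      note ig = int[OF trig_continuous[OF add.hyps(1)] B Y[OF t]] int[OF trig_continuous[OF add.hyps(1)] B Z]
      note ih = int[OF trig_continuous[OF add.hyps(2)] B' Y[OF t]] int[OF trig_continuous[OF add.hyps(2)] B' Z]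
      let ?d = "\<lambda>g \<omega>. \<bar>real_cond_exp M (H t) (\<lambda>\<omega>. g (Y t \<omega>)) \<omega> - real_cond_exp M G (\<lambda>\<omega>. g (Z \<omega>)) \<omega>\<bar>"
      have i: "integrable M (?d g)" "integrable M (?d h)" "integrable M (?d (\<lambda>x. g x + h x))"
        using sigma_finite_subalgebra.real_cond_exp_int(1)[OF sH[of t]] sigma_finite_subalgebra.real_cond_exp_int(1)[OF sG] ig ih
        by (auto intro!: integrable_abs Bochner_Integration.integrable_diff)
      have "L (\<lambda>x. g x + h x) t \<le> (\<integral>\<omega>. ?d g \<omega> + ?d h \<omega> \<partial>M)"
        unfolding L_def
      proof (rule integral_mono_AE[OF i(3) Bochner_Integration.integrable_add[OF i(1,2)]])
        show "AE \<omega> in M. ?d (\<lambda>x. g x + h x) \<omega> \<le> ?d g \<omega> + ?d h \<omega>"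
          using sigma_finite_subalgebra.real_cond_exp_add[OF sH[of t] ig(1) ih(1)] sigma_finite_subalgebra.real_cond_exp_add[OF sG ig(2) ih(2)]
          by eventually_elim simp
      qed
      then show ?thesis using i by (simp add: L_def)
    qed
    have "((\<lambda>t. L g t + L h t) \<longlongrightarrow> 0 + 0) at_top" by (intro tendsto_add add.IH)
    then have lim: "((\<lambda>t. L g t + L h t) \<longlongrightarrow> 0) at_top" by simp
    show ?case
    proof (rule tendsto_sandwich[OF _ _ tendsto_const lim])
      show "\<forall>\<^sub>F t in at_top. 0 \<le> L (\<lambda>x. g x + h x) t" by (simp add: L0)
      show "\<forall>\<^sub>F t in at_top. L (\<lambda>x. g x + h x) t \<le> L g t + L h t" by (rule eventually_mono[OF ev0 le])
    qed
  qed
  have tightZ: "\<exists>K>0. prob {\<omega>\<in>space M. K < \<bar>Z \<omega>\<bar>} \<le> e" if e: "0 < e" for e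
  proof -
    have "(\<lambda>n::nat. prob {\<omega>\<in>space M. real n < \<bar>Z \<omega>\<bar>}) \<longlonglongrightarrow> prob (\<Inter>n::nat. {\<omega>\<in>space M. real n < \<bar>Z \<omega>\<bar>})"
      using Z by (intro finite_Lim_measure_decseq) (auto simp: decseq_def intro: order_trans le_less_trans)
    moreover have "(\<Inter>n::nat. {\<omega>\<in>space M. real n < \<bar>Z \<omega>\<bar>}) = {}"
    proof -
      have "\<exists>n::nat. \<not> real n < \<bar>Z \<omega>\<bar>" for \<omega>
        using real_arch_simple[of "\<bar>Z \<omega>\<bar>"] by (auto simp: not_less)
      then show ?thesis by auto
    qed
    ultimately have "(\<lambda>n::nat. prob {\<omega>\<in>space M. real n < \<bar>Z \<omega>\<bar>}) \<longlonglongrightarrow> 0" by simp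
    then have "\<forall>\<^sub>F n::nat in sequentially. prob {\<omega>\<in>space M. real n < \<bar>Z \<omega>\<bar>} < e" by (rule order_tendstoD) (rule e)
    then have "\<forall>\<^sub>F n::nat in sequentially. prob {\<omega>\<in>space M. real n < \<bar>Z \<omega>\<bar>} < e \<and> 0 < n"
      by (intro eventually_conj eventually_gt_at_top)
    then obtain n :: nat where "prob {\<omega>\<in>space M. real n < \<bar>Z \<omega>\<bar>} < e" "0 < n"
      by (auto simp: eventually_sequentially)
    then show ?thesis by (intro exI[of _ "real n"]) auto
  qed
  have L_all: "(L f \<longlongrightarrow> 0) at_top" if f: "continuous_on UNIV f" and bdd: "bounded (range f)" for f :: "real \<Rightarrow> real"
  proof (rule order_tendstoI)
    fix \<epsilon> :: real assume "\<epsilon> < 0"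
    then show "\<forall>\<^sub>F t in at_top. \<epsilon> < L f t" using L0 by (intro always_eventually) (auto intro: less_le_trans)
  next
    fix \<epsilon> :: real assume \<epsilon>: "0 < \<epsilon>"
    obtain B where B: "\<And>x. \<bar>f x\<bar> \<le> B" using bdd by (auto simp: bounded_iff)
    have B0: "0 \<le> B" using order_trans[OF abs_ge_zero B[of 0]] .
    \<comment> \<open>\<open>e\<close> is the error on \<open>[-K, K]\<close>. Outside,
      \<open>f\<close> and \<open>g\<close> differ by at most \<open>B + (B + e)\<close>, which
      \<open>e \<le> 1\<close> turns into \<open>2 * B + 1\<close>, and \<open>p\<close> makes this
      bound times the tail probability at most \<open>\<epsilon> / 16\<close>.\<close>
    define e where "e = min 1 (\<epsilon> / 16)"
    define p where "p = \<epsilon> / (16 * (2 * B + 1))"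
    have e: "0 < e" "e \<le> 1" "e \<le> \<epsilon> / 16" using \<epsilon> by (auto simp: e_def)
    have p: "0 < p" using \<epsilon> B0 by (simp add: p_def)
    obtain K1 where K1: "0 < K1" "\<And>t. 0 \<le> t \<Longrightarrow> prob {\<omega>\<in>space M. K1 < \<bar>Y t \<omega>\<bar>} \<le> p" using tightY[OF p] by blast
    obtain K2 where K2: "0 < K2" "prob {\<omega>\<in>space M. K2 < \<bar>Z \<omega>\<bar>} \<le> p" using tightZ[OF p] by blast
    define K where "K = max K1 K2"
    have K: "0 < K" using K1(1) by (simp add: K_def)
    obtain g where g: "trig g" "\<And>x. \<bar>x\<bar> \<le> K \<Longrightarrow> \<bar>f x - g x\<bar> \<le> e" "\<And>x. \<bar>g x\<bar> \<le> B + e"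
      using trig_approximation[OF f B e(1) K] by blast
    have dist: "(\<integral>\<omega>. \<bar>f (V \<omega>) - g (V \<omega>)\<bar> \<partial>M) \<le> \<epsilon> / 8"
      if V: "V \<in> borel_measurable M" and K': "K' \<le> K" "prob {\<omega>\<in>space M. K' < \<bar>V \<omega>\<bar>} \<le> p" for V K'
    proof -
      let ?S = "{\<omega>\<in>space M. K' < \<bar>V \<omega>\<bar>}"
      have S: "?S \<in> sets M" using V by measurable
      have iS: "integrable M (indicator ?S :: _ \<Rightarrow> real)"
        by (rule integrable_real_indicator[OF S]) (simp add: emeasure_eq_measure)
      have "(\<integral>\<omega>. \<bar>f (V \<omega>) - g (V \<omega>)\<bar> \<partial>M) \<le> (\<integral>\<omega>. e + (2 * B + 1) * indicator ?S \<omega> \<partial>M)"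
      proof (rule integral_mono)
        show "integrable M (\<lambda>\<omega>. \<bar>f (V \<omega>) - g (V \<omega>)\<bar>)"
          by (intro integrable_abs Bochner_Integration.integrable_diff int[OF f B V] int[OF trig_continuous[OF g(1)] g(3) V])
        show "integrable M (\<lambda>\<omega>. e + (2 * B + 1) * indicator ?S \<omega>)" using iS by simp
        fix \<omega> assume \<omega>: "\<omega> \<in> space M"
        show "\<bar>f (V \<omega>) - g (V \<omega>)\<bar> \<le> e + (2 * B + 1) * indicator ?S \<omega>"
        proof (cases "\<bar>V \<omega>\<bar> \<le> K'")
          case True
          then have "\<bar>f (V \<omega>) - g (V \<omega>)\<bar> \<le> e" using K'(1) by (intro g(2)) simp
          then show ?thesis using True by (simp add: indicator_def)
        next
          case False
          have "\<bar>f (V \<omega>) - g (V \<omega>)\<bar> \<le> B + (B + e)" using B[of "V \<omega>"] g(3)[of "V \<omega>"] by linarith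
          then show ?thesis using False \<omega> by (simp add: indicator_def)
        qed
      qed
      also have "\<dots> = e + (2 * B + 1) * prob ?S"
        using iS by (simp add: prob_space Int_absorb2[OF sets.sets_into_space[OF S]])
      also have "\<dots> \<le> \<epsilon> / 16 + (2 * B + 1) * p" using e(3) K'(2) B0 by (intro add_mono mult_left_mono) auto
      also have "(2 * B + 1) * p = \<epsilon> / 16" using B0 by (simp add: p_def field_simps)
      finally show ?thesis by simp
    qed
    have "\<forall>\<^sub>F t in at_top. L g t < \<epsilon> / 4" using L_trig[OF g(1)] by (rule order_tendstoD) (use \<epsilon> in simp)
    then show "\<forall>\<^sub>F t in at_top. L f t < \<epsilon>" using ev0
    proof eventually_elim
      case (elim t)
      have "L f t \<le> L g t + 2 * (\<integral>\<omega>. \<bar>f (Y t \<omega>) - g (Y t \<omega>)\<bar> \<partial>M) + 2 * (\<integral>\<omega>. \<bar>f (Z \<omega>) - g (Z \<omega>)\<bar> \<partial>M)"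
        by (rule L_split[OF int[OF f B Y[OF elim(2)]] int[OF f B Z] int[OF trig_continuous[OF g(1)] g(3) Y[OF elim(2)]] int[OF trig_continuous[OF g(1)] g(3) Z]])
      also have "\<dots> \<le> L g t + 2 * (\<epsilon> / 8) + 2 * (\<epsilon> / 8)"
        by (intro add_mono mult_left_mono order.refl dist[OF Y[OF elim(2)] _ K1(2)[OF elim(2)]] dist[OF Z _ K2(2)]) (auto simp: K_def)
      also have "\<dots> < \<epsilon>" using elim(1) \<epsilon> by simp
      finally show ?case .
    qed
  qed
  show ?thesis
    unfolding cond_law_tendsto_in_prob_def tendsto_in_prob_def
  proof (intro allI impI)
    fix f :: "real \<Rightarrow> real" and \<epsilon> :: real
    assume f: "continuous_on UNIV f" "bounded (range f)" and \<epsilon>: "0 < \<epsilon>"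
    obtain B where B: "\<And>x. \<bar>f x\<bar> \<le> B" using f(2) by (auto simp: bounded_iff)
    let ?D = "\<lambda>t \<omega>. real_cond_exp M (H t) (\<lambda>\<omega>. f (Y t \<omega>)) \<omega> - real_cond_exp M G (\<lambda>\<omega>. f (Z \<omega>)) \<omega>"
    have le: "prob {\<omega>\<in>space M. \<epsilon> < \<bar>?D t \<omega>\<bar>} \<le> L f t / \<epsilon>" if t: "0 \<le> t" for t
    proof -
      have i: "integrable M (\<lambda>\<omega>. \<bar>?D t \<omega>\<bar>)"
        using sigma_finite_subalgebra.real_cond_exp_int(1)[OF sH[of t] int[OF f(1) B Y[OF t]]]
          sigma_finite_subalgebra.real_cond_exp_int(1)[OF sG int[OF f(1) B Z]] by auto
      have "prob {\<omega>\<in>space M. \<epsilon> < \<bar>?D t \<omega>\<bar>} \<le> prob {\<omega>\<in>space M. \<epsilon> \<le> \<bar>?D t \<omega>\<bar>}"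
        using i by (intro finite_measure_mono) auto
      also have "\<dots> \<le> L f t / \<epsilon>"
        unfolding L_def by (rule integral_Markov_inequality_measure[OF i, of "{}"]) (use \<epsilon> in auto)
      finally show ?thesis .
    qed
    have "((\<lambda>t. L f t / \<epsilon>) \<longlongrightarrow> 0 / \<epsilon>) at_top" using \<epsilon> by (intro tendsto_divide tendsto_const L_all f) auto
    then have lim: "((\<lambda>t. L f t / \<epsilon>) \<longlongrightarrow> 0) at_top" by simp
    show "((\<lambda>t. prob {\<omega>\<in>space M. \<epsilon> < \<bar>?D t \<omega>\<bar>}) \<longlongrightarrow> 0) at_top"
      by (rule tendsto_sandwich[OF _ eventually_mono[OF ev0 le] tendsto_const lim]) simp_all
  qed
qed

section \<open>Conditional expectations involving a variable independent of the
  \<sigma>-algebra\<close>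

lemma (in prob_space) distr_pair_indep:
  assumes G: "subalgebra M G" and X: "X \<in> borel_measurable M"
    and indep: "indep_set (sets G) (sets (vimage_algebra (space M) X borel))"
  shows "distr M G (\<lambda>\<omega>. \<omega>) \<Otimes>\<^sub>M distr M borel X = distr M (G \<Otimes>\<^sub>M borel) (\<lambda>\<omega>. (\<omega>, X \<omega>))"
proof -
  have id: "(\<lambda>\<omega>. \<omega>) \<in> measurable M G"
    using G by (auto simp: subalgebra_def measurable_def vimage_ident dest: sets.sets_into_space)
  have m: "(\<lambda>\<omega>. (\<omega>, X \<omega>)) \<in> measurable M (G \<Otimes>\<^sub>M borel)" by (rule measurable_Pair[OF id X])
  interpret \<mu>: prob_space "distr M G (\<lambda>\<omega>. \<omega>)" by (rule prob_space_distr[OF id])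
  interpret \<nu>: prob_space "distr M borel X" by (rule prob_space_distr[OF X])
  show ?thesis
  proof (rule pair_measure_eqI)
    fix A B assume "A \<in> sets (distr M G (\<lambda>\<omega>. \<omega>))" "B \<in> sets (distr M borel X)"
    then have A: "A \<in> sets G" and B: "B \<in> sets borel" by simp_all
    let ?B = "X -` B \<inter> space M"
    have AM: "A \<subseteq> space M" using sets.sets_into_space[OF A] G by (simp add: subalgebra_def)
    have "?B \<in> sets (vimage_algebra (space M) X borel)" by (rule in_vimage_algebra[OF B])
    then have "prob (A \<inter> ?B) = prob A * prob ?B" using A indep unfolding indep_sets2_eq by blast
    then have "emeasure M (A \<inter> ?B) = emeasure M A * emeasure M ?B"
      by (simp add: emeasure_eq_measure ennreal_mult)
    moreover have "emeasure (distr M G (\<lambda>\<omega>. \<omega>)) A = emeasure M A"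
      using A AM by (simp add: emeasure_distr[OF id] Int_absorb2)
    moreover have "emeasure (distr M borel X) B = emeasure M ?B"
      using B X by (simp add: emeasure_distr)
    moreover have "emeasure (distr M (G \<Otimes>\<^sub>M borel) (\<lambda>\<omega>. (\<omega>, X \<omega>))) (A \<times> B) = emeasure M (A \<inter> ?B)"
      using A B AM by (subst emeasure_distr[OF m]) (auto intro!: arg_cong[where f="emeasure M"])
    ultimately show "emeasure (distr M G (\<lambda>\<omega>. \<omega>)) A * emeasure (distr M borel X) B =
        emeasure (distr M (G \<Otimes>\<^sub>M borel) (\<lambda>\<omega>. (\<omega>, X \<omega>))) (A \<times> B)" by simp
  qed (auto intro: \<mu>.sigma_finite_measure_axioms \<nu>.sigma_finite_measure_axioms cong: sets_pair_measure_cong)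
qed

lemma (in prob_space) freeze_indep:
  fixes h :: "real \<Rightarrow> real \<Rightarrow> real"
  assumes G: "subalgebra M G" and X: "X \<in> borel_measurable M"
    and indep: "indep_set (sets G) (sets (vimage_algebra (space M) X borel))"
    and U: "U \<in> borel_measurable G" and h: "case_prod h \<in> borel_measurable (borel \<Otimes>\<^sub>M borel)"
    and h1: "\<And>u x. \<bar>h u x\<bar> \<le> 1"
  shows "AE \<omega> in M. real_cond_exp M G (\<lambda>\<omega>. h (U \<omega>) (X \<omega>)) \<omega> = (\<integral>x. h (U \<omega>) x \<partial>distr M borel X)"
proof -
  interpret S: finite_measure_subalgebra M G
    using G by (intro finite_measure_subalgebra.intro finite_measure_axioms finite_measure_subalgebra_axioms.intro)
  let ?\<mu> = "distr M G (\<lambda>\<omega>. \<omega>)" and ?\<nu> = "distr M borel X"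
  have id: "(\<lambda>\<omega>. \<omega>) \<in> measurable M G"
    using G by (auto simp: subalgebra_def measurable_def vimage_ident dest: sets.sets_into_space)
  have m: "(\<lambda>\<omega>. (\<omega>, X \<omega>)) \<in> measurable M (G \<Otimes>\<^sub>M borel)" by (rule measurable_Pair[OF id X])
  interpret \<mu>: prob_space ?\<mu> by (rule prob_space_distr[OF id])
  interpret \<nu>: prob_space ?\<nu> by (rule prob_space_distr[OF X])
  interpret P: pair_prob_space ?\<mu> ?\<nu> ..
  have UM: "U \<in> borel_measurable M" by (rule measurable_from_subalg[OF G U])
  have hU: "(\<lambda>\<omega>. \<integral>x. h (U \<omega>) x \<partial>?\<nu>) \<in> borel_measurable G"
  proof -
    have "(\<lambda>u. \<integral>x. h u x \<partial>?\<nu>) \<in> borel_measurable borel"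
      by (rule \<nu>.borel_measurable_lebesgue_integral) (use h in \<open>simp cong: measurable_cong_sets\<close>)
    then show ?thesis by (rule measurable_compose[OF U])
  qed
  show ?thesis
  proof (rule S.real_cond_exp_charact)
    have hm: "(\<lambda>\<omega>. h (U \<omega>) (X \<omega>)) \<in> borel_measurable M"
      using measurable_compose[OF measurable_Pair[OF UM X] h] by simp
    show "integrable M (\<lambda>\<omega>. h (U \<omega>) (X \<omega>))"
      by (rule integrable_const_bound[where B=1, OF _ hm]) (simp add: h1)
    have b: "\<bar>\<integral>x. h (U \<omega>) x \<partial>?\<nu>\<bar> \<le> 1" for \<omega>
    proof -
      have "(\<lambda>x. h (U \<omega>) x) \<in> borel_measurable borel" using measurable_compose[OF measurable_Pair1' h] by simp
      then have i: "integrable ?\<nu> (\<lambda>x. h (U \<omega>) x)" by (intro \<nu>.integrable_const_bound[where B=1]) (auto simp: h1)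
      have "\<bar>\<integral>x. h (U \<omega>) x \<partial>?\<nu>\<bar> \<le> (\<integral>x. \<bar>h (U \<omega>) x\<bar> \<partial>?\<nu>)" by (rule integral_abs_bound)
      also have "\<dots> \<le> (\<integral>x. 1 \<partial>?\<nu>)" by (intro integral_mono integrable_abs i) (auto simp: h1)
      finally show ?thesis using \<nu>.prob_space by simp
    qed
    show "integrable M (\<lambda>\<omega>. \<integral>x. h (U \<omega>) x \<partial>?\<nu>)"
      by (rule integrable_const_bound[where B=1]) (auto simp: b intro: measurable_from_subalg[OF G hU])
    show "(\<lambda>\<omega>. \<integral>x. h (U \<omega>) x \<partial>?\<nu>) \<in> borel_measurable G" by (rule hU)
    fix A assume A: "A \<in> sets G"
    let ?H = "\<lambda>(\<omega>, x). indicator A \<omega> * h (U \<omega>) x"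
    have HH: "?H \<in> borel_measurable (G \<Otimes>\<^sub>M borel)"
    proof -
      have "(\<lambda>p. h (U (fst p)) (snd p)) \<in> borel_measurable (G \<Otimes>\<^sub>M borel)"
        using measurable_compose[OF measurable_Pair[OF measurable_compose[OF measurable_fst U] measurable_snd] h] by simp
      moreover have "(\<lambda>p. indicator A (fst p) :: real) \<in> borel_measurable (G \<Otimes>\<^sub>M borel)"
        using A by (intro measurable_compose[OF measurable_fst borel_measurable_indicator])
      ultimately show ?thesis unfolding case_prod_beta' by (rule borel_measurable_times[rotated])
    qed
    have HH': "?H \<in> borel_measurable (?\<mu> \<Otimes>\<^sub>M ?\<nu>)" using HH by (simp cong: measurable_cong_sets)
    have I: "integrable (?\<mu> \<Otimes>\<^sub>M ?\<nu>) ?H"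
      by (rule P.integrable_const_bound[where B=1, OF _ HH']) (auto simp: indicator_def h1)
    have "(\<integral>\<omega>\<in>A. h (U \<omega>) (X \<omega>) \<partial>M) = (\<integral>\<omega>. ?H (\<omega>, X \<omega>) \<partial>M)"
      by (simp add: set_lebesgue_integral_def)
    also have "\<dots> = (\<integral>p. ?H p \<partial>(?\<mu> \<Otimes>\<^sub>M ?\<nu>))"
      unfolding distr_pair_indep[OF G X indep] by (rule integral_distr[OF m HH, symmetric])
    also have "\<dots> = (\<integral>\<omega>. \<integral>x. ?H (\<omega>, x) \<partial>?\<nu> \<partial>?\<mu>)" by (rule P.integral_fst'[OF I, symmetric])
    also have "\<dots> = (\<integral>\<omega>. indicator A \<omega> * (\<integral>x. h (U \<omega>) x \<partial>?\<nu>) \<partial>?\<mu>)" by simp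
    also have "\<dots> = (\<integral>\<omega>. indicator A \<omega> * (\<integral>x. h (U \<omega>) x \<partial>?\<nu>) \<partial>M)"
      by (rule integral_distr[OF id]) (intro borel_measurable_times borel_measurable_indicator A hU)
    finally show "(\<integral>\<omega>\<in>A. h (U \<omega>) (X \<omega>) \<partial>M) = (\<integral>\<omega>\<in>A. (\<integral>x. h (U \<omega>) x \<partial>?\<nu>) \<partial>M)"
      by (simp add: set_lebesgue_integral_def)
  qed
qed

section \<open>The branching process as a multiplicative cascade\<close>

text \<open>The default values agree in the divergent case: \<open>infsum\<close> is 0 there, and so
  is \<open>enn2real\<close> at infinity.\<close>

lemma infsum_nonneg_eq_nn_integral:
  fixes h :: "'i \<Rightarrow> real"
  assumes h: "\<And>i. i \<in> A \<Longrightarrow> 0 \<le> h i"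
  shows "infsum h A = enn2real (\<integral>\<^sup>+i. ennreal (h i) \<partial>count_space A)"
proof (cases "h summable_on A")
  case True
  then have "(\<lambda>i. norm (h i)) summable_on A"
    using h by (subst summable_on_cong[of A _ h]) auto
  then have "Infinite_Set_Sum.abs_summable_on h A" by (rule abs_summable_equivalent[THEN iffD1])
  then show ?thesis
    using h by (simp add: infsetsum_infsum[symmetric] nn_integral_conv_infsetsum infsetsum_nonneg)
next
  case False
  have "(\<integral>\<^sup>+i. ennreal (h i) \<partial>count_space A) = \<infinity>"
  proof (rule ccontr)
    assume "(\<integral>\<^sup>+i. ennreal (h i) \<partial>count_space A) \<noteq> \<infinity>"
    moreover have "(\<integral>\<^sup>+i. ennreal (norm (h i)) \<partial>count_space A) = (\<integral>\<^sup>+i. ennreal (h i) \<partial>count_space A)"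
      using h by (intro nn_integral_cong) simp
    ultimately have "integrable (count_space A) h"
      by (intro integrableI_bounded) (auto simp: less_top)
    then have "Infinite_Set_Sum.abs_summable_on h A"
      by (simp only: Infinite_Set_Sum.abs_summable_on_def)
    then have "(\<lambda>i. norm (h i)) summable_on A" by (rule abs_summable_equivalent[THEN iffD2])
    then have "h summable_on A" by (rule abs_summable_summable)
    then show False using False by contradiction
  qed
  then show ?thesis using False by (simp add: infsum_not_exists)
qed

text \<open>The guard \<open>0 < x k \<zeta>\<close> only matters for measures \<open>\<zeta>\<close> that do not occur as realizations.\<close>
definition discount :: "(nat \<Rightarrow> real measure \<Rightarrow> real) \<Rightarrow> real \<Rightarrow> nat \<Rightarrow> real measure \<Rightarrow> real" where
  "discount x \<alpha> k \<zeta> = (if of_nat k < npoints \<zeta> \<and> 0 < x k \<zeta> then exp (- \<alpha> * x k \<zeta>) else 0)"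

locale branching =
  fixes M :: "'w measure" and \<xi> :: "nat list \<Rightarrow> 'w \<Rightarrow> real measure" and x :: "nat \<Rightarrow> real measure \<Rightarrow> real"
    and \<alpha> :: real
  assumes gbp: "general_branching_process M \<xi> x" and \<alpha>: "0 < \<alpha>"
begin

lemma measurable_x [measurable]: "x k \<in> borel_measurable (measure_algebra halfline)"
  using gbp by (simp add: general_branching_process_def)

lemma measurable_npoints [measurable]: "npoints \<in> borel_measurable (measure_algebra halfline)"
  unfolding npoints_def[abs_def] by measurable

end

sublocale branching \<subseteq> cascade M \<xi> "discount x \<alpha>"
proof (intro cascade.intro cascade_axioms.intro)
  show "prob_space M" using gbp by (simp add: general_branching_process_def)
  show "prob_space.indep_vars M (\<lambda>_. measure_algebra halfline) \<xi> UNIV"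
    using gbp by (simp add: general_branching_process_def)
  show "distr M (measure_algebra halfline) (\<xi> u) = distr M (measure_algebra halfline) (\<xi> [])" for u
    using gbp unfolding general_branching_process_def by blast
  show "discount x \<alpha> k \<in> borel_measurable (measure_algebra halfline)" for k
    unfolding discount_def[abs_def] by measurable
  show "0 \<le> discount x \<alpha> k \<zeta>" "discount x \<alpha> k \<zeta> < 1" for k \<zeta>
    using \<alpha> by (simp_all add: discount_def)
qed

context branching
begin

lemma enumerates_xi: "\<omega> \<in> space M \<Longrightarrow> enumerates x (\<xi> u \<omega>)"
  using gbp by (simp add: general_branching_process_def)

lemma discount_xi:
  assumes "\<omega> \<in> space M"
  shows "discount x \<alpha> k (\<xi> u \<omega>) = (if of_nat k < npoints (\<xi> u \<omega>) then exp (- \<alpha> * x k (\<xi> u \<omega>)) else 0)"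
  using enumerates_xi[OF assms, of u] by (simp add: discount_def enumerates_def)

section \<open>Intensity measure and step law\<close>

lemma space_intensity: "space (intensity M \<xi>) = {0<..}"
  using sets_eq_imp_space_eq[OF sets_intensity, of M \<xi>] by simp

lemma measurable_intensity: "g \<in> borel_measurable borel \<Longrightarrow> g \<in> borel_measurable (intensity M \<xi>)"
  unfolding measurable_cong_sets[OF sets_intensity refl] halfline_def by (rule measurable_restrict_space1)

text \<open>Campbell's formula. For indicators it is the enumeration of the atoms combined with the
  definition of the intensity; the other cases are linearity and monotone convergence.\<close>

lemma campbell:
  assumes "g \<in> borel_measurable borel"
  shows "(\<Sum>k. \<integral>\<^sup>+\<omega>. (if of_nat k < npoints (\<xi> [] \<omega>) then g (x k (\<xi> [] \<omega>)) else 0) \<partial>M) = (\<integral>\<^sup>+s. g s \<partial>intensity M \<xi>)"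
  using assms
proof (induction rule: borel_measurable_induct)
  case (cong f g)
  have "f = g" using cong(3) by (simp add: fun_eq_iff)
  show ?case unfolding \<open>f = g\<close> by (rule cong(4))
next
  case (set A)
  note [measurable] = set
  \<comment> \<open>The intensity lives on the open half-line, so a Borel set is cut down to its
    positive part, which contains the same points of the process.\<close>
  have Ah: "A \<inter> {0<..} \<in> sets halfline"
    using set by (auto simp: halfline_def sets_restrict_space)
  have "(\<Sum>k. \<integral>\<^sup>+\<omega>. (if of_nat k < npoints (\<xi> [] \<omega>) then indicator A (x k (\<xi> [] \<omega>)) else 0) \<partial>M) =
      (\<integral>\<^sup>+\<omega>. (\<Sum>k. if of_nat k < npoints (\<xi> [] \<omega>) then indicator A (x k (\<xi> [] \<omega>)) else 0) \<partial>M)"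
    by (intro nn_integral_suminf[symmetric]) measurable
  also have "\<dots> = (\<integral>\<^sup>+\<omega>. emeasure (\<xi> [] \<omega>) (A \<inter> {0<..}) \<partial>M)"
  proof (rule nn_integral_cong)
    fix \<omega> assume \<omega>: "\<omega> \<in> space M"
    have "emeasure (\<xi> [] \<omega>) (A \<inter> {0<..}) = (\<Sum>k. if of_nat k < npoints (\<xi> [] \<omega>) then indicator (A \<inter> {0<..}) (x k (\<xi> [] \<omega>)) else 0)"
      using enumerates_xi[OF \<omega>, of "[]"] Ah unfolding enumerates_def by blast
    also have "\<dots> = (\<Sum>k. if of_nat k < npoints (\<xi> [] \<omega>) then indicator A (x k (\<xi> [] \<omega>)) else 0)"
      using enumerates_xi[OF \<omega>, of "[]"] unfolding enumerates_def by (intro suminf_cong) (simp add: indicator_def)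
    finally show "(\<Sum>k. if of_nat k < npoints (\<xi> [] \<omega>) then indicator A (x k (\<xi> [] \<omega>)) else 0) = emeasure (\<xi> [] \<omega>) (A \<inter> {0<..})"
      by (rule sym)
  qed
  also have "\<dots> = emeasure (intensity M \<xi>) (A \<inter> {0<..})" by (rule emeasure_intensity[OF gbp Ah, symmetric])
  also have "\<dots> = (\<integral>\<^sup>+s. indicator (A \<inter> {0<..}) s \<partial>intensity M \<xi>)"
    using Ah by (simp add: sets_intensity)
  also have "\<dots> = (\<integral>\<^sup>+s. indicator A s \<partial>intensity M \<xi>)"
    by (rule nn_integral_cong) (simp add: space_intensity indicator_def)
  finally show ?case .
next
  case (mult u c)
  note [measurable] = mult(2)
  have "(\<integral>\<^sup>+\<omega>. (if of_nat k < npoints (\<xi> [] \<omega>) then c * u (x k (\<xi> [] \<omega>)) else 0) \<partial>M) =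
      c * (\<integral>\<^sup>+\<omega>. (if of_nat k < npoints (\<xi> [] \<omega>) then u (x k (\<xi> [] \<omega>)) else 0) \<partial>M)" for k
    by (subst nn_integral_cmult[symmetric]) (auto intro!: nn_integral_cong)
  then show ?case
    using mult(4) by (simp add: ennreal_suminf_cmult nn_integral_cmult measurable_intensity)
next
  case (add u v)
  note [measurable] = add.hyps(1,3)
  have "(\<integral>\<^sup>+\<omega>. (if of_nat k < npoints (\<xi> [] \<omega>) then v (x k (\<xi> [] \<omega>)) + u (x k (\<xi> [] \<omega>)) else 0) \<partial>M) =
      (\<integral>\<^sup>+\<omega>. (if of_nat k < npoints (\<xi> [] \<omega>) then v (x k (\<xi> [] \<omega>)) else 0) \<partial>M) +
      (\<integral>\<^sup>+\<omega>. (if of_nat k < npoints (\<xi> [] \<omega>) then u (x k (\<xi> [] \<omega>)) else 0) \<partial>M)" for k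
    by (subst nn_integral_add[symmetric]) (auto intro!: nn_integral_cong)
  then show ?case
    using add.IH by (simp add: suminf_add[symmetric] nn_integral_add measurable_intensity)
next
  case (seq U)
  note [measurable] = seq.hyps(1)
  have mono: "U i s \<le> U j s" if "i \<le> j" for i j s using incseqD[OF seq.hyps(3) that] by (simp add: le_fun_def)
  let ?I = "\<lambda>k i. \<integral>\<^sup>+\<omega>. (if of_nat k < npoints (\<xi> [] \<omega>) then U i (x k (\<xi> [] \<omega>)) else 0) \<partial>M"
  have "(\<integral>\<^sup>+\<omega>. (if of_nat k < npoints (\<xi> [] \<omega>) then (SUP i. U i) (x k (\<xi> [] \<omega>)) else 0) \<partial>M) = (SUP i. ?I k i)" for k
  proof -
    have "(\<integral>\<^sup>+\<omega>. (if of_nat k < npoints (\<xi> [] \<omega>) then (SUP i. U i) (x k (\<xi> [] \<omega>)) else 0) \<partial>M) =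
        (\<integral>\<^sup>+\<omega>. (SUP i. if of_nat k < npoints (\<xi> [] \<omega>) then U i (x k (\<xi> [] \<omega>)) else 0) \<partial>M)"
      by (rule nn_integral_cong) (simp add: image_comp)
    also have "\<dots> = (SUP i. ?I k i)"
      by (rule nn_integral_monotone_convergence_SUP) (auto simp: incseq_def le_fun_def mono)
    finally show ?thesis .
  qed
  then have "(\<Sum>k. \<integral>\<^sup>+\<omega>. (if of_nat k < npoints (\<xi> [] \<omega>) then (SUP i. U i) (x k (\<xi> [] \<omega>)) else 0) \<partial>M) = (\<Sum>k. SUP i. ?I k i)"
    by simp
  also have "\<dots> = (SUP i. \<Sum>k. ?I k i)"
    by (rule ennreal_suminf_SUP_eq) (auto simp: incseq_def mono intro!: nn_integral_mono)
  also have "\<dots> = (SUP i. \<integral>\<^sup>+s. U i s \<partial>intensity M \<xi>)" by (simp add: seq.IH)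
  also have "\<dots> = (\<integral>\<^sup>+s. (SUP i. U i s) \<partial>intensity M \<xi>)"
    by (rule nn_integral_monotone_convergence_SUP[symmetric]) (auto intro: seq.hyps(3) measurable_intensity)
  also have "\<dots> = (\<integral>\<^sup>+s. (SUP i. U i) s \<partial>intensity M \<xi>)" by (simp add: image_comp)
  finally show ?case .
qed

text \<open>Displacements are measured in units of \<open>1 / \<alpha>\<close>, so that a child displaced by \<open>y\<close> has weight \<open>e\<^bsup>-y\<^esup>\<close>.\<close>
definition step_law :: "real measure" where
  "step_law = distr (density (intensity M \<xi>) (\<lambda>s. ennreal (exp (- \<alpha> * s)))) borel (\<lambda>s. \<alpha> * s)"

lemma nn_integral_step_law:
  assumes [measurable]: "g \<in> borel_measurable borel"
  shows "(\<integral>\<^sup>+y. g y \<partial>step_law) = (\<integral>\<^sup>+s. ennreal (exp (- \<alpha> * s)) * g (\<alpha> * s) \<partial>intensity M \<xi>)"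
proof -
  have m: "(\<lambda>s. \<alpha> * s) \<in> measurable (density (intensity M \<xi>) (\<lambda>s. ennreal (exp (- \<alpha> * s)))) borel"
    unfolding measurable_cong_sets[OF sets_density refl] by (rule measurable_intensity) simp
  show ?thesis
    unfolding step_law_def
    by (subst nn_integral_distr[OF m]) (auto intro!: nn_integral_density measurable_intensity)
qed

text \<open>Campbell's formula with displacements expressed by weights: \<open>- ln\<close> of a
  positive discount is \<open>\<alpha>\<close> times the displacement, and a vanishing discount
  removes the undefined logarithm.\<close>

lemma discount_step_law:
  assumes g: "g \<in> borel_measurable borel"
  shows "(\<integral>\<^sup>+y. g y \<partial>step_law) =
    (\<Sum>k. \<integral>\<^sup>+\<omega>. ennreal (discount x \<alpha> k (\<xi> [] \<omega>)) * g (- ln (discount x \<alpha> k (\<xi> [] \<omega>))) \<partial>M)"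
proof -
  have "(\<integral>\<^sup>+y. g y \<partial>step_law) =
      (\<Sum>k. \<integral>\<^sup>+\<omega>. (if of_nat k < npoints (\<xi> [] \<omega>) then ennreal (exp (- \<alpha> * x k (\<xi> [] \<omega>))) * g (\<alpha> * x k (\<xi> [] \<omega>)) else 0) \<partial>M)"
    unfolding nn_integral_step_law[OF g] using g by (subst campbell) auto
  also have "\<dots> = (\<Sum>k. \<integral>\<^sup>+\<omega>. ennreal (discount x \<alpha> k (\<xi> [] \<omega>)) * g (- ln (discount x \<alpha> k (\<xi> [] \<omega>))) \<partial>M)"
    by (intro suminf_cong nn_integral_cong) (simp add: discount_xi)
  finally show ?thesis .
qed

section \<open>Birth times, coming generations and Nerman's martingale in terms of weights\<close>

lemma first_generation_sum_eq:
  assumes \<omega>: "\<omega> \<in> space M"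
  shows "first_generation_sum \<xi> x \<alpha> \<omega> = enn2real (tot 1 (fam \<omega>))"
proof -
  let ?K = "{k. of_nat k < npoints (\<xi> [] \<omega>)}"
  have "first_generation_sum \<xi> x \<alpha> \<omega> = enn2real (\<integral>\<^sup>+k. ennreal (exp (- \<alpha> * x k (\<xi> [] \<omega>))) \<partial>count_space ?K)"
    unfolding first_generation_sum_def by (rule infsum_nonneg_eq_nn_integral) simp
  also have "(\<integral>\<^sup>+k. ennreal (exp (- \<alpha> * x k (\<xi> [] \<omega>))) \<partial>count_space ?K) = (\<integral>\<^sup>+k. ennreal (discount x \<alpha> k (\<xi> [] \<omega>)) \<partial>count_space UNIV)"
    by (subst nn_integral_count_space_indicator) (auto intro!: nn_integral_cong simp: discount_xi[OF \<omega>])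
  also have "\<dots> = tot 1 (fam \<omega>)" by (simp add: nn_integral_count_space_nat)
  finally show ?thesis .
qed

lemma birth_time_wt:
  assumes \<omega>: "\<omega> \<in> space M"
  shows "birth_time \<xi> x u \<omega> = \<infinity> \<and> wt u (fam \<omega>) = 0 \<or>
    (\<exists>r\<ge>0. birth_time \<xi> x u \<omega> = ereal r \<and> wt u (fam \<omega>) = exp (- \<alpha> * r))"
proof (induction u rule: rev_induct)
  case Nil
  show ?case by (intro disjI2 exI[of _ 0]) simp
next
  case (snoc k u)
  show ?case
  proof (cases "birth_time \<xi> x u \<omega> = \<infinity> \<and> wt u (fam \<omega>) = 0")
    case True
    then show ?thesis by (simp add: birth_time_snoc wt_snoc displacement_def)
  next
    case False
    then obtain r where r: "0 \<le> r" "birth_time \<xi> x u \<omega> = ereal r" "wt u (fam \<omega>) = exp (- \<alpha> * r)"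
      using snoc.IH by blast
    show ?thesis
    proof (cases "of_nat k < npoints (\<xi> u \<omega>)")
      case True
      have "0 < x k (\<xi> u \<omega>)" using enumerates_xi[OF \<omega>, of u] True by (simp add: enumerates_def)
      then show ?thesis
        using r True
        by (intro disjI2 exI[of _ "r + x k (\<xi> u \<omega>)"])
          (simp add: birth_time_snoc wt_snoc displacement_def fam_apply[of _ u] discount_xi[OF \<omega>] exp_add[symmetric] distrib_left)
    next
      case False
      then show ?thesis using r by (simp add: birth_time_snoc wt_snoc displacement_def fam_apply[of _ u] discount_xi[OF \<omega>])
    qed
  qed
qed

lemma wt_birth_time:
  assumes \<omega>: "\<omega> \<in> space M"
  shows "0 < wt u (fam \<omega>) \<longleftrightarrow> birth_time \<xi> x u \<omega> < \<infinity>"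
    and "exp (- \<alpha> * t) \<le> wt u (fam \<omega>) \<longleftrightarrow> birth_time \<xi> x u \<omega> \<le> ereal t"
    and "birth_time \<xi> x u \<omega> < \<infinity> \<Longrightarrow> exp (- \<alpha> * real_of_ereal (birth_time \<xi> x u \<omega>)) = wt u (fam \<omega>)"
  using birth_time_wt[OF \<omega>, of u] \<alpha> by auto

text \<open>The coming generation refers to the parent only, the stopping line to all strict
  ancestors. Weights do not increase along a line of descent, so the condition on the parent implies
  those on the other ancestors.\<close>

lemma coming_generation_iff:
  assumes \<omega>: "\<omega> \<in> space M" and t: "0 \<le> t"
  shows "u \<in> coming_generation \<xi> x t \<omega> \<longleftrightarrow> st u (exp (- \<alpha> * t)) (fam \<omega>)"
proof -
  have 1: "ereal t < birth_time \<xi> x u \<omega> \<longleftrightarrow> wt u (fam \<omega>) < exp (- \<alpha> * t)"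
    using wt_birth_time(2)[OF \<omega>, of t u] by (simp add: not_le[symmetric])
  have T1: "exp (- \<alpha> * t) \<le> 1" using \<alpha> t by simp
  have 2: "(\<forall>j<length u. exp (- \<alpha> * t) \<le> wt (take j u) (fam \<omega>)) \<longleftrightarrow> exp (- \<alpha> * t) \<le> wt (butlast u) (fam \<omega>)"
  proof
    assume *: "\<forall>j<length u. exp (- \<alpha> * t) \<le> wt (take j u) (fam \<omega>)"
    show "exp (- \<alpha> * t) \<le> wt (butlast u) (fam \<omega>)"
    \<comment> \<open>For the root the hypothesis is empty and \<open>butlast [] = []\<close> has
      weight 1, so \<open>t \<ge> 0\<close> is needed here.\<close>
    proof (cases "u = []")
      case True
      then show ?thesis using T1 by simp
    next
      case False
      then show ?thesis using *[rule_format, of "length u - 1"] by (simp add: butlast_conv_take)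
    qed
  next
    assume *: "exp (- \<alpha> * t) \<le> wt (butlast u) (fam \<omega>)"
    show "\<forall>j<length u. exp (- \<alpha> * t) \<le> wt (take j u) (fam \<omega>)"
    proof (intro allI impI)
      fix j assume "j < length u"
      then have "take j u = take j (butlast u)" by (simp add: take_butlast)
      then have "wt (butlast u) (fam \<omega>) \<le> wt (take j u) (fam \<omega>)"
        by (simp add: wt_antimono take_is_prefix)
      then show "exp (- \<alpha> * t) \<le> wt (take j u) (fam \<omega>)" using * by simp
    qed
  qed
  show ?thesis
    unfolding coming_generation_def mem_Collect_eq st_iff 1 2 wt_birth_time(1)[OF \<omega>] wt_birth_time(2)[OF \<omega>, symmetric]
    by blast
qed

lemma nerman_eq:
  assumes \<omega>: "\<omega> \<in> space M" and t: "0 \<le> t"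
  shows "nerman \<xi> x \<alpha> t \<omega> = enn2real (Ls (exp (- \<alpha> * t)) (fam \<omega>))"
proof -
  let ?J = "coming_generation \<xi> x t \<omega>"
  have "nerman \<xi> x \<alpha> t \<omega> = enn2real (\<integral>\<^sup>+u. ennreal (exp (- \<alpha> * real_of_ereal (birth_time \<xi> x u \<omega>))) \<partial>count_space ?J)"
    unfolding nerman_def by (rule infsum_nonneg_eq_nn_integral) simp
  also have "(\<integral>\<^sup>+u. ennreal (exp (- \<alpha> * real_of_ereal (birth_time \<xi> x u \<omega>))) \<partial>count_space ?J) =
      (\<integral>\<^sup>+u. ennreal (wt u (fam \<omega>)) \<partial>count_space ?J)"
    by (intro nn_integral_cong arg_cong[where f=ennreal] wt_birth_time(3)[OF \<omega>]) (simp add: coming_generation_def)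
  also have "\<dots> = Ls (exp (- \<alpha> * t)) (fam \<omega>)"
    unfolding Ls_def by (subst nn_integral_count_space_indicator)
      (auto intro!: nn_integral_cong simp: coming_generation_iff[OF \<omega> t] indicator_def)
  finally show ?thesis .
qed

lemma nn_integral_tot_1: "(\<integral>\<^sup>+\<omega>. tot 1 (fam \<omega>) \<partial>M) = laplace (intensity M \<xi>) \<alpha>"
proof -
  have "(\<integral>\<^sup>+\<omega>. tot 1 (fam \<omega>) \<partial>M) = (\<Sum>k. \<integral>\<^sup>+\<omega>. ennreal (discount x \<alpha> k (\<xi> [] \<omega>)) \<partial>M)"
    by (simp add: nn_integral_suminf)
  also have "\<dots> = (\<integral>\<^sup>+y. 1 \<partial>step_law)" by (subst discount_step_law) simp_all
  also have "\<dots> = laplace (intensity M \<xi>) \<alpha>" by (subst nn_integral_step_law) (simp_all add: laplace_def)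
  finally show ?thesis .
qed

lemma step_law_mean:
  assumes "integrable (intensity M \<xi>) (\<lambda>s. s * exp (- \<alpha> * s))"
  shows "integrable step_law (\<lambda>y. y)" "(\<integral>y. y \<partial>step_law) = - \<alpha> * laplace_deriv (intensity M \<xi>) \<alpha>"
proof -
  let ?D = "density (intensity M \<xi>) (\<lambda>s. ennreal (exp (- \<alpha> * s)))"
  have m: "(\<lambda>s. \<alpha> * s) \<in> borel_measurable ?D" "(\<lambda>s. \<alpha> * s) \<in> borel_measurable (intensity M \<xi>)"
    "(\<lambda>s. exp (- \<alpha> * s)) \<in> borel_measurable (intensity M \<xi>)"
    unfolding measurable_cong_sets[OF sets_density refl] by (rule measurable_intensity, simp)+
  have eq: "exp (- \<alpha> * s) *\<^sub>R (\<alpha> * s) = \<alpha> * (s * exp (- \<alpha> * s))" for s by simp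
  have "integrable ?D (\<lambda>s. \<alpha> * s)"
    unfolding integrable_density[OF m(2,3) AE_I2[OF exp_ge_zero]] eq using assms by simp
  then show "integrable step_law (\<lambda>y. y)"
    unfolding step_law_def by (subst integrable_distr_eq[OF m(1)]) simp_all
  have "(\<integral>y. y \<partial>step_law) = (\<integral>s. \<alpha> * s \<partial>?D)"
    unfolding step_law_def by (subst integral_distr[OF m(1)]) simp_all
  also have "\<dots> = (\<integral>s. \<alpha> * (s * exp (- \<alpha> * s)) \<partial>intensity M \<xi>)"
    unfolding integral_density[OF m(2,3) AE_I2[OF exp_ge_zero]] eq ..
  also have "\<dots> = - \<alpha> * laplace_deriv (intensity M \<xi>) \<alpha>" by (simp add: laplace_deriv_def)
  finally show "(\<integral>y. y \<partial>step_law) = - \<alpha> * laplace_deriv (intensity M \<xi>) \<alpha>" .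
qed

text \<open>The exponential density is positive, so up to scaling by \<open>\<alpha>\<close> the
  step law and the intensity have the same null sets.\<close>

lemma step_law_lattice:
  assumes "AE y in step_law. y \<in> range (\<lambda>n::nat. d * real n)"
  shows "AE s in intensity M \<xi>. s \<in> range (\<lambda>n::nat. d / \<alpha> * real n)"
proof -
  let ?D = "density (intensity M \<xi>) (\<lambda>s. ennreal (exp (- \<alpha> * s)))"
  have m: "(\<lambda>s. \<alpha> * s) \<in> borel_measurable ?D" "(\<lambda>s. ennreal (exp (- \<alpha> * s))) \<in> borel_measurable (intensity M \<xi>)"
    unfolding measurable_cong_sets[OF sets_density refl] by (rule measurable_intensity, simp)+
  have "countable (range (\<lambda>n::nat. d * real n))" by simp
  then have "range (\<lambda>n::nat. d * real n) \<in> sets borel" by (rule sets.countable[rotated]) simp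
  then have "AE s in ?D. \<alpha> * s \<in> range (\<lambda>n::nat. d * real n)"
    using assms unfolding step_law_def by (subst (asm) AE_distr_iff[OF m(1)]) simp_all
  then have "AE s in intensity M \<xi>. \<alpha> * s \<in> range (\<lambda>n::nat. d * real n)"
    unfolding AE_density[OF m(2)] by simp
  then show ?thesis
  proof eventually_elim
    case (elim s)
    then obtain n :: nat where "\<alpha> * s = d * real n" by blast
    then have "s = d / \<alpha> * real n" using \<alpha> by (simp add: field_simps)
    then show ?case by blast
  qed
qed

subsection \<open>The filtrations\<close>

lemma sets_F_infty: "sets (F_infty M \<xi>) = sigma_sets (space M) (\<Union>n. sets (F_gen M \<xi> n))"
  unfolding F_infty_def
proof (rule sets_measure_of)
  show "(\<Union>n. sets (F_gen M \<xi> n)) \<subseteq> Pow (space M)"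
    using sets.space_closed[of "generated M \<xi> U" for U] by (auto simp: F_gen_def)
qed

lemma gen_subset_F_infty: "sets (gen U) \<subseteq> sets (F_infty M \<xi>)"
proof -
  have "\<xi> u -` A \<inter> space M \<in> sets (F_infty M \<xi>)" if "A \<in> sets N" for u A
  proof -
    have "\<xi> u -` A \<inter> space (gen {w. length w < Suc (length u)}) \<in> sets (gen {w. length w < Suc (length u)})"
      by (rule measurable_sets[OF measurable_xi_gen that]) simp
    then have "\<xi> u -` A \<inter> space M \<in> (\<Union>n. sets (F_gen M \<xi> n))" by (auto simp: F_gen_def)
    then show ?thesis unfolding sets_F_infty by (rule sigma_sets.Basic)
  qed
  then show ?thesis
    unfolding sets_gen using sets.top[of "F_infty M \<xi>"] by (intro sets.sigma_sets_subset') auto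
qed

lemma subalgebra_F_infty: "subalgebra M (F_infty M \<xi>)"
  unfolding subalgebra_def sets_F_infty
  using gen_subset_M by (auto simp: F_gen_def intro!: sets.sigma_sets_subset)

lemma measurable_fam_F_infty: "fam \<in> measurable (F_infty M \<xi>) Om"
  using measurable_sh_fam_gen[of "[]" UNIV] gen_subset_F_infty[of UNIV] by (auto simp: measurable_def)

lemma space_H [simp]: "space (H_filtration M \<xi> x t) = space M"
  by (simp add: H_filtration_def space_measure_of_conv)

lemma subalgebra_H: "subalgebra M (H_filtration M \<xi> x t)"
  using subalgebra_F_infty unfolding subalgebra_def sets_H_filtration[OF gbp] pre_line_events_def by auto

lemma F_line_singleton: "F_line M \<xi> {u} = outside u"
  by (simp add: F_line_def stems_from_def)

end

locale malthusian = branching M \<xi> x \<alpha> + renewal_cascade M \<xi> "discount x \<alpha>" \<sigma>2 F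
  for M :: "'w measure" and \<xi> x \<alpha> \<sigma>2 F
begin

text \<open>The definition of the filtration is used for the line consisting of \<open>u\<close>
  alone, whose \<sigma>-algebra is \<open>outside u\<close>. If \<open>u\<close> is in the coming
  generation, then the coming generation covers this line, so the part of \<open>A\<close> on which
  \<open>u\<close> stops is cut out of an event of \<open>outside u\<close>.\<close>

lemma pre_H:
  assumes t: "0 \<le> t" and A: "A \<in> sets (H_filtration M \<xi> x t)"
  shows "pre (exp (- \<alpha> * t)) A"
  unfolding pre_def
proof (intro conjI allI)
  show AM: "A \<in> sets M" using A subalgebra_H unfolding subalgebra_def by blast
  fix u
  let ?C = "{\<omega>\<in>space M. covers (coming_generation \<xi> x t \<omega>) {u}}"
  have "is_line {u}" by (simp add: is_line_def)
  then have 1: "A \<inter> ?C \<in> sets (outside u)"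
    using A unfolding sets_H_filtration[OF gbp] pre_line_events_def F_line_singleton[symmetric] by blast
  have "{w. strict_prefix w u} \<subseteq> {w. \<not> prefix u w}" by (auto simp: strict_prefix_def dest: prefix_order.antisym)
  from st_gen[OF this, of "exp (- \<alpha> * t)"]
  have 2: "{\<omega>\<in>space M. st u (exp (- \<alpha> * t)) (fam \<omega>)} \<in> sets (outside u)" by (simp add: pred_def)
  have "covers (coming_generation \<xi> x t \<omega>) {u}" if "\<omega> \<in> space M" "st u (exp (- \<alpha> * t)) (fam \<omega>)" for \<omega>
    using that coming_generation_iff[OF that(1) t, of u]
    by (auto simp: covers_def stems_from_def intro!: bexI[of _ u])
  then have "{\<omega>\<in>A. st u (exp (- \<alpha> * t)) (fam \<omega>)} = (A \<inter> ?C) \<inter> {\<omega>\<in>space M. st u (exp (- \<alpha> * t)) (fam \<omega>)}"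
    using sets.sets_into_space[OF AM] by auto
  then show "{\<omega>\<in>A. st u (exp (- \<alpha> * t)) (fam \<omega>)} \<in> sets (outside u)"
    using sets.Int[OF 1 2] by simp
qed

text \<open>The event that \<open>u\<close> stops with weight above \<open>r\<close> has to be
  tested on every line \<open>L\<close>. If a member of \<open>L\<close> is a strict ancestor of
  \<open>u\<close>, then covering \<open>L\<close> would put another individual of the coming
  generation above \<open>u\<close>, which is impossible. Otherwise no strict ancestor of
  \<open>u\<close> stems from \<open>L\<close>, and these ancestors decide the event.\<close>

lemma measurable_WT_H:
  assumes t: "0 \<le> t"
  shows "(\<lambda>\<omega>. WT (exp (- \<alpha> * t)) (fam \<omega>)) \<in> borel_measurable (H_filtration M \<xi> x t)"
proof -
  define T where "T = exp (- \<alpha> * t)"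
  have D: "{\<omega>\<in>space M. st u T (fam \<omega>) \<and> r < wt u (fam \<omega>)} \<in> sets (H_filtration M \<xi> x t)" for u r
  proof -
    let ?D = "{\<omega>\<in>space M. st u T (fam \<omega>) \<and> r < wt u (fam \<omega>)}"
    have g: "?D \<in> sets (gen U)" if "{w. strict_prefix w u} \<subseteq> U" for U
    proof -
      note [measurable] = st_gen[OF that] wt_gen[OF that]
      have "{\<omega>\<in>space (gen U). st u T (fam \<omega>) \<and> r < wt u (fam \<omega>)} \<in> sets (gen U)" by measurable
      then show ?thesis by simp
    qed
    have "?D \<inter> {\<omega>\<in>space M. covers (coming_generation \<xi> x t \<omega>) L} \<in> sets (F_line M \<xi> L)" if L: "is_line L" for L
    proof (cases "\<exists>v\<in>L. strict_prefix v u")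
      case True
      then obtain v where v: "v \<in> L" "strict_prefix v u" by blast
      have False if \<omega>: "\<omega> \<in> space M" "st u T (fam \<omega>)" "covers (coming_generation \<xi> x t \<omega>) L" for \<omega>
      proof -
        obtain w where w: "w \<in> coming_generation \<xi> x t \<omega>" "prefix w v"
          using \<omega>(3) v(1) unfolding covers_def stems_from_def by blast
        have "strict_prefix w u" using w(2) v(2) by (rule prefix_order.le_less_trans)
        moreover have "st w T (fam \<omega>)" using w(1) coming_generation_iff[OF \<omega>(1) t] by (simp add: T_def)
        ultimately show False
          using line_st[of T] \<omega>(1,2) unfolding line_def strict_prefix_def by blast
      qed
      then have "?D \<inter> {\<omega>\<in>space M. covers (coming_generation \<xi> x t \<omega>) L} = {}" by blast
      then show ?thesis by (simp only: sets.empty_sets)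
    next
      case False
      have "{w. strict_prefix w u} \<subseteq> {w. \<not> stems_from L w}"
        using False prefix_order.le_less_trans unfolding stems_from_def by blast
      from g[OF this] show ?thesis
        using optional_line_coming_generation[OF gbp L, of t] unfolding F_line_def by (rule sets.Int)
    qed
    moreover have "?D \<in> sets (F_infty M \<xi>)" using g[OF order.refl] gen_subset_F_infty by blast
    ultimately show ?thesis unfolding sets_H_filtration[OF gbp] pre_line_events_def by blast
  qed
  have "(\<lambda>\<omega>. of_bool (st u T (fam \<omega>)) * wt u (fam \<omega>)) \<in> borel_measurable (H_filtration M \<xi> x t)" for u
    unfolding borel_measurable_iff_greater
  proof
    fix r :: real
    have "{\<omega>\<in>space M. r < of_bool (st u T (fam \<omega>)) * wt u (fam \<omega>)} =
        (if r < 0 then space M else {\<omega>\<in>space M. st u T (fam \<omega>) \<and> r < wt u (fam \<omega>)})"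
      using wt_nonneg[of u] by (auto intro: less_le_trans)
    then show "{\<omega>\<in>space (H_filtration M \<xi> x t). r < of_bool (st u T (fam \<omega>)) * wt u (fam \<omega>)} \<in> sets (H_filtration M \<xi> x t)"
      using D[of u r] sets.top[of "H_filtration M \<xi> x t"] by simp
  qed
  then have "(\<lambda>\<omega>. enn2real (\<integral>\<^sup>+u. ennreal (of_bool (st u T (fam \<omega>)) * wt u (fam \<omega>)) \<partial>count_space UNIV)) \<in> borel_measurable (H_filtration M \<xi> x t)"
    by (intro borel_measurable_enn2real borel_measurable_nn_integral_count_space measurable_compose[OF _ measurable_ennreal])
  moreover have "ennreal (of_bool P * w) = of_bool P * ennreal w" for P w by (cases P) simp_all
  ultimately show ?thesis by (simp add: WT_def[abs_def] Ls_def T_def)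
qed

subsection \<open>The conditional central limit theorem\<close>

definition fluct :: "real \<Rightarrow> 'w \<Rightarrow> real" where
  "fluct t \<omega> = exp (\<alpha> * t / 2) * (W (fam \<omega>) - WT (exp (- \<alpha> * t)) (fam \<omega>))"

lemma measurable_fluct [measurable]: "fluct t \<in> borel_measurable M"
  unfolding fluct_def[abs_def] by measurable

lemma fluct_eq: "fluct t \<omega> = (W (fam \<omega>) - WT (exp (- \<alpha> * t)) (fam \<omega>)) / sqrt (exp (- \<alpha> * t))"
proof -
  have "sqrt (exp (- \<alpha> * t)) = exp (- (\<alpha> * t / 2))"
    by (rule real_sqrt_unique) (simp_all add: exp_double[symmetric])
  then show ?thesis unfolding fluct_def by (simp only: exp_minus divide_inverse inverse_inverse_eq mult.commute)
qed

lemma integrable_deviation: "integrable M (\<lambda>\<omega>. W (fam \<omega>) - WT (exp (- \<alpha> * t)) (fam \<omega>))"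
  and deviation_L1: "(\<integral>\<omega>. \<bar>W (fam \<omega>) - WT (exp (- \<alpha> * t)) (fam \<omega>)\<bar> \<partial>M) \<le> sqrt (v * exp (- \<alpha> * t))"
proof -
  have m: "(\<lambda>\<omega>. W (fam \<omega>) - WT (exp (- \<alpha> * t)) (fam \<omega>)) \<in> borel_measurable M" by measurable
  have vT: "0 \<le> v * exp (- \<alpha> * t)" using v_nonneg by simp
  note * = mean_le_of_square[OF m dev_square[OF exp_gt_zero] vT]
  show i: "integrable M (\<lambda>\<omega>. W (fam \<omega>) - WT (exp (- \<alpha> * t)) (fam \<omega>))" by (rule *(1))
  have "ennreal (\<integral>\<omega>. \<bar>W (fam \<omega>) - WT (exp (- \<alpha> * t)) (fam \<omega>)\<bar> \<partial>M) \<le> ennreal (sqrt (v * exp (- \<alpha> * t)))"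
    using *(4) nn_integral_eq_integral[OF integrable_abs[OF i]] by simp
  then show "(\<integral>\<omega>. \<bar>W (fam \<omega>) - WT (exp (- \<alpha> * t)) (fam \<omega>)\<bar> \<partial>M) \<le> sqrt (v * exp (- \<alpha> * t))"
    using vT by (subst (asm) ennreal_le_iff) simp_all
qed

text \<open>Tightness uniform in \<open>t\<close>: the factor \<open>exp (\<alpha> * t / 2)\<close>
  cancels exactly against the L1 bound of the deviation.\<close>

lemma fluct_tail:
  assumes K: "0 < K"
  shows "prob {\<omega>\<in>space M. K < \<bar>fluct t \<omega>\<bar>} \<le> sqrt v / K"
proof -
  have eq: "\<bar>fluct t \<omega>\<bar> = exp (\<alpha> * t / 2) * \<bar>W (fam \<omega>) - WT (exp (- \<alpha> * t)) (fam \<omega>)\<bar>" for \<omega>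
    by (simp add: fluct_def abs_mult)
  have i: "integrable M (\<lambda>\<omega>. \<bar>fluct t \<omega>\<bar>)"
    unfolding eq using integrable_deviation[of t] by (intro integrable_mult_right integrable_abs)
  have "prob {\<omega>\<in>space M. K < \<bar>fluct t \<omega>\<bar>} \<le> prob {\<omega>\<in>space M. K \<le> \<bar>fluct t \<omega>\<bar>}"
    by (intro finite_measure_mono) auto
  also have "\<dots> \<le> (\<integral>\<omega>. \<bar>fluct t \<omega>\<bar> \<partial>M) / K"
    by (rule integral_Markov_inequality_measure[OF i, of "{}"]) (use K in auto)
  also have "(\<integral>\<omega>. \<bar>fluct t \<omega>\<bar> \<partial>M) = exp (\<alpha> * t / 2) * (\<integral>\<omega>. \<bar>W (fam \<omega>) - WT (exp (- \<alpha> * t)) (fam \<omega>)\<bar> \<partial>M)"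
    unfolding eq by simp
  also have "\<dots> / K \<le> exp (\<alpha> * t / 2) * sqrt (v * exp (- \<alpha> * t)) / K"
    using K by (intro divide_right_mono mult_left_mono deviation_L1) simp_all
  also have "sqrt (v * exp (- \<alpha> * t)) = sqrt v * exp (- (\<alpha> * t / 2))"
  proof -
    have "sqrt (exp (- \<alpha> * t)) = exp (- (\<alpha> * t / 2))"
      by (rule real_sqrt_unique) (simp_all add: exp_double[symmetric])
    then show ?thesis by (simp add: real_sqrt_mult)
  qed
  also have "exp (\<alpha> * t / 2) * (sqrt v * exp (- (\<alpha> * t / 2))) / K = sqrt v / K"
    by (simp add: exp_minus)
  finally show ?thesis .
qed

text \<open>Real and imaginary parts of one complex estimate, treated together. The Gaussian term is
  real, so it appears with coefficient \<open>b = 1\<close> for the cosine and \<open>b = 0\<close>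
  for the sine.\<close>

lemma test_trig:
  fixes \<phi> :: "real \<Rightarrow> real"
  assumes \<phi>: "\<phi> = cos \<and> b = 1 \<or> \<phi> = sin \<and> b = 0"
    and A: "A \<in> sets M" and [measurable]: "Y \<in> borel_measurable M" "E \<in> borel_measurable M"
    and E: "\<And>\<omega>. \<bar>E \<omega>\<bar> \<le> 1"
    and le: "norm ((\<integral>\<omega>. indicator A \<omega> * iexp (\<theta> * Y \<omega>) \<partial>M) - (\<integral>\<omega>. indicator A \<omega> * complex_of_real (E \<omega>) \<partial>M)) \<le> \<delta>"
  shows "\<bar>\<integral>\<omega>. indicator A \<omega> * (\<phi> (\<theta> * Y \<omega>) - b * E \<omega>) \<partial>M\<bar> \<le> \<delta>"
proof -
  note [measurable] = A
  let ?z = "\<lambda>\<omega>. indicator A \<omega> * iexp (\<theta> * Y \<omega>) - indicator A \<omega> * complex_of_real (E \<omega>)"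
  have i1: "integrable M (\<lambda>\<omega>. indicator A \<omega> * iexp (\<theta> * Y \<omega>))"
    by (rule integrable_const_bound[where B=1]) (auto simp: indicator_def)
  have i2: "integrable M (\<lambda>\<omega>. indicator A \<omega> * complex_of_real (E \<omega>))"
    by (rule integrable_const_bound[where B=1]) (auto simp: indicator_def E)
  have i: "integrable M ?z" using i1 i2 by (rule Bochner_Integration.integrable_diff)
  have z: "norm (\<integral>\<omega>. ?z \<omega> \<partial>M) \<le> \<delta>" using le i1 i2 by (subst Bochner_Integration.integral_diff)
  from \<phi> show ?thesis
  proof (elim disjE conjE)
    assume "\<phi> = cos" "b = 1"
    then have "(\<integral>\<omega>. indicator A \<omega> * (\<phi> (\<theta> * Y \<omega>) - b * E \<omega>) \<partial>M) = (\<integral>\<omega>. Re (?z \<omega>) \<partial>M)"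
      by (intro Bochner_Integration.integral_cong refl) (simp add: indicator_def Re_exp)
    also have "\<dots> = Re (\<integral>\<omega>. ?z \<omega> \<partial>M)" by (rule integral_Re[OF i])
    finally show ?thesis using abs_Re_le_cmod[of "\<integral>\<omega>. ?z \<omega> \<partial>M"] z by linarith
  next
    assume "\<phi> = sin" "b = 0"
    then have "(\<integral>\<omega>. indicator A \<omega> * (\<phi> (\<theta> * Y \<omega>) - b * E \<omega>) \<partial>M) = (\<integral>\<omega>. Im (?z \<omega>) \<partial>M)"
      by (intro Bochner_Integration.integral_cong refl) (simp add: indicator_def Im_exp)
    also have "\<dots> = Im (\<integral>\<omega>. ?z \<omega> \<partial>M)" by (rule integral_Im[OF i])
    finally show ?thesis using abs_Im_le_cmod[of "\<integral>\<omega>. ?z \<omega> \<partial>M"] z by linarith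
  qed
qed

text \<open>The limit depends on \<open>W\<close> and is not measurable at time \<open>t\<close>, so
  it passes through the version with Nerman's martingale in place of \<open>W\<close>. Testing on
  events costs \<open>2 * \<delta>\<close>, comparing the conditional expectations of the two
  versions costs twice their L1 distance, and comparing the versions themselves costs it once more;
  this is the coefficient 3.\<close>

lemma cond_char_bound:
  fixes \<phi> :: "real \<Rightarrow> real"
  assumes \<phi>: "\<phi> = cos \<and> b = 1 \<or> \<phi> = sin \<and> b = 0" and t: "0 \<le> t"
    and le: "\<And>A. pre (exp (- \<alpha> * t)) A \<Longrightarrow>
      norm ((\<integral>\<omega>. indicator A \<omega> * iexp (\<theta> * fluct t \<omega>) \<partial>M) -
        (\<integral>\<omega>. indicator A \<omega> * complex_of_real (exp (- (\<theta>\<^sup>2 * v * (c * W (fam \<omega>)) / 2))) \<partial>M)) \<le> \<delta>"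
  shows "(\<integral>\<omega>. \<bar>real_cond_exp M (H_filtration M \<xi> x t) (\<lambda>\<omega>. \<phi> (\<theta> * fluct t \<omega>)) \<omega> -
      b * exp (- (\<theta>\<^sup>2 * v * (c * W (fam \<omega>)) / 2))\<bar> \<partial>M) \<le> 2 * \<delta> + 3 * (\<theta>\<^sup>2 * v * c / 2) * sqrt (v * exp (- \<alpha> * t))"
proof -
  let ?H = "H_filtration M \<xi> x t"
  interpret S: finite_measure_subalgebra M ?H
    by (intro finite_measure_subalgebra.intro finite_measure_axioms finite_measure_subalgebra_axioms.intro subalgebra_H)
  define \<kappa> where "\<kappa> = \<theta>\<^sup>2 * v * c / 2"
  have \<kappa>: "0 \<le> \<kappa>" using v_nonneg c_nonneg by (simp add: \<kappa>_def)
  define E where "E = (\<lambda>w. exp (- (\<kappa> * w)))"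
  have E_eq: "exp (- (\<theta>\<^sup>2 * v * (c * w) / 2)) = E w" for w by (simp add: E_def \<kappa>_def)
  have [measurable]: "E \<in> borel_measurable borel" unfolding E_def by measurable
  have E1: "\<bar>E w\<bar> \<le> 1" if "0 \<le> w" for w using \<kappa> that by (simp add: E_def)
  have WT0: "0 \<le> WT T \<eta>" for T \<eta> by (simp add: WT_def)
  have b: "0 \<le> b" "b \<le> 1" using \<phi> by auto
  have \<phi>m [measurable]: "\<phi> \<in> borel_measurable borel" using \<phi> by auto
  have \<phi>1: "\<bar>\<phi> r\<bar> \<le> 1" for r using \<phi> by auto
  let ?W = "\<lambda>\<omega>. W (fam \<omega>)" and ?V = "\<lambda>\<omega>. WT (exp (- \<alpha> * t)) (fam \<omega>)"
  define g where "g = (\<lambda>\<omega>. \<phi> (\<theta> * fluct t \<omega>))"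
  define U where "U = (\<lambda>\<omega>. b * E (?W \<omega>))"
  define U' where "U' = (\<lambda>\<omega>. b * E (?V \<omega>))"
  have gm [measurable]: "g \<in> borel_measurable M" unfolding g_def by measurable
  have Um [measurable]: "U \<in> borel_measurable M" unfolding U_def by measurable
  have U'H: "U' \<in> borel_measurable ?H"
    unfolding U'_def
    by (intro borel_measurable_times borel_measurable_const measurable_compose[OF measurable_WT_H[OF t]]) measurable
  have U'm [measurable]: "U' \<in> borel_measurable M" by (rule measurable_from_subalg[OF subalgebra_H U'H])
  have bE: "\<bar>b * E w\<bar> \<le> 1" if "0 \<le> w" for w
    using mult_mono[OF b(2) E1[OF that]] b(1) by (simp add: abs_mult)
  have ig: "integrable M g" unfolding g_def by (rule integrable_const_bound[where B=1]) (auto simp: \<phi>1)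
  have iU: "integrable M U" unfolding U_def by (rule integrable_const_bound[where B=1]) (auto simp: bE)
  have iU': "integrable M U'" using U'm unfolding U'_def by (intro integrable_const_bound[where B=1]) (auto simp: bE WT0)
  have "(\<integral>\<omega>. \<bar>U \<omega> - U' \<omega>\<bar> \<partial>M) \<le> (\<integral>\<omega>. \<kappa> * \<bar>?W \<omega> - ?V \<omega>\<bar> \<partial>M)"
  proof (rule integral_mono)
    show "integrable M (\<lambda>\<omega>. \<bar>U \<omega> - U' \<omega>\<bar>)" using iU iU' by simp
    show "integrable M (\<lambda>\<omega>. \<kappa> * \<bar>?W \<omega> - ?V \<omega>\<bar>)" by (intro integrable_mult_right integrable_abs integrable_deviation)
    fix \<omega>
    have "\<bar>U \<omega> - U' \<omega>\<bar> = b * \<bar>E (?W \<omega>) - E (?V \<omega>)\<bar>"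
      using b(1) by (simp add: U_def U'_def right_diff_distrib[symmetric] abs_mult)
    also have "\<dots> \<le> 1 * \<bar>E (?W \<omega>) - E (?V \<omega>)\<bar>" using b(2) by (intro mult_right_mono) simp_all
    also have "1 * \<bar>E (?W \<omega>) - E (?V \<omega>)\<bar> \<le> \<bar>\<kappa> * ?W \<omega> - \<kappa> * ?V \<omega>\<bar>"
      unfolding E_def mult_1 using \<kappa> by (intro abs_exp_diff_le) (simp_all add: WT0)
    also have "\<bar>\<kappa> * ?W \<omega> - \<kappa> * ?V \<omega>\<bar> = \<kappa> * \<bar>?W \<omega> - ?V \<omega>\<bar>"
      using \<kappa> by (simp add: right_diff_distrib[symmetric] abs_mult)
    finally show "\<bar>U \<omega> - U' \<omega>\<bar> \<le> \<kappa> * \<bar>?W \<omega> - ?V \<omega>\<bar>" .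
  qed
  also have "\<dots> \<le> \<kappa> * sqrt (v * exp (- \<alpha> * t))" using \<kappa> deviation_L1[of t] by (simp add: mult_left_mono)
  finally have UU': "(\<integral>\<omega>. \<bar>U \<omega> - U' \<omega>\<bar> \<partial>M) \<le> \<kappa> * sqrt (v * exp (- \<alpha> * t))" .
  have test: "\<bar>\<integral>\<omega>. indicator A \<omega> * (g \<omega> - U \<omega>) \<partial>M\<bar> \<le> \<delta>" if A: "A \<in> sets ?H" for A
  proof -
    have AM: "A \<in> sets M" using A subalgebra_H unfolding subalgebra_def by blast
    show ?thesis
      unfolding g_def U_def
      by (rule test_trig[OF \<phi> AM]) (use le[OF pre_H[OF t A]] in \<open>simp_all add: E_eq E1\<close>)
  qed
  let ?E = "real_cond_exp M ?H"
  note ints = S.real_cond_exp_int(1)[OF ig] S.real_cond_exp_int(1)[OF iU] S.real_cond_exp_int(1)[OF iU']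
    S.real_cond_exp_int(1)[OF Bochner_Integration.integrable_diff[OF ig iU]]
  have "(\<integral>\<omega>. \<bar>?E g \<omega> - U \<omega>\<bar> \<partial>M) \<le> (\<integral>\<omega>. \<bar>?E (\<lambda>\<omega>. g \<omega> - U \<omega>) \<omega>\<bar> + \<bar>?E U \<omega> - ?E U' \<omega>\<bar> + \<bar>U \<omega> - U' \<omega>\<bar> \<partial>M)"
  proof (rule integral_mono_AE)
    show "integrable M (\<lambda>\<omega>. \<bar>?E g \<omega> - U \<omega>\<bar>)" using ints iU by simp
    show "integrable M (\<lambda>\<omega>. \<bar>?E (\<lambda>\<omega>. g \<omega> - U \<omega>) \<omega>\<bar> + \<bar>?E U \<omega> - ?E U' \<omega>\<bar> + \<bar>U \<omega> - U' \<omega>\<bar>)" using ints iU iU' by simp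
    show "AE \<omega> in M. \<bar>?E g \<omega> - U \<omega>\<bar> \<le> \<bar>?E (\<lambda>\<omega>. g \<omega> - U \<omega>) \<omega>\<bar> + \<bar>?E U \<omega> - ?E U' \<omega>\<bar> + \<bar>U \<omega> - U' \<omega>\<bar>"
      using S.real_cond_exp_diff[OF ig iU] S.real_cond_exp_F_meas[OF iU' U'H]
      by eventually_elim linarith
  qed
  also have "\<dots> = (\<integral>\<omega>. \<bar>?E (\<lambda>\<omega>. g \<omega> - U \<omega>) \<omega>\<bar> \<partial>M) + (\<integral>\<omega>. \<bar>?E U \<omega> - ?E U' \<omega>\<bar> \<partial>M) + (\<integral>\<omega>. \<bar>U \<omega> - U' \<omega>\<bar> \<partial>M)"
    using ints iU iU' by simp
  also have "\<dots> \<le> 2 * \<delta> + 2 * (\<kappa> * sqrt (v * exp (- \<alpha> * t))) + \<kappa> * sqrt (v * exp (- \<alpha> * t))"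
    using S.cond_exp_L1[OF Bochner_Integration.integrable_diff[OF ig iU] test] S.cond_exp_contraction[OF iU iU'] UU'
    by linarith
  finally show ?thesis by (simp add: g_def U_def E_eq \<kappa>_def[symmetric])
qed

lemma tendsto_exp_minus_at_top: "((\<lambda>t. exp (- \<alpha> * t)) \<longlongrightarrow> 0) at_top"
  by (rule filterlim_compose[OF exp_at_bot filterlim_tendsto_neg_mult_at_bot[OF tendsto_const _ filterlim_ident]])
    (use \<alpha> in simp)

lemma cond_char_limit:
  fixes \<phi> :: "real \<Rightarrow> real"
  assumes \<phi>: "\<phi> = cos \<and> b = 1 \<or> \<phi> = sin \<and> b = 0"
  shows "((\<lambda>t. \<integral>\<omega>. \<bar>real_cond_exp M (H_filtration M \<xi> x t) (\<lambda>\<omega>. \<phi> (\<theta> * fluct t \<omega>)) \<omega> -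
      b * exp (- (\<theta>\<^sup>2 * v * (c * W (fam \<omega>)) / 2))\<bar> \<partial>M) \<longlongrightarrow> 0) at_top" (is "(?L \<longlongrightarrow> 0) at_top")
proof (rule order_tendstoI)
  show "\<forall>\<^sub>F t in at_top. r < ?L t" if "r < 0" for r
    using that by (intro always_eventually allI less_le_trans[OF that] integral_nonneg_AE) simp
  fix \<epsilon> :: real assume \<epsilon>: "0 < \<epsilon>"
  obtain T0 where T0: "0 < T0" "\<And>T A. 0 < T \<Longrightarrow> T \<le> T0 \<Longrightarrow> pre T A \<Longrightarrow>
      norm ((\<integral>\<omega>. indicator A \<omega> * iexp (\<theta> * ((W (fam \<omega>) - WT T (fam \<omega>)) / sqrt T)) \<partial>M)
      - (\<integral>\<omega>. indicator A \<omega> * of_real (exp (- (\<theta>\<^sup>2 * v * (c * W (fam \<omega>)) / 2))) \<partial>M)) \<le> \<epsilon> / 4"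
    using clt_uniform[of "\<epsilon> / 4" \<theta>] \<epsilon> by auto
  let ?s = "\<lambda>t. 3 * (\<theta>\<^sup>2 * v * c / 2) * sqrt (v * exp (- \<alpha> * t))"
  have "(?s \<longlongrightarrow> 3 * (\<theta>\<^sup>2 * v * c / 2) * sqrt (v * 0)) at_top"
    by (intro tendsto_intros tendsto_exp_minus_at_top)
  then have "\<forall>\<^sub>F t in at_top. ?s t < \<epsilon> / 4" by (rule order_tendstoD) (use \<epsilon> in simp)
  moreover have "\<forall>\<^sub>F t in at_top. exp (- \<alpha> * t) < T0" by (rule order_tendstoD(2)[OF tendsto_exp_minus_at_top T0(1)])
  ultimately show "\<forall>\<^sub>F t in at_top. ?L t < \<epsilon>" using eventually_ge_at_top[of "0::real"]
  proof eventually_elim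
    case (elim t)
    have "?L t \<le> 2 * (\<epsilon> / 4) + ?s t"
      by (rule cond_char_bound[OF \<phi> elim(3)], unfold fluct_eq, rule T0(2)) (use elim in auto)
    then show ?case using elim(1) \<epsilon> by linarith
  qed
qed

text \<open>\<open>W\<close> is measurable with respect to \<open>F_infty\<close> and can be frozen,
  which leaves the characteristic function of the standard normal law at
  \<open>\<theta> * sqrt (v * c * W)\<close>.\<close>

lemma cond_char_mixture:
  fixes \<phi> :: "real \<Rightarrow> real"
  assumes \<phi>: "\<phi> = cos \<and> b = 1 \<or> \<phi> = sin \<and> b = 0"
    and X: "distributed M lborel X (\<lambda>z. ennreal (std_normal_density z))"
    and indep: "indep_set (sets (F_infty M \<xi>)) (sets (vimage_algebra (space M) X borel))"
  shows "AE \<omega> in M. real_cond_exp M (F_infty M \<xi>) (\<lambda>\<omega>. \<phi> (\<theta> * (sqrt (v * c * W (fam \<omega>)) * X \<omega>))) \<omega> =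
    b * exp (- (\<theta>\<^sup>2 * v * (c * W (fam \<omega>)) / 2))"
proof -
  have Xm: "X \<in> borel_measurable M" using distributed_measurable[OF X] by simp
  have "distr M borel X = distr M lborel X" by (rule distr_cong) simp_all
  then have dX: "distr M borel X = std_normal_distribution" using distributed_distr_eq_density[OF X] by simp
  have mean: "(\<integral>z. \<phi> (s * z) \<partial>std_normal_distribution) = b * exp (- (s\<^sup>2 / 2))" for s
  proof -
    interpret X: prob_space "distr M borel X" by (rule prob_space_distr[OF Xm])
    have i: "integrable std_normal_distribution (\<lambda>z. iexp (s * z))"
      unfolding dX[symmetric] by (rule X.integrable_const_bound[where B=1]) auto
    have "(\<integral>z. iexp (s * z) \<partial>std_normal_distribution) = complex_of_real (exp (- (s\<^sup>2 / 2)))"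
      using fun_cong[OF char_std_normal_distribution, of s] by (simp add: char_def)
    then have "(\<integral>z. Re (iexp (s * z)) \<partial>std_normal_distribution) = exp (- (s\<^sup>2 / 2))"
      "(\<integral>z. Im (iexp (s * z)) \<partial>std_normal_distribution) = 0"
      unfolding integral_Re[OF i] integral_Im[OF i] by simp_all
    then show ?thesis using \<phi> by (auto simp: Re_exp Im_exp)
  qed
  have Um: "(\<lambda>\<omega>. sqrt (v * c * W (fam \<omega>))) \<in> borel_measurable (F_infty M \<xi>)"
    by (rule measurable_compose[OF measurable_fam_F_infty]) measurable
  have "AE \<omega> in M. real_cond_exp M (F_infty M \<xi>) (\<lambda>\<omega>. \<phi> (\<theta> * (sqrt (v * c * W (fam \<omega>)) * X \<omega>))) \<omega> =
      (\<integral>z. \<phi> (\<theta> * (sqrt (v * c * W (fam \<omega>)) * z)) \<partial>distr M borel X)"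
  proof (rule freeze_indep[OF subalgebra_F_infty Xm indep Um, of "\<lambda>u z. \<phi> (\<theta> * (u * z))"])
    have [measurable]: "\<phi> \<in> borel_measurable borel" using \<phi> by auto
    show "(\<lambda>(u, z). \<phi> (\<theta> * (u * z))) \<in> borel_measurable (borel \<Otimes>\<^sub>M borel)" by measurable
    show "\<bar>\<phi> (\<theta> * (u * z))\<bar> \<le> 1" for u z using \<phi> by auto
  qed
  then show ?thesis
  proof eventually_elim
    case (elim \<omega>)
    have "0 \<le> v * c * W (fam \<omega>)" using v_nonneg c_nonneg by simp
    then have "(\<theta> * sqrt (v * c * W (fam \<omega>)))\<^sup>2 = \<theta>\<^sup>2 * v * (c * W (fam \<omega>))"
      by (simp add: power_mult_distrib mult.assoc)
    then show ?case using elim mean[of "\<theta> * sqrt (v * c * W (fam \<omega>))"] by (simp add: dX mult.assoc)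
  qed
qed

text \<open>Conditional expectations do not see null sets, so versions \<open>Y\<close> and
  \<open>Z\<close> that agree almost surely with the cascade expressions suffice. This admits an
  arbitrary version of the limit of Nerman's martingale.\<close>

lemma conditional_clt:
  assumes Y: "\<And>t. 0 \<le> t \<Longrightarrow> Y t \<in> borel_measurable M" "\<And>t. 0 \<le> t \<Longrightarrow> AE \<omega> in M. Y t \<omega> = fluct t \<omega>"
    and Z: "Z \<in> borel_measurable M" "AE \<omega> in M. Z \<omega> = sqrt (v * c * W (fam \<omega>)) * X \<omega>"
    and X: "distributed M lborel X (\<lambda>z. ennreal (std_normal_density z))"
    and indep: "indep_set (sets (F_infty M \<xi>)) (sets (vimage_algebra (space M) X borel))"
  shows "cond_law_tendsto_in_prob M Y (H_filtration M \<xi> x) Z (F_infty M \<xi>)"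
proof -
  have Xm: "X \<in> borel_measurable M" using distributed_measurable[OF X] by simp
  have sub: "sigma_finite_subalgebra M G" if "subalgebra M G" for G
    by (intro finite_measure_subalgebra_is_sigma_finite finite_measure_subalgebra.intro
        finite_measure_axioms finite_measure_subalgebra_axioms.intro that)
  have lim: "((\<lambda>t. \<integral>\<omega>. \<bar>real_cond_exp M (H_filtration M \<xi> x t) (\<lambda>\<omega>. \<phi> (\<theta> * Y t \<omega>)) \<omega> -
      real_cond_exp M (F_infty M \<xi>) (\<lambda>\<omega>. \<phi> (\<theta> * Z \<omega>)) \<omega>\<bar> \<partial>M) \<longlongrightarrow> 0) at_top"
    if \<phi>: "\<phi> = cos \<and> b = 1 \<or> \<phi> = sin \<and> b = 0" for \<phi> :: "real \<Rightarrow> real" and b \<theta> :: real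
  proof -
    have \<phi>m [measurable]: "\<phi> \<in> borel_measurable borel" using \<phi> by auto
    have Zc: "AE \<omega> in M. real_cond_exp M (F_infty M \<xi>) (\<lambda>\<omega>. \<phi> (\<theta> * Z \<omega>)) \<omega> =
        real_cond_exp M (F_infty M \<xi>) (\<lambda>\<omega>. \<phi> (\<theta> * (sqrt (v * c * W (fam \<omega>)) * X \<omega>))) \<omega>"
    proof (rule sigma_finite_subalgebra.real_cond_exp_cong[OF sub[OF subalgebra_F_infty]])
      show "AE \<omega> in M. \<phi> (\<theta> * Z \<omega>) = \<phi> (\<theta> * (sqrt (v * c * W (fam \<omega>)) * X \<omega>))" using Z(2) by eventually_elim simp
      show "(\<lambda>\<omega>. \<phi> (\<theta> * Z \<omega>)) \<in> borel_measurable M" using Z(1) by measurable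
      show "(\<lambda>\<omega>. \<phi> (\<theta> * (sqrt (v * c * W (fam \<omega>)) * X \<omega>))) \<in> borel_measurable M" using Xm by measurable
    qed
    have eq: "(\<integral>\<omega>. \<bar>real_cond_exp M (H_filtration M \<xi> x t) (\<lambda>\<omega>. \<phi> (\<theta> * fluct t \<omega>)) \<omega> -
        b * exp (- (\<theta>\<^sup>2 * v * (c * W (fam \<omega>)) / 2))\<bar> \<partial>M) =
      (\<integral>\<omega>. \<bar>real_cond_exp M (H_filtration M \<xi> x t) (\<lambda>\<omega>. \<phi> (\<theta> * Y t \<omega>)) \<omega> -
        real_cond_exp M (F_infty M \<xi>) (\<lambda>\<omega>. \<phi> (\<theta> * Z \<omega>)) \<omega>\<bar> \<partial>M)" if t: "0 \<le> t" for t
    proof (rule integral_cong_AE)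
      have "AE \<omega> in M. real_cond_exp M (H_filtration M \<xi> x t) (\<lambda>\<omega>. \<phi> (\<theta> * Y t \<omega>)) \<omega> =
          real_cond_exp M (H_filtration M \<xi> x t) (\<lambda>\<omega>. \<phi> (\<theta> * fluct t \<omega>)) \<omega>"
      proof (rule sigma_finite_subalgebra.real_cond_exp_cong[OF sub[OF subalgebra_H]])
        show "AE \<omega> in M. \<phi> (\<theta> * Y t \<omega>) = \<phi> (\<theta> * fluct t \<omega>)" using Y(2)[OF t] by eventually_elim simp
        show "(\<lambda>\<omega>. \<phi> (\<theta> * Y t \<omega>)) \<in> borel_measurable M" using Y(1)[OF t] by measurable
      qed measurable
      then show "AE \<omega> in M. \<bar>real_cond_exp M (H_filtration M \<xi> x t) (\<lambda>\<omega>. \<phi> (\<theta> * fluct t \<omega>)) \<omega> -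
          b * exp (- (\<theta>\<^sup>2 * v * (c * W (fam \<omega>)) / 2))\<bar> =
        \<bar>real_cond_exp M (H_filtration M \<xi> x t) (\<lambda>\<omega>. \<phi> (\<theta> * Y t \<omega>)) \<omega> -
          real_cond_exp M (F_infty M \<xi>) (\<lambda>\<omega>. \<phi> (\<theta> * Z \<omega>)) \<omega>\<bar>"
        using cond_char_mixture[OF \<phi> X indep, of \<theta>] Zc by eventually_elim simp
    qed (auto intro!: borel_measurable_abs borel_measurable_diff)
    show ?thesis
      by (rule Lim_transform_eventually[OF cond_char_limit[OF \<phi>, of \<theta>] eventually_mono[OF eventually_ge_at_top[of 0] eq]])
  qed
  show ?thesis
  proof (rule cond_law_tendsto_in_prob_of_trig[OF subalgebra_H subalgebra_F_infty Y(1) Z(1)])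
    fix e :: real assume e: "0 < e"
    \<comment> \<open>The \<open>+ 1\<close> keeps \<open>K\<close> positive if
      \<open>v = 0\<close>.\<close>
    define K where "K = sqrt v / e + 1"
    have K: "0 < K" using v_nonneg e by (simp add: K_def add_nonneg_pos)
    have "sqrt v \<le> K * e" using e by (simp add: K_def distrib_right)
    then have Ke: "sqrt v / K \<le> e" using K by (simp add: divide_le_eq mult.commute)
    have "prob {\<omega>\<in>space M. K < \<bar>Y t \<omega>\<bar>} \<le> e" if t: "0 \<le> t" for t
    proof -
      have "prob {\<omega>\<in>space M. K < \<bar>Y t \<omega>\<bar>} = prob {\<omega>\<in>space M. K < \<bar>fluct t \<omega>\<bar>}"
        using Y(1)[OF t] by (intro finite_measure_eq_AE) (use Y(2)[OF t] in \<open>auto elim!: eventually_mono\<close>)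
      then show ?thesis using fluct_tail[OF K, of t] Ke by linarith
    qed
    then show "\<exists>K>0. \<forall>t\<ge>0. prob {\<omega>\<in>space M. K < \<bar>Y t \<omega>\<bar>} \<le> e" using K by blast
  qed (use lim[of cos 1] lim[of sin 0] in simp_all)
qed

text \<open>\<open>dev_square\<close> gives convergence in L2 of Nerman's martingale to the limit of
  the generation totals. Fatou's lemma along integer times from \<open>k\<close> on bounds the
  squared distance to the given almost sure limit by \<open>v * exp (- \<alpha> * real k)\<close>,
  for every \<open>k\<close>.\<close>

lemma limit_unique:
  assumes W0: "W0 \<in> borel_measurable M" and lim: "AE \<omega> in M. ((\<lambda>t. nerman \<xi> x \<alpha> t \<omega>) \<longlongrightarrow> W0 \<omega>) at_top"
  shows "AE \<omega> in M. W0 \<omega> = W (fam \<omega>)"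
proof -
  have le: "(\<integral>\<^sup>+\<omega>. ennreal ((W (fam \<omega>) - W0 \<omega>)\<^sup>2) \<partial>M) \<le> ennreal (v * exp (- \<alpha> * real k))" for k :: nat
  proof (rule fatou_square)
    show "(\<lambda>\<omega>. W (fam \<omega>) - WT (exp (- \<alpha> * real (n + k))) (fam \<omega>)) \<in> borel_measurable M" for n by measurable
    show "(\<lambda>\<omega>. W (fam \<omega>) - W0 \<omega>) \<in> borel_measurable M" using W0 by measurable
    have f: "filterlim (\<lambda>n. real (n + k)) at_top sequentially"
      by (rule filterlim_compose[OF filterlim_real_sequentially filterlim_add_const_nat_at_top])
    show "AE \<omega> in M. (\<lambda>n. W (fam \<omega>) - WT (exp (- \<alpha> * real (n + k))) (fam \<omega>)) \<longlonglongrightarrow> W (fam \<omega>) - W0 \<omega>"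
      using lim AE_space
    proof eventually_elim
      case (elim \<omega>)
      have "(\<lambda>n. nerman \<xi> x \<alpha> (real (n + k)) \<omega>) \<longlonglongrightarrow> W0 \<omega>" by (rule filterlim_compose[OF elim(1) f])
      moreover have "nerman \<xi> x \<alpha> (real (n + k)) \<omega> = WT (exp (- \<alpha> * real (n + k))) (fam \<omega>)" for n
        unfolding WT_def by (rule nerman_eq[OF elim(2)]) simp
      ultimately have "(\<lambda>n. WT (exp (- \<alpha> * real (n + k))) (fam \<omega>)) \<longlonglongrightarrow> W0 \<omega>" by (simp only:)
      then show ?case by (intro tendsto_diff tendsto_const)
    qed
    fix n
    have "(\<integral>\<^sup>+\<omega>. ennreal ((W (fam \<omega>) - WT (exp (- \<alpha> * real (n + k))) (fam \<omega>))\<^sup>2) \<partial>M) \<le> ennreal (v * exp (- \<alpha> * real (n + k)))"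
      by (rule dev_square) simp
    also have "\<dots> \<le> ennreal (v * exp (- \<alpha> * real k))"
      using v_nonneg \<alpha> by (intro ennreal_leI mult_left_mono) simp_all
    finally show "(\<integral>\<^sup>+\<omega>. ennreal ((W (fam \<omega>) - WT (exp (- \<alpha> * real (n + k))) (fam \<omega>))\<^sup>2) \<partial>M) \<le> ennreal (v * exp (- \<alpha> * real k))" .
  qed
  have "(\<lambda>k. ennreal (v * exp (- \<alpha> * real k))) \<longlonglongrightarrow> ennreal (v * 0)"
    by (intro tendsto_ennrealI tendsto_mult tendsto_const filterlim_compose[OF tendsto_exp_minus_at_top filterlim_real_sequentially])
  then have "(\<integral>\<^sup>+\<omega>. ennreal ((W (fam \<omega>) - W0 \<omega>)\<^sup>2) \<partial>M) \<le> ennreal (v * 0)"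
    by (rule LIMSEQ_le_const) (use le in blast)
  then have "(\<integral>\<^sup>+\<omega>. ennreal ((W (fam \<omega>) - W0 \<omega>)\<^sup>2) \<partial>M) = 0" by simp
  then have "AE \<omega> in M. ennreal ((W (fam \<omega>) - W0 \<omega>)\<^sup>2) = 0"
    using W0 by (subst (asm) nn_integral_0_iff_AE) measurable
  then show ?thesis
  proof eventually_elim
    case (elim \<omega>)
    then show ?case using zero_le_power2[of "W (fam \<omega>) - W0 \<omega>"] by (simp add: ennreal_eq_0_iff)
  qed
qed

end

section \<open>The limit theorem for the general branching process\<close>

theorem theorem2p1:
  fixes M :: "'w measure"
    and \<xi> :: "nat list \<Rightarrow> 'w \<Rightarrow> real measure"
    and x :: "nat \<Rightarrow> real measure \<Rightarrow> real"
    and \<alpha> \<sigma>2 :: real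
    and \<mu> :: "real measure"
    and W X :: "'w \<Rightarrow> real"
  assumes gbp: "general_branching_process M \<xi> x"
    and mu: "\<mu> = intensity M \<xi>"
    and nonlattice: "\<And>h. h > 0 \<Longrightarrow> \<not> (AE s in \<mu>. s \<in> range (\<lambda>n::nat. h * real n))"
    and A1: "emeasure \<mu> {0<..} > 1"
    and A2: "\<alpha> > 0" "laplace \<mu> \<alpha> = 1"
    and A3: "integrable \<mu> (\<lambda>s. s * exp (- \<alpha> * s))" "laplace_deriv \<mu> \<alpha> < 0"
    and A4: "integrable M (\<lambda>\<omega>. (first_generation_sum \<xi> x \<alpha> \<omega> - 1)\<^sup>2)"
      "\<sigma>2 = prob_space.expectation M (\<lambda>\<omega>. (first_generation_sum \<xi> x \<alpha> \<omega> - 1)\<^sup>2)"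
      "\<sigma>2 > 0"
    and W: "W \<in> borel_measurable M"
      "AE \<omega> in M. ((\<lambda>t. nerman \<xi> x \<alpha> t \<omega>) \<longlongrightarrow> W \<omega>) at_top"
    and X: "distributed M lborel X (\<lambda>z. ennreal (std_normal_density z))"
      "prob_space.indep_set M (sets (F_infty M \<xi>)) (sets (vimage_algebra (space M) X borel))"
  shows "cond_law_tendsto_in_prob M
           (\<lambda>t \<omega>. exp (\<alpha> * t / 2) * (W \<omega> - nerman \<xi> x \<alpha> t \<omega>)) (H_filtration M \<xi> x)
           (\<lambda>\<omega>. sqrt (\<sigma>2 / (- \<alpha> * laplace_deriv \<mu> \<alpha>) * W \<omega>) * X \<omega>) (F_infty M \<xi>)"
proof -
  interpret C: branching M \<xi> x \<alpha> by (rule branching.intro[OF gbp A2(1)])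

  have tot1: "(\<integral>\<^sup>+\<omega>. C.tot 1 (C.fam \<omega>) \<partial>M) = 1"
    unfolding C.nn_integral_tot_1 using A2(2) by (simp only: mu)
  have var: "(\<integral>\<^sup>+\<omega>. ennreal ((enn2real (C.tot 1 (C.fam \<omega>)) - 1)\<^sup>2) \<partial>M) = ennreal \<sigma>2"
  proof -
    have "(\<integral>\<^sup>+\<omega>. ennreal ((enn2real (C.tot 1 (C.fam \<omega>)) - 1)\<^sup>2) \<partial>M) =
        (\<integral>\<^sup>+\<omega>. ennreal ((first_generation_sum \<xi> x \<alpha> \<omega> - 1)\<^sup>2) \<partial>M)"
      by (rule nn_integral_cong) (simp only: C.first_generation_sum_eq)
    also have "\<dots> = ennreal \<sigma>2"
      unfolding A4(2) by (rule nn_integral_eq_integral[OF A4(1)]) simp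
    finally show ?thesis .
  qed
  note mean = C.step_law_mean[unfolded mu[symmetric], OF A3(1)]
  interpret B: malthusian M \<xi> x \<alpha> \<sigma>2 C.step_law
  proof (intro malthusian.intro renewal_cascade.intro normalized_cascade.intro C.branching_axioms C.cascade_axioms
      normalized_cascade_axioms.intro renewal_cascade_axioms.intro tot1 var C.discount_step_law mean(1))
    show "0 \<le> \<sigma>2" using A4(3) by simp
    show "sets C.step_law = sets borel" by (simp add: C.step_law_def)
    show "\<not> (AE y in C.step_law. y \<in> range (\<lambda>n::nat. d * real n))" if "0 < d" for d
    proof
      assume "AE y in C.step_law. y \<in> range (\<lambda>n::nat. d * real n)"
      then have "AE s in \<mu>. s \<in> range (\<lambda>n::nat. d / \<alpha> * real n)" unfolding mu by (rule C.step_law_lattice)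
      moreover have "0 < d / \<alpha>" using that A2(1) by simp
      ultimately show False using nonlattice by blast
    qed
  qed
  have W0: "AE \<omega> in M. W \<omega> = B.W (C.fam \<omega>)" by (rule B.limit_unique[OF W])
  have Xm: "X \<in> borel_measurable M" using distributed_measurable[OF X(1)] by simp
  have ner: "nerman \<xi> x \<alpha> t \<omega> = B.WT (exp (- \<alpha> * t)) (C.fam \<omega>)" if "0 \<le> t" "\<omega> \<in> space M" for t \<omega>
    unfolding B.WT_def by (rule C.nerman_eq[OF that(2,1)])
  \<comment> \<open>\<open>f < 1\<close> permits cancelling \<open>1 - f\<close>.\<close>
  have vc: "B.v * B.c = \<sigma>2 / (- \<alpha> * laplace_deriv \<mu> \<alpha>)"
    using B.f_less_1 by (simp add: B.v_eq B.c_def B.m_def mean(2))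
  show ?thesis
  proof (rule B.conditional_clt[OF _ _ _ _ X])
    fix t :: real assume t: "0 \<le> t"
    have "(\<lambda>\<omega>. B.WT (exp (- \<alpha> * t)) (C.fam \<omega>)) \<in> borel_measurable M" by measurable
    then have "(\<lambda>\<omega>. nerman \<xi> x \<alpha> t \<omega>) \<in> borel_measurable M"
      by (subst measurable_cong[OF ner[OF t]])
    then show "(\<lambda>\<omega>. exp (\<alpha> * t / 2) * (W \<omega> - nerman \<xi> x \<alpha> t \<omega>)) \<in> borel_measurable M"
      by (intro borel_measurable_times borel_measurable_diff borel_measurable_const W(1))
    show "AE \<omega> in M. exp (\<alpha> * t / 2) * (W \<omega> - nerman \<xi> x \<alpha> t \<omega>) = B.fluct t \<omega>"
      using W0 AE_space
    proof eventually_elim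
      case (elim \<omega>)
      show ?case by (simp only: B.fluct_def elim(1) ner[OF t elim(2)])
    qed
  next
    show "(\<lambda>\<omega>. sqrt (\<sigma>2 / (- \<alpha> * laplace_deriv \<mu> \<alpha>) * W \<omega>) * X \<omega>) \<in> borel_measurable M"
      using W(1) Xm by measurable
    show "AE \<omega> in M. sqrt (\<sigma>2 / (- \<alpha> * laplace_deriv \<mu> \<alpha>) * W \<omega>) * X \<omega> = sqrt (B.v * B.c * B.W (C.fam \<omega>)) * X \<omega>"
      using W0
    proof eventually_elim
      case (elim \<omega>)
      show ?case by (simp only: vc elim)
    qed
  qed
qed

end
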